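(* The local Mellin transform $\mathcal{M}^{(\infty,\infty)}$ induces an equivalence of categories between $\mathcal{C}_{\infty}^{>0}$ and $\mathcal{N}^{<0}$.
   Context: $\Bbbk$ is an algebraically closed field of characteristic zero; $\mathrm{ord}$ is the order of vanishing of a (Puiseux-)Laurent series. **Connections at infinity.** Let $\zeta=1/z$ and $K=\Bbbk((\zeta))$. Objects of $\mathcal{C}_\infty$ are pairs $(V,\nabla)$ with $V$ a finite-dimensional $K$-vector space and $\nabla$ a connection, written with respect to the coordinate $z$: $\nabla=\nabla_z:V\to V$ is $\Bbbk$-linear with $\nabla(hv)=h\nabla(v)+\frac{dh}{dz}v$ for $h\in K$, where $\frac{d}{dz}=-\zeta^2\frac{d}{d\zeta}$ (thus $\nabla_z=-\zeta^2\nabla_\zeta$, where $\nabla_\zeta$ is the connection with respect to $\zeta$); morphisms are $K$-linear maps commuting with the $\nabla$'s. For $f\in K_q=\Bbbk((\zeta^{1/q}))$ the object $E_f$ is $K_q$, viewed over $K$, with $\nabla=\frac{d}{dz}+z^{-1}f=-\zeta^2\frac{d}{d\zeta}+\zeta f$; its isomorphism class depends only on the $\mathrm{Gal}(K_q/K)$-orbit of $f$ modulo $\zeta^{1/q}\Bbbk[[\zeta^{1/q}]]+\frac{\mathbb{Z}}{q}$, and every irreducible object is isomorphic to some $E_f$. $\mathcal{C}_\infty^{>0}$ is the full subcategory of objects whose irreducible components $E_f$ all have slope greater than zero, i.e. $\mathrm{ord}(f)<0$. **Difference operators.** Over $\Bbbk((\theta))$, let $\varphi$ be the $\Bbbk$-automorphism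 $\varphi(v(\theta))=v\left(\frac{\theta}{1+\theta}\right)$, extended to $\Bbbk((\theta^{1/q}))$ by $\varphi(v(\theta^{1/q}))=v\left(\theta^{1/q}\sum_{i\ge0}\binom{-1/q}{i}\theta^i\right)$. Objects of $\mathcal{N}$ are pairs $(V,\Phi)$, $V$ a finite-dimensional $\Bbbk((\theta))$-vector space and $\Phi:V\to V$ an invertible $\Bbbk$-linear map with $\Phi(hv)=\varphi(h)\Phi(v)$ for all $h\in\Bbbk((\theta))$; morphisms are $\Bbbk((\theta))$-linear maps commuting with the $\Phi$'s. For $g\in\Bbbk((\theta^{1/q}))^*$ set $D_g=(\Bbbk((\theta^{1/q})),g\varphi)$, viewed over $\Bbbk((\theta))$; every irreducible object of $\mathcal{N}$ is isomorphic to some $D_g$. $\mathcal{N}^{<0}$ is the full subcategory of $\mathcal{N}$ of objects whose irreducible components $D_g$ all have $\mathrm{ord}(g)<0$. **Local Mellin transform.** For $E=(V,\nabla)\in\mathcal{C}_\infty^{>0}$ put $\theta:=-(z\nabla)^{-1}:V\to V$ and $\Phi:=z=\zeta^{-1}:V\to V$. Then $\theta$ extends to an action of $\Bbbk((\theta))$ on $V$ (compatible with the topology: the $\theta$-adic topology on $V$ coincides with the $\zeta$-adic topology), $V$ is finite-dimensional over $\Bbbk((\theta))$ (written $V_\theta$), $\Phi$ is an invertible difference operator, and $\mathcal{M}^{(\infty,\infty)}(E):=(V_\theta,\Phi)\in\mathcal{N}$. On morphisms the functor leaves the underlying $\Bbbk$-linear map unchanged. *)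

theory Defs
  imports
    "HOL-Computational_Algebra.Computational_Algebra"
    "HOL-Algebra.AbelCoset"
    "Jordan_Normal_Form.VS_Connect"
begin

section \<open>Categories, functors and equivalences\<close>

text \<open>Hom-sets of different pairs of objects may overlap, so composition and the action of a
  functor on morphisms carry the objects as arguments:
  \<open>comp C X Y Z g f\<close> is the composite of \<open>f : X \<rightarrow> Y\<close> and \<open>g : Y \<rightarrow> Z\<close>.\<close>

record ('o, 'm) cat =
  obj :: "'o set"
  hom :: "'o \<Rightarrow> 'o \<Rightarrow> 'm set"
  ident :: "'o \<Rightarrow> 'm"
  comp :: "'o \<Rightarrow> 'o \<Rightarrow> 'o \<Rightarrow> 'm \<Rightarrow> 'm \<Rightarrow> 'm"

locale category =
  fixes C :: "('o, 'm) cat"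
  assumes ident_in_hom: "X \<in> obj C \<Longrightarrow> ident C X \<in> hom C X X"
    and comp_in_hom: "\<lbrakk>X \<in> obj C; Y \<in> obj C; Z \<in> obj C; f \<in> hom C X Y; g \<in> hom C Y Z\<rbrakk>
      \<Longrightarrow> comp C X Y Z g f \<in> hom C X Z"
    and comp_ident_right: "\<lbrakk>X \<in> obj C; Y \<in> obj C; f \<in> hom C X Y\<rbrakk>
      \<Longrightarrow> comp C X X Y f (ident C X) = f"
    and comp_ident_left: "\<lbrakk>X \<in> obj C; Y \<in> obj C; f \<in> hom C X Y\<rbrakk>
      \<Longrightarrow> comp C X Y Y (ident C Y) f = f"
    and comp_assoc: "\<lbrakk>W \<in> obj C; X \<in> obj C; Y \<in> obj C; Z \<in> obj C;
        f \<in> hom C W X; g \<in> hom C X Y; h \<in> hom C Y Z\<rbrakk>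
      \<Longrightarrow> comp C W X Z (comp C X Y Z h g) f = comp C W Y Z h (comp C W X Y g f)"

definition full_subcategory :: "('o, 'm) cat \<Rightarrow> ('o \<Rightarrow> bool) \<Rightarrow> ('o, 'm) cat" where
  "full_subcategory C P = C\<lparr>obj := {X \<in> obj C. P X}\<rparr>"

record ('o1, 'm1, 'o2, 'm2) ftor =
  fobj :: "'o1 \<Rightarrow> 'o2"
  fmap :: "'o1 \<Rightarrow> 'o1 \<Rightarrow> 'm1 \<Rightarrow> 'm2"

locale cat_functor = src: category C + tgt: category D
  for C :: "('o1, 'm1) cat" and D :: "('o2, 'm2) cat" +
  fixes F :: "('o1, 'm1, 'o2, 'm2) ftor"
  assumes fobj_in_obj: "X \<in> obj C \<Longrightarrow> fobj F X \<in> obj D"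
    and fmap_in_hom: "\<lbrakk>X \<in> obj C; Y \<in> obj C; f \<in> hom C X Y\<rbrakk>
      \<Longrightarrow> fmap F X Y f \<in> hom D (fobj F X) (fobj F Y)"
    and fmap_ident: "X \<in> obj C \<Longrightarrow> fmap F X X (ident C X) = ident D (fobj F X)"
    and fmap_comp: "\<lbrakk>X \<in> obj C; Y \<in> obj C; Z \<in> obj C; f \<in> hom C X Y; g \<in> hom C Y Z\<rbrakk>
      \<Longrightarrow> fmap F X Z (comp C X Y Z g f)
        = comp D (fobj F X) (fobj F Y) (fobj F Z) (fmap F Y Z g) (fmap F X Y f)"

definition ident_ftor :: "('o, 'm, 'o, 'm) ftor" where
  "ident_ftor = \<lparr>fobj = (\<lambda>X. X), fmap = (\<lambda>X Y f. f)\<rparr>"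

definition comp_ftor ::
  "('o2, 'm2, 'o3, 'm3) ftor \<Rightarrow> ('o1, 'm1, 'o2, 'm2) ftor \<Rightarrow> ('o1, 'm1, 'o3, 'm3) ftor" where
  "comp_ftor G F = \<lparr>fobj = (\<lambda>X. fobj G (fobj F X)),
     fmap = (\<lambda>X Y f. fmap G (fobj F X) (fobj F Y) (fmap F X Y f))\<rparr>"

definition is_iso :: "('o, 'm) cat \<Rightarrow> 'o \<Rightarrow> 'o \<Rightarrow> 'm \<Rightarrow> bool" where
  "is_iso C X Y f \<longleftrightarrow> f \<in> hom C X Y \<and>
     (\<exists>g \<in> hom C Y X. comp C X Y X g f = ident C X \<and> comp C Y X Y f g = ident C Y)"

definition naturally_isomorphic ::
  "('o1, 'm1) cat \<Rightarrow> ('o2, 'm2) cat \<Rightarrow> ('o1, 'm1, 'o2, 'm2) ftor \<Rightarrow> ('o1, 'm1, 'o2, 'm2) ftor \<Rightarrow> bool"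
  where
  "naturally_isomorphic C D F G \<longleftrightarrow>
     (\<exists>\<eta>. (\<forall>X \<in> obj C. is_iso D (fobj F X) (fobj G X) (\<eta> X)) \<and>
       (\<forall>X \<in> obj C. \<forall>Y \<in> obj C. \<forall>f \<in> hom C X Y.
          comp D (fobj F X) (fobj G X) (fobj G Y) (fmap G X Y f) (\<eta> X)
        = comp D (fobj F X) (fobj F Y) (fobj G Y) (\<eta> Y) (fmap F X Y f)))"

definition cat_equivalence ::
  "('o1, 'm1) cat \<Rightarrow> ('o2, 'm2) cat \<Rightarrow> ('o1, 'm1, 'o2, 'm2) ftor \<Rightarrow> bool" where
  "cat_equivalence C D F \<longleftrightarrow> cat_functor C D F \<and>
     (\<exists>G. cat_functor D C G \<and>
        naturally_isomorphic C C (comp_ftor G F) ident_ftor \<and>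
        naturally_isomorphic D D (comp_ftor F G) ident_ftor)"

section \<open>Vector spaces over a Laurent series field with an operator\<close>

text \<open>Connections and difference modules share one carrier type: a module over \<^typ>\<open>'k fls\<close>
  together with a map \<open>opr\<close>, which plays the role of \<open>\<nabla>\<close> or of \<open>\<Phi>\<close>. The type \<^typ>\<open>'v\<close> of the
  vectors is the universe of the categories below; it is arbitrary. The fields \<open>mult\<close> and \<open>one\<close> that
  module records inherit from ring records have no meaning here, nor do the values of
  the operations outside the carrier.\<close>

record ('a, 'v) op_module = "('a, 'v) module" +
  opr :: "'v \<Rightarrow> 'v"

text \<open>The field of constants \<^typ>\<open>'k\<close> acts through \<^const>\<open>fls_const\<close>.\<close>

definition const_linear :: "('k::field fls, 'v) op_module \<Rightarrow> ('v \<Rightarrow> 'v) \<Rightarrow> bool" where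
  "const_linear E T \<longleftrightarrow> T \<in> carrier E \<rightarrow> carrier E \<and>
     (\<forall>v \<in> carrier E. \<forall>w \<in> carrier E. T (v \<oplus>\<^bsub>E\<^esub> w) = T v \<oplus>\<^bsub>E\<^esub> T w) \<and>
     (\<forall>c. \<forall>v \<in> carrier E. T (fls_const c \<odot>\<^bsub>E\<^esub> v) = fls_const c \<odot>\<^bsub>E\<^esub> T v)"

definition op_hom ::
  "('k::field fls, 'v) op_module \<Rightarrow> ('k fls, 'w) op_module \<Rightarrow> ('v \<Rightarrow> 'w) set" where
  "op_hom E F = {h \<in> carrier E \<rightarrow>\<^sub>E carrier F.
     h \<in> LinearCombinations.module_hom class_ring E F \<and>
     (\<forall>v \<in> carrier E. h (opr E v) = opr F (h v))}"

definition op_isomorphic ::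
  "('k::field fls, 'v) op_module \<Rightarrow> ('k fls, 'w) op_module \<Rightarrow> bool" where
  "op_isomorphic E F \<longleftrightarrow> (\<exists>h \<in> op_hom E F. bij_betw h (carrier E) (carrier F))"

definition op_cat ::
  "(('k::field fls, 'v) op_module \<Rightarrow> bool) \<Rightarrow> (('k fls, 'v) op_module, 'v \<Rightarrow> 'v) cat" where
  "op_cat P = \<lparr>obj = {E. P E}, hom = op_hom,
     ident = (\<lambda>E. restrict (\<lambda>v. v) (carrier E)),
     comp = (\<lambda>X Y Z g f. compose (carrier X) g f)\<rparr>"

text \<open>If \<open>opr\<close> is bijective and semilinear over an automorphism, its restriction to a stable
  subspace of a finite-dimensional space is again bijective, by dimension; so the following notion
  of subobject is also the right one for difference modules.\<close>

definition stable_subspace :: "('k::field fls, 'v) op_module \<Rightarrow> 'v set \<Rightarrow> bool" where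
  "stable_subspace E W \<longleftrightarrow> VectorSpace.subspace class_ring W E \<and> opr E ` W \<subseteq> W"

definition op_irreducible :: "('k::field fls, 'v) op_module \<Rightarrow> bool" where
  "op_irreducible E \<longleftrightarrow> carrier E \<noteq> {\<zero>\<^bsub>E\<^esub>} \<and>
     (\<forall>W. stable_subspace E W \<longrightarrow> W = {\<zero>\<^bsub>E\<^esub>} \<or> W = carrier E)"

text \<open>The quotient \<open>W/U\<close> for stable subspaces \<open>U \<subseteq> W\<close> of \<open>E\<close>; its vectors are cosets of \<open>U\<close>.\<close>

definition subquotient ::
  "('k::field fls, 'v) op_module \<Rightarrow> 'v set \<Rightarrow> 'v set \<Rightarrow> ('k fls, 'v set) op_module" where
  "subquotient E W U =
     \<lparr>carrier = (\<lambda>w. U +>\<^bsub>E\<^esub> w) ` W, mult = undefined, one = undefined,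
      zero = U, add = set_add E,
      smult = (\<lambda>a X. \<Union>x \<in> X. U +>\<^bsub>E\<^esub> (a \<odot>\<^bsub>E\<^esub> x)),
      opr = (\<lambda>X. \<Union>x \<in> X. U +>\<^bsub>E\<^esub> opr E x)\<rparr>"

definition irreducible_components ::
  "('k::field fls, 'v) op_module \<Rightarrow> ('k fls, 'v set) op_module set" where
  "irreducible_components E = {subquotient E W U | W U.
     stable_subspace E U \<and> stable_subspace E W \<and> U \<subseteq> W \<and> op_irreducible (subquotient E W U)}"

section \<open>Puiseux series\<close>

text \<open>An element of \<open>k((x^(1/q)))\<close> is represented by the Laurent series in \<open>t = x^(1/q)\<close>,
  and \<open>k((x))\<close> acts on it through the substitution \<open>x = t^q\<close>, i.e. through
  \<open>\<lambda>a. fls_compose_power a q\<close>. The order of vanishing is taken with respect to \<open>x\<close>. The zero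
  series gets order \<open>0\<close> instead of \<open>\<infinity>\<close>; in both cases its order is not negative, which is all
  that is used.\<close>

definition puiseux_ord :: "nat \<Rightarrow> 'k::zero fls \<Rightarrow> rat" where
  "puiseux_ord q f = of_int (fls_subdegree f) / of_nat q"

section \<open>Connections at infinity\<close>

text \<open>Here \<^typ>\<open>'k fls\<close> is \<open>K = k((\<zeta>))\<close> with \<open>\<zeta> = 1/z\<close>; so \<^const>\<open>fls_X\<close> is \<open>\<zeta>\<close> and
  \<^const>\<open>fls_X_inv\<close> is \<open>z\<close>.\<close>

definition d_dz :: "'k::field_char_0 fls \<Rightarrow> 'k fls" where
  "d_dz h = - (fls_X ^ 2 * fls_deriv h)"

text \<open>On \<open>k((t))\<close> with \<open>t^q = \<zeta>\<close> one has \<open>\<zeta> d/d\<zeta> = (1/q) t d/dt\<close>, hence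
  \<open>d/dz = -\<zeta>^2 d/d\<zeta> = -(1/q) t^(q+1) d/dt\<close>.\<close>

definition d_dz_root :: "nat \<Rightarrow> 'k::field_char_0 fls \<Rightarrow> 'k fls" where
  "d_dz_root q v = - (fls_const (1 / of_nat q) * fls_X ^ (q + 1) * fls_deriv v)"

locale connection_at_infinity =
  vectorspace class_ring E for E :: "('k::field_char_0 fls, 'v) op_module" +
  assumes finite_dimensional: "fin_dim"
    and nabla_linear: "const_linear E (opr E)"
    and nabla_leibniz: "v \<in> carrier E \<Longrightarrow>
      opr E (h \<odot>\<^bsub>E\<^esub> v) = h \<odot>\<^bsub>E\<^esub> opr E v \<oplus>\<^bsub>E\<^esub> d_dz h \<odot>\<^bsub>E\<^esub> v"

text \<open>The object \<open>E_f\<close> for \<open>f \<in> k((\<zeta>^(1/q)))\<close>.\<close>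

definition E_obj :: "nat \<Rightarrow> 'k::field_char_0 fls \<Rightarrow> ('k fls, 'k fls) op_module" where
  "E_obj q f =
     \<lparr>carrier = UNIV, mult = undefined, one = undefined, zero = 0, add = (+),
      smult = (\<lambda>a v. fls_compose_power a q * v),
      opr = (\<lambda>v. d_dz_root q v + fls_X ^ q * f * v)\<rparr>"

text \<open>Every irreducible object is isomorphic to some \<open>E_f\<close>, and whether the order of \<open>f\<close> is negative
  depends only on the isomorphism class, so it does not matter which \<open>f\<close> is chosen. The same holds for the
  objects \<open>D_g\<close> below.\<close>

definition positive_slopes :: "('k::field_char_0 fls, 'v) op_module \<Rightarrow> bool" where
  "positive_slopes E \<longleftrightarrow> (\<forall>L \<in> irreducible_components E.
     \<exists>q f. q \<ge> 1 \<and> op_isomorphic L (E_obj q f) \<and> puiseux_ord q f < 0)"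

definition C_inf :: "(('k::field_char_0 fls, 'v) op_module, 'v \<Rightarrow> 'v) cat" where
  "C_inf = op_cat connection_at_infinity"

definition C_inf_pos :: "(('k::field_char_0 fls, 'v) op_module, 'v \<Rightarrow> 'v) cat" where
  "C_inf_pos = full_subcategory C_inf positive_slopes"

section \<open>Difference modules\<close>

text \<open>Here \<^typ>\<open>'k fls\<close> is \<open>k((\<theta>))\<close>.\<close>

definition phi :: "'k::field_char_0 fls \<Rightarrow> 'k fls" where
  "phi v = fls_compose_fps v (fps_X / (1 + fps_X))"

text \<open>The extension of \<^const>\<open>phi\<close> to \<open>k((t))\<close> with \<open>t^q = \<theta>\<close>: it substitutes
  \<open>t * (1 + \<theta>)^(-1/q)\<close>, expanded as a binomial series in \<open>\<theta> = t^q\<close>, for \<open>t\<close>.\<close>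

definition phi_root :: "nat \<Rightarrow> 'k::field_char_0 fls \<Rightarrow> 'k fls" where
  "phi_root q v = fls_compose_fps v
     (fps_X * fps_compose (fps_binomial (- 1 / of_nat q)) (fps_X ^ q))"

locale difference_module =
  vectorspace class_ring W for W :: "('k::field_char_0 fls, 'v) op_module" +
  assumes finite_dimensional: "fin_dim"
    and Phi_linear: "const_linear W (opr W)"
    and Phi_invertible: "bij_betw (opr W) (carrier W) (carrier W)"
    and Phi_semilinear: "v \<in> carrier W \<Longrightarrow> opr W (h \<odot>\<^bsub>W\<^esub> v) = phi h \<odot>\<^bsub>W\<^esub> opr W v"

text \<open>The object \<open>D_g\<close> for a nonzero \<open>g \<in> k((\<theta>^(1/q)))\<close>.\<close>

definition D_obj :: "nat \<Rightarrow> 'k::field_char_0 fls \<Rightarrow> ('k fls, 'k fls) op_module" where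
  "D_obj q g =
     \<lparr>carrier = UNIV, mult = undefined, one = undefined, zero = 0, add = (+),
      smult = (\<lambda>a v. fls_compose_power a q * v),
      opr = (\<lambda>v. g * phi_root q v)\<rparr>"

definition negative_orders :: "('k::field_char_0 fls, 'v) op_module \<Rightarrow> bool" where
  "negative_orders W \<longleftrightarrow> (\<forall>L \<in> irreducible_components W.
     \<exists>q g. q \<ge> 1 \<and> g \<noteq> 0 \<and> op_isomorphic L (D_obj q g) \<and> puiseux_ord q g < 0)"

definition N_cat :: "(('k::field_char_0 fls, 'v) op_module, 'v \<Rightarrow> 'v) cat" where
  "N_cat = op_cat difference_module"

definition N_neg :: "(('k::field_char_0 fls, 'v) op_module, 'v \<Rightarrow> 'v) cat" where
  "N_neg = full_subcategory N_cat negative_orders"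

section \<open>The local Mellin transform\<close>

text \<open>The lattices, i.e. the \<open>k[[\<zeta>]]\<close>-spans of finite generating sets of \<open>E\<close> over \<open>k((\<zeta>))\<close>,
  are a base of neighbourhoods of \<open>0\<close> for the \<open>\<zeta>\<close>-adic topology of \<open>E\<close>.\<close>

definition zeta_lattice :: "('k::field_char_0 fls, 'v) op_module \<Rightarrow> 'v set \<Rightarrow> bool" where
  "zeta_lattice E L \<longleftrightarrow> (\<exists>B. finite B \<and> B \<subseteq> carrier E \<and>
     LinearCombinations.module.span class_ring E B = carrier E \<and>
     L = {LinearCombinations.module.lincomb E (\<lambda>b. fps_to_fls (a b)) B | a. True})"

definition zeta_adic_lim ::
  "('k::field_char_0 fls, 'v) op_module \<Rightarrow> (nat \<Rightarrow> 'v) \<Rightarrow> 'v \<Rightarrow> bool" where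
  "zeta_adic_lim E s w \<longleftrightarrow> w \<in> carrier E \<and>
     (\<forall>L. zeta_lattice E L \<longrightarrow> (\<forall>\<^sub>F n in sequentially. s n \<in> carrier E \<and> s n \<ominus>\<^bsub>E\<^esub> w \<in> L))"

definition z_nabla :: "('k::field_char_0 fls, 'v) op_module \<Rightarrow> 'v \<Rightarrow> 'v" where
  "z_nabla E v = fls_X_inv \<odot>\<^bsub>E\<^esub> opr E v"

definition theta :: "('k::field_char_0 fls, 'v) op_module \<Rightarrow> 'v \<Rightarrow> 'v" where
  "theta E v = \<ominus>\<^bsub>E\<^esub> inv_into (carrier E) (z_nabla E) v"

definition theta_power :: "('k::field_char_0 fls, 'v) op_module \<Rightarrow> int \<Rightarrow> 'v \<Rightarrow> 'v" where
  "theta_power E n = (if n \<ge> 0 then theta E ^^ nat n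
     else (\<lambda>v. \<ominus>\<^bsub>E\<^esub> z_nabla E v) ^^ nat (- n))"

text \<open>The continuous extension of \<open>\<theta>\<close> to an action of \<open>k((\<theta>))\<close>: the series
  \<open>h = \<Sum>n. h n * \<theta>^n\<close> acts on \<open>v\<close> by the \<open>\<zeta>\<close>-adic limit of the partial sums of
  \<open>\<Sum>n. h n * \<theta>^n v\<close>.\<close>

definition theta_smult ::
  "('k::field_char_0 fls, 'v) op_module \<Rightarrow> 'k fls \<Rightarrow> 'v \<Rightarrow> 'v" where
  "theta_smult E h v = (THE w. zeta_adic_lim E
     (\<lambda>N. \<Oplus>\<^bsub>E\<^esub> n \<in> {fls_subdegree h..int N}. fls_const (fls_nth h n) \<odot>\<^bsub>E\<^esub> theta_power E n v) w)"

text \<open>The additive group stays the same, \<open>k((\<theta>))\<close> replaces \<open>k((\<zeta>))\<close> as field of scalars, and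
  multiplication by \<open>z\<close> becomes the difference operator.\<close>

definition mellin_obj :: "('k::field_char_0 fls, 'v) op_module \<Rightarrow> ('k fls, 'v) op_module" where
  "mellin_obj E = E\<lparr>smult := theta_smult E, opr := (\<lambda>v. fls_X_inv \<odot>\<^bsub>E\<^esub> v)\<rparr>"

definition local_mellin ::
  "(('k::field_char_0 fls, 'v) op_module, 'v \<Rightarrow> 'v, ('k fls, 'v) op_module, 'v \<Rightarrow> 'v) ftor" where
  "local_mellin = \<lparr>fobj = mellin_obj, fmap = (\<lambda>X Y f. f)\<rparr>"

end

theory Submission
  imports Defs
begin

text \<open>
  Let \<open>E\<close> be a connection at infinity with positive slopes, and \<open>T = - z \<nabla>\<close>. The Mellin transform
  keeps the additive group of \<open>E\<close> and the operators \<open>T\<close> and \<open>z\<close>, and exchanges their roles: on \<open>E\<close> the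
  scalar is \<open>\<zeta> = z^(- 1)\<close> and \<open>T\<close> is a semilinear operator; on the transform the scalar is
  \<open>\<theta> = T^(- 1)\<close> and \<open>z\<close> is a semilinear operator. The relation \<open>z T = (T + 1) z\<close> is at the same time the
  Leibniz rule for \<open>\<nabla>\<close> over \<open>k((\<zeta>))\<close> and the rule that \<open>\<Phi> = z\<close> is semilinear over
  \<open>\<phi>(1/\<theta>) = 1/\<theta> + 1\<close>. So the inverse functor is the same exchange, applied to a difference
  module \<open>(W, \<Phi>)\<close> with \<open>T = \<Phi>\<close>, and it returns \<open>\<zeta> = \<Phi>^(- 1)\<close>, \<open>\<nabla> = - \<zeta> \<theta>^(- 1)\<close>. Three things have to be
  shown, for both directions at once in the locale \<open>mellin_pair\<close>.

  The exchange is possible. \<open>T\<close> must be bijective with a topologically nilpotent inverse, so that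
  series in \<open>T^(- 1)\<close> converge. A composition series reduces this to the models \<open>E_f\<close> and \<open>D_g\<close>
  with \<open>ord f < 0\<close> and \<open>ord g < 0\<close>, on which \<open>T\<close> lowers the order of Puiseux series by a fixed positive number
  (\<open>shift_filtered_surj\<close>, \<open>shift_filtered_contracting\<close>). The filtrations by powers of the old and of the
  new variable define the same topology (\<open>G_in_F\<close>, \<open>F_in_G\<close>). Identities for the new scalar
  multiplication hold because they hold on monomials and both sides are continuous
  (\<open>act_unique\<close>).

  The result lies in the right category. On \<open>k((t))\<close>, the operator \<open>T\<close> maps \<open>t^n\<close> to a series whose leading
  coefficient is nonzero and independent of \<open>n\<close> and whose other coefficients are polynomials in \<open>n\<close>.
  Such an operator is conjugate to multiplication by \<open>t^(- s)\<close>, since the conjugating operator is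
  the solution of a sequence of difference equations for polynomials (\<open>elliptic_normal_form\<close>). The
  other operator is then determined by the commutation relation and its value at \<open>1\<close>
  (\<open>intertwiner_zero\<close>): the transform of \<open>E_f\<close> is a \<open>D_g\<close>, and conversely (\<open>mellin_of_E_obj\<close>,
  \<open>inverse_mellin_of_D_obj\<close>). A general object has the same stable subspaces as its transform, because
  stable subspaces are closed and stable under \<open>T^(- 1)\<close>
  (\<open>stable_act\<close>, \<open>twist_stable_imp_stable\<close>). Hence the irreducible subquotients of the transform are the transforms of the
  irreducible subquotients.

  The two functors are inverse to each other. On morphisms both are the identity map, by
  continuity of linear maps (\<open>hom_act\<close>). Exchanging scalars twice gives back the original scalar
  multiplication by the same uniqueness principle (\<open>double_twist\<close>), and the identity of the carrier is the
  natural isomorphism.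
\<close>

no_notation Matrix.index_mat (infixl "$$" 100)
notation fls_nth (infixl "$$" 75)

section \<open>Orders of Laurent series\<close>

text \<open>A lower bound for the order of vanishing. Unlike the subdegree it treats the zero series
  as a series of infinite order.\<close>

definition ord_ge :: "int \<Rightarrow> 'k::zero fls \<Rightarrow> bool" where
  "ord_ge n v \<longleftrightarrow> (\<forall>i<n. v $$ i = 0)"

lemma ord_geD: "ord_ge n v \<Longrightarrow> i < n \<Longrightarrow> v $$ i = 0"
  by (simp add: ord_ge_def)

lemma ord_ge_iff_subdegree: "ord_ge n v \<longleftrightarrow> v = 0 \<or> n \<le> fls_subdegree v"
  unfolding ord_ge_def
  by (metis fls_eq0_below_subdegree fls_subdegree_geI fls_zero_nth order_less_le_trans)

lemma ord_ge_subdegree [simp]: "ord_ge (fls_subdegree v) v"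
  by (simp add: ord_ge_iff_subdegree)

lemma ord_ge_zero [simp]: "ord_ge n 0"
  by (simp add: ord_ge_def)

lemma ord_ge_mono: "ord_ge n v \<Longrightarrow> m \<le> n \<Longrightarrow> ord_ge m v"
  by (auto simp: ord_ge_def)

lemma ord_ge_add: "ord_ge n u \<Longrightarrow> ord_ge n v \<Longrightarrow> ord_ge n (u + v :: 'k::comm_monoid_add fls)"
  by (auto simp: ord_ge_def)

lemma ord_ge_diff: "ord_ge n u \<Longrightarrow> ord_ge n v \<Longrightarrow> ord_ge n (u - v :: 'k::ab_group_add fls)"
  by (auto simp: ord_ge_def)

lemma ord_ge_shift [simp]: "ord_ge n (fls_shift k v) \<longleftrightarrow> ord_ge (n + k) v"
proof
  assume h: "ord_ge n (fls_shift k v)"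
  show "ord_ge (n + k) v" unfolding ord_ge_def
  proof (intro allI impI)
    fix i assume "i < n + k"
    then have "fls_shift k v $$ (i - k) = 0" using h by (intro ord_geD) auto
    then show "v $$ i = 0" by simp
  qed
qed (simp add: ord_ge_def)

lemma ord_ge_mult:
  fixes a b :: "'k::idom fls"
  assumes "ord_ge m a" "ord_ge n b"
  shows "ord_ge (m + n) (a * b)"
proof (cases "a = 0 \<or> b = 0")
  case False
  then show ?thesis using assms by (auto simp: ord_ge_iff_subdegree)
qed auto

lemma ord_ge_const [simp]: "ord_ge 0 (fls_const c)"
  by (simp add: ord_ge_def)

lemma ord_ge_const_mult: "ord_ge n v \<Longrightarrow> ord_ge n (fls_const c * v :: 'k::idom fls)"
  using ord_ge_mult[OF ord_ge_const] by fastforce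

lemma ord_ge_X_intpow: "ord_ge n (fls_X_intpow n :: 'k::zero_neq_one fls)"
  by (simp add: ord_ge_def)

lemma eq_zero_if_ord_ge: "(\<And>i::nat. ord_ge (a + int i) v) \<Longrightarrow> v = 0"
proof -
  assume h: "\<And>i::nat. ord_ge (a + int i) v"
  have "v $$ n = 0" for n
    using h[of "nat (n - a + 1)"] by (auto intro!: ord_geD)
  then show ?thesis by (intro fls_zero_eqI)
qed

lemma ord_ge_remove_leading:
  fixes v :: "'k::field fls"
  assumes "ord_ge n v"
  shows "ord_ge (n + 1) (v - fls_const (v $$ n) * fls_X_intpow n)"
  unfolding ord_ge_def
proof (intro allI impI)
  fix i assume "i < n + 1"
  then have "i < n \<or> i = n" by auto
  then show "(v - fls_const (v $$ n) * fls_X_intpow n) $$ i = 0"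
    using assms by (auto simp: ord_geD fls_mult_const_nth)
qed

text \<open>Completeness of the adic topology: each coefficient of \<open>s i\<close> is eventually constant. Steps
  of size \<open>p\<close> occur when \<open>k((t))\<close> is a module over \<open>k((x))\<close> with \<open>x = t^p\<close>.\<close>

lemma fls_complete:
  fixes s :: "nat \<Rightarrow> 'k::ab_group_add fls"
  assumes "p \<ge> (1::int)" "\<And>i. ord_ge (a + p * int i) (s (Suc i) - s i)"
  shows "\<exists>y. \<forall>i. ord_ge (a + p * int i) (y - s i)"
proof -
  have step: "ord_ge (a + p * int i) (s (i + j) - s i)" for i j
  proof (induction j)
    case (Suc j)
    have "p * int i \<le> p * int (i + j)" using assms(1) by (intro mult_left_mono) auto
    then have "ord_ge (a + p * int i) (s (Suc (i + j)) - s (i + j))"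
      by (intro ord_ge_mono[OF assms(2)]) auto
    then show ?case using ord_ge_add[OF _ Suc] by fastforce
  qed auto
  define N where "N = (\<lambda>n. nat (n - a + 1))"
  have stab: "s j $$ n = s (N n) $$ n" if "j \<ge> N n" for j n
  proof -
    obtain k where j: "j = N n + k" using \<open>j \<ge> N n\<close> le_Suc_ex by blast
    have "int (N n) \<le> p * int (N n)" using assms(1)
      by (metis mult_le_cancel_right1 mult.commute of_nat_0_le_iff mult_right_mono mult_1)
    then have "n < a + p * int (N n)" unfolding N_def by linarith
    then have "(s (N n + k) - s (N n)) $$ n = 0" by (intro ord_geD[OF step])
    then show ?thesis using j by simp
  qed
  define y where "y = Abs_fls (\<lambda>n. s (N n) $$ n)"
  have y: "y $$ n = s (N n) $$ n" for n
    unfolding y_def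
  proof (rule nth_Abs_fls_lower_bound)
    show "\<forall>n<min a (fls_subdegree (s 0)). s (N n) $$ n = 0"
      by (auto simp: N_def)
  qed
  have "ord_ge (a + p * int i) (y - s i)" for i
    unfolding ord_ge_def
  proof (intro allI impI)
    fix n assume n: "n < a + p * int i"
    have "y $$ n = s (i + N n) $$ n" using y stab[of n "i + N n"] by simp
    also have "\<dots> = s i $$ n" using ord_geD[OF step n, of "N n"] by simp
    finally show "(y - s i) $$ n = 0" by simp
  qed
  then show ?thesis by blast
qed

section \<open>Operators on Laurent series and their coefficient polynomials\<close>

definition const_lin :: "('k::field fls \<Rightarrow> 'k fls) \<Rightarrow> bool" where
  "const_lin T \<longleftrightarrow> (\<forall>u v. T (u + v) = T u + T v) \<and> (\<forall>c v. T (fls_const c * v) = fls_const c * T v)"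

lemma const_linD:
  assumes "const_lin T"
  shows "T (u + v) = T u + T v" "T (fls_const c * v) = fls_const c * T v"
    "T 0 = 0" "T (- v) = - T v" "T (u - v) = T u - T v"
proof -
  show a: "T (u + v) = T u + T v" for u v using assms by (simp add: const_lin_def)
  show c: "T (fls_const c * v) = fls_const c * T v" for c v using assms by (simp add: const_lin_def)
  show z: "T 0 = 0" using a[of 0 0] by (metis add_0_right add_left_cancel)
  show m: "T (- v) = - T v" for v using a[of "- v" v] z by (metis add_eq_0_iff2 add.left_inverse)
  show "T (u - v) = T u - T v" for u v using a[of u "- v"] m by simp
qed

lemma const_linI:
  "(\<And>u v. T (u + v) = T u + T v) \<Longrightarrow> (\<And>c v. T (fls_const c * v) = fls_const c * T v) \<Longrightarrow> const_lin T"
  by (simp add: const_lin_def)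

definition raises_ord :: "int \<Rightarrow> ('k::field fls \<Rightarrow> 'k fls) \<Rightarrow> bool" where
  "raises_ord d T \<longleftrightarrow> (\<forall>n v. ord_ge n v \<longrightarrow> ord_ge (n + d) (T v))"

lemma raises_ordD: "raises_ord d T \<Longrightarrow> ord_ge n v \<Longrightarrow> ord_ge (n + d) (T v)"
  by (simp add: raises_ord_def)

text \<open>The combinations of monomials are dense, and an operator that lowers orders by a bounded amount
  is continuous.\<close>

lemma const_lin_eq_zero:
  assumes "const_lin T" "raises_ord d T" "\<And>n. T (fls_X_intpow n) = 0"
  shows "T v = 0"
proof -
  have "ord_ge (n + d + int j) (T v)" if "ord_ge n v" for n j v
    using that
  proof (induction j arbitrary: n v)
    case 0
    then show ?case using raises_ordD[OF assms(2)] by simp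
  next
    case (Suc j)
    have "T v = T (v - fls_const (v $$ n) * fls_X_intpow n)"
      by (simp add: const_linD[OF assms(1)] assms(3))
    then show ?case using Suc.IH[OF ord_ge_remove_leading[OF Suc.prems]] by (simp add: algebra_simps)
  qed
  from this[OF ord_ge_subdegree] show ?thesis by (rule eq_zero_if_ord_ge)
qed

text \<open>The operator maps \<open>t^n\<close> to a series that starts at \<open>t^(n + d)\<close> and whose coefficients depend
  polynomially on \<open>n\<close>. Multiplication by a series, the derivation \<open>t d/dt\<close> and substitutions such as
  \<open>phi_root\<close> have this form, so that identities between them become identities between
  polynomials.\<close>

definition symbol :: "int \<Rightarrow> (nat \<Rightarrow> 'k::field poly) \<Rightarrow> ('k fls \<Rightarrow> 'k fls) \<Rightarrow> bool" where
  "symbol d p T \<longleftrightarrow> const_lin T \<and> raises_ord d T \<and>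
     (\<forall>n i. T (fls_X_intpow n) $$ (n + d + int i) = poly (p i) (of_int n))"

lemma symbolD:
  assumes "symbol d p T"
  shows "const_lin T" "raises_ord d T"
    "T (fls_X_intpow n) $$ (n + d + int i) = poly (p i) (of_int n)"
  using assms by (auto simp: symbol_def)

lemma symbol_nth:
  assumes "symbol d p T" "ord_ge m v"
  shows "T v $$ (m + d + int i) = (\<Sum>j\<le>i. v $$ (m + int j) * poly (p (i - j)) (of_int (m + int j)))"
  using assms(2)
proof (induction i arbitrary: m v)
  case 0
  define v' where "v' = v - fls_const (v $$ m) * fls_X_intpow m"
  have v': "ord_ge (m + 1) v'" unfolding v'_def by (rule ord_ge_remove_leading[OF 0])
  have "v = v' + fls_const (v $$ m) * fls_X_intpow m" by (simp add: v'_def)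
  then have "T v = T v' + fls_const (v $$ m) * T (fls_X_intpow m)"
    by (metis const_linD(1,2)[OF symbolD(1)[OF assms(1)]])
  moreover have "T v' $$ (m + d) = 0"
    by (rule ord_geD[OF raises_ordD[OF symbolD(2)[OF assms(1)] v']]) simp
  ultimately show ?case using symbolD(3)[OF assms(1), of m 0] by (simp add: fls_mult_const_nth)
next
  case (Suc i)
  define v' where "v' = v - fls_const (v $$ m) * fls_X_intpow m"
  have v': "ord_ge (m + 1) v'" unfolding v'_def by (rule ord_ge_remove_leading[OF Suc.prems])
  have "v = v' + fls_const (v $$ m) * fls_X_intpow m" by (simp add: v'_def)
  then have Tv: "T v = T v' + fls_const (v $$ m) * T (fls_X_intpow m)"
    by (metis const_linD(1,2)[OF symbolD(1)[OF assms(1)]])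
  have "T v' $$ (m + d + int (Suc i)) = T v' $$ ((m + 1) + d + int i)" by (simp add: algebra_simps)
  also have "\<dots> = (\<Sum>j\<le>i. v' $$ (m + 1 + int j) * poly (p (i - j)) (of_int (m + 1 + int j)))"
    by (rule Suc.IH[OF v'])
  also have "\<dots> = (\<Sum>j\<le>i. v $$ (m + int (Suc j)) * poly (p (Suc i - Suc j)) (of_int (m + int (Suc j))))"
    by (intro sum.cong) (auto simp: v'_def fls_mult_const_nth algebra_simps)
  finally have "T v $$ (m + d + int (Suc i)) = v $$ m * poly (p (Suc i)) (of_int m) +
      (\<Sum>j\<le>i. v $$ (m + int (Suc j)) * poly (p (Suc i - Suc j)) (of_int (m + int (Suc j))))"
    using symbolD(3)[OF assms(1), of m "Suc i"] by (simp add: Tv fls_mult_const_nth)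
  then show ?case by (subst sum.atMost_Suc_shift) simp
qed

text \<open>The coefficient polynomials of a composite. The argument of the outer ones is shifted
  because the inner operator has already moved \<open>t^n\<close> to \<open>t^(n + d + j)\<close>.\<close>

definition comp_symbol :: "int \<Rightarrow> (nat \<Rightarrow> 'k::field poly) \<Rightarrow> (nat \<Rightarrow> 'k poly) \<Rightarrow> nat \<Rightarrow> 'k poly" where
  "comp_symbol d q p i = (\<Sum>j\<le>i. p j * pcompose (q (i - j)) [:of_int (d + int j), 1:])"

lemma symbol_comp:
  assumes "symbol e q S" "symbol d p T"
  shows "symbol (d + e) (comp_symbol d q p) (\<lambda>v. S (T v))"
  unfolding symbol_def
proof (intro conjI allI)
  show "const_lin (\<lambda>v. S (T v))"
    using symbolD(1)[OF assms(1)] symbolD(1)[OF assms(2)] by (simp add: const_lin_def)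
  show "raises_ord (d + e) (\<lambda>v. S (T v))"
    using symbolD(2)[OF assms(1)] symbolD(2)[OF assms(2)]
    by (metis (no_types, lifting) raises_ord_def add.assoc)
  fix n i
  have "ord_ge (n + d) (T (fls_X_intpow n))"
    by (rule raises_ordD[OF symbolD(2)[OF assms(2)] ord_ge_X_intpow])
  from symbol_nth[OF assms(1) this, of i]
  show "S (T (fls_X_intpow n)) $$ (n + (d + e) + int i) = poly (comp_symbol d q p i) (of_int n)"
    using symbolD(3)[OF assms(2), of n]
    by (simp add: comp_symbol_def poly_sum poly_pcompose add_ac)
qed

lemma symbol_diff:
  assumes "symbol d p S" "symbol d q T"
  shows "symbol d (\<lambda>i. p i - q i) (\<lambda>v. S v - T v)"
  using assms unfolding symbol_def const_lin_def raises_ord_def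
  by (auto simp: algebra_simps intro: ord_ge_diff)

lemma symbol_id: "symbol 0 (\<lambda>i. if i = 0 then 1 else 0) (\<lambda>v. v)"
  by (auto simp: symbol_def const_lin_def raises_ord_def)

lemma symbol_mult:
  assumes "ord_ge d a"
  shows "symbol d (\<lambda>i. [:a $$ (d + int i):]) (\<lambda>v. a * v)"
  unfolding symbol_def const_lin_def raises_ord_def
proof (intro conjI allI impI)
  fix n i
  show "(a * fls_X_intpow n) $$ (n + d + int i) = poly [:a $$ (d + int i):] (of_int n)"
    by (simp add: fls_X_intpow_times_conv_shift add_ac)
qed (use ord_ge_mult[OF assms] in \<open>auto simp: algebra_simps\<close>)

lemma symbol_X_inv_pow:
  "symbol (- int m) (\<lambda>i. if i = 0 then 1 else 0) (\<lambda>v. fls_shift (int m) v)"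
proof -
  have "symbol (- int m) (\<lambda>i. [:fls_X_intpow (- int m) $$ (- int m + int i):]) (\<lambda>v. fls_X_intpow (- int m) * v)"
    by (intro symbol_mult ord_ge_X_intpow)
  moreover have "(\<lambda>i. [:fls_X_intpow (- int m) $$ (- int m + int i):]) = (\<lambda>i::nat. if i = 0 then 1 else 0 :: 'a poly)"
    by (auto simp: one_pCons)
  moreover have "fls_X_intpow (- int m) * v = fls_shift (int m) v" for v :: "'a fls"
    using fls_X_intpow_times_conv_shift(1)[of "- int m" v] by simp
  ultimately show ?thesis by (metis (no_types, lifting) ext)
qed

text \<open>Each coefficient of the image involves only finitely many coefficients of the argument, so any
  family of polynomials may be prescribed. This is how conjugating operators are constructed.\<close>

lemma symbol_exists:
  fixes p :: "nat \<Rightarrow> 'k::field poly"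
  shows "\<exists>T. symbol d p T"
proof -
  define c where "c = (\<lambda>v n i. poly (p i) (of_int (n - d - int i)) * v $$ (n - d - int i))"
  define T where "T = (\<lambda>v. Abs_fls (\<lambda>n. \<Sum>i\<le>nat (n - d - fls_subdegree v). c v n i))"
  have T: "T v $$ n = (\<Sum>i\<le>nat (n - d - fls_subdegree v). c v n i)" for v n
    unfolding T_def
  proof (rule nth_Abs_fls_lower_bound)
    show "\<forall>n<d + fls_subdegree v. (\<Sum>i\<le>nat (n - d - fls_subdegree v). c v n i) = 0"
      by (auto simp: c_def)
  qed
  have T': "T v $$ n = (\<Sum>i\<le>nat (n - d - m). c v n i)" if "ord_ge m v" for v n m
  proof -
    have *: "(\<Sum>i\<le>nat (n - d - m). c v n i) = (\<Sum>i\<le>nat (n - d - m) + k. c v n i)" if "ord_ge m v" for m k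
      by (rule sum.mono_neutral_left) (auto simp: c_def intro!: ord_geD[OF \<open>ord_ge m v\<close>])
    show ?thesis
      using *[OF that, of "nat (n - d - fls_subdegree v)"]
        *[OF ord_ge_subdegree, of "nat (n - d - m)"] T[of v n] by (simp add: add.commute)
  qed
  have "const_lin T"
  proof (rule const_linI)
    fix u v :: "'k fls"
    define m where "m = min (fls_subdegree u) (fls_subdegree v)"
    have m: "ord_ge m u" "ord_ge m v" unfolding m_def by (auto intro: ord_ge_mono[OF ord_ge_subdegree])
    show "T (u + v) = T u + T v"
      by (rule fls_eqI)
        (simp add: T'[OF m(1)] T'[OF m(2)] T'[OF ord_ge_add[OF m]] c_def sum.distrib algebra_simps)
  next
    fix a and v :: "'k fls"
    show "T (fls_const a * v) = fls_const a * T v"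
    proof (rule fls_eqI)
      fix n
      show "T (fls_const a * v) $$ n = (fls_const a * T v) $$ n"
        unfolding T'[OF ord_ge_const_mult[OF ord_ge_subdegree[of v]]] fls_mult_const_nth(1) T[of v]
        by (simp only: c_def fls_mult_const_nth sum_distrib_left mult_ac)
    qed
  qed
  moreover have "raises_ord d T"
    unfolding raises_ord_def
  proof (intro allI impI)
    fix n and v :: "'k fls" assume v: "ord_ge n v"
    show "ord_ge (n + d) (T v)"
      unfolding ord_ge_def by (auto simp: T'[OF v] c_def ord_geD[OF v])
  qed
  moreover have "T (fls_X_intpow n) $$ (n + d + int i) = poly (p i) (of_int n)" for n i
  proof -
    have "T (fls_X_intpow n) $$ (n + d + int i) = (\<Sum>j\<le>i. c (fls_X_intpow n) (n + d + int i) j)"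
      by (subst T'[OF ord_ge_X_intpow]) simp
    also have "\<dots> = (\<Sum>j\<in>{i}. c (fls_X_intpow n) (n + d + int i) j)"
      by (rule sum.mono_neutral_right) (auto simp: c_def)
    finally show ?thesis by (simp add: c_def)
  qed
  ultimately show ?thesis unfolding symbol_def by blast
qed

lemma symbol_unique:
  assumes "symbol d p S" "symbol d p T"
  shows "S v = T v"
proof -
  have s: "symbol d (\<lambda>i. p i - p i) (\<lambda>v. S v - T v)" by (rule symbol_diff[OF assms])
  have "S v - T v = 0"
  proof (rule const_lin_eq_zero[OF symbolD(1,2)[OF s]])
    fix n
    have o: "ord_ge (n + d) (S (fls_X_intpow n) - T (fls_X_intpow n))"
      by (rule raises_ordD[OF symbolD(2)[OF s] ord_ge_X_intpow])
    have "(S (fls_X_intpow n) - T (fls_X_intpow n)) $$ k = 0" for k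
    proof (cases "k < n + d")
      case True
      then show ?thesis by (rule ord_geD[OF o])
    next
      case False
      then have "k = n + d + int (nat (k - n - d))" by simp
      then show ?thesis using symbolD(3)[OF s, of n "nat (k - n - d)"] by simp
    qed
    then show "S (fls_X_intpow n) - T (fls_X_intpow n) = 0" by (intro fls_zero_eqI)
  qed
  then show ?thesis by simp
qed

lemma periodic_poly_const:
  fixes p :: "'k::field_char_0 poly"
  assumes "m \<ge> (1::nat)" "\<And>n::int. poly p (of_int (n - int m)) = poly p (of_int n)"
  shows "p = [:poly p 0:]"
proof (rule ccontr)
  assume "p \<noteq> [:poly p 0:]"
  then have fin: "finite {x. poly (p - [:poly p 0:]) x = 0}" by (intro poly_roots_finite) simp
  have "poly p (of_int (- int m * int k)) = poly p 0" for k
  proof (induction k)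
    case (Suc k)
    have "- int m * int (Suc k) = - int m * int k - int m" by (simp add: algebra_simps)
    then show ?case using Suc assms(2)[of "- int m * int k"] by metis
  qed simp
  then have "range (\<lambda>k::nat. of_int (- int m * int k) :: 'k) \<subseteq> {x. poly (p - [:poly p 0:]) x = 0}"
    by auto
  with fin have "finite (range (\<lambda>k::nat. of_int (- int m * int k) :: 'k))" by (rule finite_subset[rotated])
  moreover have "inj (\<lambda>k::nat. of_int (- int m * int k) :: 'k)"
    using assms(1) by (auto simp: inj_def)
  ultimately show False using finite_imageD infinite_UNIV_nat by blast
qed

text \<open>Comparing coefficients in \<open>comm\<close> shows, by induction on \<open>i\<close>, that the polynomial \<open>r i\<close> has period
  \<open>m\<close>. In characteristic zero it is then constant, and its value at \<open>0\<close> vanishes because \<open>R 1 = 0\<close>. So a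
  solution of such a commutation relation is determined by its value at \<open>1\<close>.\<close>

lemma intertwiner_zero:
  fixes R :: "'k::field_char_0 fls \<Rightarrow> 'k fls"
  assumes R: "symbol d r R" and m: "m \<ge> (1::nat)"
    and comm: "\<And>v. R (fls_shift (int m) v) = fls_shift (int m) (R v) + fls_const c * R v"
    and one: "R 1 = 0"
  shows "R v = 0"
proof -
  have r0: "r i = 0" for i
  proof (induction i rule: less_induct)
    case (less i)
    have per: "poly (r i) (of_int (n - int m)) = poly (r i) (of_int n)" for n
    proof -
      have "R (fls_X_intpow (n - int m)) = fls_shift (int m) (R (fls_X_intpow n)) + fls_const c * R (fls_X_intpow n)"
        using comm[of "fls_X_intpow n"] by (simp add: algebra_simps)
      moreover have "R (fls_X_intpow n) $$ (n - int m + d + int i) = 0"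
      proof (cases "i < m")
        case True
        then show ?thesis
          by (intro ord_geD[OF raises_ordD[OF symbolD(2)[OF R] ord_ge_X_intpow]]) auto
      next
        case False
        then have e: "n - int m + d + int i = n + d + int (i - m)" by auto
        have "r (i - m) = 0" using less[of "i - m"] m False by simp
        then show ?thesis unfolding e using symbolD(3)[OF R, of n "i - m"] by simp
      qed
      ultimately have "R (fls_X_intpow (n - int m)) $$ (n - int m + d + int i)
          = R (fls_X_intpow n) $$ (n + d + int i)"
        by (simp add: fls_mult_const_nth algebra_simps)
      then show ?thesis using symbolD(3)[OF R, of _ i] by metis
    qed
    have "poly (r i) 0 = 0" using symbolD(3)[OF R, of 0 i] one by simp
    with periodic_poly_const[OF m per] show ?case by simp
  qed
  have "symbol d (\<lambda>i. 0 - 0) (\<lambda>v. R v - R v)"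
    using symbol_diff[OF R R] r0 by simp
  moreover have "symbol d (\<lambda>i. 0 - 0) R" using R r0 by (simp add: symbol_def)
  ultimately have "R v - R v = R v" by (rule symbol_unique)
  then show ?thesis by simp
qed

section \<open>Conjugation to a power of the variable\<close>

text \<open>The rising products \<open>x (x + m) \<cdots> (x + (n - 1) m)\<close> form a basis of the polynomials, and the
  difference operator maps the product of length \<open>n + 1\<close> to \<open>- (n + 1) m\<close> times the one of length \<open>n\<close>.
  The factor is invertible in characteristic zero.\<close>

lemma difference_equation:
  fixes r :: "'k::field_char_0 poly"
  assumes "m \<ge> (1::nat)"
  shows "\<exists>p. pcompose p [:- of_nat m, 1:] - p = r"
proof -
  define b where "b = (\<lambda>n. \<Prod>j<n. [:of_nat (j * m), 1:] :: 'k poly)"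
  have deg: "degree (b n) = n" for n
    unfolding b_def by (subst degree_prod_sum_eq) auto
  have lc: "lead_coeff (b n) = 1" for n
    unfolding b_def by (simp add: lead_coeff_prod)
  have diff: "pcompose (b (Suc n)) [:- of_nat m, 1:] - b (Suc n) = Polynomial.smult (- of_nat (Suc n * m)) (b n)" for n
  proof -
    have "pcompose (b (Suc n)) [:- of_nat m, 1:] = (\<Prod>j<Suc n. [:of_nat (j * m) - of_nat m, 1:])"
      unfolding b_def pcompose_prod by (intro prod.cong) (auto simp: pcompose_pCons)
    also have "\<dots> = [:- of_nat m, 1:] * (\<Prod>j<n. [:of_nat (j * m), 1:])"
      by (subst prod.lessThan_Suc_shift) (simp add: algebra_simps)
    finally have "pcompose (b (Suc n)) [:- of_nat m, 1:] = [:- of_nat m, 1:] * b n"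
      unfolding b_def .
    moreover have "b (Suc n) = [:of_nat (n * m), 1:] * b n"
      unfolding b_def by (simp only: prod.lessThan_Suc mult.commute)
    ultimately have "pcompose (b (Suc n)) [:- of_nat m, 1:] - b (Suc n)
        = ([:- of_nat m, 1:] - [:of_nat (n * m), 1:]) * b n"
      by (simp only: left_diff_distrib)
    also have "[:- of_nat m, 1:] - [:of_nat (n * m), 1:] = [:- of_nat (Suc n * m):: 'k:]" by simp
    finally show ?thesis by simp
  qed
  show ?thesis
  proof (induction "degree r" arbitrary: r rule: less_induct)
    case less
    define n where "n = degree r"
    define a where "a = - lead_coeff r / of_nat (Suc n * m)"
    define r' where "r' = r - Polynomial.smult (lead_coeff r) (b n)"
    have eq: "pcompose (Polynomial.smult a (b (Suc n))) [:- of_nat m, 1:] - Polynomial.smult a (b (Suc n)) = Polynomial.smult (lead_coeff r) (b n)"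
    proof -
      have "pcompose (Polynomial.smult a (b (Suc n))) [:- of_nat m, 1:] - Polynomial.smult a (b (Suc n))
          = Polynomial.smult a (Polynomial.smult (- of_nat (Suc n * m)) (b n))"
        using diff[of n] by (simp add: pcompose_smult flip: smult_diff_right)
      also have "\<dots> = Polynomial.smult (a * (- of_nat (Suc n * m))) (b n)" by (rule smult_smult)
      also have "a * (- of_nat (Suc n * m)) = lead_coeff r"
      proof -
        have "of_nat (Suc n * m) \<noteq> (0::'k)" using assms by (simp only: of_nat_eq_0_iff) simp
        moreover have "- L / N * (- N) = L" if "N \<noteq> 0" for L N :: 'k using that by simp
        ultimately show ?thesis unfolding a_def by blast
      qed
      finally show ?thesis .
    qed
    show ?case
    proof (cases "n = 0")
      case True
      then have "b n = 1" "r = [:lead_coeff r:]"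
        by (auto simp: b_def n_def elim: degree_eq_zeroE)
      then show ?thesis using eq by (intro exI[of _ "Polynomial.smult a (b (Suc n))"]) simp
    next
      case False
      have "degree r' < degree r"
      proof (cases "r' = 0")
        case True
        then show ?thesis using False n_def by simp
      next
        case nz: False
        show ?thesis
        proof (rule degree_less_if_less_eqI)
          show "degree r' \<le> degree r" unfolding r'_def using deg[of n] n_def
            by (intro degree_diff_le) (auto intro: order.trans[OF degree_smult_le])
          show "coeff r' (degree r) = 0" unfolding r'_def using deg[of n] lc[of n] n_def by simp
        qed (rule nz)
      qed
      from less[OF this] obtain p where "pcompose p [:- of_nat m, 1:] - p = r'" by blast
      then have "pcompose (p + Polynomial.smult a (b (Suc n))) [:- of_nat m, 1:] - (p + Polynomial.smult a (b (Suc n))) = r"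
        using eq by (simp add: pcompose_add r'_def algebra_simps)
      then show ?thesis by blast
    qed
  qed
qed

lemma symbol_const_shift:
  "symbol (- int m) (\<lambda>i. if i = 0 then [:c:] else 0) (\<lambda>v. fls_const c * fls_shift (int m) v)"
proof -
  have A: "symbol (- int m + 0) (comp_symbol (- int m) (\<lambda>i. [:fls_const c $$ (0 + int i):]) (\<lambda>i. if i = 0 then 1 else 0))
     (\<lambda>v. fls_const c * fls_shift (int m) v)"
    by (rule symbol_comp[OF symbol_mult[OF ord_ge_const] symbol_X_inv_pow])
  have "comp_symbol (- int m) (\<lambda>i. [:fls_const c $$ (0 + int i):]) (\<lambda>i. if i = 0 then 1 else 0) i
      = (if i = 0 then [:c:] else 0)" for i
  proof -
    have "comp_symbol (- int m) (\<lambda>i. [:fls_const c $$ (0 + int i):]) (\<lambda>i. if i = 0 then 1 else 0) i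
      = (\<Sum>j\<in>{0}. (if j = 0 then 1 else 0) * pcompose [:fls_const c $$ (0 + int (i - j)):] [:of_int (- int m + int j), 1:])"
      unfolding comp_symbol_def by (rule sum.mono_neutral_right) auto
    then show ?thesis by (simp add: pcompose_pCons)
  qed
  then have E: "comp_symbol (- int m) (\<lambda>i. [:fls_const c $$ (0 + int i):]) (\<lambda>i. if i = 0 then 1 else 0)
      = (\<lambda>i. if i = 0 then [:c:] else 0)" by blast
  show ?thesis using A unfolding E by simp
qed

text \<open>The coefficient polynomials of \<open>U\<close> are found one after the other: the coefficient of
  \<open>t^(n - m + i)\<close> in the required identity is a difference equation for \<open>u i\<close> whose right-hand side
  involves only \<open>u j\<close> with \<open>j < i\<close>.\<close>

lemma conjugator_exists:
  fixes G :: "'k::field_char_0 fls \<Rightarrow> 'k fls"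
  assumes G: "symbol (- int m) g G" and g0: "g 0 = [:c:]" "c \<noteq> 0" and m: "m \<ge> 1"
  shows "\<exists>u U. symbol 0 u U \<and> u 0 = 1 \<and> (\<forall>v. G (U v) = U (fls_const c * fls_shift (int m) v))"
proof -
  \<comment> \<open>The part of the \<open>i\<close>-th coefficient of \<open>G U\<close> that involves earlier \<open>u j\<close>.\<close>
  define rhs where "rhs = (\<lambda>(f :: nat \<Rightarrow> 'k poly) i. \<Sum>j<i. f j * pcompose (g (i - j)) [:of_int (int j), 1:])"
  define P where "P = (\<lambda>f (i::nat) r. (i = 0 \<longrightarrow> r = 1) \<and>
     pcompose r [:- of_nat m, 1:] - r = Polynomial.smult (1 / c) (rhs f i))"
  have "\<exists>u. \<forall>i. P u i (u i)"
  proof (rule dependent_wellorder_choice)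
    fix r :: "'k poly" and f g' :: "nat \<Rightarrow> 'k poly" and i :: nat assume "\<And>y. y < i \<Longrightarrow> f y = g' y"
    then have "rhs f i = rhs g' i" unfolding rhs_def by (intro sum.cong) auto
    then show "P f i r = P g' i r" by (simp add: P_def)
  next
    fix i and f :: "nat \<Rightarrow> 'k poly"
    show "\<exists>r. P f i r"
    proof (cases "i = 0")
      case True
      then show ?thesis by (intro exI[of _ 1]) (simp add: P_def rhs_def pcompose_1)
    next
      case False
      then show ?thesis using difference_equation[OF m] by (simp add: P_def)
    qed
  qed
  then obtain u where u: "\<And>i. P u i (u i)" by blast
  obtain U where U: "symbol 0 u U" using symbol_exists by blast
  have "comp_symbol 0 g u i = comp_symbol (- int m) u (\<lambda>i. if i = 0 then [:c:] else 0) i" for i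
  proof -
    have 1: "comp_symbol 0 g u i = rhs u i + u i * [:c:]"
      unfolding comp_symbol_def rhs_def by (simp add: lessThan_Suc_atMost[symmetric] g0)
    have 2: "comp_symbol (- int m) u (\<lambda>i. if i = 0 then [:c:] else 0) i
        = (\<Sum>j\<in>{0}. (if j = 0 then [:c:] else 0) * pcompose (u (i - j)) [:of_int (- int m + int j), 1:])"
      unfolding comp_symbol_def by (rule sum.mono_neutral_right) auto
    have "pcompose (u i) [:- of_nat m, 1:] = Polynomial.smult (1 / c) (rhs u i) + u i"
      using u[of i] by (simp add: P_def algebra_simps)
    then show ?thesis unfolding 1 2 using g0(2) by (simp add: smult_add_right)
  qed
  then have e: "comp_symbol 0 g u = comp_symbol (- int m) u (\<lambda>i. if i = 0 then [:c:] else 0)" by blast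
  have "symbol (- int m) (comp_symbol 0 g u) (\<lambda>v. G (U v))"
    using symbol_comp[OF G U] by simp
  moreover have "symbol (- int m) (comp_symbol 0 g u) (\<lambda>v. U (fls_const c * fls_shift (int m) v))"
    unfolding e using symbol_comp[OF U symbol_const_shift[of m c]] by simp
  ultimately have "G (U v) = U (fls_const c * fls_shift (int m) v)" for v by (rule symbol_unique)
  moreover have "u 0 = 1" using u[of 0] by (simp add: P_def)
  ultimately show ?thesis using U by blast
qed

text \<open>Since \<open>u 0 = 1\<close>, the equations for the coefficient polynomials of the inverse form a unitriangular
  system.\<close>

lemma symbol_left_inverse:
  fixes U :: "'k::field fls \<Rightarrow> 'k fls"
  assumes U: "symbol 0 u U" and u0: "u 0 = 1"
  shows "\<exists>w W. symbol 0 w W \<and> w 0 = 1 \<and> (\<forall>v. W (U v) = v)"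
proof -
  define rhs where "rhs = (\<lambda>(f :: nat \<Rightarrow> 'k poly) i. if i = 0 then 1
    else - (\<Sum>j<i. u (Suc j) * pcompose (f (i - Suc j)) [:of_int (int (Suc j)), 1:]))"
  have "\<exists>w. \<forall>i. w i = rhs w i"
  proof (rule dependent_wellorder_choice)
    fix r :: "'k poly" and f g' :: "nat \<Rightarrow> 'k poly" and i :: nat assume "\<And>y. y < i \<Longrightarrow> f y = g' y"
    then have "rhs f i = rhs g' i" unfolding rhs_def by (auto intro!: sum.cong)
    then show "(r = rhs f i) = (r = rhs g' i)" by simp
  qed simp
  then obtain w where w: "\<And>i. w i = rhs w i" by blast
  obtain W where W: "symbol 0 w W" using symbol_exists by blast
  have "comp_symbol 0 w u i = (if i = 0 then 1 else 0)" for i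
  proof (cases i)
    case 0
    then show ?thesis using w[of 0] u0 by (simp add: comp_symbol_def rhs_def)
  next
    case (Suc k)
    have "comp_symbol 0 w u i = w i + (\<Sum>j\<le>k. u (Suc j) * pcompose (w (i - Suc j)) [:of_int (int (Suc j)), 1:])"
      unfolding comp_symbol_def Suc
      by (subst sum.atMost_Suc_shift) (simp add: u0 pcompose_idR)
    also have "\<dots> = 0" by (subst w) (simp add: rhs_def Suc lessThan_Suc_atMost)
    finally show ?thesis using Suc by simp
  qed
  then have e: "comp_symbol 0 w u = (\<lambda>i. if i = 0 then 1 else 0)" by blast
  have "symbol 0 (comp_symbol 0 w u) (\<lambda>v. W (U v))" using symbol_comp[OF W U] by simp
  from symbol_unique[OF this[unfolded e] symbol_id] have "W (U v) = v" for v .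
  moreover have "w 0 = 1" by (subst w) (simp add: rhs_def)
  ultimately show ?thesis using W by blast
qed

text \<open>The left inverse \<open>W\<close> preserves leading coefficients, hence is injective; and \<open>W\<close> maps
  \<open>U (W v)\<close> and \<open>v\<close> to the same element.\<close>

lemma symbol_inverse:
  fixes U :: "'k::field fls \<Rightarrow> 'k fls"
  assumes U: "symbol 0 u U" and u0: "u 0 = 1"
  shows "\<exists>w W. symbol 0 w W \<and> w 0 = 1 \<and> (\<forall>v. W (U v) = v) \<and> (\<forall>v. U (W v) = v)"
proof -
  obtain w W where W: "symbol 0 w W" "w 0 = 1" and WU: "\<And>v. W (U v) = v"
    using symbol_left_inverse[OF assms] by blast
  have inj: "v = 0" if "W v = 0" for v
  proof (rule ccontr)
    assume "v \<noteq> 0"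
    then have "v $$ fls_subdegree v \<noteq> 0" by simp
    moreover have "W v $$ (fls_subdegree v + 0 + int 0) = v $$ fls_subdegree v"
      by (subst symbol_nth[OF W(1) ord_ge_subdegree]) (simp add: W(2))
    ultimately show False using that by simp
  qed
  have "U (W v) = v" for v
  proof -
    have "W (U (W v) - v) = 0" by (simp add: const_linD[OF symbolD(1)[OF W(1)]] WU)
    from inj[OF this] show ?thesis by simp
  qed
  then show ?thesis using W WU by blast
qed

text \<open>The leading coefficient of the operator on \<open>t^n\<close> is nonzero and independent of \<open>n\<close>. The
  operator \<open>- z \<nabla>\<close> on \<open>E_f\<close> has this property when \<open>ord f < 0\<close>, because the derivation then only
  contributes to later coefficients.\<close>

definition elliptic :: "int \<Rightarrow> ('k::field fls \<Rightarrow> 'k fls) \<Rightarrow> bool" where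
  "elliptic d T \<longleftrightarrow> (\<exists>p a. symbol d p T \<and> p 0 = [:a:] \<and> a \<noteq> 0)"

lemma ellipticI: "symbol d p T \<Longrightarrow> p 0 = [:a:] \<Longrightarrow> a \<noteq> 0 \<Longrightarrow> elliptic d T"
  unfolding elliptic_def by blast

lemma elliptic_comp:
  assumes "elliptic e S" "elliptic d T"
  shows "elliptic (d + e) (\<lambda>v. S (T v))"
proof -
  obtain q a where q: "symbol e q S" "q 0 = [:a:]" "a \<noteq> 0" using assms(1) by (auto simp: elliptic_def)
  obtain p b where p: "symbol d p T" "p 0 = [:b:]" "b \<noteq> 0" using assms(2) by (auto simp: elliptic_def)
  show ?thesis unfolding elliptic_def
    by (rule exI[of _ "comp_symbol d q p"], rule exI[of _ "a * b"])
      (use symbol_comp[OF q(1) p(1)] q p in \<open>simp add: comp_symbol_def mult.commute\<close>)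
qed

lemma ellipticI_one: "symbol 0 u U \<Longrightarrow> u 0 = 1 \<Longrightarrow> elliptic 0 U"
  by (rule ellipticI[of 0 u U 1]) (simp_all add: one_pCons)

text \<open>An operator of order \<open>- m\<close> is conjugate to \<open>c t^(- m)\<close> by the solution of the difference
  equations, and rescaling \<open>t\<close> by an \<open>m\<close>-th root of \<open>c\<close> removes the constant; this is where the
  field has to be algebraically closed. Conjugation by \<open>\<Psi>\<close> keeps the class of elliptic operators,
  which is needed to recognize the image of the second operator.\<close>

theorem elliptic_normal_form:
  fixes G :: "'k::{alg_closed_field,field_char_0} fls \<Rightarrow> 'k fls"
  assumes G: "elliptic (- int m) G" and m: "m \<ge> 1"
  shows "\<exists>\<Psi> \<Psi>'. const_lin \<Psi> \<and> raises_ord 0 \<Psi> \<and>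
     (\<forall>v. \<Psi> (\<Psi>' v) = v) \<and> (\<forall>v. \<Psi>' (\<Psi> v) = v) \<and> (\<forall>v. \<Psi> (G v) = fls_shift (int m) (\<Psi> v)) \<and>
     (\<forall>d T. elliptic d T \<longrightarrow> elliptic d (\<lambda>v. \<Psi> (T (\<Psi>' v))))"
proof -
  obtain g c where g: "symbol (- int m) g G" "g 0 = [:c:]" "c \<noteq> 0"
    using G by (auto simp: elliptic_def)
  obtain u U where U: "symbol 0 u U" "u 0 = 1" and GU: "\<And>v. G (U v) = U (fls_const c * fls_shift (int m) v)"
    using conjugator_exists[OF g m] by blast
  obtain w W where W: "symbol 0 w W" "w 0 = 1" and WU: "\<And>v. W (U v) = v" and UW: "\<And>v. U (W v) = v"
    using symbol_inverse[OF U] by blast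
  obtain l where l: "l ^ m = c" using nth_root_exists[of m c] m by auto
  have l0: "l \<noteq> 0" using l g(3) m by (auto simp: power_0_left)
  \<comment> \<open>The substitution of \<open>l t\<close> for \<open>t\<close>.\<close>
  define S where "S = (\<lambda>l (v::'k fls). fls_compose_fps v (fps_const l * fps_X))"
  have S_nth: "S l v $$ n = v $$ n * l powi n" if "l \<noteq> 0" for l v n
    unfolding S_def by (rule fls_nth_fls_compose_fps_linear[OF that])
  have S_lin: "const_lin (S l)" if "l \<noteq> 0" for l
    by (rule const_linI; rule fls_eqI) (simp_all add: S_nth[OF that] fls_mult_const_nth algebra_simps)
  have S_ord: "raises_ord 0 (S l)" if "l \<noteq> 0" for l
    unfolding raises_ord_def ord_ge_def by (simp add: S_nth[OF that])
  have SS: "S l (S (inverse l) v) = v" if "l \<noteq> 0" for l v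
    by (rule fls_eqI) (use that in \<open>simp add: S_nth power_int_inverse\<close>)
  have S_shift: "S l (fls_const c * fls_shift (int m) v) = fls_shift (int m) (S l v)" for v
  proof (rule fls_eqI)
    fix n
    have "l powi (n + int m) = l powi n * c" using l l0 by (simp add: power_int_add)
    then show "S l (fls_const c * fls_shift (int m) v) $$ n = fls_shift (int m) (S l v) $$ n"
      by (simp add: S_nth[OF l0] fls_mult_const_nth)
  qed
  have S_ell: "elliptic d (\<lambda>v. S l (T (S (inverse l) v)))" if T_ell: "elliptic d T" for d T
  proof -
    obtain p a where p: "symbol d p T" "p 0 = [:a:]" "a \<noteq> 0" using T_ell by (auto simp: elliptic_def)
    note T = symbolD[OF p(1)]
    have i0: "inverse l \<noteq> 0" using l0 by simp
    have "symbol d (\<lambda>i. Polynomial.smult (l powi (d + int i)) (p i)) (\<lambda>v. S l (T (S (inverse l) v)))"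
      unfolding symbol_def
    proof (intro conjI allI)
      show "const_lin (\<lambda>v. S l (T (S (inverse l) v)))"
        using S_lin[OF l0] S_lin[OF i0] T(1) by (simp add: const_lin_def)
      show "raises_ord d (\<lambda>v. S l (T (S (inverse l) v)))"
        using S_ord[OF l0] S_ord[OF i0] T(2) by (simp add: raises_ord_def)
      fix n i
      have "S (inverse l) (fls_X_intpow n) = fls_const (l powi (- n)) * fls_X_intpow n"
        by (rule fls_eqI) (simp add: S_nth[OF i0] fls_mult_const_nth power_int_minus power_int_inverse)
      then have "S l (T (S (inverse l) (fls_X_intpow n))) $$ (n + d + int i)
          = l powi (- n) * poly (p i) (of_int n) * l powi (n + d + int i)"
        using T(3)[of n i] by (simp add: S_nth[OF l0] const_linD[OF T(1)] fls_mult_const_nth)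
      also have "\<dots> = (l powi (- n) * l powi (n + d + int i)) * poly (p i) (of_int n)" by simp
      also have "l powi (- n) * l powi (n + d + int i) = l powi (d + int i)"
        using l0 by (simp flip: power_int_add)
      finally show "S l (T (S (inverse l) (fls_X_intpow n))) $$ (n + d + int i)
          = poly (Polynomial.smult (l powi (d + int i)) (p i)) (of_int n)" by simp
    qed
    then show ?thesis unfolding elliptic_def
      by (rule_tac exI[of _ "\<lambda>i. Polynomial.smult (l powi (d + int i)) (p i)"], rule_tac exI[of _ "l powi d * a"])
        (use p l0 in simp)
  qed
  define \<Psi> where "\<Psi> = (\<lambda>v. S l (W v))"
  define \<Psi>' where "\<Psi>' = (\<lambda>v. U (S (inverse l) v))"
  have i0: "inverse l \<noteq> 0" using l0 by simp
  have "const_lin \<Psi>" "raises_ord 0 \<Psi>"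
    unfolding \<Psi>_def
    using S_lin[OF l0] symbolD(1)[OF W(1)] S_ord[OF l0] symbolD(2)[OF W(1)]
    by (simp_all add: const_lin_def raises_ord_def)
  moreover have "\<Psi> (\<Psi>' v) = v" "\<Psi>' (\<Psi> v) = v" for v
    using SS[OF l0] SS[OF i0] by (simp_all add: \<Psi>_def \<Psi>'_def WU UW)
  moreover have "\<Psi> (G v) = fls_shift (int m) (\<Psi> v)" for v
  proof -
    have "W (G v) = fls_const c * fls_shift (int m) (W v)" using GU[of "W v"] by (simp add: UW WU)
    then show ?thesis by (simp add: \<Psi>_def S_shift)
  qed
  moreover have "elliptic d (\<lambda>v. \<Psi> (T (\<Psi>' v)))" if "elliptic d T" for d T
  proof -
    have "elliptic (0 + d + 0) (\<lambda>v. W (T (U v)))"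
      using elliptic_comp[OF ellipticI_one[OF W] elliptic_comp[OF that ellipticI_one[OF U]]] .
    then show ?thesis unfolding \<Psi>_def \<Psi>'_def by (intro S_ell) simp
  qed
  ultimately show ?thesis by blast
qed

section \<open>The operators of the irreducible objects\<close>

text \<open>The derivation \<open>\<zeta> d/d\<zeta>\<close> on \<open>k((t))\<close> with \<open>t^q = \<zeta>\<close>.\<close>

definition euler :: "nat \<Rightarrow> 'k::field_char_0 fls \<Rightarrow> 'k fls" where
  "euler q v = fls_const (1 / of_nat q) * (fls_X * fls_deriv v)"

lemma euler_nth: "euler q v $$ n = of_int n / of_nat q * v $$ n"
  by (simp add: euler_def fls_mult_const_nth fls_X_times_conv_shift)

text \<open>Multiplication by \<open>z = t^(- q)\<close> is the shift by \<open>q\<close>, so this is \<open>z \<nabla>\<close> on \<open>E_f\<close>.\<close>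

lemma shift_E_opr:
  assumes "q \<ge> 1"
  shows "fls_shift (int q) (opr (E_obj q f) v) = - euler q v + f * v"
proof -
  have "fls_X ^ q * (f * v) = fls_shift (- int q) (f * v)" by (simp add: fls_X_power_times_conv_shift)
  moreover have "fls_const (1 / of_nat q) * fls_X ^ (q + 1) * fls_deriv v = fls_X ^ q * euler q v"
    by (simp add: euler_def mult_ac)
  then have "fls_const (1 / of_nat q) * fls_X ^ (q + 1) * fls_deriv v = fls_shift (- int q) (euler q v)"
    by (simp only: fls_X_power_times_conv_shift)
  ultimately show ?thesis by (simp add: E_obj_def d_dz_root_def mult.assoc)
qed

lemma symbol_euler:
  "symbol (- int s) (\<lambda>i. if i = s then [:0, 1 / of_nat q:] else 0) (euler q)"
  unfolding symbol_def
proof (intro conjI allI)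
  show "const_lin (euler q)"
    by (rule const_linI; rule fls_eqI) (simp_all add: euler_nth fls_mult_const_nth algebra_simps)
  show "raises_ord (- int s) (euler q)" by (simp add: raises_ord_def ord_ge_def euler_nth)
  fix n i
  show "euler q (fls_X_intpow n) $$ (n + - int s + int i)
      = poly (if i = s then [:0, 1 / of_nat q:] else 0) (of_int n)"
    by (auto simp: euler_nth)
qed

lemma euler_shift:
  "q \<ge> 1 \<Longrightarrow> euler q (fls_shift (int q) v) = fls_shift (int q) (euler q v) - fls_shift (int q) v"
  by (rule fls_eqI) (simp add: euler_nth field_simps)

text \<open>By the law \<open>(1 + x)^a (1 + x)^b = (1 + x)^(a + b)\<close>, the binomial series form a homomorphic image of
  the additive group of exponents.\<close>

lemma fps_compose_binomial_powi:
  fixes a :: "'k::field_char_0"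
  assumes p: "p \<ge> (1::nat)"
  shows "fps_to_fls (fps_compose (fps_binomial a) (fps_X ^ p)) powi n
    = fps_to_fls (fps_compose (fps_binomial (of_int n * a)) (fps_X ^ p))"
proof -
  define e where "e = (\<lambda>a::'k. fps_to_fls (fps_compose (fps_binomial a) (fps_X ^ p)))"
  have X0: "fps_nth (fps_X ^ p :: 'k fps) 0 = 0" using p by simp
  have add: "e (a + b) = e a * e b" for a b
    by (simp add: e_def fps_binomial_add_mult fps_compose_mult_distrib[OF X0] fls_times_fps_to_fls)
  have e0: "e 0 = 1" by (simp add: e_def)
  have pw: "e a ^ k = e (of_nat k * a)" for k
    by (induction k) (simp_all add: e0 add algebra_simps)
  have inv: "inverse (e b) = e (- b)" for b
    using add[of b "- b"] e0 by (simp add: inverse_unique)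
  have "e a powi n = e (of_int n * a)"
  proof (cases "n \<ge> 0")
    case True
    then show ?thesis using pw[of "nat n"] by (simp add: power_int_def)
  next
    case False
    then have n: "of_nat (nat (- n)) = (- of_int n :: 'k)" by simp
    show ?thesis using False pw[of "nat (- n)"] n inv[of "- of_int n * a"]
      by (simp add: power_int_def power_inverse)
  qed
  then show ?thesis by (simp only: e_def)
qed

context
  fixes p :: nat
  assumes p: "p \<ge> 1"
begin

lemma phi_root_series:
  "fps_X * fps_compose (fps_binomial (- 1 / of_nat p)) (fps_X ^ p) \<noteq> (0 :: 'k::field_char_0 fps)"
  "fps_nth (fps_X * fps_compose (fps_binomial (- 1 / of_nat p)) (fps_X ^ p) :: 'k fps) 0 = 0"
proof -
  have "fps_nth (fps_compose (fps_binomial (- 1 / of_nat p)) (fps_X ^ p)) 0 = (1::'k)" by simp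
  then have "fps_compose (fps_binomial (- 1 / of_nat p)) (fps_X ^ p) \<noteq> (0 :: 'k fps)"
    by (metis fps_zero_nth zero_neq_one)
  then show "fps_X * fps_compose (fps_binomial (- 1 / of_nat p)) (fps_X ^ p) \<noteq> (0 :: 'k fps)" by simp
qed simp

lemma phi_root_mult: "phi_root p (u * v) = phi_root p u * phi_root p (v :: 'k::field_char_0 fls)"
  unfolding phi_root_def by (rule fls_compose_fps_mult[OF phi_root_series])

lemma phi_root_intpow:
  "phi_root p (fls_X_intpow n :: 'k::field_char_0 fls)
    = fls_X_intpow n * fps_to_fls (fps_compose (fps_binomial (- of_int n / of_nat p)) (fps_X ^ p))"
proof -
  have "phi_root p (fls_X_intpow n :: 'k fls) = phi_root p (fls_X powi n)" by simp
  also have "\<dots> = fps_to_fls (fps_X * fps_compose (fps_binomial (- 1 / of_nat p)) (fps_X ^ p)) powi n"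
    unfolding phi_root_def by (simp only: fls_compose_fps_powi[OF phi_root_series] fls_compose_fps_X)
  also have "\<dots> = fls_X_intpow n * fps_to_fls (fps_compose (fps_binomial (- 1 / of_nat p)) (fps_X ^ p)) powi n"
    by (simp add: fls_times_fps_to_fls power_int_mult_distrib del: fls_X_power_int) simp
  also have "\<dots> = fls_X_intpow n * fps_to_fls (fps_compose (fps_binomial (of_int n * (- 1 / of_nat p))) (fps_X ^ p))"
    by (simp only: fps_compose_binomial_powi[OF p])
  finally show ?thesis by simp
qed

text \<open>The image of \<open>t^n\<close> is \<open>t^n (1 + t^p)^(- n / p)\<close>, and the binomial coefficients of \<open>- n / p\<close> are
  polynomials in \<open>n\<close>.\<close>

lemma elliptic_phi_root: "elliptic 0 (phi_root p :: 'k::field_char_0 fls \<Rightarrow> 'k fls)"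
proof -
  define c :: "nat \<Rightarrow> 'k poly" where
    "c = (\<lambda>k. Polynomial.smult (1 / fact k) (\<Prod>i<k. [:- of_nat i, - 1 / of_nat p:]))"
  have c: "poly (c k) (of_int n) = (- of_int n / of_nat p) gchoose k" for k n
    by (simp add: c_def gbinomial_prod_rev poly_prod atLeast0LessThan)
      (rule prod.cong, simp_all add: algebra_simps)
  define e where "e = (\<lambda>i. if p dvd i then c (i div p) else 0)"
  have "symbol 0 e (phi_root p)"
    unfolding symbol_def e_def
  proof (intro conjI allI)
    show "const_lin (phi_root p :: 'k fls \<Rightarrow> 'k fls)"
    proof (rule const_linI)
      show "phi_root p (fls_const a * v) = fls_const a * phi_root p v" for a and v :: "'k fls"
        by (subst phi_root_mult) (simp add: phi_root_def)
      show "phi_root p (u + v) = phi_root p u + phi_root p v" for u v :: "'k fls"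
        unfolding phi_root_def by (rule fls_compose_fps_add[OF phi_root_series])
    qed
    have sd: "subdegree (fps_X * fps_compose (fps_binomial (- 1 / of_nat p)) (fps_X ^ p) :: 'k fps) = 1"
      by (rule subdegreeI) (auto simp: fps_X_mult_nth)
    show "raises_ord 0 (phi_root p :: 'k fls \<Rightarrow> 'k fls)"
      unfolding raises_ord_def
    proof (intro allI impI)
      fix n and v :: "'k fls" assume "ord_ge n v"
      moreover have "fls_subdegree (phi_root p v) = fls_subdegree v"
        using subdegree_fls_compose_fps[OF phi_root_series(2), of v] sd
        unfolding phi_root_def by (metis mult_1_right of_nat_1)
      ultimately show "ord_ge (n + 0) (phi_root p v)"
        by (auto simp: ord_ge_iff_subdegree phi_root_def)
    qed
    fix n i
    show "phi_root p (fls_X_intpow n :: 'k fls) $$ (n + 0 + int i)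
        = poly (if p dvd i then c (i div p) else 0) (of_int n)"
      unfolding phi_root_intpow fls_X_intpow_times_conv_shift
      by (simp add: fps_nth_compose_X_power c)
  qed
  moreover have "e 0 = [:1:]" by (simp add: e_def c_def one_pCons)
  ultimately show ?thesis by (rule ellipticI) simp
qed

text \<open>This is \<open>\<phi>(1/\<theta>) = 1/\<theta> + 1\<close> for \<open>\<theta> = t^p\<close>.\<close>

lemma phi_root_shift:
  "phi_root p (fls_shift (int p) v) = fls_shift (int p) (phi_root p v) + phi_root p (v :: 'k::field_char_0 fls)"
proof -
  have "fls_shift (int p) v = fls_X_intpow (- int p) * v"
    using fls_X_intpow_times_conv_shift(1)[of "- int p" v] by simp
  then have "phi_root p (fls_shift (int p) v) = phi_root p (fls_X_intpow (- int p)) * phi_root p v"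
    by (simp only: phi_root_mult)
  also have "phi_root p (fls_X_intpow (- int p) :: 'k fls) = fls_X_intpow (- int p) * fps_to_fls (1 + fps_X ^ p)"
    unfolding phi_root_intpow using p by (simp add: fps_binomial_1 fps_compose_add_distrib)
  also have "\<dots> = fls_X_intpow (- int p) + 1"
    by (rule fls_eqI) (auto simp: fls_X_intpow_times_conv_shift(1)[of "- int p", simplified] fps_to_fls_power
       fls_X_power_conv_shift_1)
  also have "(fls_X_intpow (- int p) + 1) * phi_root p v = fls_shift (int p) (phi_root p v) + phi_root p v"
    using fls_X_intpow_times_conv_shift(1)[of "- int p" "phi_root p v"] by (simp add: algebra_simps)
  finally show ?thesis .
qed

end

lemma phi_root_1 [simp]: "phi_root p 1 = 1"
  by (simp add: phi_root_def)

lemma phi_eq_phi_root: "phi = phi_root 1"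
  by (rule ext) (simp add: phi_def phi_root_def fps_binomial_minus_one fps_divide_unit)

lemma elliptic_ord:
  assumes "elliptic d T"
  shows "ord_ge (n + d) (T y) \<longleftrightarrow> ord_ge n y"
proof -
  obtain p a where p: "symbol d p T" "p 0 = [:a:]" "a \<noteq> 0" using assms by (auto simp: elliptic_def)
  show ?thesis
  proof
    show "ord_ge n y \<Longrightarrow> ord_ge (n + d) (T y)" by (rule raises_ordD[OF symbolD(2)[OF p(1)]])
    assume T: "ord_ge (n + d) (T y)"
    show "ord_ge n y"
    proof (rule ccontr)
      assume "\<not> ord_ge n y"
      then have y: "y \<noteq> 0" "fls_subdegree y < n" by (auto simp: ord_ge_iff_subdegree)
      have "T y $$ (fls_subdegree y + d + int 0) = y $$ fls_subdegree y * a"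
        by (subst symbol_nth[OF p(1) ord_ge_subdegree]) (simp add: p(2))
      then have "T y $$ (fls_subdegree y + d) \<noteq> 0" using y p(3) by simp
      then show False using ord_geD[OF T] y(2) by auto
    qed
  qed
qed

lemma elliptic_lead:
  assumes "elliptic d T"
  shows "ord_ge d (T 1)" "T 1 \<noteq> 0" "fls_subdegree (T 1) = d"
proof -
  obtain p a where p: "symbol d p T" "p 0 = [:a:]" "a \<noteq> 0" using assms by (auto simp: elliptic_def)
  show o: "ord_ge d (T 1)" using raises_ordD[OF symbolD(2)[OF p(1)], of 0 1]
    by (simp add: ord_ge_def)
  have nz: "T 1 $$ d \<noteq> 0" using symbolD(3)[OF p(1), of 0 0] p by simp
  then show "T 1 \<noteq> 0" by auto
  show "fls_subdegree (T 1) = d" using o nz by (intro fls_subdegree_eqI) (auto simp: ord_ge_def)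
qed

lemma elliptic_mult:
  "a \<noteq> 0 \<Longrightarrow> elliptic (fls_subdegree a) (\<lambda>v. a * v)"
  unfolding elliptic_def using symbol_mult[OF ord_ge_subdegree[of a]]
  by (intro exI[of _ "\<lambda>i. [:a $$ (fls_subdegree a + int i):]"] exI[of _ "a $$ fls_subdegree a"]) simp

lemma elliptic_shift: "elliptic (- int m) (fls_shift (int m) :: 'k::field fls \<Rightarrow> 'k fls)"
  unfolding elliptic_def
  by (rule exI[of _ "\<lambda>i. if i = 0 then 1 else 0"], rule exI[of _ 1])
    (use symbol_X_inv_pow[of m] in \<open>simp add: one_pCons\<close>)

lemma elliptic_E_obj:
  fixes f :: "'k::field_char_0 fls"
  assumes q: "q \<ge> 1" and s: "s \<ge> 1" and f: "fls_subdegree f = - int s"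
  shows "elliptic (- int s) (\<lambda>v. - fls_shift (int q) (opr (E_obj q f) v))"
proof -
  define T where "T = (\<lambda>v. euler q v - f * v)"
  have f0: "f \<noteq> 0" using f s by auto
  define t where "t = (\<lambda>i. (if i = s then [:0, 1 / of_nat q:] else 0) - [:f $$ (- int s + int i):])"
  have "symbol (- int s) t T"
    unfolding T_def t_def by (rule symbol_diff[OF symbol_euler symbol_mult]) (use f ord_ge_subdegree[of f] in simp)
  moreover have "t 0 = [:- (f $$ (- int s)):]" using s by (simp add: t_def)
  moreover have "- (f $$ (- int s)) \<noteq> 0" using f f0 nth_fls_subdegree_nonzero[of f] by simp
  ultimately have "elliptic (- int s) T" by (rule ellipticI)
  moreover have "(\<lambda>v. - fls_shift (int q) (opr (E_obj q f) v)) = T"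
    by (rule ext) (simp add: shift_E_opr[OF q] T_def)
  ultimately show ?thesis by simp
qed

lemma elliptic_D_obj:
  fixes g :: "'k::field_char_0 fls"
  assumes p: "p \<ge> 1" and g: "g \<noteq> 0"
  shows "elliptic (fls_subdegree g) (opr (D_obj p g))"
  using elliptic_comp[OF elliptic_mult[OF g] elliptic_phi_root[OF p]] by (simp add: D_obj_def)

section \<open>The transform of irreducible objects\<close>

text \<open>The normal form turns \<open>T = - z \<nabla>\<close>, which is the inverse of \<open>\<theta>\<close>, into multiplication by \<open>t^(- s)\<close>.
  In the new coordinate \<open>\<theta>\<close> is \<open>t^s\<close>, and multiplication by \<open>z\<close> becomes an operator \<open>Z\<close> with
  \<open>Z t^(- s) = (t^(- s) + 1) Z\<close>. The operator \<open>g \<phi>\<close> satisfies the same relation, and for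
  \<open>g = Z 1\<close> it agrees with \<open>Z\<close> at \<open>1\<close>; so the two are equal.\<close>

theorem mellin_of_E_obj:
  fixes f :: "'k::{alg_closed_field,field_char_0} fls"
  assumes q: "q \<ge> 1" and s: "s \<ge> 1" and f: "fls_subdegree f = - int s"
  shows "\<exists>g \<Psi> \<Psi>'. g \<noteq> 0 \<and> fls_subdegree g = - int q \<and> const_lin \<Psi> \<and> raises_ord 0 \<Psi> \<and>
     (\<forall>v. \<Psi> (\<Psi>' v) = v) \<and> (\<forall>v. \<Psi>' (\<Psi> v) = v) \<and>
     (\<forall>v. \<Psi> (- fls_shift (int q) (opr (E_obj q f) v)) = fls_shift (int s) (\<Psi> v)) \<and>
     (\<forall>v. \<Psi> (fls_shift (int q) v) = opr (D_obj s g) (\<Psi> v))"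
proof -
  define T where "T = (\<lambda>v. euler q v - f * v)"
  have T: "elliptic (- int s) T"
    using elliptic_E_obj[OF q s f] by (simp add: T_def shift_E_opr[OF q])
  obtain \<Psi> \<Psi>' where lin: "const_lin \<Psi>" "raises_ord 0 \<Psi>"
    and inv: "\<And>v. \<Psi> (\<Psi>' v) = v" "\<And>v. \<Psi>' (\<Psi> v) = v"
    and conj: "\<And>v. \<Psi> (T v) = fls_shift (int s) (\<Psi> v)"
    and ell: "\<And>d T. elliptic d T \<Longrightarrow> elliptic d (\<lambda>v. \<Psi> (T (\<Psi>' v)))"
    using elliptic_normal_form[OF T s] by blast
  define Z where "Z = (\<lambda>v. \<Psi> (fls_shift (int q) (\<Psi>' v)))"
  have Z: "elliptic (- int q) Z" unfolding Z_def by (intro ell elliptic_shift)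
  define g where "g = Z 1"
  have comm: "fls_shift (int q) (T v) = T (fls_shift (int q) v) + fls_shift (int q) v" for v
    by (simp add: T_def euler_shift[OF q] fls_shifted_times_simps)
  have Zs: "Z (fls_shift (int s) v) = fls_shift (int s) (Z v) + Z v" for v
  proof -
    have "\<Psi>' (fls_shift (int s) v) = T (\<Psi>' v)" using conj[of "\<Psi>' v"] inv by metis
    then show ?thesis by (simp add: Z_def comm const_linD[OF lin(1)] conj)
  qed
  obtain z where z: "symbol (- int q) z Z" using Z by (auto simp: elliptic_def)
  obtain e where e: "symbol 0 e (phi_root s :: 'k fls \<Rightarrow> 'k fls)" using elliptic_phi_root[OF s] by (auto simp: elliptic_def)
  have g: "ord_ge (- int q) g" using elliptic_lead[OF Z] by (simp add: g_def)
  have R: "symbol (- int q) (\<lambda>i. z i - comp_symbol 0 (\<lambda>i. [:g $$ (- int q + int i):]) e i) (\<lambda>v. Z v - g * phi_root s v)"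
    using symbol_diff[OF z] symbol_comp[OF symbol_mult[OF g] e] by simp
  have "Z v - g * phi_root s v = 0" for v
  proof (rule intertwiner_zero[OF R s, where c = 1])
    show "Z (fls_shift (int s) v) - g * phi_root s (fls_shift (int s) v) =
         fls_shift (int s) (Z v - g * phi_root s v) + fls_const 1 * (Z v - g * phi_root s v)" for v
      by (simp add: Zs phi_root_shift[OF s] fls_shifted_times_simps algebra_simps)
    show "Z 1 - g * phi_root s 1 = 0" by (simp add: g_def)
  qed
  from this[of "\<Psi> _"] have "\<Psi> (fls_shift (int q) v) = opr (D_obj s g) (\<Psi> v)" for v
    by (simp add: D_obj_def Z_def inv)
  note B = this
  have A: "\<Psi> (- fls_shift (int q) (opr (E_obj q f) v)) = fls_shift (int s) (\<Psi> v)" for v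
    unfolding shift_E_opr[OF q] using conj[of v] by (simp add: T_def)
  have g: "g \<noteq> 0" "fls_subdegree g = - int q" using elliptic_lead[OF Z] by (simp_all add: g_def)
  show ?thesis
    by (rule exI[of _ g], rule exI[of _ \<Psi>], rule exI[of _ \<Psi>'], intro conjI allI) (rule g lin inv A B)+
qed

text \<open>The normal form now turns \<open>\<Phi> = g \<phi>\<close> into \<open>t^(- r)\<close>. The image \<open>Z\<close> of \<open>1/\<theta>\<close> satisfies
  \<open>Z t^(- r) = t^(- r) Z - t^(- r)\<close>, as does the derivation \<open>(1/r) t d/dt\<close>, so that the two differ by
  multiplication with the series \<open>Z 1\<close>.\<close>

theorem inverse_mellin_of_D_obj:
  fixes g :: "'k::{alg_closed_field,field_char_0} fls"
  assumes p: "p \<ge> 1" and r: "r \<ge> 1" and g: "fls_subdegree g = - int r"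
  shows "\<exists>f \<Psi> \<Psi>'. fls_subdegree f = - int p \<and> const_lin \<Psi> \<and> raises_ord 0 \<Psi> \<and>
     (\<forall>v. \<Psi> (\<Psi>' v) = v) \<and> (\<forall>v. \<Psi>' (\<Psi> v) = v) \<and>
     (\<forall>v. \<Psi> (opr (D_obj p g) v) = fls_shift (int r) (\<Psi> v)) \<and>
     (\<forall>v. \<Psi> (fls_shift (int p) v) = - fls_shift (int r) (opr (E_obj r f) (\<Psi> v)))"
proof -
  define T where "T = (\<lambda>v. g * phi_root p v)"
  have g0: "g \<noteq> 0" using g r by auto
  have T: "elliptic (- int r) T"
    using elliptic_D_obj[OF p g0] g by (simp add: T_def D_obj_def)
  obtain \<Psi> \<Psi>' where lin: "const_lin \<Psi>" "raises_ord 0 \<Psi>"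
    and inv: "\<And>v. \<Psi> (\<Psi>' v) = v" "\<And>v. \<Psi>' (\<Psi> v) = v"
    and conj: "\<And>v. \<Psi> (T v) = fls_shift (int r) (\<Psi> v)"
    and ell: "\<And>d T. elliptic d T \<Longrightarrow> elliptic d (\<lambda>v. \<Psi> (T (\<Psi>' v)))"
    using elliptic_normal_form[OF T r] by blast
  define Z where "Z = (\<lambda>v. \<Psi> (fls_shift (int p) (\<Psi>' v)))"
  have Z: "elliptic (- int p) Z" unfolding Z_def by (intro ell elliptic_shift)
  define h where "h = Z 1"
  have comm: "fls_shift (int p) (T v) = T (fls_shift (int p) v) - T v" for v
    by (simp add: T_def phi_root_shift[OF p] fls_shifted_times_simps algebra_simps)
  have Zs: "Z (fls_shift (int r) v) = fls_shift (int r) (Z v) - fls_shift (int r) v" for v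
  proof -
    have "\<Psi>' (fls_shift (int r) v) = T (\<Psi>' v)" using conj[of "\<Psi>' v"] inv by metis
    then show ?thesis by (simp add: Z_def comm const_linD[OF lin(1)] conj inv)
  qed
  obtain z where z: "symbol (- int p) z Z" using Z by (auto simp: elliptic_def)
  have h: "ord_ge (- int p) h" using elliptic_lead[OF Z] by (simp add: h_def)
  note R = symbol_diff[OF symbol_diff[OF z symbol_euler[of p r]] symbol_mult[OF h]]
  have "Z v - euler r v - h * v = 0" for v
  proof (rule intertwiner_zero[OF R r, where c = 0])
    show "Z (fls_shift (int r) v) - euler r (fls_shift (int r) v) - h * fls_shift (int r) v =
         fls_shift (int r) (Z v - euler r v - h * v) + fls_const 0 * (Z v - euler r v - h * v)" for v
      by (simp add: Zs euler_shift[OF r] fls_shifted_times_simps algebra_simps)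
    have "euler r (1 :: 'k fls) = 0" by (simp add: euler_def)
    then show "Z 1 - euler r 1 - h * 1 = 0" by (simp add: h_def)
  qed
  then have Zv: "Z v = euler r v + h * v" for v by (simp add: algebra_simps)
  have B: "\<Psi> (fls_shift (int p) v) = - fls_shift (int r) (opr (E_obj r (- h)) (\<Psi> v))" for v
    unfolding shift_E_opr[OF r] using Zv[of "\<Psi> v"] by (simp add: Z_def inv)
  have A: "\<Psi> (opr (D_obj p g) v) = fls_shift (int r) (\<Psi> v)" for v
    using conj[of v] by (simp add: D_obj_def T_def)
  have h: "fls_subdegree (- h) = - int p" using elliptic_lead[OF Z] h_def by simp
  show ?thesis
    by (rule exI[of _ "- h"], rule exI[of _ \<Psi>], rule exI[of _ \<Psi>'], intro conjI allI) (rule h lin inv A B)+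
qed

section \<open>Vector spaces over the field of Laurent series\<close>

context abelian_group
begin

lemma diff_self [simp]: "a \<in> carrier G \<Longrightarrow> a \<ominus> a = \<zero>"
  by (simp add: a_minus_def r_neg)

lemma add_diff_cancel [simp]: "a \<in> carrier G \<Longrightarrow> b \<in> carrier G \<Longrightarrow> (a \<oplus> b) \<ominus> b = a"
  by (simp add: a_minus_def a_assoc r_neg)

lemma diff_add_cancel [simp]: "a \<in> carrier G \<Longrightarrow> b \<in> carrier G \<Longrightarrow> (a \<ominus> b) \<oplus> b = a"
  by (simp add: a_minus_def a_assoc l_neg)

lemma diff_zero [simp]: "a \<in> carrier G \<Longrightarrow> a \<ominus> \<zero> = a"
  by (simp add: a_minus_def)

lemma diff_eq_zero_iff: "a \<in> carrier G \<Longrightarrow> b \<in> carrier G \<Longrightarrow> a \<ominus> b = \<zero> \<longleftrightarrow> a = b"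
  by (metis diff_add_cancel diff_self l_zero)

lemma diff_add_diff: "a \<in> carrier G \<Longrightarrow> b \<in> carrier G \<Longrightarrow> c \<in> carrier G \<Longrightarrow>
    (a \<ominus> b) \<oplus> (b \<ominus> c) = a \<ominus> c"
  by (simp add: a_minus_def a_assoc) (simp add: a_assoc[symmetric] l_neg)

lemma add_diff_add: "a \<in> carrier G \<Longrightarrow> b \<in> carrier G \<Longrightarrow> c \<in> carrier G \<Longrightarrow> d \<in> carrier G \<Longrightarrow>
    (a \<oplus> b) \<ominus> (c \<oplus> d) = (a \<ominus> c) \<oplus> (b \<ominus> d)"
  by (simp add: a_minus_def minus_add a_ac)

lemma minus_diff: "a \<in> carrier G \<Longrightarrow> b \<in> carrier G \<Longrightarrow> \<ominus> (a \<ominus> b) = b \<ominus> a"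
  by (simp add: a_minus_def minus_add a_comm)

lemma diff_diff_left: "a \<in> carrier G \<Longrightarrow> b \<in> carrier G \<Longrightarrow> c \<in> carrier G \<Longrightarrow>
    (a \<ominus> b) \<ominus> (a \<ominus> c) = c \<ominus> b"
  using diff_add_diff[of c a b] by (metis a_comm a_minus_def minus_closed minus_diff)

lemma diff_diff_eq: "a \<in> carrier G \<Longrightarrow> b \<in> carrier G \<Longrightarrow> c \<in> carrier G \<Longrightarrow>
    (a \<ominus> b) \<ominus> c = a \<ominus> (b \<oplus> c)"
  by (simp add: a_minus_def minus_add a_assoc)

lemma add_add_diff: "a \<in> carrier G \<Longrightarrow> b \<in> carrier G \<Longrightarrow> c \<in> carrier G \<Longrightarrow>
    (a \<oplus> b) \<oplus> (c \<ominus> b) = a \<oplus> c"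
  by (metis a_assoc a_comm diff_add_cancel minus_closed)

end

lemma X_inverse [simp]: "fls_X * fls_X_inv = (1 :: 'k::field fls)" "fls_X_inv * fls_X = (1 :: 'k fls)"
proof -
  show "fls_X * fls_X_inv = (1 :: 'k fls)" by (rule fls_eqI) (simp add: fls_X_times_conv_shift)
  then show "fls_X_inv * fls_X = (1 :: 'k fls)" by (simp add: mult.commute)
qed

locale fls_space = abelian_group E for E :: "('k::field_char_0 fls, 'v) op_module" (structure) +
  assumes vectorspace: "vectorspace class_ring E"
begin

lemma module: "module class_ring E"
  using vectorspace by (simp add: vectorspace_def)

lemma smult_closed [simp]: "v \<in> carrier E \<Longrightarrow> h \<odot> v \<in> carrier E"
  using module.smult_closed[OF module, of h v] by simp

lemma smult_add_left: "v \<in> carrier E \<Longrightarrow> (g + h) \<odot> v = g \<odot> v \<oplus> h \<odot> v"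
  using module.smult_l_distr[OF module, of g h v] by simp

lemma smult_add_right: "u \<in> carrier E \<Longrightarrow> v \<in> carrier E \<Longrightarrow> h \<odot> (u \<oplus> v) = h \<odot> u \<oplus> h \<odot> v"
  using module.smult_r_distr[OF module, of h u v] by simp

lemma smult_smult: "v \<in> carrier E \<Longrightarrow> g \<odot> (h \<odot> v) = (g * h) \<odot> v"
  using module.smult_assoc1[OF module, of g h v] by simp

lemma smult_one [simp]: "v \<in> carrier E \<Longrightarrow> 1 \<odot> v = v"
  using module.smult_one[OF module, of v] by simp

lemma smult_zero_right [simp]: "h \<odot> \<zero> = \<zero>"
proof -
  have "h \<odot> \<zero> \<oplus> h \<odot> \<zero> = h \<odot> \<zero> \<oplus> \<zero>" using smult_add_right[of \<zero> \<zero> h] by simp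
  then show ?thesis by (metis add.l_cancel_one smult_closed zero_closed r_zero)
qed

lemma smult_zero_left [simp]: "v \<in> carrier E \<Longrightarrow> 0 \<odot> v = \<zero>"
  using smult_add_left[of v 0 0] by (metis add.l_cancel_one' add_0 smult_closed)

lemma smult_minus_right: "v \<in> carrier E \<Longrightarrow> h \<odot> (\<ominus> v) = \<ominus> (h \<odot> v)"
  using smult_add_right[of v "\<ominus> v" h] by (metis a_inv_closed minus_equality r_neg smult_closed smult_zero_right a_comm)

lemma smult_minus_left: "v \<in> carrier E \<Longrightarrow> (- h) \<odot> v = \<ominus> (h \<odot> v)"
  using smult_add_left[of v "- h" h] by (metis add.left_inverse minus_equality smult_closed smult_zero_left)

lemma smult_diff_right: "u \<in> carrier E \<Longrightarrow> v \<in> carrier E \<Longrightarrow> h \<odot> (u \<ominus> v) = h \<odot> u \<ominus> h \<odot> v"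
  by (simp add: a_minus_def smult_add_right smult_minus_right)

lemma smult_diff_left: "v \<in> carrier E \<Longrightarrow> (g - h) \<odot> v = g \<odot> v \<ominus> h \<odot> v"
  using smult_add_left[of v g "- h"] by (simp add: a_minus_def smult_minus_left)

lemma X_X_inv [simp]:
  assumes "v \<in> carrier E"
  shows "fls_X \<odot> (fls_X_inv \<odot> v) = v" "fls_X_inv \<odot> (fls_X \<odot> v) = v"
  using assms by (simp_all only: smult_smult X_inverse smult_one)

text \<open>Subspaces (\<open>ksub\<close>) over the field of Laurent series, and submodules (\<open>osub\<close>) over its ring of
  power series.\<close>

definition ksub :: "'v set \<Rightarrow> bool" where
  "ksub S \<longleftrightarrow> S \<subseteq> carrier E \<and> \<zero> \<in> S \<and> (\<forall>u\<in>S. \<forall>v\<in>S. u \<oplus> v \<in> S) \<and> (\<forall>h. \<forall>v\<in>S. h \<odot> v \<in> S)"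

definition osub :: "'v set \<Rightarrow> bool" where
  "osub L \<longleftrightarrow> L \<subseteq> carrier E \<and> \<zero> \<in> L \<and> (\<forall>u\<in>L. \<forall>v\<in>L. u \<oplus> v \<in> L) \<and>
     (\<forall>h. ord_ge 0 h \<longrightarrow> (\<forall>v\<in>L. h \<odot> v \<in> L))"

lemma ksub_iff_subspace: "ksub S \<longleftrightarrow> VectorSpace.subspace class_ring S E"
  unfolding ksub_def VectorSpace.subspace_def LinearCombinations.submodule_def
  using module vectorspace by auto

lemma ksubD:
  assumes "ksub S"
  shows "S \<subseteq> carrier E" "\<zero> \<in> S" "u \<in> S \<Longrightarrow> v \<in> S \<Longrightarrow> u \<oplus> v \<in> S" "v \<in> S \<Longrightarrow> h \<odot> v \<in> S"
    "v \<in> S \<Longrightarrow> \<ominus> v \<in> S" "u \<in> S \<Longrightarrow> v \<in> S \<Longrightarrow> u \<ominus> v \<in> S" "v \<in> S \<Longrightarrow> v \<in> carrier E"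
proof -
  show c: "S \<subseteq> carrier E" and "\<zero> \<in> S" and a: "u \<in> S \<Longrightarrow> v \<in> S \<Longrightarrow> u \<oplus> v \<in> S"
    and s: "v \<in> S \<Longrightarrow> h \<odot> v \<in> S" for u v h
    using assms by (auto simp: ksub_def)
  show m: "v \<in> S \<Longrightarrow> \<ominus> v \<in> S" for v using s[of v "- 1"] c by (auto simp: smult_minus_left)
  show "u \<in> S \<Longrightarrow> v \<in> S \<Longrightarrow> u \<ominus> v \<in> S" for u v using a m by (simp add: a_minus_def)
  show "v \<in> S \<Longrightarrow> v \<in> carrier E" for v using c by auto
qed

lemma osubD:
  assumes "osub S"
  shows "S \<subseteq> carrier E" "\<zero> \<in> S" "u \<in> S \<Longrightarrow> v \<in> S \<Longrightarrow> u \<oplus> v \<in> S" "ord_ge 0 h \<Longrightarrow> v \<in> S \<Longrightarrow> h \<odot> v \<in> S"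
    "v \<in> S \<Longrightarrow> \<ominus> v \<in> S" "u \<in> S \<Longrightarrow> v \<in> S \<Longrightarrow> u \<ominus> v \<in> S" "v \<in> S \<Longrightarrow> v \<in> carrier E"
proof -
  show c: "S \<subseteq> carrier E" and "\<zero> \<in> S" and a: "u \<in> S \<Longrightarrow> v \<in> S \<Longrightarrow> u \<oplus> v \<in> S"
    and s: "ord_ge 0 h \<Longrightarrow> v \<in> S \<Longrightarrow> h \<odot> v \<in> S" for u v h
    using assms by (auto simp: osub_def)
  show m: "v \<in> S \<Longrightarrow> \<ominus> v \<in> S" for v using s[of "- 1" v] c
    by (auto simp: smult_minus_left ord_ge_def)
  show "u \<in> S \<Longrightarrow> v \<in> S \<Longrightarrow> u \<ominus> v \<in> S" for u v using a m by (simp add: a_minus_def)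
  show "v \<in> S \<Longrightarrow> v \<in> carrier E" for v using c by auto
qed

lemma ksub_zero: "ksub {\<zero>}" by (simp add: ksub_def)
lemma ksub_carrier: "ksub (carrier E)" by (simp add: ksub_def)
lemma ksub_Int: "ksub S \<Longrightarrow> ksub T \<Longrightarrow> ksub (S \<inter> T)" by (auto simp: ksub_def)

definition adjoin :: "'v set \<Rightarrow> 'v \<Rightarrow> 'v set" where
  "adjoin N b = {u \<oplus> h \<odot> b | u h. u \<in> N}"

lemma adjoinI: "u \<in> N \<Longrightarrow> u \<oplus> h \<odot> b \<in> adjoin N b" by (auto simp: adjoin_def)

lemma adjoinE: "v \<in> adjoin N b \<Longrightarrow> (\<And>u h. u \<in> N \<Longrightarrow> v = u \<oplus> h \<odot> b \<Longrightarrow> P) \<Longrightarrow> P"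
  by (auto simp: adjoin_def)

text \<open>Finite dimension as reachability from zero by adjoining vectors. Inductions along this chain
  replace the choice of bases.\<close>

inductive fg :: "'v set \<Rightarrow> bool" where
  zero: "fg {\<zero>}"
| adjoin: "fg N \<Longrightarrow> b \<in> carrier E \<Longrightarrow> fg (adjoin N b)"

lemma ksub_adjoin:
  assumes N: "ksub N" and b: "b \<in> carrier E"
  shows "ksub (adjoin N b)" "N \<subseteq> adjoin N b" "b \<in> adjoin N b"
proof -
  note N' = ksubD[OF N]
  show sub: "N \<subseteq> adjoin N b"
  proof
    fix v assume "v \<in> N"
    then show "v \<in> adjoin N b" using adjoinI[of v N 0 b] N'(1) b by auto
  qed
  show "b \<in> adjoin N b" using adjoinI[OF N'(2), of 1 b] b by simp
  show "ksub (adjoin N b)"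
    unfolding ksub_def
  proof (intro conjI ballI allI)
    show "adjoin N b \<subseteq> carrier E" using N'(1) b by (auto simp: adjoin_def)
    show "\<zero> \<in> adjoin N b" using sub N' by auto
    fix u v assume "u \<in> adjoin N b" "v \<in> adjoin N b"
    then obtain u' v' g h where u: "u = u' \<oplus> g \<odot> b" "u' \<in> N" and v: "v = v' \<oplus> h \<odot> b" "v' \<in> N"
      by (auto elim!: adjoinE)
    have "u \<oplus> v = (u' \<oplus> v') \<oplus> (g + h) \<odot> b"
      using u v N'(7) b by (simp add: smult_add_left a_ac)
    then show "u \<oplus> v \<in> adjoin N b" using N'(3) u v adjoinI by metis
  next
    fix f u assume "u \<in> adjoin N b"
    then obtain u' g where u: "u = u' \<oplus> g \<odot> b" "u' \<in> N" by (auto elim!: adjoinE)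
    then have "f \<odot> u = f \<odot> u' \<oplus> (f * g) \<odot> b" using N'(7) b by (simp add: smult_add_right smult_smult)
    then show "f \<odot> u \<in> adjoin N b" using N'(4) u adjoinI by metis
  qed
qed

lemma adjoin_least: "ksub S \<Longrightarrow> N \<subseteq> S \<Longrightarrow> b \<in> S \<Longrightarrow> adjoin N b \<subseteq> S"
  by (auto simp: adjoin_def ksub_def)

lemma fg_ksub: "fg N \<Longrightarrow> ksub N"
  by (induction rule: fg.induct) (auto intro: ksub_zero ksub_adjoin)

lemma ksub_fg:
  assumes "fg N" "ksub S" "S \<subseteq> N"
  shows "fg S"
  using assms
proof (induction arbitrary: S rule: fg.induct)
  case zero
  then have "S = {\<zero>}" using ksubD(2) by blast
  then show ?case by (simp add: fg.zero)
next
  case (adjoin N b)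
  note S = ksubD[OF adjoin.prems(1)] and N = ksubD[OF fg_ksub[OF adjoin.hyps(1)]]
  have fgi: "fg (S \<inter> N)"
    using adjoin fg_ksub ksub_Int by (metis inf_le2)
  show ?case
  proof (cases "S \<subseteq> N")
    case True
    then show ?thesis using fgi by (simp add: Int_absorb2)
  next
    case False
    then obtain s where s: "s \<in> S" "s \<notin> N" by blast
    then obtain u h where uh: "u \<in> N" "s = u \<oplus> h \<odot> b" using adjoin.prems(2) by (blast elim: adjoinE)
    have h: "h \<noteq> 0" using uh s(2) N adjoin.hyps(2) by auto
    define c where "c = inverse h \<odot> s"
    have c: "c \<in> S" "c = inverse h \<odot> u \<oplus> b"
    proof -
      show "c \<in> S" unfolding c_def by (rule S(4)[OF s(1)])
      show "c = inverse h \<odot> u \<oplus> b"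
        unfolding c_def uh(2) using h uh(1) N(7) adjoin.hyps(2) by (simp add: smult_add_right smult_smult)
    qed
    have "S = adjoin (S \<inter> N) c"
    proof
      show "S \<subseteq> adjoin (S \<inter> N) c"
      proof
        fix v assume v: "v \<in> S"
        then obtain w g where wg: "w \<in> N" "v = w \<oplus> g \<odot> b" using adjoin.prems(2) by (blast elim: adjoinE)
        have "v \<ominus> g \<odot> c = w \<ominus> g \<odot> (inverse h \<odot> u)"
          using wg c(2) uh N(7) adjoin.hyps(2)
          by (simp add: smult_add_right smult_smult add_diff_add)
        then have "v \<ominus> g \<odot> c \<in> S \<inter> N"
          using N(4,6) S(4,6) v c(1) wg(1) uh(1) by (metis IntI)
        then have "(v \<ominus> g \<odot> c) \<oplus> g \<odot> c \<in> adjoin (S \<inter> N) c" by (rule adjoinI)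
        then show "v \<in> adjoin (S \<inter> N) c" using v c(1) S(7) by simp
      qed
      show "adjoin (S \<inter> N) c \<subseteq> S" using c(1) adjoin.prems(1) by (intro adjoin_least) auto
    qed
    then show ?thesis using fg.adjoin[OF fgi] c(1) S(7) by metis
  qed
qed

text \<open>All that is needed of the dimension is a bounded strictly increasing function on the subspaces
  of \<open>N\<close>; it yields maximal and minimal stable subspaces.\<close>

lemma fg_length:
  assumes "fg N"
  shows "\<exists>(\<mu> :: 'v set \<Rightarrow> nat) k. \<forall>S S'. ksub S \<longrightarrow> ksub S' \<longrightarrow> S \<subset> S' \<longrightarrow> S' \<subseteq> N \<longrightarrow> \<mu> S < \<mu> S' \<and> \<mu> S' \<le> k"
  using assms
proof (induction rule: fg.induct)
  case zero
  show ?case using ksubD(2) by blast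
next
  case (adjoin N b)
  note N = ksubD[OF fg_ksub[OF adjoin.hyps(1)]]
  obtain \<mu> k where \<mu>: "\<And>S S'. ksub S \<Longrightarrow> ksub S' \<Longrightarrow> S \<subset> S' \<Longrightarrow> S' \<subseteq> N \<Longrightarrow> \<mu> S < (\<mu> S' :: nat) \<and> \<mu> S' \<le> k"
    using adjoin.IH by blast
  define K where "K = max k (\<mu> {\<zero>})"
  have bound: "\<mu> S \<le> K" if "ksub S" "S \<subseteq> N" for S
  proof (cases "S = {\<zero>}")
    case False
    then have "{\<zero>} \<subset> S" using ksubD(2)[OF that(1)] by blast
    then show ?thesis using \<mu>[OF ksub_zero that(1) _ that(2)] by (simp add: K_def)
  qed (simp add: K_def)
  \<comment> \<open>One more dimension appears exactly when \<open>S\<close> has a vector with a nonzero coefficient at \<open>b\<close>.\<close>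
  define \<nu> where "\<nu> S = \<mu> (S \<inter> N) + (if S \<subseteq> N then 0 else 1)" for S
  have "\<nu> S < \<nu> S' \<and> \<nu> S' \<le> K + 1" if S: "ksub S" and S': "ksub S'" and lt: "S \<subset> S'" and le: "S' \<subseteq> adjoin N b" for S S'
  proof
    have i: "ksub (S \<inter> N)" "ksub (S' \<inter> N)" using S S' ksub_Int fg_ksub[OF adjoin.hyps(1)] by auto
    show "\<nu> S' \<le> K + 1" using bound[OF i(2)] by (simp add: \<nu>_def)
    show "\<nu> S < \<nu> S'"
    proof (cases "S \<inter> N = S' \<inter> N")
      case False
      then have "S \<inter> N \<subset> S' \<inter> N" using lt by blast
      then have "\<mu> (S \<inter> N) < \<mu> (S' \<inter> N)" using \<mu>[OF i] by blast
      then show ?thesis using lt by (auto simp: \<nu>_def)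
    next
      case True
      have "S \<subseteq> N"
      proof (rule ccontr)
        assume "\<not> S \<subseteq> N"
        then obtain s where s: "s \<in> S" "s \<notin> N" by blast
        then obtain u h where uh: "u \<in> N" "s = u \<oplus> h \<odot> b" using le lt by (blast elim: adjoinE)
        have h: "h \<noteq> 0" using uh s(2) N adjoin.hyps(2) by auto
        have "v \<in> S" if v: "v \<in> S'" for v
        proof -
          obtain w g where wg: "w \<in> N" "v = w \<oplus> g \<odot> b" using v le by (blast elim: adjoinE)
          define d where "d = g * inverse h"
          have g: "g = d * h" using h by (simp add: d_def)
          have wu: "w \<in> carrier E" "u \<in> carrier E" using wg(1) uh(1) N(7) by blast+
          have "d \<odot> s = d \<odot> u \<oplus> g \<odot> b"
            using wu adjoin.hyps(2) by (simp add: uh(2) g smult_add_right smult_smult)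
          then have "v \<ominus> d \<odot> s = w \<ominus> d \<odot> u"
            using wu adjoin.hyps(2) by (simp add: wg(2) add_diff_add)
          moreover have "w \<ominus> d \<odot> u \<in> N" using N(4,6) wg(1) uh(1) by blast
          moreover have "v \<ominus> d \<odot> s \<in> S'" using ksubD(4,6)[OF S'] v s(1) lt by blast
          ultimately have "v \<ominus> d \<odot> s \<in> S' \<inter> N" by simp
          then have "v \<ominus> d \<odot> s \<in> S" using True by blast
          then have "(v \<ominus> d \<odot> s) \<oplus> d \<odot> s \<in> S" using s(1) ksubD(3,4)[OF S] by blast
          then show ?thesis using v s(1) ksubD(7)[OF S] ksubD(7)[OF S'] by simp
        qed
        then show False using lt by blast
      qed
      moreover then have "\<not> S' \<subseteq> N" using lt True by blast
      ultimately show ?thesis using True by (simp add: \<nu>_def)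
    qed
  qed
  then show ?case by blast
qed

end

section \<open>Filtrations\<close>

text \<open>An exhaustive, separated and complete filtration by modules over the power series on which \<open>X^m\<close> acts
  as a shift by \<open>m\<close>. On a finite-dimensional space any such filtration defines the adic topology.\<close>

locale filtration = fls_space E for E :: "('k::field_char_0 fls, 'v) op_module" (structure) +
  fixes S :: "'v set" and F :: "int \<Rightarrow> 'v set"
  assumes ksub_S: "ksub S"
    and F_osub: "osub (F n)"
    and F_sub: "F n \<subseteq> S"
    and F_shift: "v \<in> S \<Longrightarrow> fls_X_intpow m \<odot> v \<in> F (n + m) \<longleftrightarrow> v \<in> F n"
    and F_exhaustive: "v \<in> S \<Longrightarrow> \<exists>n. v \<in> F n"
    and F_separated: "v \<in> S \<Longrightarrow> (\<And>n. v \<in> F n) \<Longrightarrow> v = \<zero>"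
    and F_complete: "(\<And>i::nat. s i \<in> S) \<Longrightarrow> (\<And>i. s (Suc i) \<ominus> s i \<in> F (int i)) \<Longrightarrow>
          \<exists>w\<in>S. \<forall>i. w \<ominus> s i \<in> F (int i)"
begin

lemma F_smult:
  assumes "ord_ge m h" "v \<in> F n"
  shows "h \<odot> v \<in> F (n + m)"
proof -
  have c: "v \<in> S" "v \<in> carrier E" using assms F_sub ksubD(7)[OF ksub_S] by auto
  have "h = fls_X_intpow m * fls_shift m h"
    using fls_X_intpow_times_conv_shift(1)[of m "fls_shift m h"] by simp
  then have "h \<odot> v = fls_X_intpow m \<odot> (fls_shift m h \<odot> v)"
    using c by (metis smult_smult)
  moreover have "fls_shift m h \<odot> v \<in> F n" using assms by (intro osubD(4)[OF F_osub]) auto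
  ultimately show ?thesis using F_shift F_sub by (metis subsetD)
qed

lemma F_mono: "v \<in> F n \<Longrightarrow> m \<le> n \<Longrightarrow> v \<in> F m"
proof -
  assume v: "v \<in> F n" "m \<le> n"
  have c: "v \<in> S" "v \<in> carrier E" using v F_sub ksubD(7)[OF ksub_S] by auto
  have "fls_X_intpow (n - m) \<odot> v \<in> F n"
    using v by (intro osubD(4)[OF F_osub]) (auto simp: ord_ge_def)
  then show ?thesis using F_shift[OF c(1), of "n - m" m] by simp
qed

lemmas F_add = osubD(3)[OF F_osub] and F_minus = osubD(5)[OF F_osub] and F_diff = osubD(6)[OF F_osub]
  and F_zero = osubD(2)[OF F_osub]

lemma F_carrier: "v \<in> F n \<Longrightarrow> v \<in> carrier E" by (rule osubD(7)[OF F_osub])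

text \<open>Two facts about a finite-dimensional subspace \<open>N\<close>: it is closed, and a module over the power
  series that absorbs every vector of \<open>N\<close> is open in \<open>N\<close>. Both pass from \<open>N\<close> to \<open>N + K b\<close> for the same
  reason: since \<open>N\<close> is closed, \<open>b\<close> has a positive distance from \<open>N\<close>, and this bounds the coefficient \<open>h\<close>
  in terms of the size of \<open>u + h b\<close>.\<close>

lemma fg_closed_open:
  assumes "fg N" "N \<subseteq> S"
  shows "(\<forall>v\<in>S. (\<forall>n. \<exists>s\<in>N. v \<ominus> s \<in> F n) \<longrightarrow> v \<in> N) \<and>
    (\<forall>L. osub L \<and> (\<forall>v\<in>N. \<exists>m. fls_X_intpow m \<odot> v \<in> L) \<longrightarrow> (\<exists>m. \<forall>v\<in>N. v \<in> F m \<longrightarrow> v \<in> L))"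
  using assms
proof (induction rule: fg.induct)
  case zero
  then show ?case using osubD(2) ksubD(7)[OF ksub_S] F_separated by (auto intro!: F_separated)
next
  case (adjoin N b)
  note kN = fg_ksub[OF adjoin.hyps(1)]
  note N = ksubD[OF kN] and S = ksubD[OF ksub_S]
  have sub: "N \<subseteq> S" "b \<in> S" using adjoin.prems ksub_adjoin[OF kN adjoin.hyps(2)] by auto
  note closed = adjoin.IH[OF sub(1), THEN conjunct1, rule_format]
  note op = adjoin.IH[OF sub(1), THEN conjunct2, rule_format]
  show ?case
  proof (cases "b \<in> N")
    case True
    then have "adjoin N b = N" using adjoin_least[OF kN] ksub_adjoin[OF kN adjoin.hyps(2)] by blast
    then show ?thesis using adjoin.IH[OF sub(1)] by simp
  next
    case False
    then obtain n0 where n0: "\<And>s. s \<in> N \<Longrightarrow> b \<ominus> s \<notin> F n0" using closed[OF sub(2)] by blast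
    \<comment> \<open>The distance of \<open>b\<close> from \<open>N\<close> bounds the coefficient of \<open>b\<close>.\<close>
    have key: "ord_ge (n - n0 + 1) h" if "u \<in> N" "u \<oplus> h \<odot> b \<in> F n" for u h n
    proof (rule ccontr)
      assume "\<not> ord_ge (n - n0 + 1) h"
      then have h: "h \<noteq> 0" "fls_subdegree h \<le> n - n0" by (auto simp: ord_ge_iff_subdegree)
      have "ord_ge (- fls_subdegree h) (inverse h)"
        by (simp add: ord_ge_iff_subdegree fls_inverse_subdegree)
      from F_smult[OF this that(2)] have "inverse h \<odot> (u \<oplus> h \<odot> b) \<in> F (n + - fls_subdegree h)" .
      moreover have "inverse h \<odot> (u \<oplus> h \<odot> b) = b \<ominus> (\<ominus> (inverse h \<odot> u))"
        using N(7)[OF that(1)] adjoin.hyps(2) h(1)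
        by (simp add: smult_add_right smult_smult a_minus_def a_comm)
      ultimately have "b \<ominus> (\<ominus> (inverse h \<odot> u)) \<in> F n0" using h(2) by (auto intro: F_mono)
      then show False using n0 N(4,5) that(1) by blast
    qed
    obtain j where j: "b \<in> F j" using F_exhaustive sub(2) by blast
    have cl: "v \<in> adjoin N b" if v: "v \<in> S" and appr: "\<And>n. \<exists>s\<in>adjoin N b. v \<ominus> s \<in> F n" for v
    proof -
      have "\<exists>u h. u \<in> N \<and> v \<ominus> (u \<oplus> h \<odot> b) \<in> F (int i)" for i :: nat
        using appr[of "int i"] by (auto elim!: adjoinE)
      then obtain u h where uh: "\<And>i. u i \<in> N" "\<And>i::nat. v \<ominus> (u i \<oplus> h i \<odot> b) \<in> F (int i)" by metis
      have uc: "u i \<in> carrier E" for i using N(7) uh(1) by blast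
      have vc: "v \<in> carrier E" using v S(7) by blast
      note bc = adjoin.hyps(2)
      have inc: "ord_ge (1 - n0 + 1 * int i) (h (Suc i) - h i)" for i
      proof -
        define x y where "x = u (Suc i) \<oplus> h (Suc i) \<odot> b" and "y = u i \<oplus> h i \<odot> b"
        have xy: "x \<in> carrier E" "y \<in> carrier E" using uc bc by (auto simp: x_def y_def)
        have "v \<ominus> x \<in> F (int i)" using uh(2)[of "Suc i"] by (auto simp: x_def intro: F_mono)
        then have "(v \<ominus> y) \<ominus> (v \<ominus> x) \<in> F (int i)" using uh(2)[of i] by (auto simp: y_def intro: F_diff)
        moreover have "(v \<ominus> y) \<ominus> (v \<ominus> x) = x \<ominus> y"
          using xy vc by (simp add: diff_diff_left)
        moreover have "x \<ominus> y = (u (Suc i) \<ominus> u i) \<oplus> (h (Suc i) - h i) \<odot> b"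
          using uc bc by (simp add: x_def y_def add_diff_add smult_diff_left)
        ultimately have "(u (Suc i) \<ominus> u i) \<oplus> (h (Suc i) - h i) \<odot> b \<in> F (int i)" by simp
        then have "ord_ge (int i - n0 + 1) (h (Suc i) - h i)" using key uh(1) N(6) by blast
        then show ?thesis by (simp add: algebra_simps)
      qed
      have "\<exists>y. \<forall>i. ord_ge (1 - n0 + 1 * int i) (y - h i)"
        by (rule fls_complete[OF order_refl inc])
      then obtain y where y: "\<And>i. ord_ge (1 - n0 + 1 * int i) (y - h i)" by blast
      have "v \<ominus> y \<odot> b \<in> N"
      proof (rule closed)
        show "v \<ominus> y \<odot> b \<in> S" using v sub(2) by (intro S(4,6))
        show "\<exists>s\<in>N. (v \<ominus> y \<odot> b) \<ominus> s \<in> F n" for n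
        proof -
          define i where "i = nat (max n (n - j - 1 + n0))"
          have i: "n \<le> int i" "n - j - 1 + n0 \<le> int i" by (auto simp: i_def)
          have "(v \<ominus> y \<odot> b) \<ominus> u i = (v \<ominus> (u i \<oplus> h i \<odot> b)) \<ominus> (y - h i) \<odot> b"
            using vc uc bc
            by (simp add: smult_diff_left diff_diff_eq add_add_diff a_comm)
          moreover have "v \<ominus> (u i \<oplus> h i \<odot> b) \<in> F n" using uh(2)[of i] i(1) by (rule F_mono)
          moreover have "(y - h i) \<odot> b \<in> F n"
            by (rule F_mono[OF F_smult[OF y[of i] j]]) (use i(2) in simp)
          ultimately have "(v \<ominus> y \<odot> b) \<ominus> u i \<in> F n" by (metis F_diff)
          then show "\<exists>s\<in>N. (v \<ominus> y \<odot> b) \<ominus> s \<in> F n" using uh(1) by blast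
        qed
      qed
      from adjoinI[OF this, of y b] show ?thesis using vc bc by simp
    qed
    have "\<exists>m. \<forall>v\<in>adjoin N b. v \<in> F m \<longrightarrow> v \<in> L"
      if L: "osub L" and ab: "\<And>v. v \<in> adjoin N b \<Longrightarrow> \<exists>m. fls_X_intpow m \<odot> v \<in> L" for L
    proof -
      have Nb: "N \<subseteq> adjoin N b" "b \<in> adjoin N b" using ksub_adjoin[OF kN adjoin.hyps(2)] by auto
      obtain m1 where m1: "\<And>v. v \<in> N \<Longrightarrow> v \<in> F m1 \<Longrightarrow> v \<in> L"
        using op[of L] L ab Nb(1) by blast
      obtain m2 where m2: "fls_X_intpow m2 \<odot> b \<in> L" using ab Nb(2) by blast
      define m where "m = max m1 (max (m2 + n0) (m1 + n0 - j))"
      have "v \<in> L" if vm: "v \<in> adjoin N b" "v \<in> F m" for v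
      proof -
        obtain u h where uh: "u \<in> N" "v = u \<oplus> h \<odot> b" using vm(1) by (auto elim: adjoinE)
        have h: "ord_ge (m - n0) h" using key[of u h m] uh vm(2) by (auto intro: ord_ge_mono)
        have "h \<odot> b = fls_shift m2 h \<odot> (fls_X_intpow m2 \<odot> b)"
          using adjoin.hyps(2) fls_X_intpow_times_conv_shift(2)[of "fls_shift m2 h" m2] by (simp add: smult_smult)
        moreover have "ord_ge 0 (fls_shift m2 h)" using h by (auto simp: m_def intro: ord_ge_mono)
        ultimately have hb: "h \<odot> b \<in> L" using osubD(4)[OF L] m2 by simp
        have "h \<odot> b \<in> F m1" by (rule F_mono[OF F_smult[OF h j]]) (simp add: m_def)
        moreover have "v \<in> F m1" by (rule F_mono[OF vm(2)]) (simp add: m_def)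
        ultimately have "v \<ominus> h \<odot> b \<in> F m1" by (intro F_diff)
        moreover have "v \<ominus> h \<odot> b = u" using uh N(7) adjoin.hyps(2) by simp
        ultimately have "u \<in> L" using m1 uh(1) by metis
        then show "v \<in> L" unfolding uh(2) using hb osubD(3)[OF L] by blast
      qed
      then show ?thesis by blast
    qed
    then show ?thesis using cl by blast
  qed
qed

lemma fg_closed:
  assumes "fg N" "N \<subseteq> S" "v \<in> S" "\<And>n. \<exists>s\<in>N. v \<ominus> s \<in> F n"
  shows "v \<in> N"
  using fg_closed_open[OF assms(1,2)] assms(3,4) by blast

lemma fg_open:
  assumes "fg N" "N \<subseteq> S" "osub L" "\<And>v. v \<in> N \<Longrightarrow> \<exists>m. fls_X_intpow m \<odot> v \<in> L"
  obtains m where "\<And>v. v \<in> N \<Longrightarrow> v \<in> F m \<Longrightarrow> v \<in> L"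
  using fg_closed_open[OF assms(1,2)] assms(3,4) by blast

end

section \<open>Lattices and the adic topology\<close>

context fls_space
begin

lemma span_ksub:
  assumes "A \<subseteq> carrier E"
  shows "ksub (LinearCombinations.module.span class_ring E A)"
    "A \<subseteq> LinearCombinations.module.span class_ring E A"
proof -
  interpret V: vectorspace class_ring E by (rule vectorspace)
  show "ksub (V.span A)" unfolding ksub_iff_subspace by (rule V.span_is_subspace[OF assms])
  show "A \<subseteq> V.span A" by (rule V.in_own_span[OF assms])
qed

lemma fg_span:
  assumes "finite A" "A \<subseteq> carrier E"
  shows "fg (LinearCombinations.module.span class_ring E A)"
  using assms
proof (induction A rule: finite_induct)
  case empty
  interpret V: vectorspace class_ring E by (rule vectorspace)
  have "V.span {} = {\<zero>}" by (auto simp: V.span_def V.lincomb_def)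
  then show ?case by (simp add: fg.zero)
next
  case (insert b A)
  interpret V: vectorspace class_ring E by (rule vectorspace)
  have A: "A \<subseteq> carrier E" "b \<in> carrier E" using insert.prems by auto
  have "V.span (insert b A) = adjoin (V.span A) b"
  proof
    show "V.span (insert b A) \<subseteq> adjoin (V.span A) b"
    proof
      fix v assume "v \<in> V.span (insert b A)"
      then obtain a where v: "v = V.lincomb a (insert b A)"
        using V.finite_in_span[of "insert b A" v] insert by auto
      have "v = a b \<odot> b \<oplus> V.lincomb a A"
        unfolding v using V.lincomb_insert[of A a b] insert by auto
      also have "\<dots> = V.lincomb a A \<oplus> a b \<odot> b" using A by (intro a_comm V.lincomb_closed) auto
      finally show "v \<in> adjoin (V.span A) b"
        using insert.hyps by (auto simp: V.span_def intro!: adjoinI)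
    qed
    show "adjoin (V.span A) b \<subseteq> V.span (insert b A)"
      using span_ksub[OF insert.prems] V.span_is_monotone[of A "insert b A"]
      by (intro adjoin_least) auto
  qed
  then show ?case using fg.adjoin[OF insert.IH[OF A(1)] A(2)] by simp
qed

lemma fg_subset_span:
  assumes "fg N"
  shows "\<exists>A. finite A \<and> A \<subseteq> carrier E \<and> N \<subseteq> LinearCombinations.module.span class_ring E A"
  using assms
proof (induction rule: fg.induct)
  case zero
  then show ?case using span_ksub[of "{}"] ksubD(2) by (intro exI[of _ "{}"]) auto
next
  case (adjoin N b)
  interpret V: vectorspace class_ring E by (rule vectorspace)
  obtain A where A: "finite A" "A \<subseteq> carrier E" "N \<subseteq> V.span A" using adjoin.IH by blast
  have "adjoin N b \<subseteq> V.span (insert b A)"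
    using span_ksub[of "insert b A"] A adjoin.hyps(2) V.span_is_monotone[of A "insert b A"]
    by (intro adjoin_least) auto
  then show ?case using A adjoin.hyps(2) by (intro exI[of _ "insert b A"]) auto
qed

lemma fin_dim_iff_fg: "VectorSpace.vectorspace.fin_dim class_ring E \<longleftrightarrow> fg (carrier E)"
proof -
  interpret V: vectorspace class_ring E by (rule vectorspace)
  show ?thesis
  proof
    assume "V.fin_dim"
    then show "fg (carrier E)" unfolding V.fin_dim_def using fg_span by metis
  next
    assume "fg (carrier E)"
    then obtain A where "finite A" "A \<subseteq> carrier E" "carrier E \<subseteq> V.span A" using fg_subset_span by blast
    then show "V.fin_dim" unfolding V.fin_dim_def using ksubD(1)[OF span_ksub(1)] by blast
  qed
qed

text \<open>Together with the next lemma: lattices and absorbing modules over the power series are cofinal.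
  This lets a filtration replace the lattices in the definition of convergence.\<close>

lemma zeta_lattice_osub:
  assumes "zeta_lattice E L"
  shows "osub L" "v \<in> carrier E \<Longrightarrow> \<exists>m. fls_X_intpow m \<odot> v \<in> L"
proof -
  interpret V: vectorspace class_ring E by (rule vectorspace)
  obtain B where B: "finite B" "B \<subseteq> carrier E" "V.span B = carrier E"
    and L: "L = {V.lincomb (\<lambda>b. fps_to_fls (a b)) B | a. True}"
    using assms unfolding zeta_lattice_def by blast
  have LI: "V.lincomb h B \<in> L" if h: "\<And>b. b \<in> B \<Longrightarrow> ord_ge 0 (h b)" for h
  proof -
    have "h b = fps_to_fls (fls_regpart (h b))" if "b \<in> B" for b
      using h[OF that] by (auto simp: ord_ge_iff_subdegree)
    then have "V.lincomb h B = V.lincomb (\<lambda>b. fps_to_fls (fls_regpart (h b))) B"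
      using B by (intro V.lincomb_cong) auto
    then show ?thesis unfolding L by (intro CollectI exI[of _ "\<lambda>b. fls_regpart (h b)"]) simp
  qed
  have LD: "\<exists>h. (\<forall>b. ord_ge 0 (h b)) \<and> v = V.lincomb h B" if "v \<in> L" for v
  proof -
    obtain a where "v = V.lincomb (\<lambda>b. fps_to_fls (a b)) B" using \<open>v \<in> L\<close> unfolding L by blast
    then show ?thesis by (intro exI[of _ "\<lambda>b. fps_to_fls (a b)"]) (simp add: ord_ge_def)
  qed
  show "osub L"
    unfolding osub_def
  proof (intro conjI ballI allI impI)
    show "L \<subseteq> carrier E" unfolding L using B by auto
    have "V.lincomb (\<lambda>_. 0) B = \<zero>"
      using V.lincomb_smult[of B "\<lambda>_. 0" 0] B by simp
    then show "\<zero> \<in> L" using LI[of "\<lambda>_. 0"] by simp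
    fix u v assume "u \<in> L" "v \<in> L"
    then obtain g h where gh: "\<And>b. ord_ge 0 (g b)" "\<And>b. ord_ge 0 (h b)" "u = V.lincomb g B" "v = V.lincomb h B"
      using LD by metis
    have "u \<oplus> v = V.lincomb (\<lambda>b. g b + h b) B"
      using V.lincomb_sum[of B g h] B gh by simp
    then show "u \<oplus> v \<in> L" using LI gh by (simp add: ord_ge_add)
  next
    fix g :: "'k fls" and v assume g: "ord_ge 0 g" and "v \<in> L"
    then obtain h where h: "\<And>b. ord_ge 0 (h b)" "v = V.lincomb h B" using LD by metis
    have "g \<odot> v = V.lincomb (\<lambda>b. g * h b) B"
      using V.lincomb_smult[of B h g] B h by simp
    then show "g \<odot> v \<in> L" using LI[of "\<lambda>b. g * h b"] ord_ge_mult[OF g h(1)] by simp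
  qed
  assume v: "v \<in> carrier E"
  then obtain h where h: "v = V.lincomb h B" using V.finite_in_span[OF B(1,2)] B(3) by auto
  define k where "k = Min (insert 0 ((\<lambda>b. fls_subdegree (h b)) ` B))"
  define m where "m = - k"
  have m: "- m \<le> fls_subdegree (h b)" if "b \<in> B" for b
  proof -
    have "k \<le> fls_subdegree (h b)" unfolding k_def by (rule Min_le) (use that B(1) in auto)
    then show ?thesis by (simp add: m_def)
  qed
  have "fls_X_intpow m \<odot> v = V.lincomb (\<lambda>b. fls_X_intpow m * h b) B"
    using V.lincomb_smult[of B h "fls_X_intpow m"] B h by simp
  moreover have "ord_ge 0 (fls_X_intpow m * h b)" if "b \<in> B" for b
    using m[OF that] ord_ge_mult[OF ord_ge_X_intpow[of m] ord_ge_subdegree[of "h b"]]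
    by (rule_tac ord_ge_mono) auto
  ultimately show "\<exists>m. fls_X_intpow m \<odot> v \<in> L" using LI by metis
qed

lemma zeta_lattice_in_osub:
  assumes fin: "fg (carrier E)" and M: "osub M" "\<And>v. v \<in> carrier E \<Longrightarrow> \<exists>m. fls_X_intpow m \<odot> v \<in> M"
  shows "\<exists>L. zeta_lattice E L \<and> L \<subseteq> M"
proof -
  interpret V: vectorspace class_ring E by (rule vectorspace)
  obtain A where A: "finite A" "A \<subseteq> carrier E" "carrier E \<subseteq> V.span A" using fg_subset_span[OF fin] by blast
  obtain m where m: "\<And>v. v \<in> carrier E \<Longrightarrow> fls_X_intpow (m v) \<odot> v \<in> M" using M(2) by metis
  define B where "B = (\<lambda>v. fls_X_intpow (m v) \<odot> v) ` A"
  have B: "finite B" "B \<subseteq> carrier E" "B \<subseteq> M" using A m by (auto simp: B_def)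
  have "A \<subseteq> V.span B"
  proof
    fix v assume v: "v \<in> A"
    then have "fls_X_intpow (m v) \<odot> v \<in> V.span B" using span_ksub(2)[OF B(2)] by (auto simp: B_def)
    then have "fls_X_intpow (- m v) \<odot> (fls_X_intpow (m v) \<odot> v) \<in> V.span B"
      using ksubD(4)[OF span_ksub(1)[OF B(2)]] by blast
    then show "v \<in> V.span B" using v A(2) by (auto simp: smult_smult fls_X_intpow_times_fls_X_intpow[of "- m v" "m v", simplified])
  qed
  then have "V.span A \<subseteq> V.span B"
    using V.span_is_subset[of A "V.span B"] V.span_is_submodule[OF B(2)] by blast
  then have "V.span B = carrier E" using A(3) ksubD(1)[OF span_ksub(1)[OF B(2)]] by blast
  then have "zeta_lattice E {V.lincomb (\<lambda>b. fps_to_fls (a b)) B | a. True}"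
    unfolding zeta_lattice_def using B by blast
  moreover have "V.lincomb (\<lambda>b. fps_to_fls (a b)) B \<in> M" for a
    using B(1) B(2,3)
  proof (induction B rule: finite_induct)
    case empty
    then show ?case using osubD(2)[OF M(1)] by (simp add: V.lincomb_def)
  next
    case (insert b B)
    have "V.lincomb (\<lambda>b. fps_to_fls (a b)) (insert b B) = fps_to_fls (a b) \<odot> b \<oplus> V.lincomb (\<lambda>b. fps_to_fls (a b)) B"
      using V.lincomb_insert[of B "\<lambda>b. fps_to_fls (a b)" b] insert by auto
    moreover have "ord_ge 0 (fps_to_fls (a b))" by (simp add: ord_ge_def)
    ultimately show ?case using osubD(3,4)[OF M(1)] insert by auto
  qed
  ultimately show ?thesis by blast
qed

lemma complement:
  assumes "fg N" and U: "ksub U"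
  shows "\<exists>C. ksub C \<and> C \<subseteq> N \<and> C \<inter> U = {\<zero>} \<and> (\<forall>v\<in>N. \<exists>u\<in>U. \<exists>c\<in>C. v = u \<oplus> c)"
  using assms(1)
proof (induction rule: fg.induct)
  case zero
  then show ?case using ksubD(2)[OF U]
    by (intro exI[of _ "{\<zero>}"]) (auto intro!: ksub_zero bexI[of _ \<zero>])
next
  case (adjoin N b)
  note kN = fg_ksub[OF adjoin.hyps(1)] and U' = ksubD[OF U]
  obtain C where "ksub C \<and> C \<subseteq> N \<and> C \<inter> U = {\<zero>} \<and> (\<forall>v\<in>N. \<exists>u\<in>U. \<exists>c\<in>C. v = u \<oplus> c)"
    using adjoin.IH by (rule exE)
  then have C: "ksub C" "C \<subseteq> N" "C \<inter> U = {\<zero>}" and dec: "\<And>v. v \<in> N \<Longrightarrow> \<exists>u\<in>U. \<exists>c\<in>C. v = u \<oplus> c"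
    by simp_all
  note C' = ksubD[OF C(1)] and bc = adjoin.hyps(2)
  show ?case
  proof (cases "\<exists>u\<in>U. \<exists>c\<in>C. b = u \<oplus> c")
    case True
    then obtain u0 c0 where b: "u0 \<in> U" "c0 \<in> C" "b = u0 \<oplus> c0" by blast
    have "\<exists>u\<in>U. \<exists>c\<in>C. v = u \<oplus> c" if vN: "v \<in> adjoin N b" for v
    proof -
      obtain w h where w: "w \<in> N" "v = w \<oplus> h \<odot> b" using vN by (rule adjoinE)
      obtain u c where uc: "u \<in> U" "c \<in> C" "w = u \<oplus> c" using dec[OF w(1)] by blast
      have "v = (u \<oplus> h \<odot> u0) \<oplus> (c \<oplus> h \<odot> c0)"
        using uc b U'(7) C'(7) unfolding w(2) uc(3) b(3) by (simp add: smult_add_right a_ac)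
      then show ?thesis using U'(3,4) C'(3,4) uc b by metis
    qed
    then show ?thesis using C ksub_adjoin(2)[OF kN bc] by blast
  next
    case False
    have sub: "adjoin C b \<subseteq> adjoin N b" using C(2) by (auto simp: adjoin_def)
    have "v = \<zero>" if "v \<in> adjoin C b" "v \<in> U" for v
    proof -
      obtain c h where c: "c \<in> C" "v = c \<oplus> h \<odot> b" using \<open>v \<in> adjoin C b\<close> by (rule adjoinE)
      have cc: "c \<in> carrier E" "v \<in> carrier E" using c C'(7) U'(7) that(2) by auto
      show ?thesis
      proof (cases "h = 0")
        case True
        then show ?thesis using c cc bc C(3) that(2) by auto
      next
        case h: False
        have hb: "h \<odot> b = v \<ominus> c" using c cc bc by (metis a_comm add_diff_cancel smult_closed)
        have "b = inverse h \<odot> (h \<odot> b)" using h bc by (simp add: smult_smult)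
        also have "\<dots> = inverse h \<odot> v \<oplus> \<ominus> (inverse h \<odot> c)"
          unfolding hb using cc by (simp add: a_minus_def smult_add_right smult_minus_right)
        finally show ?thesis using False U'(4) C'(4,5) c(1) that(2) by blast
      qed
    qed
    then have "adjoin C b \<inter> U = {\<zero>}" using U'(2) ksubD(2)[OF ksub_adjoin(1)[OF C(1) bc]] by blast
    moreover have "\<exists>u\<in>U. \<exists>c\<in>adjoin C b. v = u \<oplus> c" if vN: "v \<in> adjoin N b" for v
    proof -
      obtain w h where w: "w \<in> N" "v = w \<oplus> h \<odot> b" using vN by (rule adjoinE)
      obtain u c where uc: "u \<in> U" "c \<in> C" "w = u \<oplus> c" using dec[OF w(1)] by blast
      have "v = u \<oplus> (c \<oplus> h \<odot> b)" using uc U'(7) C'(7) bc unfolding w(2) uc(3) by (simp add: a_assoc)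
      then show ?thesis using uc adjoinI by blast
    qed
    ultimately show ?thesis using ksub_adjoin(1)[OF C(1) bc] sub by blast
  qed
qed

end

context filtration
begin

lemma F_complete_offset:
  assumes "\<And>i::nat. s i \<in> S" "\<And>i. s (Suc i) \<ominus> s i \<in> F (int i + c)"
  shows "\<exists>w\<in>S. \<forall>i. w \<ominus> s i \<in> F (int i + c)"
proof -
  note S = ksubD[OF ksub_S]
  have X: "fls_X_intpow c \<odot> (fls_X_intpow (- c) \<odot> v) = v" "fls_X_intpow (- c) \<odot> (fls_X_intpow c \<odot> v) = v"
    if "v \<in> carrier E" for v
  proof -
    have e: "fls_X_intpow c * fls_X_intpow (- c) = (1 :: 'k fls)" "fls_X_intpow (- c) * fls_X_intpow c = (1 :: 'k fls)"
      by (simp_all only: fls_X_intpow_times_conv_shift fls_shift_fls_shift) simp_all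
    show "fls_X_intpow c \<odot> (fls_X_intpow (- c) \<odot> v) = v" "fls_X_intpow (- c) \<odot> (fls_X_intpow c \<odot> v) = v"
      using that by (simp_all only: smult_smult e smult_one)
  qed
  define t where "t = (\<lambda>i. fls_X_intpow (- c) \<odot> s i)"
  have sc: "s i \<in> carrier E" for i using assms(1) S(7) by blast
  have "\<exists>w\<in>S. \<forall>i. w \<ominus> t i \<in> F (int i)"
  proof (rule F_complete)
    show "t i \<in> S" for i unfolding t_def using assms(1) S(4) by blast
    fix i
    have "t (Suc i) \<ominus> t i = fls_X_intpow (- c) \<odot> (s (Suc i) \<ominus> s i)"
      unfolding t_def using sc by (simp add: smult_diff_right)
    then show "t (Suc i) \<ominus> t i \<in> F (int i)"
      using F_shift[of "s (Suc i) \<ominus> s i" "- c" "int i + c"] assms S(6) by simp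
  qed
  then obtain w where w: "w \<in> S" "\<And>i. w \<ominus> t i \<in> F (int i)" by blast
  have "fls_X_intpow c \<odot> w \<ominus> s i \<in> F (int i + c)" for i
  proof -
    have e: "fls_X_intpow c \<odot> t i = s i" "t i \<in> carrier E"
      unfolding t_def using X(1)[OF sc[of i]] sc by auto
    have "fls_X_intpow c \<odot> w \<ominus> s i = fls_X_intpow c \<odot> (w \<ominus> t i)"
      using S(7)[OF w(1)] e by (simp add: smult_diff_right)
    then show ?thesis using F_shift[of "w \<ominus> t i" c "int i"] w S(6,4) assms(1) by (simp add: t_def)
  qed
  then show ?thesis using w(1) S(4) by blast
qed

end

text \<open>The members of any filtration form a base of neighbourhoods of \<open>0\<close> for the topology
  defined by the lattices.\<close>

lemma (in fls_space) zeta_adic_lim_iff: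
  assumes F: "filtration E (carrier E) F" and fin: "fg (carrier E)"
  shows "zeta_adic_lim E s w \<longleftrightarrow> w \<in> carrier E \<and> (\<forall>n. \<forall>\<^sub>F N in sequentially. s N \<in> carrier E \<and> s N \<ominus> w \<in> F n)"
proof -
  interpret filtration E "carrier E" F by (rule F)
  show ?thesis
  proof
    assume lim: "zeta_adic_lim E s w"
    have "\<forall>\<^sub>F N in sequentially. s N \<in> carrier E \<and> s N \<ominus> w \<in> F n" for n
    proof -
      have "\<exists>m. fls_X_intpow m \<odot> v \<in> F n" if v: "v \<in> carrier E" for v
      proof -
        obtain j where "v \<in> F j" using F_exhaustive v by blast
        then have "fls_X_intpow (n - j) \<odot> v \<in> F n" using F_shift[OF v, of "n - j" j] by simp
        then show ?thesis by blast
      qed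
      then obtain L where L: "zeta_lattice E L" "L \<subseteq> F n" using zeta_lattice_in_osub[OF fin F_osub] by blast
      then have "\<forall>\<^sub>F N in sequentially. s N \<in> carrier E \<and> s N \<ominus> w \<in> L" using lim by (auto simp: zeta_adic_lim_def)
      then show ?thesis by (rule eventually_mono) (use L in auto)
    qed
    then show "w \<in> carrier E \<and> (\<forall>n. \<forall>\<^sub>F N in sequentially. s N \<in> carrier E \<and> s N \<ominus> w \<in> F n)"
      using lim by (simp add: zeta_adic_lim_def)
  next
    assume h: "w \<in> carrier E \<and> (\<forall>n. \<forall>\<^sub>F N in sequentially. s N \<in> carrier E \<and> s N \<ominus> w \<in> F n)"
    have "\<forall>\<^sub>F N in sequentially. s N \<in> carrier E \<and> s N \<ominus> w \<in> L" if L: "zeta_lattice E L" for L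
    proof -
      obtain m where m: "\<And>v. v \<in> carrier E \<Longrightarrow> v \<in> F m \<Longrightarrow> v \<in> L"
        using fg_open[OF fin order_refl zeta_lattice_osub(1)[OF L]] zeta_lattice_osub(2)[OF L] by blast
      from h have "\<forall>\<^sub>F N in sequentially. s N \<in> carrier E \<and> s N \<ominus> w \<in> F m" by blast
      then show ?thesis by (rule eventually_mono) (use m F_carrier in auto)
    qed
    then show "zeta_adic_lim E s w" using h by (simp add: zeta_adic_lim_def)
  qed
qed

section \<open>Puiseux series as a vector space\<close>

lemma fls_space_E_obj:
  assumes "p \<ge> 1"
  shows "fls_space (E_obj p f)"
proof -
  have "vectorspace class_ring (E_obj p f)"
  proof (rule vs_criteria)
    show "field (class_ring :: 'a fls ring)" by (rule class_field)
    show "\<forall>v\<in>carrier (E_obj p f). \<exists>neg_v\<in>carrier (E_obj p f). v \<oplus>\<^bsub>E_obj p f\<^esub> neg_v = \<zero>\<^bsub>E_obj p f\<^esub>"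
      by (auto simp: E_obj_def intro: exI[of _ "- _"] right_minus)
  qed (use assms in \<open>auto simp: E_obj_def algebra_simps\<close>)
  then show ?thesis
    by (simp add: fls_space_def fls_space_axioms_def vectorspace_def Module.module_def)
qed

lemma E_obj_sel [simp]:
  "carrier (E_obj p f) = UNIV" "\<zero>\<^bsub>E_obj p f\<^esub> = 0" "add (E_obj p f) = (+)"
  "smult (E_obj p f) = (\<lambda>a v. fls_compose_power a p * v)"
  by (simp_all add: E_obj_def)

lemma E_obj_minus [simp]: "p \<ge> 1 \<Longrightarrow> u \<ominus>\<^bsub>E_obj p f\<^esub> v = u - v"
proof -
  assume "p \<ge> 1"
  then interpret fls_space "E_obj p f" by (rule fls_space_E_obj)
  have "\<ominus>\<^bsub>E_obj p f\<^esub> v = - v" using minus_equality[of "- v" v] by simp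
  then show ?thesis by (simp add: a_minus_def)
qed

lemma ord_ge_compose_power:
  assumes "p \<ge> 1" "ord_ge n h"
  shows "ord_ge (int p * n) (fls_compose_power h p)"
  unfolding ord_ge_def
proof (intro allI impI)
  fix i assume i: "i < int p * n"
  show "fls_compose_power h p $$ i = 0"
  proof (cases "int p dvd i")
    case True
    then obtain k where "i = int p * k" by (auto elim: dvdE)
    then have "k < n" using i assms(1) by simp
    then show ?thesis using assms \<open>i = int p * k\<close> by (simp add: fls_nth_compose_power ord_geD)
  qed (use assms in \<open>simp add: fls_nth_compose_power\<close>)
qed

lemma filtration_E_obj:
  assumes p: "p \<ge> 1"
  shows "filtration (E_obj p f) UNIV (\<lambda>n. {y. ord_ge (int p * n) y})"
proof -
  interpret M: fls_space "E_obj p f" by (rule fls_space_E_obj[OF p])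
  show ?thesis
  proof
    show "M.ksub UNIV" by (simp add: M.ksub_def)
    fix n m and v :: "'a fls"
    show "M.osub {y. ord_ge (int p * n) y}"
      unfolding M.osub_def
    proof (intro conjI ballI allI impI)
      fix h v :: "'a fls" assume "ord_ge 0 h" "v \<in> {y. ord_ge (int p * n) y}"
      then show "h \<odot>\<^bsub>E_obj p f\<^esub> v \<in> {y. ord_ge (int p * n) y}"
        using ord_ge_mult[OF ord_ge_compose_power[OF p, of 0 h]] by fastforce
    qed (auto intro: ord_ge_add)
    show "(fls_X_intpow m \<odot>\<^bsub>E_obj p f\<^esub> v \<in> {y. ord_ge (int p * (n + m)) y}) = (v \<in> {y. ord_ge (int p * n) y})"
      using p fls_X_intpow_times_conv_shift(1)[of "int p * m" v] by (simp add: algebra_simps)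
  next
    fix v :: "'a fls"
    show "\<exists>n. v \<in> {y. ord_ge (int p * n) y}"
    proof (rule exI[of _ "- \<bar>fls_subdegree v\<bar>"])
      have "\<bar>fls_subdegree v\<bar> \<le> int p * \<bar>fls_subdegree v\<bar>" using p by (simp add: mult_le_cancel_right1)
      then show "v \<in> {y. ord_ge (int p * - \<bar>fls_subdegree v\<bar>) y}"
        by (auto intro!: ord_ge_mono[OF ord_ge_subdegree])
    qed
    assume "\<And>n. v \<in> {y. ord_ge (int p * n) y}"
    moreover have "int i \<le> int p * int i" for i using p by (simp add: mult_le_cancel_right1)
    ultimately have "ord_ge (0 + int i) v" for i by (metis add_0 mem_Collect_eq ord_ge_mono)
    then have "v = 0" by (rule eq_zero_if_ord_ge)
    then show "v = \<zero>\<^bsub>E_obj p f\<^esub>" by simp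
  next
    fix s :: "nat \<Rightarrow> 'a fls"
    assume "\<And>i. s (Suc i) \<ominus>\<^bsub>E_obj p f\<^esub> s i \<in> {y. ord_ge (int p * int i) y}"
    then have "ord_ge (0 + int p * int i) (s (Suc i) - s i)" for i using p by simp
    from fls_complete[OF _ this] p show "\<exists>w\<in>UNIV. \<forall>i. w \<ominus>\<^bsub>E_obj p f\<^esub> s i \<in> {y. ord_ge (int p * int i) y}"
      by auto
  qed auto
qed

text \<open>The monomials \<open>t^0, \<dots>, t^(p - 1)\<close> form a basis; the induction admits one more residue class of
  exponents in each step.\<close>

lemma fg_E_obj:
  assumes p: "p \<ge> 1"
  shows "fls_space.fg (E_obj p f) UNIV"
proof -
  interpret M: fls_space "E_obj p f" by (rule fls_space_E_obj[OF p])
  have "M.fg {y. \<forall>n. y $$ n \<noteq> 0 \<longrightarrow> n mod int p < int k}" for k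
  proof (induction k)
    case 0
    have "{y :: 'a fls. \<forall>n. y $$ n \<noteq> 0 \<longrightarrow> n mod int p < int 0} = {\<zero>\<^bsub>E_obj p f\<^esub>}"
    proof -
      have "\<not> n mod int p < 0" for n using p by (simp add: not_less)
      then show ?thesis by (auto intro!: fls_zero_eqI)
    qed
    then show ?case using M.fg.zero by simp
  next
    case (Suc k)
    show ?case
    proof (cases "k < p")
      case False
      then have "n mod int p < int k" "n mod int p < int (Suc k)" for n
        using p pos_mod_bound[of "int p" n] by linarith+
      then show ?thesis using Suc by simp
    next
      case k: True
      have nth: "(fls_compose_power h p * fls_X_intpow (int k)) $$ n
          = (if n mod int p = int k then h $$ (n div int p) else 0)" for h :: "'a fls" and n
      proof -
        have "(fls_compose_power h p * fls_X_intpow (int k)) $$ n = fls_compose_power h p $$ (n - int k)"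
          by (simp add: fls_X_intpow_times_conv_shift)
        moreover have "int p dvd (n - int k) \<longleftrightarrow> n mod int p = int k"
          using k by (metis mod_eq_dvd_iff mod_pos_pos_trivial of_nat_0_le_iff of_nat_less_iff)
        moreover have "(n - int k) div int p = n div int p" if "n mod int p = int k"
          using that p by (metis minus_mod_eq_mult_div nonzero_mult_div_cancel_left of_nat_0_eq_iff not_one_le_zero)
        ultimately show ?thesis using p by (simp add: fls_nth_compose_power)
      qed
      have "{y :: 'a fls. \<forall>n. y $$ n \<noteq> 0 \<longrightarrow> n mod int p < int (Suc k)}
          = M.adjoin {y. \<forall>n. y $$ n \<noteq> 0 \<longrightarrow> n mod int p < int k} (fls_X_intpow (int k))"
      proof (intro equalityI subsetI)
        fix y :: "'a fls" assume y: "y \<in> {y. \<forall>n. y $$ n \<noteq> 0 \<longrightarrow> n mod int p < int (Suc k)}"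
        define h where "h = Abs_fls (\<lambda>n. y $$ (n * int p + int k))"
        have h: "h $$ n = y $$ (n * int p + int k)" for n
          unfolding h_def
        proof (rule nth_Abs_fls_lower_bound)
          show "\<forall>n < - \<bar>fls_subdegree y\<bar> - int k. y $$ (n * int p + int k) = 0"
          proof (intro allI impI)
            fix n assume n: "n < - \<bar>fls_subdegree y\<bar> - int k"
            then have "n * int p \<le> n * 1" using p by (intro mult_left_mono_neg) auto
            then show "y $$ (n * int p + int k) = 0" using n by (intro fls_eq0_below_subdegree) auto
          qed
        qed
        define u where "u = y - fls_compose_power h p * fls_X_intpow (int k)"
        have "n mod int p < int k" if "u $$ n \<noteq> 0" for n
        proof -
          have "n mod int p \<noteq> int k"
          proof
            assume e: "n mod int p = int k"
            then have "n div int p * int p + int k = n" by (metis div_mult_mod_eq)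
            then show False using that e by (simp add: u_def nth h)
          qed
          moreover then have "y $$ n \<noteq> 0" using that by (simp add: u_def nth)
          ultimately show ?thesis using y by force
        qed
        moreover have "y = u + fls_compose_power h p * fls_X_intpow (int k)" by (simp add: u_def)
        ultimately show "y \<in> M.adjoin {y. \<forall>n. y $$ n \<noteq> 0 \<longrightarrow> n mod int p < int k} (fls_X_intpow (int k))"
          unfolding M.adjoin_def by auto
      next
        fix y assume "y \<in> M.adjoin {y. \<forall>n. y $$ n \<noteq> 0 \<longrightarrow> n mod int p < int k} (fls_X_intpow (int k))"
        then obtain u h where u: "\<And>n. u $$ n \<noteq> 0 \<Longrightarrow> n mod int p < int k"
          and y: "y = u + fls_compose_power h p * fls_X_intpow (int k)"
          unfolding M.adjoin_def by auto
        show "y \<in> {y. \<forall>n. y $$ n \<noteq> 0 \<longrightarrow> n mod int p < int (Suc k)}"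
        proof (intro CollectI allI impI)
          fix n assume "y $$ n \<noteq> 0"
          then have "u $$ n \<noteq> 0 \<or> n mod int p = int k" by (auto simp: y nth split: if_splits)
          then show "n mod int p < int (Suc k)" using u by fastforce
        qed
      qed
      then show ?thesis using M.fg.adjoin[OF Suc] by simp
    qed
  qed
  from this[of p] show ?thesis using p by simp
qed

text \<open>Successive approximation inside a closed subspace \<open>S\<close>. The preimage of a leading term has to be found in \<open>S\<close>,
  where scalars only shift exponents by multiples of \<open>p\<close>. But \<open>t^(p s) T^(p - 1) v\<close> lies in \<open>S\<close> and
  has order \<open>ord v + s\<close>, so \<open>T\<close> maps a constant multiple of it to a series with the leading term
  of \<open>v\<close>.\<close>

lemma shift_operator_surj:
  assumes p: "p \<ge> (1::nat)" and s: "s \<ge> (1::nat)"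
    and add: "\<And>u v. u \<in> S \<Longrightarrow> v \<in> S \<Longrightarrow> u + v \<in> S"
    and smult: "\<And>h v. v \<in> S \<Longrightarrow> fls_compose_power h p * v \<in> S"
    and closed: "\<And>y. (\<And>n. \<exists>v\<in>S. ord_ge n (y - v)) \<Longrightarrow> y \<in> S"
    and T: "const_lin T" "\<And>v. v \<in> S \<Longrightarrow> T v \<in> S" "\<And>n v. ord_ge (n - int s) (T v) \<longleftrightarrow> ord_ge n v"
    and y: "y \<in> (S :: 'k::field_char_0 fls set)"
  shows "\<exists>u\<in>S. T u = y"
proof -
  note T' = const_linD[OF T(1)]
  have minus: "u - v \<in> S" if "u \<in> S" "v \<in> S" for u v
    using add[OF that(1) smult[OF that(2), of "- 1"]] p by (simp add: fls_compose_power_1_left)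
  have const: "fls_const c * v \<in> S" if "v \<in> S" for c v
    using smult[OF that, of "fls_const c"] p by simp
  have Tpow: "(T ^^ k) v \<in> S" if "v \<in> S" for k v
    by (induction k) (use that T(2) in auto)
  have Tord: "ord_ge (n - int k * int s) ((T ^^ k) v) \<longleftrightarrow> ord_ge n v" for k n v
  proof (induction k)
    case (Suc k)
    have "n - int (Suc k) * int s = (n - int k * int s) - int s" by (simp add: algebra_simps)
    then show ?case using T(3)[of "n - int k * int s" "(T ^^ k) v"] Suc
      by (simp only: funpow.simps o_apply)
  qed simp
  have step: "\<exists>u\<in>S. ord_ge (n + int s) u \<and> ord_ge (n + 1) (v - T u)" if v: "v \<in> S" "ord_ge n v" for n v
  proof (cases "v $$ n = 0")
    case True
    have "ord_ge (n + 1) v" unfolding ord_ge_def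
      using True ord_geD[OF v(2)] by (metis int_one_le_iff_zero_less less_le_not_le zle_add1_eq_le order_le_less)
    moreover have "0 \<in> S" using minus[OF v(1) v(1)] by simp
    ultimately show ?thesis by (intro bexI[of _ 0]) (simp_all add: T')
  next
    case False
    \<comment> \<open>The element \<open>t^(p s) T^(p - 1) v\<close> of \<open>S\<close>, of order \<open>s\<close> above that of \<open>v\<close>.\<close>
    define w where "w = fls_shift (- (int p * int s)) ((T ^^ (p - 1)) v)"
    have "w = fls_compose_power (fls_X_intpow (int s)) p * (T ^^ (p - 1)) v"
      using p fls_X_intpow_times_conv_shift(1)[of "int p * int s" "(T ^^ (p - 1)) v"]
      by (simp add: w_def)
    then have wS: "w \<in> S" using smult Tpow[OF v(1)] by simp
    have pp: "int (p - 1) = int p - 1" using p by simp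
    have word: "ord_ge m w \<longleftrightarrow> ord_ge (m - int s) v" for m
    proof -
      have "ord_ge m w \<longleftrightarrow> ord_ge ((m - int s) - int (p - 1) * int s) ((T ^^ (p - 1)) v)"
      proof -
        have e: "(m - int s) - int (p - 1) * int s = m - int p * int s" unfolding pp by (simp add: algebra_simps)
        show ?thesis unfolding e by (simp add: w_def)
      qed
      then show ?thesis by (simp only: Tord)
    qed
    have Tw: "ord_ge m (T w) \<longleftrightarrow> ord_ge m v" for m
      using T(3)[of "m + int s" w] word[of "m + int s"] by simp
    have "T w $$ n \<noteq> 0"
    proof
      assume "T w $$ n = 0"
      then have "ord_ge (n + 1) (T w)" using Tw[of n] v(2) unfolding ord_ge_def
        by (metis zless_add1_eq)
      then show False using Tw[of "n + 1"] False by (auto simp: ord_ge_def)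
    qed
    define u where "u = fls_const (v $$ n / T w $$ n) * w"
    have "u \<in> S" unfolding u_def by (rule const[OF wS])
    moreover have "ord_ge (n + int s) u" unfolding u_def
      by (rule ord_ge_const_mult) (simp add: word v(2))
    moreover have "ord_ge (n + 1) (v - T u)"
      unfolding ord_ge_def
    proof (intro allI impI)
      fix i assume "i < n + 1"
      then consider "i < n" | "i = n" by linarith
      then show "(v - T u) $$ i = 0"
      proof cases
        case 1
        then show ?thesis using ord_geD[OF v(2)] ord_geD[of n "T w"] Tw[of n] v(2)
          by (simp add: u_def T' fls_mult_const_nth)
      next
        case 2
        then show ?thesis using \<open>T w $$ n \<noteq> 0\<close> by (simp add: u_def T' fls_mult_const_nth)
      qed
    qed
    ultimately show ?thesis by blast
  qed
  define n where "n = fls_subdegree y"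
  define P where "P = (\<lambda>i v. v \<in> S \<and> ord_ge (n + int i) (y - T v))"
  have "\<exists>f. \<forall>i. P i (f i) \<and> ord_ge (n + int s + 1 * int i) (f (Suc i) - f i)"
  proof (rule dependent_nat_choice)
    have "0 \<in> S" using minus[OF y y] by simp
    then show "\<exists>v. P 0 v" by (intro exI[of _ 0]) (simp add: P_def T' n_def)
    fix v i assume v: "P i v"
    then have "y - T v \<in> S" using y T(2) minus by (simp add: P_def)
    then obtain u where u: "u \<in> S" "ord_ge (n + int i + int s) u" "ord_ge (n + int i + 1) (y - T v - T u)"
      using step[of "y - T v" "n + int i"] v by (auto simp: P_def)
    show "\<exists>v'. P (Suc i) v' \<and> ord_ge (n + int s + 1 * int i) (v' - v)"
      by (rule exI[of _ "v + u"]) (use u v add in \<open>auto simp: P_def T' algebra_simps\<close>)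
  qed
  then obtain f where f: "\<And>i. P i (f i)" "\<And>i. ord_ge (n + int s + 1 * int i) (f (Suc i) - f i)" by blast
  obtain u where u: "\<And>i. ord_ge (n + int s + 1 * int i) (u - f i)"
    using fls_complete[OF order_refl f(2)] by blast
  have "u \<in> S"
  proof (rule closed)
    fix m
    show "\<exists>v\<in>S. ord_ge m (u - v)"
      by (rule bexI[of _ "f (nat (m - n))"]) (use f(1) in \<open>auto simp: P_def intro: ord_ge_mono[OF u]\<close>)
  qed
  moreover have "T u = y"
  proof -
    have "ord_ge (n + int i) (T u - y)" for i
    proof -
      have "ord_ge (n + int i) (T (u - f i))" using T(3)[of "n + int s + int i" "u - f i"] u[of i]
        by (simp add: algebra_simps)
      moreover have "ord_ge (n + int i) (y - T (f i))" using f(1) by (simp add: P_def)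
      ultimately have "ord_ge (n + int i) (T (u - f i) - (y - T (f i)))" by (rule ord_ge_diff)
      then show ?thesis by (simp add: T')
    qed
    from eq_zero_if_ord_ge[OF this] show ?thesis by simp
  qed
  ultimately show ?thesis by blast
qed

section \<open>Semilinear operators of negative order\<close>

text \<open>The common setting for \<open>T = - z \<nabla>\<close>, with \<open>a\<close> the identity and \<open>d = \<zeta> d/d\<zeta>\<close>, and for \<open>T = \<Phi>\<close>, with
  \<open>a = \<phi>\<close> and \<open>d = 0\<close>. In both cases the transform makes \<open>T\<close> the inverse of the new variable.\<close>

locale semilinear_space = fls_space E for E :: "('k::field_char_0 fls, 'v) op_module" (structure) +
  fixes T :: "'v \<Rightarrow> 'v" and a d :: "'k fls \<Rightarrow> 'k fls"
  assumes fg_carrier: "fg (carrier E)"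
    and T_closed [simp]: "v \<in> carrier E \<Longrightarrow> T v \<in> carrier E"
    and T_add: "u \<in> carrier E \<Longrightarrow> v \<in> carrier E \<Longrightarrow> T (u \<oplus> v) = T u \<oplus> T v"
    and T_smult: "v \<in> carrier E \<Longrightarrow> T (h \<odot> v) = a h \<odot> T v \<oplus> d h \<odot> v"
    and a_ord: "ord_ge n h \<Longrightarrow> ord_ge n (a h)"
    and d_ord: "ord_ge n h \<Longrightarrow> ord_ge n (d h)"
    and a_const: "a (fls_const c) = fls_const c"
    and d_const: "d (fls_const c) = 0"
begin

lemma T_const: "v \<in> carrier E \<Longrightarrow> T (fls_const c \<odot> v) = fls_const c \<odot> T v"
  by (simp add: T_smult a_const d_const)

lemma T_zero [simp]: "T \<zero> = \<zero>"
  using T_add[of \<zero> \<zero>] by (metis T_closed add.l_cancel_one r_zero zero_closed)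

lemma T_minus: "v \<in> carrier E \<Longrightarrow> T (\<ominus> v) = \<ominus> T v"
proof -
  assume v: "v \<in> carrier E"
  have "fls_const (- 1) = (- 1 :: 'k fls)" by (rule fls_eqI) simp
  then show ?thesis using T_const[OF v, of "- 1"] v by (simp add: smult_minus_left)
qed

lemma T_diff: "u \<in> carrier E \<Longrightarrow> v \<in> carrier E \<Longrightarrow> T (u \<ominus> v) = T u \<ominus> T v"
  by (simp add: a_minus_def T_add T_minus)

definition stable :: "'v set \<Rightarrow> bool" where
  "stable S \<longleftrightarrow> ksub S \<and> (\<forall>v\<in>S. T v \<in> S)"

text \<open>\<open>\<pi>\<close> identifies \<open>W/U\<close> with the Puiseux series \<open>k((t))\<close>, \<open>t^p = X\<close>, and \<open>T\<close> lowers the order in \<open>t\<close>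
  by exactly \<open>s\<close>.\<close>

definition shift_model :: "'v set \<Rightarrow> 'v set \<Rightarrow> nat \<Rightarrow> nat \<Rightarrow> ('v \<Rightarrow> 'k fls) \<Rightarrow> bool" where
  "shift_model W U p s \<pi> \<longleftrightarrow> p \<ge> 1 \<and> s \<ge> 1 \<and> stable W \<and> ksub U \<and> U \<subseteq> W \<and>
     (\<forall>u\<in>W. \<forall>v\<in>W. \<pi> (u \<oplus> v) = \<pi> u + \<pi> v) \<and>
     (\<forall>h. \<forall>v\<in>W. \<pi> (h \<odot> v) = fls_compose_power h p * \<pi> v) \<and>
     (\<forall>y. \<exists>w\<in>W. \<pi> w = y) \<and> (\<forall>w\<in>W. \<pi> w = 0 \<longleftrightarrow> w \<in> U) \<and>
     (\<forall>w\<in>W. \<forall>n. ord_ge (n - int s) (\<pi> (T w)) \<longleftrightarrow> ord_ge n (\<pi> w))"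

inductive shift_filtered :: "'v set \<Rightarrow> bool" where
  zero: "shift_filtered {\<zero>}"
| step: "shift_filtered U \<Longrightarrow> shift_model W U p s \<pi> \<Longrightarrow> shift_filtered W"

lemma stableD: "stable S \<Longrightarrow> ksub S" "stable S \<Longrightarrow> v \<in> S \<Longrightarrow> T v \<in> S"
  by (auto simp: stable_def)

lemma stable_Int: "stable S \<Longrightarrow> stable S' \<Longrightarrow> stable (S \<inter> S')"
  by (auto simp: stable_def intro: ksub_Int)

lemma shift_filtered_stable: "shift_filtered W \<Longrightarrow> stable W"
  by (induction rule: shift_filtered.induct) (auto simp: stable_def ksub_zero shift_model_def)

lemma shift_modelD:
  assumes "shift_model W U p s \<pi>"
  shows "p \<ge> 1" "s \<ge> 1" "stable W" "ksub W" "ksub U" "U \<subseteq> W"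
    "u \<in> W \<Longrightarrow> v \<in> W \<Longrightarrow> \<pi> (u \<oplus> v) = \<pi> u + \<pi> v"
    "v \<in> W \<Longrightarrow> \<pi> (h \<odot> v) = fls_compose_power h p * \<pi> v"
    "\<exists>w\<in>W. \<pi> w = y" "w \<in> W \<Longrightarrow> \<pi> w = 0 \<longleftrightarrow> w \<in> U"
    "w \<in> W \<Longrightarrow> ord_ge (n - int s) (\<pi> (T w)) \<longleftrightarrow> ord_ge n (\<pi> w)"
    "u \<in> W \<Longrightarrow> v \<in> W \<Longrightarrow> \<pi> (u \<ominus> v) = \<pi> u - \<pi> v"
    "v \<in> W \<Longrightarrow> \<pi> (fls_const c \<odot> v) = fls_const c * \<pi> v"
proof -
  show p: "p \<ge> 1" and s: "s \<ge> 1" and W: "stable W" "ksub W" and U: "ksub U" "U \<subseteq> W"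
    and add: "u \<in> W \<Longrightarrow> v \<in> W \<Longrightarrow> \<pi> (u \<oplus> v) = \<pi> u + \<pi> v"
    and smult: "v \<in> W \<Longrightarrow> \<pi> (h \<odot> v) = fls_compose_power h p * \<pi> v"
    and "\<exists>w\<in>W. \<pi> w = y" "w \<in> W \<Longrightarrow> \<pi> w = 0 \<longleftrightarrow> w \<in> U"
    and "w \<in> W \<Longrightarrow> ord_ge (n - int s) (\<pi> (T w)) \<longleftrightarrow> ord_ge n (\<pi> w)" for u v w h n y
    using assms by (auto simp: shift_model_def stable_def)
  have add': "\<pi> (u \<oplus> v) = \<pi> u + \<pi> v" if "u \<in> W" "v \<in> W" for u v using assms that by (auto simp: shift_model_def)
  have smult': "\<pi> (h \<odot> v) = fls_compose_power h p * \<pi> v" if "v \<in> W" for h v using assms that by (auto simp: shift_model_def)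
  show c: "\<pi> (fls_const c \<odot> v) = fls_const c * \<pi> v" if "v \<in> W" for c v
    using smult'[OF that] p by simp
  have m: "\<pi> (\<ominus> v) = - \<pi> v" if v: "v \<in> W" for v
  proof -
    have "\<ominus> v = (- 1) \<odot> v" using ksubD(7)[OF W(2) v] by (simp add: smult_minus_left)
    then show ?thesis using smult'[OF v, of "- 1"] p by simp
  qed
  show "\<pi> (u \<ominus> v) = \<pi> u - \<pi> v" if "u \<in> W" "v \<in> W" for u v
    using add'[OF that(1) ksubD(5)[OF W(2) that(2)]] m[OF that(2)] by (simp add: a_minus_def)
qed

text \<open>\<open>T\<close> induces an operator on the quotient: if \<open>\<pi> u = 0\<close>, then \<open>\<pi> (T u)\<close> has arbitrarily large order.\<close>

lemma shift_model_operator: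
  assumes M: "shift_model W U p s \<pi>"
  shows "\<exists>T0. const_lin T0 \<and> (\<forall>w\<in>W. \<pi> (T w) = T0 (\<pi> w)) \<and>
    (\<forall>n y. ord_ge (n - int s) (T0 y) \<longleftrightarrow> ord_ge n y)"
proof -
  note M' = shift_modelD[OF M]
  note W = ksubD[OF M'(4)] and TW = stableD(2)[OF M'(3)]
  define l where "l y = (SOME w. w \<in> W \<and> \<pi> w = y)" for y
  have l: "l y \<in> W" "\<pi> (l y) = y" for y
    using someI_ex[of "\<lambda>w. w \<in> W \<and> \<pi> w = y"] M'(9)[of y] unfolding l_def by blast+
  define T0 where "T0 y = \<pi> (T (l y))" for y
  have T0: "\<pi> (T w) = T0 (\<pi> w)" if w: "w \<in> W" for w
  proof -
    define u where "u = w \<ominus> l (\<pi> w)"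
    have u: "u \<in> W" "\<pi> u = 0" unfolding u_def using W(6) w l by (auto simp: M'(12))
    have "ord_ge (n - int s) (\<pi> (T u))" for n using M'(11)[OF u(1), of n] u(2) by simp
    from this[of "0 + int s + int i" for i] have "\<pi> (T u) = 0"
      by (intro eq_zero_if_ord_ge[of 0]) (metis add.commute add_diff_cancel_right' group_cancel.add1)
    moreover have "T u = T w \<ominus> T (l (\<pi> w))" unfolding u_def using W(7) w l by (simp add: T_diff)
    ultimately show ?thesis using TW w l(1) by (simp add: M'(12) T0_def)
  qed
  have "const_lin T0"
  proof (rule const_linI)
    fix x y c
    have "T0 (x + y) = T0 (\<pi> (l x \<oplus> l y))" using l by (simp add: M'(7))
    also have "\<dots> = \<pi> (T (l x) \<oplus> T (l y))" using W(3,7) l by (simp add: T_add flip: T0)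
    also have "\<dots> = T0 x + T0 y" using TW l by (simp add: M'(7) T0_def)
    finally show "T0 (x + y) = T0 x + T0 y" .
    have "T0 (fls_const c * x) = T0 (\<pi> (fls_const c \<odot> l x))" using l by (simp add: M'(13))
    also have "\<dots> = \<pi> (fls_const c \<odot> T (l x))" using W(4,7) l by (simp add: T_const flip: T0)
    also have "\<dots> = fls_const c * T0 x" using TW l by (simp add: M'(13) T0_def)
    finally show "T0 (fls_const c * x) = fls_const c * T0 x" .
  qed
  moreover have "ord_ge (n - int s) (T0 y) \<longleftrightarrow> ord_ge n y" for n y
    using M'(11)[OF l(1), of n y] l(2)[of y] by (simp add: T0_def)
  ultimately show ?thesis using T0 by blast
qed

end

lemma (in fls_space) fg_image:
  assumes p: "p \<ge> 1" and W: "ksub W"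
    and add: "\<And>u v. u \<in> W \<Longrightarrow> v \<in> W \<Longrightarrow> \<pi> (u \<oplus> v) = \<pi> u + \<pi> v"
    and smult: "\<And>h v. v \<in> W \<Longrightarrow> \<pi> (h \<odot> v) = fls_compose_power h p * \<pi> v"
    and N: "fg N" "N \<subseteq> W"
  shows "fls_space.fg (E_obj p 0) (\<pi> ` N)"
  using N
proof (induction rule: fg.induct)
  interpret M: fls_space "E_obj p 0" by (rule fls_space_E_obj[OF p])
  case zero
  have "\<pi> \<zero> = 0" using add[of \<zero> \<zero>] ksubD(2)[OF W] by simp
  then have "\<pi> ` {\<zero>} = {\<zero>\<^bsub>E_obj p 0\<^esub>}" by simp
  then show ?case using M.fg.zero by metis
next
  interpret M: fls_space "E_obj p 0" by (rule fls_space_E_obj[OF p])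
  case (adjoin N b)
  have sub: "N \<subseteq> W" "b \<in> W" using adjoin.prems ksub_adjoin[OF fg_ksub[OF adjoin.hyps(1)] adjoin.hyps(2)] by auto
  have "\<pi> (u \<oplus> h \<odot> b) = \<pi> u + fls_compose_power h p * \<pi> b" if "u \<in> N" for u h
    using that sub add[of u "h \<odot> b"] smult[of b h] ksubD(4)[OF W] by auto
  then have "\<pi> ` adjoin N b = M.adjoin (\<pi> ` N) (\<pi> b)"
    unfolding adjoin_def M.adjoin_def by (force simp: image_iff)
  then show ?case using M.fg.adjoin[OF adjoin.IH[OF sub(1)], of "\<pi> b"] by simp
qed

context semilinear_space
begin

lemma shift_filtered_inj:
  assumes "shift_filtered W"
  shows "w \<in> W \<Longrightarrow> T w = \<zero> \<Longrightarrow> w = \<zero>"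
  using assms
proof (induction arbitrary: w rule: shift_filtered.induct)
  case (step U W p s \<pi>)
  note M = shift_modelD[OF step.hyps(2)]
  have z: "\<pi> \<zero> = 0" using M(10)[OF ksubD(2)[OF M(4)]] ksubD(2)[OF M(5)] by simp
  have "ord_ge n (\<pi> w)" for n using M(11)[OF step.prems(1), of n] step.prems(2) z by simp
  then have "\<pi> w = 0" by (rule eq_zero_if_ord_ge)
  then show ?case using step M(10) by blast
qed auto

text \<open>The statement for all stable subspaces \<open>S\<close>, not only for \<open>W\<close>, makes them stable under the
  inverse of \<open>T\<close>. Its proof uses that the image of \<open>S\<close> in
  the Puiseux series is closed, being finite-dimensional.\<close>

theorem shift_filtered_surj:
  assumes "shift_filtered W" and S: "stable S"
  shows "y \<in> S \<Longrightarrow> y \<in> W \<Longrightarrow> \<exists>u\<in>S \<inter> W. T u = y"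
  using assms(1)
proof (induction arbitrary: y rule: shift_filtered.induct)
  case zero
  then show ?case using ksubD(2)[OF stableD(1)[OF S]] by auto
next
  case (step U W p s \<pi>)
  note M = shift_modelD[OF step.hyps(2)]
  obtain T0 where T0: "const_lin T0" "\<And>w. w \<in> W \<Longrightarrow> \<pi> (T w) = T0 (\<pi> w)"
    "\<And>n y. ord_ge (n - int s) (T0 y) \<longleftrightarrow> ord_ge n y"
    using shift_model_operator[OF step.hyps(2)] by blast
  interpret P: filtration "E_obj p 0" UNIV "\<lambda>n. {y. ord_ge (int p * n) y}"
    by (rule filtration_E_obj[OF M(1)])
  have SW: "stable (S \<inter> W)" by (rule stable_Int[OF S M(3)])
  note kSW = ksubD[OF stableD(1)[OF SW]]
  have fgS: "P.fg (\<pi> ` (S \<inter> W))"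
    by (rule fg_image[OF M(1) M(4) M(7) M(8)]) (use ksub_fg[OF fg_carrier stableD(1)[OF SW] kSW(1)] in auto)
  have "\<exists>z\<in>\<pi> ` (S \<inter> W). T0 z = \<pi> y"
  proof (rule shift_operator_surj[OF M(1) M(2)])
    show "const_lin T0" "\<And>n v. ord_ge (n - int s) (T0 v) \<longleftrightarrow> ord_ge n v" by (fact T0)+
    show "\<pi> y \<in> \<pi> ` (S \<inter> W)" using step.prems by blast
    show "u + v \<in> \<pi> ` (S \<inter> W)" if uv: "u \<in> \<pi> ` (S \<inter> W)" "v \<in> \<pi> ` (S \<inter> W)" for u v
    proof -
      obtain u' v' where "u' \<in> S \<inter> W" "v' \<in> S \<inter> W" "u = \<pi> u'" "v = \<pi> v'" using uv by blast
      then show ?thesis using kSW(3)[of u' v'] by (intro image_eqI[of _ _ "u' \<oplus> v'"]) (auto simp: M(7))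
    qed
    show "fls_compose_power h p * v \<in> \<pi> ` (S \<inter> W)" if v: "v \<in> \<pi> ` (S \<inter> W)" for h v
    proof -
      obtain v' where "v' \<in> S \<inter> W" "v = \<pi> v'" using v by blast
      then show ?thesis using kSW(4)[of v' h] by (intro image_eqI[of _ _ "h \<odot> v'"]) (auto simp: M(8))
    qed
    show "T0 v \<in> \<pi> ` (S \<inter> W)" if v: "v \<in> \<pi> ` (S \<inter> W)" for v
    proof -
      obtain v' where "v' \<in> S \<inter> W" "v = \<pi> v'" using v by blast
      then show ?thesis using stableD(2)[OF SW, of v'] by (intro image_eqI[of _ _ "T v'"]) (auto simp: T0(2))
    qed
    fix z assume z: "\<And>n. \<exists>v\<in>\<pi> ` (S \<inter> W). ord_ge n (z - v)"
    show "z \<in> \<pi> ` (S \<inter> W)"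
      by (rule P.fg_closed[OF fgS]) (use z M(1) in auto)
  qed
  then obtain u where u: "u \<in> S \<inter> W" "T0 (\<pi> u) = \<pi> y" by blast
  have yTu: "y \<ominus> T u \<in> S \<inter> W" using step.prems u stableD(2)[OF SW] kSW(6) by blast
  have Tu: "T u \<in> W" using stableD(2)[OF SW] u by blast
  have "\<pi> (y \<ominus> T u) = 0" using step.prems(2) Tu u T0(2) by (simp add: M(12))
  then have "y \<ominus> T u \<in> U" using M(10) yTu by blast
  then obtain u' where u': "u' \<in> S \<inter> U" "T u' = y \<ominus> T u" using step.IH yTu by blast
  have "u \<in> carrier E" "u' \<in> carrier E" "y \<in> carrier E"
    using u u' M(6) step.prems ksubD(7)[OF M(4)] by blast+
  then have "T (u' \<oplus> u) = y" using u'(2) by (simp add: T_add)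
  moreover have "u' \<oplus> u \<in> S \<inter> W" using u u' kSW(3) M(6) by blast
  ultimately show ?case by blast
qed

text \<open>The inverse of \<open>T\<close> preserves the filtration, and its \<open>N\<close>-th power moves every member into the next one.\<close>

definition contracting :: "'v set \<Rightarrow> (int \<Rightarrow> 'v set) \<Rightarrow> nat \<Rightarrow> bool" where
  "contracting W F N \<longleftrightarrow> filtration E W F \<and> (\<forall>v\<in>W. \<forall>n. T v \<in> F n \<longrightarrow> v \<in> F n) \<and>
     (\<forall>v\<in>W. \<forall>n. (T ^^ N) v \<in> F n \<longrightarrow> v \<in> F (n + 1))"

lemma stable_funpow: "stable S \<Longrightarrow> v \<in> S \<Longrightarrow> (T ^^ k) v \<in> S"
  by (induction k) (auto simp: stable_def)

lemma funpow_T_linear: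
  assumes "u \<in> carrier E" "v \<in> carrier E"
  shows "(T ^^ k) u \<in> carrier E" "(T ^^ k) (u \<ominus> v) = (T ^^ k) u \<ominus> (T ^^ k) v"
proof -
  have c: "(T ^^ k) u \<in> carrier E" if "u \<in> carrier E" for u k
    by (induction k) (use that in auto)
  show "(T ^^ k) u \<in> carrier E" by (rule c[OF assms(1)])
  show "(T ^^ k) (u \<ominus> v) = (T ^^ k) u \<ominus> (T ^^ k) v"
    by (induction k) (use assms c in \<open>simp_all add: T_diff\<close>)
qed

lemma shift_filtered_funpow_surj:
  assumes "shift_filtered W" "y \<in> W"
  shows "\<exists>u\<in>W. (T ^^ k) u = y"
  using assms(2)
proof (induction k arbitrary: y)
  case (Suc k)
  obtain z where z: "z \<in> W" "T z = y" using shift_filtered_surj[OF assms(1) shift_filtered_stable[OF assms(1)] Suc.prems Suc.prems] by blast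
  obtain u where "u \<in> W" "(T ^^ k) u = z" using Suc.IH[OF z(1)] by blast
  then show ?case using z by auto
qed simp

text \<open>A filtration of \<open>W\<close> is composed of the one on \<open>U\<close> and the order filtration of \<open>W/U\<close> by means of a
  complement \<open>C\<close> of \<open>U\<close>. As \<open>C\<close> is not stable, \<open>T\<close> maps it into \<open>U\<close> with an error \<open>\<gamma>\<close>, which is
  continuous; the filtration on \<open>U\<close> is shifted by a number \<open>m\<close> that absorbs the error. Applying \<open>T\<close>
  \<open>p\<close> times lowers the order in the quotient by \<open>p s\<close>, at least one step of the filtration, and \<open>N'\<close> further
  applications gain one step in \<open>U\<close>.\<close>

theorem shift_filtered_contracting:
  assumes "shift_filtered W"
  shows "\<exists>F N. contracting W F N"
  using assms
proof (induction rule: shift_filtered.induct)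
  case zero
  have "filtration E {\<zero>} (\<lambda>_. {\<zero>})"
    by unfold_locales (auto simp: ksub_zero osub_def)
  then show ?case by (intro exI[of _ "\<lambda>_. {\<zero>}"] exI[of _ 0]) (simp add: contracting_def)
next
  case (step U W p s \<pi>)
  note M = shift_modelD[OF step.hyps(2)]
  note W = ksubD[OF M(4)] and U = ksubD[OF M(5)] and TW = stableD(2)[OF M(3)]
  have stU: "stable U" by (rule shift_filtered_stable[OF step.hyps(1)])
  note TU = stableD(2)[OF stU]
  obtain F' N' where cF': "contracting U F' N'" using step.IH by blast
  interpret F': filtration E U F' using cF' by (simp add: contracting_def)
  obtain T0 where T0: "const_lin T0" "\<And>w. w \<in> W \<Longrightarrow> \<pi> (T w) = T0 (\<pi> w)"
    "\<And>n y. ord_ge (n - int s) (T0 y) \<longleftrightarrow> ord_ge n y"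
    using shift_model_operator[OF step.hyps(2)] by blast
  interpret P: filtration "E_obj p 0" UNIV "\<lambda>n. {y. ord_ge (int p * n) y}"
    by (rule filtration_E_obj[OF M(1)])
  have fgW: "fg W" by (rule ksub_fg[OF fg_carrier M(4) W(1)])
  obtain C where "ksub C \<and> C \<subseteq> W \<and> C \<inter> U = {\<zero>} \<and> (\<forall>v\<in>W. \<exists>u\<in>U. \<exists>c\<in>C. v = u \<oplus> c)"
    using complement[OF fgW M(5)] by (rule exE)
  then have C: "ksub C" "C \<subseteq> W" "C \<inter> U = {\<zero>}" and dec: "\<And>v. v \<in> W \<Longrightarrow> \<exists>u\<in>U. \<exists>c\<in>C. v = u \<oplus> c"
    by simp_all
  note C' = ksubD[OF C(1)]
  have "\<forall>v\<in>W. \<exists>u. u \<in> U \<and> (\<exists>c\<in>C. v = u \<oplus> c)" using dec by blast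
  then obtain P where P0: "\<And>v. v \<in> W \<Longrightarrow> P v \<in> U" "\<And>v. v \<in> W \<Longrightarrow> \<exists>c\<in>C. v = P v \<oplus> c" by metis
  \<comment> \<open>\<open>P\<close> is the projection of \<open>W\<close> onto \<open>U\<close> along \<open>C\<close>.\<close>
  have P_eq: "P v = u" if "u \<in> U" "c \<in> C" "v = u \<oplus> c" for v u c
  proof -
    have v: "v \<in> W" using that M(6) C(2) W(3) by blast
    then obtain c' where c': "c' \<in> C" "v = P v \<oplus> c'" using P0(2) by blast
    have cl: "u \<in> carrier E" "c \<in> carrier E" "c' \<in> carrier E" "P v \<in> carrier E"
      using that c' P0(1)[OF v] U(7) C'(7) by auto
    have "u \<oplus> c = P v \<oplus> c'" using that(3) c'(2) by simp
    then have "(u \<oplus> c) \<ominus> (P v \<oplus> c) = (P v \<oplus> c') \<ominus> (P v \<oplus> c)" by simp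
    then have "u \<ominus> P v = c' \<ominus> c" using cl by (simp add: add_diff_add)
    moreover have "u \<ominus> P v \<in> U" using U(6) that(1) P0(1)[OF v] by blast
    moreover have "c' \<ominus> c \<in> C" using C'(6) c'(1) that(2) by blast
    ultimately have "u \<ominus> P v = \<zero>" using C(3) by auto
    then show ?thesis using cl by (simp add: diff_eq_zero_iff)
  qed
  have P_U: "P v = v" if "v \<in> U" for v
    by (rule P_eq[OF that C'(2)]) (use U(7) that in simp)
  have P_C: "P v = \<zero>" if "v \<in> C" for v
    by (rule P_eq[OF U(2) that]) (use C'(7) that in simp)
  have P_add: "P (u \<oplus> v) = P u \<oplus> P v" if uv: "u \<in> W" "v \<in> W" for u v
  proof -
    obtain c c' where c: "c \<in> C" "u = P u \<oplus> c" and c': "c' \<in> C" "v = P v \<oplus> c'" using P0(2) uv by blast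
    have cl: "c \<in> carrier E" "c' \<in> carrier E" "P u \<in> carrier E" "P v \<in> carrier E"
      using c(1) c'(1) P0(1) uv U(7) C'(7) by auto
    have "u \<oplus> v = (P u \<oplus> P v) \<oplus> (c \<oplus> c')"
      by (subst c(2), subst c'(2)) (use cl in \<open>simp add: a_ac\<close>)
    then show ?thesis by (rule P_eq[rotated 2]) (use U(3) P0(1) uv C'(3) c(1) c'(1) in auto)
  qed
  have P_smult: "P (h \<odot> v) = h \<odot> P v" if v: "v \<in> W" for h v
  proof -
    obtain c where c: "c \<in> C" "v = P v \<oplus> c" using P0(2) v by blast
    have cl: "c \<in> carrier E" "P v \<in> carrier E" using c(1) P0(1) v U(7) C'(7) by auto
    have "h \<odot> v = h \<odot> P v \<oplus> h \<odot> c" by (subst c(2)) (use cl in \<open>simp add: smult_add_right\<close>)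
    then show ?thesis by (rule P_eq[rotated 2]) (use U(4) P0(1) v C'(4) c(1) in auto)
  qed
  have P_minus: "P (\<ominus> v) = \<ominus> P v" if "v \<in> W" for v
    using P_smult[OF that, of "- 1"] W(7)[OF that] U(7)[OF P0(1)[OF that]] by (simp add: smult_minus_left)
  have P_diff: "P (u \<ominus> v) = P u \<ominus> P v" if "u \<in> W" "v \<in> W" for u v
    using P_add[OF that(1) W(5)[OF that(2)]] P_minus[OF that(2)] by (simp add: a_minus_def)
  have diffP: "v \<ominus> P v \<in> C" if v: "v \<in> W" for v
  proof -
    obtain c where c: "c \<in> C" "v = P v \<oplus> c" using P0(2) v by blast
    have "v \<ominus> P v = c" using c C'(7)[OF c(1)] U(7)[OF P0(1)[OF v]]
      by (metis a_comm add_diff_cancel)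
    then show ?thesis using c by simp
  qed
  have pi_P: "\<pi> (v \<ominus> P v) = \<pi> v" if v: "v \<in> W" for v
    using M(12)[OF v] P0(1)[OF v] M(6,10) by auto
  \<comment> \<open>The section of \<open>\<pi>\<close> with values in \<open>C\<close>; it is linear.\<close>
  define l where "l y = (SOME c. c \<in> C \<and> \<pi> c = y)" for y
  have "\<exists>c. c \<in> C \<and> \<pi> c = y" for y
  proof -
    obtain w where "w \<in> W" "\<pi> w = y" using M(9) by blast
    then show ?thesis using diffP pi_P by blast
  qed
  then have l: "l y \<in> C" "\<pi> (l y) = y" for y
    unfolding l_def using someI_ex[of "\<lambda>c. c \<in> C \<and> \<pi> c = y"] by blast+
  have C_inj: "c = c'" if "c \<in> C" "c' \<in> C" "\<pi> c = \<pi> c'" for c c'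
  proof -
    have "\<pi> (c \<ominus> c') = 0" using that C(2) by (simp add: M(12) subsetD)
    then have "c \<ominus> c' \<in> U" using M(10) C'(6) that C(2) by blast
    then have "c \<ominus> c' = \<zero>" using C(3) C'(6) that by blast
    then show ?thesis using C'(7) that by (simp add: diff_eq_zero_iff)
  qed
  have lW: "l y \<in> W" for y using l C(2) by blast
  have l_add: "l (x + y) = l x \<oplus> l y" for x y
    by (rule C_inj) (use l C'(3) lW M(7) in auto)
  have l_smult: "l (fls_compose_power h p * y) = h \<odot> l y" for h y
    by (rule C_inj) (use l C'(4) lW M(8) in auto)
  \<comment> \<open>The failure of \<open>C\<close> to be stable. It is semilinear with the same \<open>a\<close>, the term with \<open>d\<close> being killed by \<open>P\<close>.\<close>
  define \<gamma> where "\<gamma> y = P (T (l y))" for y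
  have \<gamma>U: "\<gamma> y \<in> U" for y unfolding \<gamma>_def using P0(1) TW lW by blast
  have \<gamma>_add: "\<gamma> (x + y) = \<gamma> x \<oplus> \<gamma> y" for x y
    unfolding \<gamma>_def l_add using T_add W(7) lW P_add TW by simp
  have \<gamma>_smult: "\<gamma> (fls_compose_power h p * y) = a h \<odot> \<gamma> y" for h y
  proof -
    have "T (h \<odot> l y) = a h \<odot> T (l y) \<oplus> d h \<odot> l y" using T_smult W(7) lW by blast
    then have "\<gamma> (fls_compose_power h p * y) = a h \<odot> \<gamma> y \<oplus> d h \<odot> P (l y)"
      unfolding \<gamma>_def l_smult using W(4) lW TW P_add P_smult by simp
    then show ?thesis using P_C[OF l(1)] U(7)[OF \<gamma>U] by simp
  qed
  have \<gamma>0: "\<gamma> 0 = \<zero>" using \<gamma>_smult[of 0 0] by (metis F'.F_zero U(7) \<gamma>U \<gamma>_add add.l_cancel_one add_0)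
  have osubL: "P.osub {y. \<gamma> y \<in> F' 0}"
    unfolding P.osub_def using \<gamma>0 F'.F_zero F'.F_add
    by (auto simp: \<gamma>_add \<gamma>_smult intro!: osubD(4)[OF F'.F_osub] a_ord)
  have absL: "\<exists>m. fls_X_intpow m \<odot>\<^bsub>E_obj p 0\<^esub> y \<in> {y. \<gamma> y \<in> F' 0}" for y
  proof -
    obtain j where j: "\<gamma> y \<in> F' j" using F'.F_exhaustive[OF \<gamma>U] by blast
    have "\<gamma> (fls_compose_power (fls_X_intpow (- j)) p * y) \<in> F' (j + - j)"
      unfolding \<gamma>_smult by (rule F'.F_smult[OF a_ord[OF ord_ge_X_intpow] j])
    then show ?thesis by (intro exI[of _ "- j"]) (simp del: fls_compose_power_X_intpow)
  qed
  obtain m where m: "\<And>y. ord_ge (int p * m) y \<Longrightarrow> \<gamma> y \<in> F' 0"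
    using P.fg_open[OF fg_E_obj[OF M(1)] order_refl osubL absL] by auto
  have \<gamma>_bound: "\<gamma> y \<in> F' (n - m)" if y: "ord_ge (int p * n) y" for n y
  proof -
    define y' where "y' = fls_shift (int p * (n - m)) y"
    have "ord_ge (int p * m) y'" using y by (simp add: y'_def algebra_simps)
    then have "\<gamma> y' \<in> F' 0" by (rule m)
    moreover have "y = fls_compose_power (fls_X_intpow (n - m)) p * y'"
    proof -
      have "fls_compose_power (fls_X_intpow (n - m)) p = (fls_X_intpow (int p * (n - m)) :: 'k fls)"
        by (rule fls_compose_power_X_intpow) (use M(1) in simp)
      then show ?thesis
        by (simp only: fls_X_intpow_times_conv_shift y'_def) simp
    qed
    ultimately show ?thesis
      using F'.F_smult[OF a_ord[OF ord_ge_X_intpow], of "\<gamma> y'" 0 "n - m"] by (simp only: \<gamma>_smult add_0)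
  qed
  \<comment> \<open>The shift by \<open>m\<close> gives room for \<open>\<gamma>\<close>, by \<open>\<gamma>_bound\<close>.\<close>
  define F where "F n = {w \<in> W. P w \<in> F' (n - m) \<and> ord_ge (int p * n) (\<pi> w)}" for n
  have FI: "w \<in> F n" if "w \<in> W" "P w \<in> F' (n - m)" "ord_ge (int p * n) (\<pi> w)" for w n
    using that by (simp add: F_def)
  have FD: "w \<in> W" "P w \<in> F' (n - m)" "ord_ge (int p * n) (\<pi> w)" if "w \<in> F n" for w n
    using that by (simp_all add: F_def)
  have pi0: "\<pi> \<zero> = 0" using M(10)[OF W(2)] U(2) by simp
  have "filtration E W F"
  proof
    show "ksub W" by (rule M(4))
    fix n k :: int
    show "osub (F n)"
      unfolding osub_def
    proof (intro conjI ballI allI impI)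
      show "F n \<subseteq> carrier E" using W(1) by (auto simp: F_def)
      show "\<zero> \<in> F n" by (rule FI) (use W(2) P_U[OF U(2)] F'.F_zero pi0 in auto)
      show "u \<oplus> v \<in> F n" if "u \<in> F n" "v \<in> F n" for u v
        by (rule FI) (use FD[OF that(1)] FD[OF that(2)] W(3) in \<open>auto simp: P_add M(7) intro: F'.F_add ord_ge_add\<close>)
      show "h \<odot> v \<in> F n" if h: "ord_ge 0 h" and v: "v \<in> F n" for h v
      proof (rule FI)
        note v' = FD[OF v]
        show "h \<odot> v \<in> W" using W(4) v' by blast
        show "P (h \<odot> v) \<in> F' (n - m)" unfolding P_smult[OF v'(1)] by (rule osubD(4)[OF F'.F_osub h v'(2)])
        show "ord_ge (int p * n) (\<pi> (h \<odot> v))"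
          using ord_ge_mult[OF ord_ge_compose_power[OF M(1) h] v'(3)] by (simp add: M(8)[OF v'(1)])
      qed
    qed
    show "F n \<subseteq> W" by (auto simp: F_def)
    fix v assume v: "v \<in> W"
    have "P (fls_X_intpow k \<odot> v) \<in> F' (n + k - m) \<longleftrightarrow> P v \<in> F' (n - m)"
      unfolding P_smult[OF v] using F'.F_shift[OF P0(1)[OF v], of k "n - m"] by (simp add: algebra_simps)
    moreover have "ord_ge (int p * (n + k)) (\<pi> (fls_X_intpow k \<odot> v)) \<longleftrightarrow> ord_ge (int p * n) (\<pi> v)"
      unfolding M(8)[OF v] using M(1) fls_X_intpow_times_conv_shift(1)[of "int p * k" "\<pi> v"]
      by (simp add: algebra_simps)
    ultimately show "fls_X_intpow k \<odot> v \<in> F (n + k) \<longleftrightarrow> v \<in> F n"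
      using v W(4) by (simp add: F_def)
  next
    fix v assume v: "v \<in> W"
    obtain i where i: "P v \<in> F' i" using F'.F_exhaustive[OF P0(1)[OF v]] by blast
    obtain j where j: "ord_ge (int p * j) (\<pi> v)" using P.F_exhaustive by blast
    have "v \<in> F (min (i + m) j)"
    proof (rule FI[OF v])
      show "P v \<in> F' (min (i + m) j - m)" by (rule F'.F_mono[OF i]) simp
      show "ord_ge (int p * min (i + m) j) (\<pi> v)" by (rule ord_ge_mono[OF j]) (simp add: mult_left_mono)
    qed
    then show "\<exists>n. v \<in> F n" by blast
    assume all: "\<And>n. v \<in> F n"
    have "\<pi> v = \<zero>\<^bsub>E_obj p 0\<^esub>" by (rule P.F_separated) (use FD(3)[OF all] in auto)
    then have "v \<in> U" using M(10)[OF v] by simp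
    moreover have "P v = \<zero>" 
    proof (rule F'.F_separated[OF P0(1)[OF v]])
      show "P v \<in> F' n" for n using FD(2)[OF all[of "n + m"]] by simp
    qed
    ultimately show "v = \<zero>" using P_U by simp
  next
    fix t :: "nat \<Rightarrow> 'v" assume tW: "\<And>i. t i \<in> W" and t: "\<And>i. t (Suc i) \<ominus> t i \<in> F (int i)"
    have "\<exists>u\<in>U. \<forall>i. u \<ominus> P (t i) \<in> F' (int i + - m)"
    proof (rule F'.F_complete_offset)
      show "P (t i) \<in> U" for i by (rule P0(1)[OF tW])
      show "P (t (Suc i)) \<ominus> P (t i) \<in> F' (int i + - m)" for i
        using FD(2)[OF t[of i]] by (simp add: P_diff tW)
    qed
    then obtain u where u: "u \<in> U" "\<And>i. u \<ominus> P (t i) \<in> F' (int i - m)" by auto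
    have "ord_ge (0 + int p * int i) (\<pi> (t (Suc i)) - \<pi> (t i))" for i
      using FD(3)[OF t[of i]] by (simp add: M(12) tW)
    from fls_complete[OF _ this] M(1) obtain y where y: "\<And>i. ord_ge (0 + int p * int i) (y - \<pi> (t i))" by auto
    define w where "w = u \<oplus> l y"
    have uW: "u \<in> W" using u M(6) by blast
    have w: "w \<in> W" "P w = u" "\<pi> w = y"
      using uW lW W(3) P_eq[OF u(1) l(1)] M(7)[OF uW lW] M(10)[OF uW] u(1) l(2) by (simp_all add: w_def)
    have "w \<ominus> t i \<in> F (int i)" for i
      by (rule FI) (use w tW W(6) u(2) y in \<open>simp_all add: P_diff M(12)\<close>)
    then show "\<exists>w\<in>W. \<forall>i. w \<ominus> t i \<in> F (int i)" using w(1) by blast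
  qed
  moreover have c1: "v \<in> F n" if v: "v \<in> W" and Tv: "T v \<in> F n" for v n
  proof -
    note Tv' = FD[OF Tv]
    have o: "ord_ge (int p * n + int s) (\<pi> v)" using M(11)[OF v, of "int p * n + int s"] Tv'(3) by simp
    then have o': "ord_ge (int p * n) (\<pi> v)" by (rule ord_ge_mono) simp
    have "v \<ominus> P v = l (\<pi> v)" by (rule C_inj) (use diffP[OF v] l pi_P[OF v] in auto)
    moreover have PW: "P v \<in> W" "v \<in> carrier E" "P v \<in> carrier E" using P0(1)[OF v] M(6) W(7) v by auto
    ultimately have "T v = T (P v) \<oplus> T (l (\<pi> v))"
      by (metis (no_types) T_add a_comm diff_add_cancel minus_closed)
    then have "P (T v) = T (P v) \<oplus> \<gamma> (\<pi> v)"
      using P_add[of "T (P v)" "T (l (\<pi> v))"] TW PW lW P_U[of "T (P v)"] TU P0(1)[OF v] by (simp add: \<gamma>_def)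
    moreover have "\<gamma> (\<pi> v) \<in> F' (n - m)" by (rule \<gamma>_bound[OF o'])
    ultimately have "(T (P v) \<oplus> \<gamma> (\<pi> v)) \<ominus> \<gamma> (\<pi> v) \<in> F' (n - m)" using Tv'(2) F'.F_diff by metis
    then have "T (P v) \<in> F' (n - m)" using PW U(7)[OF \<gamma>U] by simp
    then have "P v \<in> F' (n - m)" using cF' P0(1)[OF v] by (simp add: contracting_def)
    then show ?thesis by (rule FI[OF v _ o'])
  qed
  have c1': "v \<in> F n" if v: "v \<in> W" and Tv: "(T ^^ k) v \<in> F n" for v n k
    using Tv
  proof (induction k)
    case (Suc k)
    then show ?case using c1[OF stable_funpow[OF M(3) v, of k]] by simp
  qed simp
  have ordpow: "ord_ge (n + int k * int s) (\<pi> v) \<longleftrightarrow> ord_ge n (\<pi> ((T ^^ k) v))" if v: "v \<in> W" for v n k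
  proof (induction k arbitrary: n)
    case (Suc k)
    have "ord_ge (n + int (Suc k) * int s) (\<pi> v) \<longleftrightarrow> ord_ge ((n + int s) + int k * int s) (\<pi> v)"
      by (simp add: algebra_simps)
    then show ?case using Suc[of "n + int s"] M(11)[OF stable_funpow[OF M(3) v, of k], of "n + int s"] by simp
  qed simp
  have "v \<in> F (n + 1)" if v: "v \<in> W" and Tv: "(T ^^ (p + N')) v \<in> F n" for v n
  proof -
    define w where "w = (T ^^ N') v"
    have w: "w \<in> W" unfolding w_def by (rule stable_funpow[OF M(3) v])
    have Tw: "(T ^^ p) w \<in> F n" using Tv by (simp add: w_def funpow_add)
    have wF: "w \<in> F n" by (rule c1'[OF w Tw])
    have "ord_ge (int p * n + int p * int s) (\<pi> w)" using ordpow[OF w] FD(3)[OF Tw] by simp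
    moreover have "int p * (n + 1) \<le> int p * n + int p * int s" using M(2) by (simp add: algebra_simps mult_le_cancel_left1)
    ultimately have ow: "ord_ge (int p * (n + 1)) (\<pi> w)" by (rule ord_ge_mono)
    \<comment> \<open>\<open>v\<close> is compared with a vector of \<open>U\<close> that has the same image under \<open>T^N'\<close> up to \<open>C\<close>.\<close>
    obtain u where u: "u \<in> U" "(T ^^ N') u = P w"
      using shift_filtered_funpow_surj[OF step.hyps(1) P0(1)[OF w]] by blast
    have uW: "u \<in> W" using u M(6) by blast
    have "(T ^^ N') u \<in> F' (n - m)" using FD(2)[OF wF] u(2) by simp
    then have uF: "u \<in> F' (n - m + 1)" using cF' u(1) by (simp add: contracting_def)
    have uF: "u \<in> F (n + 1)"
    proof (rule FI[OF uW])
      show "P u \<in> F' (n + 1 - m)" using uF P_U[OF u(1)] by (simp add: algebra_simps)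
      show "ord_ge (int p * (n + 1)) (\<pi> u)" using M(10)[OF uW] u(1) by simp
    qed
    have "(T ^^ N') (v \<ominus> u) = w \<ominus> P w"
      using funpow_T_linear(2)[of v u N'] W(7) v uW u(2) by (simp add: w_def)
    moreover have "w \<ominus> P w \<in> F (n + 1)"
    proof (rule FI)
      show "w \<ominus> P w \<in> W" using diffP[OF w] C(2) by blast
      show "P (w \<ominus> P w) \<in> F' (n + 1 - m)" using P_C[OF diffP[OF w]] F'.F_zero by simp
      show "ord_ge (int p * (n + 1)) (\<pi> (w \<ominus> P w))" using ow pi_P[OF w] by simp
    qed
    ultimately have vu: "v \<ominus> u \<in> F (n + 1)" using c1'[OF W(6)[OF v uW]] by metis
    have "P v \<in> F' (n + 1 - m)" 
      using F'.F_add[OF FD(2)[OF vu] FD(2)[OF uF]] P_diff[OF v uW] U(7) P0(1)[OF v] P0(1)[OF uW] by simp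
    moreover have "ord_ge (int p * (n + 1)) (\<pi> v)"
      using ord_ge_add[OF FD(3)[OF vu] FD(3)[OF uF]] M(12)[OF v uW] by simp
    ultimately show ?thesis by (rule FI[OF v])
  qed
  ultimately have "contracting W F (p + N')" unfolding contracting_def using c1 by blast
  then show ?case by blast
qed

end

section \<open>Two comparable topologies\<close>

text \<open>The values of a continuous \<open>e\<close> are limits of its values on the partial sums of the series \<open>h\<close>.\<close>

lemma (in fls_space) approximation:
  assumes S: "S \<subseteq> carrier E" "\<zero> \<in> S" "\<And>u v. u \<in> S \<Longrightarrow> v \<in> S \<Longrightarrow> u \<oplus> v \<in> S"
    and e: "\<And>h. e h \<in> carrier E" "\<And>g h. e (g + h) = e g \<oplus> e h"
      "\<And>b h. e (fls_const b * h) = fls_const b \<odot> e h"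
    and mono: "\<And>b n. fls_const b \<odot> e (fls_X_intpow n) \<in> S"
    and cont: "\<And>n h. ord_ge n h \<Longrightarrow> e h \<in> Fl (n + (c::int))"
    and anti: "\<And>m n v. m \<le> n \<Longrightarrow> v \<in> Fl n \<Longrightarrow> v \<in> Fl m"
  shows "\<exists>s\<in>S. e (h :: 'k fls) \<ominus> s \<in> Fl m"
proof -
  have "\<exists>s\<in>S. e h \<ominus> s \<in> Fl (n + int j + c)" if "ord_ge n h" for n h j
    using that
  proof (induction j arbitrary: n h)
    case 0
    show ?case using cont[OF 0] e(1)[of h] S(2) by (intro bexI[of _ \<zero>]) simp_all
  next
    case (Suc j)
    define h' where "h' = h - fls_const (h $$ n) * fls_X_intpow n"
    define r where "r = fls_const (h $$ n) \<odot> e (fls_X_intpow n)"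
    have r: "r \<in> S" unfolding r_def by (rule mono)
    have "h = h' + fls_const (h $$ n) * fls_X_intpow n" by (simp add: h'_def)
    then have eh: "e h = e h' \<oplus> r" unfolding r_def using e(2,3) by metis
    obtain s where s: "s \<in> S" "e h' \<ominus> s \<in> Fl (n + 1 + int j + c)"
      using Suc.IH[OF ord_ge_remove_leading[OF Suc.prems]] unfolding h'_def by blast
    have "e h \<ominus> (s \<oplus> r) = e h' \<ominus> s"
      using e(1)[of h'] S(1) s(1) r by (simp add: eh add_diff_add subset_iff)
    then show ?case using s S(3)[OF s(1) r] by (intro bexI[of _ "s \<oplus> r"]) (simp_all add: add_ac)
  qed
  from this[OF ord_ge_subdegree, of h "nat (m - fls_subdegree h - c)"]
  obtain s where "s \<in> S" "e h \<ominus> s \<in> Fl (fls_subdegree h + int (nat (m - fls_subdegree h - c)) + c)" by blast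
  moreover have "m \<le> fls_subdegree h + int (nat (m - fls_subdegree h - c)) + c" by linarith
  ultimately show ?thesis using anti by blast
qed

text \<open>\<open>theta_smult\<close> with an arbitrary family \<open>P n\<close> in place of the powers of \<open>\<theta>\<close>, so that it also
  describes the inverse transform.\<close>

definition series_smult ::
  "('k::field_char_0 fls, 'v) op_module \<Rightarrow> (int \<Rightarrow> 'v \<Rightarrow> 'v) \<Rightarrow> 'k fls \<Rightarrow> 'v \<Rightarrow> 'v" where
  "series_smult E P h v = (THE w. zeta_adic_lim E
     (\<lambda>N. \<Oplus>\<^bsub>E\<^esub> n \<in> {fls_subdegree h..int N}. fls_const (fls_nth h n) \<odot>\<^bsub>E\<^esub> P n v) w)"

text \<open>\<open>P n\<close> is \<open>T^(- n)\<close>, the \<open>n\<close>-th power of the new variable. It is a parameter so that \<open>theta_power\<close> can be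
  substituted for it, whose values outside the carrier are unspecified.\<close>

locale mellin_pair = semilinear_space E T a d
  for E :: "('k::field_char_0 fls, 'v) op_module" (structure) and T a d +
  fixes P :: "int \<Rightarrow> 'v \<Rightarrow> 'v" and F :: "int \<Rightarrow> 'v set" and N :: nat
  assumes shift_filtered_carrier: "shift_filtered (carrier E)"
    and contracting: "contracting (carrier E) F N"
    and P_0: "v \<in> carrier E \<Longrightarrow> P 0 v = v"
    and P_closed [simp]: "v \<in> carrier E \<Longrightarrow> P n v \<in> carrier E"
    and T_P: "v \<in> carrier E \<Longrightarrow> T (P (n + 1) v) = P n v"

sublocale mellin_pair \<subseteq> filtration E "carrier E" F
  using contracting by (simp add: contracting_def)

context mellin_pair
begin

lemma T_inj: "u \<in> carrier E \<Longrightarrow> v \<in> carrier E \<Longrightarrow> T u = T v \<Longrightarrow> u = v"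
  using shift_filtered_inj[OF shift_filtered_carrier, of "u \<ominus> v"] by (simp add: T_diff diff_eq_zero_iff)

lemma P_T: assumes "v \<in> carrier E" shows "P n (T v) = P (n - 1) v"
proof -
  have u: "P (n - 1 + 1) (T v) = P (n - 1) v" for n
  proof (induction n rule: int_induct[where k = 0])
    case base
    have "P (- 1) v = T (P (- 1 + 1) v)" by (rule T_P[symmetric]) (rule assms)
    then show ?case using assms by (simp add: P_0)
  next
    case (step1 i)
    have "T (P (i + 1) (T v)) = P i (T v)" using assms by (intro T_P) simp
    also have "\<dots> = P (i - 1) v" using step1 by simp
    also have "\<dots> = T (P (i - 1 + 1) v)" by (rule T_P[symmetric]) (rule assms)
    finally have "T (P (i + 1) (T v)) = T (P i v)" by simp
    then have "P (i + 1) (T v) = P i v" by (rule T_inj[rotated 2]) (simp_all add: assms)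
    then show ?case by simp
  next
    case (step2 i)
    have "P (i - 1) (T v) = T (P (i - 1 + 1) (T v))" using assms by (intro T_P[symmetric]) simp
    also have "\<dots> = T (P (i - 1) v)" using step2 by simp
    also have "\<dots> = T (P (i - 2 + 1) v)" by simp
    also have "\<dots> = P (i - 2) v" by (rule T_P) (rule assms)
    finally show ?case by simp
  qed
  show ?thesis using u[of n] by simp
qed

lemma P_P: assumes "v \<in> carrier E" shows "P m (P n v) = P (m + n) v"
proof -
  have *: "P m (P (int k) w) = P (m + int k) w" if "w \<in> carrier E" for w k m
  proof (induction k arbitrary: m)
    case 0
    then show ?case using that by (simp add: P_0)
  next
    case (Suc k)
    have "P (m + 1) (T (P (int k + 1) w)) = P m (P (int k + 1) w)"
      using P_T[of "P (int k + 1) w" "m + 1"] that by simp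
    then have "P m (P (int k + 1) w) = P (m + 1) (P (int k) w)" using T_P[OF that, of "int k"] by simp
    then show ?case using Suc[of "m + 1"] by (simp add: algebra_simps)
  qed
  show ?thesis
  proof (cases "n \<ge> 0")
    case True
    then show ?thesis using *[OF assms, of m "nat n"] by simp
  next
    case False
    have v: "v = P (int (nat (- n))) (P n v)"
    proof -
      have k: "P (int k) (P (- int k) v) = v" for k
      proof (induction k)
        case (Suc k)
        have "P (- int k - 1) v = T (P (- int k) v)"
          using T_P[of v "- int k - 1"] assms by simp
        then have "P (int k + 1) (P (- int k - 1) v) = P (int k) (P (- int k) v)"
          using P_T[of "P (- int k) v" "int k + 1"] assms by simp
        moreover have "- int (Suc k) = - int k - 1" "int (Suc k) = int k + 1" by simp_all
        ultimately show ?case using Suc by metis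
      qed (simp add: P_0 assms)
      show ?thesis using k[of "nat (- n)"] False by simp
    qed
    have "P (m + n) v = P (m + n) (P (int (nat (- n))) (P n v))" using v by simp
    also have "\<dots> = P (m + n + int (nat (- n))) (P n v)" by (rule *) (simp add: assms)
    finally show ?thesis using False by simp
  qed
qed

lemma P_neg: "v \<in> carrier E \<Longrightarrow> P (- int k) v = (T ^^ k) v"
proof (induction k)
  case (Suc k)
  have "P (- int k - 1) v = T (P (- int k) v)" using T_P[of v "- int k - 1"] Suc.prems by simp
  then have "P (- int k - 1) v = (T ^^ Suc k) v" using Suc by simp
  moreover have e: "- int (Suc k) = - int k - 1" by simp
  ultimately show ?case unfolding e by simp
qed (simp add: P_0)

lemma P_add: assumes "u \<in> carrier E" "v \<in> carrier E" shows "P n (u \<oplus> v) = P n u \<oplus> P n v"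
proof (induction n rule: int_induct[where k = 0])
  case base
  then show ?case using assms by (simp add: P_0)
next
  case (step1 i)
  have "T (P (i + 1) (u \<oplus> v)) = T (P (i + 1) u \<oplus> P (i + 1) v)"
    using assms step1 by (simp add: T_P T_add)
  then show ?case by (rule T_inj[rotated 2]) (simp_all add: assms)
next
  case (step2 i)
  have "P (i - 1) w = T (P i w)" if "w \<in> carrier E" for w using T_P[OF that, of "i - 1"] by simp
  then show ?case using assms step2 by (simp add: T_add)
qed

lemma P_const: assumes "v \<in> carrier E" shows "P n (fls_const c \<odot> v) = fls_const c \<odot> P n v"
proof (induction n rule: int_induct[where k = 0])
  case base
  then show ?case using assms by (simp add: P_0)
next
  case (step1 i)
  have "T (P (i + 1) (fls_const c \<odot> v)) = T (fls_const c \<odot> P (i + 1) v)"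
    using assms step1 by (simp add: T_P T_const)
  then show ?case by (rule T_inj[rotated 2]) (simp_all add: assms)
next
  case (step2 i)
  have "P (i - 1) w = T (P i w)" if "w \<in> carrier E" for w using T_P[OF that, of "i - 1"] by simp
  then show ?case using assms step2 by (simp add: T_const)
qed

lemma P_zero [simp]: "P n \<zero> = \<zero>"
  using P_const[of \<zero> n 0] by simp

lemma P_diff: assumes "u \<in> carrier E" "v \<in> carrier E" shows "P n (u \<ominus> v) = P n u \<ominus> P n v"
proof -
  have "P n (u \<ominus> v) \<oplus> P n v = P n u" using P_add[of "u \<ominus> v" v n] assms by simp
  then show ?thesis using assms by (metis P_closed add_diff_cancel minus_closed)
qed

text \<open>The filtration by powers of the new variable: \<open>G n\<close> is the image of \<open>F 0\<close> under \<open>P n\<close>.\<close>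

definition G :: "int \<Rightarrow> 'v set" where
  "G n = {v \<in> carrier E. P (- n) v \<in> F 0}"

lemma G_carrier: "v \<in> G n \<Longrightarrow> v \<in> carrier E" by (simp add: G_def)

lemma G_P: "v \<in> carrier E \<Longrightarrow> P m v \<in> G (n + m) \<longleftrightarrow> v \<in> G n"
  by (simp add: G_def P_P)

lemma G_zero: "\<zero> \<in> G n" by (simp add: G_def F_zero)

lemma G_add: "u \<in> G n \<Longrightarrow> v \<in> G n \<Longrightarrow> u \<oplus> v \<in> G n"
  by (simp add: G_def P_add F_add)

lemma G_const: "v \<in> G n \<Longrightarrow> fls_const c \<odot> v \<in> G n"
  by (simp add: G_def P_const osubD(4)[OF F_osub])

lemma G_diff: "u \<in> G n \<Longrightarrow> v \<in> G n \<Longrightarrow> u \<ominus> v \<in> G n"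
  by (simp add: G_def P_diff F_diff)

lemma T_F: "v \<in> carrier E \<Longrightarrow> T v \<in> F n \<Longrightarrow> v \<in> F n"
  using contracting by (simp add: contracting_def)

lemma G_Suc: "v \<in> G (n + 1) \<Longrightarrow> v \<in> G n"
  using T_P[of v "- n - 1"] by (auto simp: G_def intro: T_F)

lemma G_mono: assumes "v \<in> G n" "m \<le> n" shows "v \<in> G m"
proof -
  have "v \<in> G (n - int k)" for k
  proof (induction k)
    case (Suc k)
    then show ?case using G_Suc[of v "n - int (Suc k)"] by simp
  qed (use assms in simp)
  from this[of "nat (n - m)"] show ?thesis using assms by simp
qed

text \<open>The exponent \<open>Suc N\<close> instead of \<open>N\<close> is never zero, so that it may serve as a factor.\<close>

lemma TN_F: "v \<in> carrier E \<Longrightarrow> (T ^^ (Suc N)) v \<in> F n \<Longrightarrow> v \<in> F (n + 1)"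
proof -
  assume v: "v \<in> carrier E" "(T ^^ (Suc N)) v \<in> F n"
  have "(T ^^ (Suc N)) v = (T ^^ N) (T v)" by (simp add: funpow_swap1)
  then have "T v \<in> F (n + 1)" using contracting v by (simp add: contracting_def)
  then show ?thesis using T_F v by blast
qed

lemma TNj_F: "v \<in> carrier E \<Longrightarrow> (T ^^ (Suc N * j)) v \<in> F n \<Longrightarrow> v \<in> F (n + int j)"
proof (induction j arbitrary: v)
  case (Suc j)
  have "(T ^^ (Suc N * j)) ((T ^^ (Suc N)) v) \<in> F n"
    using Suc.prems(2) by (simp only: mult_Suc_right add.commute[of "Suc N"] funpow_add o_apply)
  from Suc.IH[OF _ this] have "(T ^^ (Suc N)) v \<in> F (n + int j)"
    using funpow_T_linear(1) Suc.prems(1) by blast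
  from TN_F[OF Suc.prems(1) this] show ?case by (simp add: add_ac)
qed simp

lemma G_F: assumes "v \<in> G (int (Suc N * j))" shows "v \<in> F (int j)"
proof -
  have v: "v \<in> carrier E" "(T ^^ (Suc N * j)) v \<in> F 0" using assms P_neg[of v "Suc N * j"] by (auto simp: G_def)
  from TNj_F[OF this] show ?thesis by simp
qed

lemma G_exhaustive: assumes "v \<in> carrier E" shows "\<exists>n. v \<in> G n"
proof -
  obtain i where i: "v \<in> F i" using F_exhaustive assms by blast
  define j where "j = nat (- i)"
  define w where "w = P (int (Suc N * j)) v"
  have w: "w \<in> carrier E" using assms by (simp add: w_def)
  have "(T ^^ (Suc N * j)) w = v" using P_neg[OF w, of "Suc N * j"] assms by (simp add: w_def P_P P_0)
  moreover have "v \<in> F (- int j)" by (rule F_mono[OF i]) (simp add: j_def)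
  ultimately have "w \<in> F (- int j + int j)" using TNj_F[OF w] by metis
  then have "v \<in> G (- int (Suc N * j))" using assms
    by (simp only: w_def group_add_class.minus_minus mem_Collect_eq G_def add.left_inverse simp_thms)
  then show ?thesis by blast
qed

text \<open>This inclusion and \<open>F_in_G\<close> below say that the two filtrations define the same topology.\<close>

lemma G_in_F: "\<exists>n. G n \<subseteq> F m"
proof -
  have "v \<in> F m" if "v \<in> G (int (Suc N * nat m))" for v
    using F_mono[OF G_F[OF that], of m] by simp
  then show ?thesis by blast
qed

text \<open>The vectors of \<open>F 0\<close> that \<open>T\<close> maps to \<open>F 0\<close> form an absorbing module over the power series,
  hence an open one.\<close>

lemma T_bounded: "\<exists>k::nat. \<forall>n. \<forall>v\<in>F (n + int k). T v \<in> F n"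
proof -
  define L where "L = {v \<in> F 0. T v \<in> F 0}"
  have "osub L"
    unfolding osub_def
  proof (intro conjI ballI allI impI)
    show "L \<subseteq> carrier E" using F_carrier by (auto simp: L_def)
    show "\<zero> \<in> L" by (simp add: L_def F_zero)
    show "u \<oplus> v \<in> L" if "u \<in> L" "v \<in> L" for u v
      using that F_carrier by (auto simp: L_def T_add intro!: F_add)
    show "h \<odot> v \<in> L" if "ord_ge 0 h" "v \<in> L" for h v
    proof -
      have v: "v \<in> F 0" "T v \<in> F 0" using that(2) by (auto simp: L_def)
      have "a h \<odot> T v \<oplus> d h \<odot> v \<in> F 0"
        using F_smult[OF a_ord[OF that(1)] v(2)] F_smult[OF d_ord[OF that(1)] v(1)] by (simp add: F_add)
      then show ?thesis using osubD(4)[OF F_osub that(1) v(1)] F_carrier[OF v(1)] by (simp add: L_def T_smult)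
    qed
  qed
  moreover have "\<exists>m. fls_X_intpow m \<odot> v \<in> L" if v: "v \<in> carrier E" for v
  proof -
    obtain i j where ij: "v \<in> F i" "T v \<in> F j" using F_exhaustive v T_closed by meson
    define m where "m = max (- i) (- j)"
    have 1: "fls_X_intpow m \<odot> v \<in> F 0"
      by (rule F_mono[OF F_smult[OF ord_ge_X_intpow ij(1)]]) (simp add: m_def)
    have 2: "a (fls_X_intpow m) \<odot> T v \<in> F 0"
      by (rule F_mono[OF F_smult[OF a_ord[OF ord_ge_X_intpow] ij(2)]]) (simp add: m_def)
    have 3: "d (fls_X_intpow m) \<odot> v \<in> F 0"
      by (rule F_mono[OF F_smult[OF d_ord[OF ord_ge_X_intpow] ij(1)]]) (simp add: m_def)
    have "fls_X_intpow m \<odot> v \<in> L" using 1 F_add[OF 2 3] v by (simp add: L_def T_smult)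
    then show ?thesis by blast
  qed
  ultimately obtain m where m: "\<And>v. v \<in> carrier E \<Longrightarrow> v \<in> F m \<Longrightarrow> v \<in> L"
    using fg_open[OF fg_carrier order_refl] by metis
  have "T v \<in> F n" if v: "v \<in> F (n + int (nat m))" for n v
  proof -
    have vm: "v \<in> F (n + m)" by (rule F_mono[OF v]) simp
    have vc: "v \<in> carrier E" by (rule F_carrier[OF v])
    define v' where "v' = fls_X_intpow (- n) \<odot> v"
    have "v' \<in> F m" using F_smult[OF ord_ge_X_intpow vm, of "- n"] by (simp add: v'_def)
    then have v': "v' \<in> F 0" "T v' \<in> F 0" using m[OF F_carrier] by (auto simp: L_def)
    have "fls_X_intpow n * fls_X_intpow (- n) = (1 :: 'k fls)"
      by (simp only: fls_X_intpow_times_conv_shift fls_shift_fls_shift) simp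
    then have "v = fls_X_intpow n \<odot> v'" using vc by (simp only: v'_def smult_smult smult_one)
    then have "T v = a (fls_X_intpow n) \<odot> T v' \<oplus> d (fls_X_intpow n) \<odot> v'"
      using F_carrier[OF v'(1)] by (simp add: T_smult)
    then show ?thesis
      using F_smult[OF a_ord[OF ord_ge_X_intpow] v'(2), of n] F_smult[OF d_ord[OF ord_ge_X_intpow] v'(1), of n]
      by (simp add: F_add)
  qed
  then show ?thesis by blast
qed

lemma F_in_G: "\<exists>m. F m \<subseteq> G n"
proof -
  obtain k :: nat where k: "\<And>n v. v \<in> F (n + int k) \<Longrightarrow> T v \<in> F n" using T_bounded by blast
  have "(T ^^ j) v \<in> F m" if "v \<in> F (m + int (k * j))" for j v m
    using that
  proof (induction j arbitrary: m)
    case (Suc j)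
    then have "(T ^^ j) v \<in> F (m + int k)" using Suc.IH[of "m + int k"] by (simp add: algebra_simps)
    from k[OF this] show ?case by simp
  qed simp
  from this[of _ 0] have GI: "v \<in> G (int j)" if "v \<in> F (int (k * j))" for j v
    using that F_carrier[OF that] by (simp add: G_def P_neg)
  have "v \<in> G n" if "v \<in> F (int (k * nat n))" for v
    by (rule G_mono[OF GI[OF that]]) simp
  then show ?thesis by blast
qed

end

section \<open>The new scalar multiplication\<close>

lemma (in fls_space) finsum_smult:
  assumes "finite A" "f \<in> A \<rightarrow> carrier E"
  shows "h \<odot> finsum E f A = finsum E (\<lambda>i. h \<odot> f i) A"
  using assms
  by (induction A rule: finite_induct) (auto simp: smult_add_right Pi_def)

context mellin_pair
begin

definition converges :: "(nat \<Rightarrow> 'v) \<Rightarrow> 'v \<Rightarrow> bool" where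
  "converges s w \<longleftrightarrow> w \<in> carrier E \<and> (\<forall>n. \<forall>\<^sub>F N in sequentially. s N \<in> carrier E \<and> s N \<ominus> w \<in> F n)"

lemma zeta_adic_lim_eq: "zeta_adic_lim E = converges"
  using zeta_adic_lim_iff[OF filtration_axioms fg_carrier] by (simp add: fun_eq_iff converges_def)

lemma separated: "v \<in> carrier E \<Longrightarrow> (\<And>n. v \<in> G n) \<Longrightarrow> v = \<zero>"
  using F_separated G_in_F by blast

lemma converges_unique: assumes "converges s w" "converges s w'" shows "w = w'"
proof -
  have w: "w \<in> carrier E" "w' \<in> carrier E" using assms by (auto simp: converges_def)
  have "w \<ominus> w' \<in> F n" for n
  proof -
    have "\<forall>\<^sub>F N in sequentially. s N \<in> carrier E \<and> s N \<ominus> w \<in> F n \<and> s N \<ominus> w' \<in> F n"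
      using assms by (auto simp: converges_def eventually_conj_iff)
    then obtain N' where N': "s N' \<in> carrier E" "s N' \<ominus> w \<in> F n" "s N' \<ominus> w' \<in> F n"
      by (auto simp: eventually_sequentially)
    then have "(s N' \<ominus> w') \<ominus> (s N' \<ominus> w) \<in> F n" by (rule_tac F_diff)
    then show ?thesis using N'(1) w by (simp add: diff_diff_left)
  qed
  then show ?thesis using w F_separated[of "w \<ominus> w'"] by (simp add: diff_eq_zero_iff)
qed

lemma converges_add:
  assumes "converges s w" "converges t x"
  shows "converges (\<lambda>N. s N \<oplus> t N) (w \<oplus> x)"
  unfolding converges_def
proof (intro conjI allI)
  show "w \<oplus> x \<in> carrier E" using assms by (simp add: converges_def)
  fix n
  have "\<forall>\<^sub>F N in sequentially. s N \<in> carrier E \<and> s N \<ominus> w \<in> F n \<and> t N \<in> carrier E \<and> t N \<ominus> x \<in> F n"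
    using assms by (auto simp: converges_def eventually_conj_iff)
  then show "\<forall>\<^sub>F N in sequentially. s N \<oplus> t N \<in> carrier E \<and> (s N \<oplus> t N) \<ominus> (w \<oplus> x) \<in> F n"
    by (rule eventually_mono) (use assms in \<open>auto simp: converges_def add_diff_add F_add\<close>)
qed

lemma converges_const:
  assumes "converges s w"
  shows "converges (\<lambda>N. fls_const c \<odot> s N) (fls_const c \<odot> w)"
  unfolding converges_def
proof (intro conjI allI)
  show "fls_const c \<odot> w \<in> carrier E" using assms by (simp add: converges_def)
  fix n
  have "\<forall>\<^sub>F N in sequentially. s N \<in> carrier E \<and> s N \<ominus> w \<in> F n" using assms by (simp add: converges_def)
  then show "\<forall>\<^sub>F N in sequentially. fls_const c \<odot> s N \<in> carrier E \<and> fls_const c \<odot> s N \<ominus> fls_const c \<odot> w \<in> F n"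
    by (rule eventually_mono)
      (use assms in \<open>auto simp: converges_def osubD(4)[OF F_osub] simp flip: smult_diff_right\<close>)
qed

lemma converges_G:
  assumes "converges s w" "\<And>N. s N \<in> G n"
  shows "w \<in> G n"
proof -
  obtain m where m: "F m \<subseteq> G n" using F_in_G by blast
  have w: "w \<in> carrier E" using assms(1) by (simp add: converges_def)
  have "\<forall>\<^sub>F N in sequentially. s N \<ominus> w \<in> F m" using assms(1) by (auto simp: converges_def eventually_conj_iff)
  then obtain N' where "s N' \<ominus> w \<in> F m" by (auto simp: eventually_sequentially)
  then have "s N' \<ominus> w \<in> G n" using m by blast
  then have "s N' \<ominus> (s N' \<ominus> w) \<in> G n" by (rule G_diff[OF assms(2)])
  moreover have "s N' \<ominus> (s N' \<ominus> w) = w"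
    using G_carrier[OF assms(2)[of N']] w diff_diff_left[of "s N'" \<zero> w] by simp
  ultimately show ?thesis by simp
qed

lemma G_complete:
  assumes s: "\<And>i::nat. s i \<in> carrier E" "\<And>i. s (Suc i) \<ominus> s i \<in> G (int i + c)"
  shows "\<exists>w\<in>carrier E. \<forall>i. w \<ominus> s i \<in> G (int i + c)"
proof -
  have tele: "s (i + j) \<ominus> s i \<in> G (int i + c)" for i j
  proof (induction j)
    case (Suc j)
    have "s (Suc (i + j)) \<ominus> s (i + j) \<in> G (int i + c)" by (rule G_mono[OF s(2)]) simp
    from G_add[OF this Suc] show ?case using s(1) by (simp add: diff_add_diff)
  qed (simp add: s G_zero)
  \<comment> \<open>A subsequence sparse enough to be Cauchy for \<open>F\<close>, which loses a factor \<open>Suc N\<close> against \<open>G\<close>.\<close>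
  define o' where "o' = nat (- c)"
  define r where "r i = s (Suc N * i + o')" for i
  have r: "r (Suc i) \<ominus> r i \<in> F (int i)" for i
  proof (rule G_F, rule G_mono)
    have "Suc N * Suc i + o' = (Suc N * i + o') + Suc N" by simp
    then show "r (Suc i) \<ominus> r i \<in> G (int (Suc N * i + o') + c)"
      unfolding r_def by (metis tele)
    show "int (Suc N * i) \<le> int (Suc N * i + o') + c" by (simp add: o'_def)
  qed
  obtain w where w: "w \<in> carrier E" "\<And>i. w \<ominus> r i \<in> F (int i)"
    using F_complete[of r] r s(1) by (auto simp: r_def)
  have "w \<ominus> s i \<in> G (int i + c)" for i
  proof -
    obtain m where m: "F m \<subseteq> G (int i + c)" using F_in_G by blast
    define l where "l = max (nat m) i"
    have "w \<ominus> r l \<in> F m" by (rule F_mono[OF w(2)]) (simp add: l_def)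
    moreover have "r l \<ominus> s i \<in> G (int i + c)"
    proof -
      have "i \<le> Suc N * l + o'" by (simp add: l_def trans_le_add1)
      then obtain j where "Suc N * l + o' = i + j" using le_Suc_ex by blast
      then show ?thesis unfolding r_def using tele by metis
    qed
    ultimately have "(w \<ominus> r l) \<oplus> (r l \<ominus> s i) \<in> G (int i + c)" using m by (intro G_add) auto
    then show ?thesis using w(1) s(1) by (simp add: r_def diff_add_diff)
  qed
  then show ?thesis using w(1) by blast
qed

definition psum :: "'k fls \<Rightarrow> 'v \<Rightarrow> int \<Rightarrow> int \<Rightarrow> 'v" where
  "psum h v A B = (\<Oplus>n\<in>{A..B}. fls_const (h $$ n) \<odot> P n v)"

lemma psum_closed [simp]: "v \<in> carrier E \<Longrightarrow> psum h v A B \<in> carrier E"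
  unfolding psum_def by (intro finsum_closed) auto

lemma psum_drop: assumes "v \<in> carrier E" "h $$ A = 0" shows "psum h v A B = psum h v (A + 1) B"
proof (cases "A \<le> B")
  case True
  then have "{A..B} = insert A {A+1..B}" by auto
  then show ?thesis using assms by (simp add: psum_def Pi_def)
qed (simp add: psum_def)

lemma psum_window: assumes v: "v \<in> carrier E" and "ord_ge A h" "C \<le> A" shows "psum h v C B = psum h v A B"
proof -
  have "psum h v (A - int k) B = psum h v A B" for k
  proof (induction k)
    case (Suc k)
    have "psum h v (A - int (Suc k)) B = psum h v (A - int (Suc k) + 1) B"
      by (rule psum_drop[OF v]) (rule ord_geD[OF assms(2)], simp)
    then show ?case using Suc by simp
  qed simp
  from this[of "nat (A - C)"] show ?thesis using assms by simp
qed

lemma psum_step: assumes "v \<in> carrier E" "A \<le> B + 1"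
  shows "psum h v A (B + 1) = fls_const (h $$ (B + 1)) \<odot> P (B + 1) v \<oplus> psum h v A B"
proof -
  have "{A..B+1} = insert (B + 1) {A..B}" using assms by auto
  then show ?thesis using assms by (simp add: psum_def Pi_def)
qed

lemma psum_add: "v \<in> carrier E \<Longrightarrow> psum (g + h) v A B = psum g v A B \<oplus> psum h v A B"
  unfolding psum_def
  by (subst finsum_addf[symmetric]) (auto simp: smult_add_left simp flip: fls_plus_const intro!: finsum_cong')

lemma psum_const: "v \<in> carrier E \<Longrightarrow> psum (fls_const c * h) v A B = fls_const c \<odot> psum h v A B"
  unfolding psum_def
  by (subst finsum_smult)
    (auto simp: smult_smult fls_mult_const_nth simp flip: fls_const_mult_const intro!: finsum_cong')

lemma psum_G: assumes "v \<in> G j" "ord_ge n h" shows "psum h v A B \<in> G (n + j)"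
proof -
  have v: "v \<in> carrier E" by (rule G_carrier[OF assms(1)])
  have t: "fls_const (h $$ i) \<odot> P i v \<in> G (n + j)" for i
  proof (cases "i < n")
    case True
    then show ?thesis using ord_geD[OF assms(2) True] v G_zero by simp
  next
    case False
    have "P i v \<in> G (j + i)" using G_P[OF v] assms(1) by blast
    then have "P i v \<in> G (n + j)" by (rule G_mono) (use False in simp)
    then show ?thesis by (rule G_const)
  qed
  have "finsum E (\<lambda>i. fls_const (h $$ i) \<odot> P i v) I \<in> G (n + j)" if "finite I" for I
    using that
  proof (induction I rule: finite_induct)
    case (insert i I)
    then show ?case using G_add[OF t insert.IH] v by (simp add: Pi_def)
  qed (simp add: G_zero)
  then show ?thesis by (simp add: psum_def)
qed

definition act :: "'k fls \<Rightarrow> 'v \<Rightarrow> 'v" where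
  "act = series_smult E P"

lemma act_converges':
  assumes v: "v \<in> carrier E"
  shows "converges (\<lambda>N. psum h v (fls_subdegree h) (int N)) (act h v)"
proof -
  define A where "A = fls_subdegree h"
  obtain j where j: "v \<in> G j" using G_exhaustive[OF v] by blast
  define s where "s i = psum h v A (A + int i)" for i
  have "\<exists>w\<in>carrier E. \<forall>i. w \<ominus> s i \<in> G (int i + (A + j))"
  proof (rule G_complete)
    show "s i \<in> carrier E" for i using v by (simp add: s_def)
    fix i
    have "P (A + int i + 1) v \<in> G (j + (A + int i + 1))" using G_P[OF v] j by blast
    then have "P (A + int i + 1) v \<in> G (int i + (A + j))" by (rule G_mono) simp
    then have "fls_const (h $$ (A + int i + 1)) \<odot> P (A + int i + 1) v \<in> G (int i + (A + j))" by (rule G_const)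
    moreover have "s (Suc i) = fls_const (h $$ (A + int i + 1)) \<odot> P (A + int i + 1) v \<oplus> s i"
      using psum_step[OF v, of A "A + int i" h] by (simp add: s_def algebra_simps)
    ultimately show "s (Suc i) \<ominus> s i \<in> G (int i + (A + j))"
      using v by (simp add: s_def)
  qed
  then obtain w where w: "w \<in> carrier E" "\<And>i. w \<ominus> s i \<in> G (int i + (A + j))" by blast
  have c: "converges (\<lambda>N. psum h v A (int N)) w"
    unfolding converges_def
  proof (intro conjI allI)
    fix n
    obtain m where m: "G m \<subseteq> F n" using G_in_F by blast
    show "\<forall>\<^sub>F N in sequentially. psum h v A (int N) \<in> carrier E \<and> psum h v A (int N) \<ominus> w \<in> F n"
      unfolding eventually_sequentially
    proof (intro exI[of _ "nat (max A (m - j))"] allI impI conjI)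
      fix N' assume N': "nat (max A (m - j)) \<le> N'"
      show "psum h v A (int N') \<in> carrier E" using v by simp
      define i where "i = nat (int N' - A)"
      have i: "A + int i = int N'" using N' by (simp add: i_def)
      have "w \<ominus> s i \<in> G m" by (rule G_mono[OF w(2)]) (use N' i in linarith)
      then have "w \<ominus> s i \<in> F n" using m by blast
      then have "\<ominus> (w \<ominus> s i) \<in> F n" by (rule F_minus)
      then show "psum h v A (int N') \<ominus> w \<in> F n"
        using w(1) v by (simp add: s_def i minus_diff)
    qed
  qed (rule w(1))
  have "act h v = w"
    unfolding act_def series_smult_def zeta_adic_lim_eq A_def[symmetric] psum_def[symmetric]
    by (rule the_equality, rule c, rule converges_unique[OF _ c])
  then show ?thesis using c by (simp add: A_def)
qed

lemma act_converges:
  assumes "v \<in> carrier E" "ord_ge A h"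
  shows "converges (\<lambda>N. psum h v A (int N)) (act h v)"
proof (cases "A \<le> fls_subdegree h")
  case True
  then show ?thesis using act_converges'[OF assms(1), of h] psum_window[OF assms(1) ord_ge_subdegree True] by simp
next
  case False
  then have "h = 0" using assms(2) by (simp add: ord_ge_iff_subdegree)
  then have "psum h v A B = psum h v (fls_subdegree h) B" for B
    using assms(1) by (simp add: psum_def Pi_def cong: finsum_cong)
  then show ?thesis using act_converges'[OF assms(1), of h] by simp
qed

lemma act_closed [simp]: "v \<in> carrier E \<Longrightarrow> act h v \<in> carrier E"
  using act_converges' by (simp add: converges_def)

lemma act_add_left: assumes v: "v \<in> carrier E" shows "act (g + h) v = act g v \<oplus> act h v"
proof -
  define A where "A = min (fls_subdegree g) (fls_subdegree h)"
  have A: "ord_ge A g" "ord_ge A h" by (auto simp: A_def intro: ord_ge_mono[OF ord_ge_subdegree])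
  show ?thesis
    using converges_unique[OF act_converges[OF v ord_ge_add[OF A]]]
      converges_add[OF act_converges[OF v A(1)] act_converges[OF v A(2)]] v by (simp add: psum_add)
qed

lemma act_const_left: assumes v: "v \<in> carrier E" shows "act (fls_const c * h) v = fls_const c \<odot> act h v"
proof (rule converges_unique)
  show "converges (\<lambda>N. psum (fls_const c * h) v (fls_subdegree h) (int N)) (act (fls_const c * h) v)"
    by (rule act_converges[OF v ord_ge_const_mult[OF ord_ge_subdegree]])
  show "converges (\<lambda>N. psum (fls_const c * h) v (fls_subdegree h) (int N)) (fls_const c \<odot> act h v)"
    using converges_const[OF act_converges'[OF v]] v by (simp add: psum_const)
qed

lemma act_X: assumes v: "v \<in> carrier E" shows "act (fls_X_intpow m) v = P m v"
proof -
  have "psum (fls_X_intpow m) v m B = P m v" if "B \<ge> m" for B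
  proof -
    have "psum (fls_X_intpow m) v m (m + int k) = P m v" for k
    proof (induction k)
      case 0
      have "fls_const 1 \<odot> P m v = P m v" using v by simp
      then show ?case using v by (simp add: psum_def Pi_def)
    next
      case (Suc k)
      have "psum (fls_X_intpow m) v m (m + int k + 1) = P m v"
        using psum_step[OF v, of m "m + int k" "fls_X_intpow m"] Suc v by simp
      then show ?case by (simp add: algebra_simps)
    qed
    from this[of "nat (B - m)"] show ?thesis using that by simp
  qed
  then have "\<forall>\<^sub>F N in sequentially. psum (fls_X_intpow m) v m (int N) = P m v"
    unfolding eventually_sequentially by (intro exI[of _ "nat m"]) auto
  then have "converges (\<lambda>N. psum (fls_X_intpow m) v m (int N)) (P m v)"
    unfolding converges_def using v by (auto elim!: eventually_mono simp: F_zero)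
  then show ?thesis using converges_unique[OF act_converges[OF v ord_ge_X_intpow]] by blast
qed

lemma act_G: assumes "v \<in> G j" "ord_ge n h" shows "act h v \<in> G (n + j)"
  using converges_G[OF act_converges'[OF G_carrier[OF assms(1)]] psum_G[OF assms]] .

text \<open>The uniqueness principle behind all identities for the new action: a continuous \<open>k\<close>-linear
  function of \<open>h\<close> is determined by its values on the monomials.\<close>

lemma act_unique:
  assumes v: "v \<in> carrier E"
    and e: "\<And>h. e h \<in> carrier E" "\<And>g h. e (g + h) = e g \<oplus> e h"
      "\<And>b h. e (fls_const b * h) = fls_const b \<odot> e h"
    and X: "\<And>n. e (fls_X_intpow n) = P n v"
    and cont: "\<And>n h. ord_ge n h \<Longrightarrow> e h \<in> G (n + c)"
  shows "e h = act h v"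
proof -
  obtain j where j: "v \<in> G j" using G_exhaustive[OF v] by blast
  have "\<exists>s\<in>{\<zero>}. (e h \<ominus> act h v) \<ominus> s \<in> G m" for m
  proof (rule approximation[where Fl = G])
    show "e h \<ominus> act h v \<in> carrier E" for h using v e(1) by simp
    show "e (g + h) \<ominus> act (g + h) v = (e g \<ominus> act g v) \<oplus> (e h \<ominus> act h v)" for g h
      using v e by (simp add: act_add_left add_diff_add)
    show "e (fls_const b * h) \<ominus> act (fls_const b * h) v = fls_const b \<odot> (e h \<ominus> act h v)" for b h
      using v e by (simp add: act_const_left smult_diff_right)
    show "fls_const b \<odot> (e (fls_X_intpow n) \<ominus> act (fls_X_intpow n) v) \<in> {\<zero>}" for b n
      using v by (simp add: X act_X)
    show "e h \<ominus> act h v \<in> G (n + min c j)" if "ord_ge n h" for n h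
      by (rule G_diff) (auto intro: G_mono[OF cont[OF that]] G_mono[OF act_G[OF j that]])
    show "\<And>m n v. m \<le> n \<Longrightarrow> v \<in> G n \<Longrightarrow> v \<in> G m" by (rule G_mono)
  qed simp_all
  then have "e h \<ominus> act h v \<in> G m" for m using v e(1)[of h] by simp
  then have "e h \<ominus> act h v = \<zero>" using v e(1) by (intro separated) auto
  then show ?thesis using v e(1) by (simp add: diff_eq_zero_iff)
qed

lemma act_one: "v \<in> carrier E \<Longrightarrow> act 1 v = v"
  using act_X[of v 0] by (simp add: P_0)

lemma act_add_right:
  assumes u: "u \<in> carrier E" and v: "v \<in> carrier E" shows "act h (u \<oplus> v) = act h u \<oplus> act h v"
proof -
  obtain i j where ij: "u \<in> G i" "v \<in> G j" using G_exhaustive u v by meson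
  have "act h u \<oplus> act h v = act h (u \<oplus> v)"
  proof (rule act_unique[where c = "min i j"])
    show "act h u \<oplus> act h v \<in> G (n + min i j)" if "ord_ge n h" for n h
      by (rule G_add) (auto intro: G_mono[OF act_G[OF ij(1) that]] G_mono[OF act_G[OF ij(2) that]])
  qed (use u v in \<open>auto simp: act_add_left act_const_left act_X P_add smult_add_right a_ac\<close>)
  then show ?thesis by simp
qed

lemma act_shift: assumes v: "v \<in> carrier E" shows "act (fls_X_intpow m * h) v = P m (act h v)"
proof -
  obtain j where j: "v \<in> G j" using G_exhaustive[OF v] by blast
  have "P (- m) (act (fls_X_intpow m * h) v) = act h v"
  proof (rule act_unique[OF v, where c = j])
    show "P (- m) (act (fls_X_intpow m * h) v) \<in> carrier E" for h using v by simp
    show "P (- m) (act (fls_X_intpow m * (g + h)) v)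
        = P (- m) (act (fls_X_intpow m * g) v) \<oplus> P (- m) (act (fls_X_intpow m * h) v)" for g h
      using v by (simp add: distrib_left act_add_left P_add)
    show "P (- m) (act (fls_X_intpow m * (fls_const b * h)) v)
        = fls_const b \<odot> P (- m) (act (fls_X_intpow m * h) v)" for b h
      using v by (simp add: mult.left_commute[of _ "fls_const b"] act_const_left P_const)
    show "P (- m) (act (fls_X_intpow m * fls_X_intpow n) v) = P n v" for n
      using v by (simp only: fls_X_intpow_times_fls_X_intpow act_X P_P P_closed) simp
    show "P (- m) (act (fls_X_intpow m * h) v) \<in> G (n + j)" if "ord_ge n h" for n h
    proof -
      have "act (fls_X_intpow m * h) v \<in> G (m + n + j)"
        by (rule act_G[OF j ord_ge_mult[OF ord_ge_X_intpow that]])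
      then show ?thesis using G_P[of "act (fls_X_intpow m * h) v" "- m" "m + n + j"] v by simp
    qed
  qed
  then have "P m (P (- m) (act (fls_X_intpow m * h) v)) = P m (act h v)" by simp
  then show ?thesis using v by (simp add: P_P P_0)
qed

lemma act_mult: assumes v: "v \<in> carrier E" shows "act (g * h) v = act g (act h v)"
proof -
  obtain j where j: "v \<in> G j" using G_exhaustive[OF v] by blast
  show ?thesis
  proof (rule act_unique)
  show "act (g * h) v \<in> G (n + (fls_subdegree h + j))" if "ord_ge n g" for n g
    using act_G[OF j ord_ge_mult[OF that ord_ge_subdegree[of h]]] by (simp add: add_ac)
qed (use v in \<open>auto simp: distrib_right act_add_left act_const_left act_shift mult.assoc\<close>)
qed

text \<open>The exchanged structure: the same additive group, the new scalars, and \<open>R\<close> as operator.\<close>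

definition twist :: "('v \<Rightarrow> 'v) \<Rightarrow> ('k fls, 'v) op_module" where
  "twist R = E\<lparr>smult := series_smult E P, opr := R\<rparr>"

lemma twist_sel [simp]:
  "carrier (twist R) = carrier E" "add (twist R) = add E" "zero (twist R) = zero E"
  "smult (twist R) = act" "opr (twist R) = R"
  by (simp_all add: twist_def act_def)

lemma twist_minus [simp]: "a_inv (twist R) = a_inv E" "a_minus (twist R) = a_minus E"
proof -
  show "a_inv (twist R) = a_inv E" by (simp add: a_inv_def m_inv_def fun_eq_iff)
  then show "a_minus (twist R) = a_minus E" by (simp add: a_minus_def fun_eq_iff)
qed

lemma fls_space_twist: "fls_space (twist R)"
proof -
  have "vectorspace class_ring (twist R)"
  proof (rule vs_criteria)
    show "field (class_ring :: 'k fls ring)" by (rule class_field)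
    show "\<forall>v\<in>carrier (twist R). \<exists>neg_v\<in>carrier (twist R). v \<oplus>\<^bsub>twist R\<^esub> neg_v = \<zero>\<^bsub>twist R\<^esub>"
      by (auto intro!: bexI[of _ "\<ominus> _"] simp: r_neg)
  qed (auto simp: a_ac act_add_right act_add_left act_mult act_one)
  then show ?thesis
    by (simp add: fls_space_def fls_space_axioms_def vectorspace_def Module.module_def)
qed

lemma filtration_twist: "filtration (twist R) (carrier E) G"
proof -
  interpret E': fls_space "twist R" by (rule fls_space_twist)
  show ?thesis
  proof
    show "E'.ksub (carrier E)" using E'.ksub_carrier by simp
    fix n m v
    show "E'.osub (G n)"
      unfolding E'.osub_def using G_carrier G_zero G_add act_G[of _ n 0] by auto
    show "G n \<subseteq> carrier E" using G_carrier by blast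
    show "(fls_X_intpow m \<odot>\<^bsub>twist R\<^esub> v \<in> G (n + m)) = (v \<in> G n)" if "v \<in> carrier E"
      using that by (simp add: act_X G_P)
  next
    show "\<exists>n. v \<in> G n" if "v \<in> carrier E" for v by (rule G_exhaustive[OF that])
    show "v = \<zero>\<^bsub>twist R\<^esub>" if "v \<in> carrier E" "\<And>n. v \<in> G n" for v using separated that by simp
    show "\<exists>w\<in>carrier E. \<forall>i. w \<ominus>\<^bsub>twist R\<^esub> s i \<in> G (int i)"
      if "\<And>i. s i \<in> carrier E" "\<And>i. s (Suc i) \<ominus>\<^bsub>twist R\<^esub> s i \<in> G (int i)" for s
      using G_complete[of s 0] that by simp
  qed
qed

end

section \<open>Filtrations by irreducible models\<close>

text \<open>An isomorphism of \<open>W/U\<close> with \<open>M\<close>, expressed without cosets by a surjection on \<open>M\<close> with kernel \<open>U\<close>.\<close>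

definition model_map ::
  "('k::field fls, 'v) op_module \<Rightarrow> 'v set \<Rightarrow> 'v set \<Rightarrow> ('k fls, 'k fls) op_module \<Rightarrow> ('v \<Rightarrow> 'k fls) \<Rightarrow> bool" where
  "model_map E W U M \<pi> \<longleftrightarrow>
     (\<forall>u\<in>W. \<forall>v\<in>W. \<pi> (u \<oplus>\<^bsub>E\<^esub> v) = \<pi> u + \<pi> v) \<and> (\<forall>h. \<forall>v\<in>W. \<pi> (h \<odot>\<^bsub>E\<^esub> v) = h \<odot>\<^bsub>M\<^esub> \<pi> v) \<and>
     (\<forall>y. \<exists>w\<in>W. \<pi> w = y) \<and> (\<forall>w\<in>W. \<pi> w = 0 \<longleftrightarrow> w \<in> U) \<and> (\<forall>w\<in>W. \<pi> (opr E w) = opr M (\<pi> w))"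

lemma model_mapD:
  assumes "model_map E W U M \<pi>"
  shows "u \<in> W \<Longrightarrow> v \<in> W \<Longrightarrow> \<pi> (u \<oplus>\<^bsub>E\<^esub> v) = \<pi> u + \<pi> v" "v \<in> W \<Longrightarrow> \<pi> (h \<odot>\<^bsub>E\<^esub> v) = h \<odot>\<^bsub>M\<^esub> \<pi> v"
    "\<exists>w\<in>W. \<pi> w = y" "w \<in> W \<Longrightarrow> \<pi> w = 0 \<longleftrightarrow> w \<in> U" "w \<in> W \<Longrightarrow> \<pi> (opr E w) = opr M (\<pi> w)"
  using assms by (auto simp: model_map_def)

inductive filtered_by ::
  "('k::field fls, 'v) op_module \<Rightarrow> ('k fls, 'k fls) op_module set \<Rightarrow> 'v set \<Rightarrow> bool" for E \<M> where
  zero: "filtered_by E \<M> {\<zero>\<^bsub>E\<^esub>}"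
| step: "filtered_by E \<M> U \<Longrightarrow> stable_subspace E W \<Longrightarrow> stable_subspace E U \<Longrightarrow> U \<subseteq> W \<Longrightarrow> M \<in> \<M> \<Longrightarrow>
    model_map E W U M \<pi> \<Longrightarrow> filtered_by E \<M> W"

definition conn_models :: "('k::field_char_0 fls, 'k fls) op_module set" where
  "conn_models = {E_obj q f | q f. q \<ge> 1 \<and> puiseux_ord q f < 0}"

definition diff_models :: "('k::field_char_0 fls, 'k fls) op_module set" where
  "diff_models = {D_obj q g | q g. q \<ge> 1 \<and> g \<noteq> 0 \<and> puiseux_ord q g < 0}"

lemma puiseux_ord_neg:
  assumes "q \<ge> 1"
  shows "puiseux_ord q f < 0 \<longleftrightarrow> fls_subdegree f < 0"
  using assms by (simp add: puiseux_ord_def divide_less_0_iff)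

lemma conn_modelsE:
  assumes "M \<in> conn_models"
  obtains q f s where "M = E_obj q f" "q \<ge> 1" "s \<ge> 1" "fls_subdegree f = - int s"
proof -
  obtain q f where "M = E_obj q f" "q \<ge> 1" "fls_subdegree f < 0"
    using assms puiseux_ord_neg by (auto simp: conn_models_def)
  then show ?thesis by (intro that[of q f "nat (- fls_subdegree f)"]) auto
qed

lemma diff_modelsE:
  assumes "M \<in> diff_models"
  obtains q g s where "M = D_obj q g" "q \<ge> 1" "s \<ge> 1" "g \<noteq> 0" "fls_subdegree g = - int s"
proof -
  obtain q g where "M = D_obj q g" "q \<ge> 1" "g \<noteq> 0" "fls_subdegree g < 0"
    using assms puiseux_ord_neg by (auto simp: diff_models_def)
  then show ?thesis by (intro that[of q g "nat (- fls_subdegree g)"]) auto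
qed

lemma D_obj_smult [simp]: "smult (D_obj p g) = (\<lambda>h v. fls_compose_power h p * v)"
  by (simp add: D_obj_def)

text \<open>Preimages of the subspaces in a chain for the quotient extend a chain for \<open>U\<close>.\<close>

lemma (in fls_space) fg_extension:
  assumes p: "p \<ge> 1" and U: "fg U" and W: "ksub W" and UW: "U \<subseteq> W"
    and add: "\<And>u v. u \<in> W \<Longrightarrow> v \<in> W \<Longrightarrow> \<pi> (u \<oplus> v) = \<pi> u + \<pi> v"
    and smult: "\<And>h v. v \<in> W \<Longrightarrow> \<pi> (h \<odot> v) = fls_compose_power h p * \<pi> v"
    and surj: "\<And>y. \<exists>w\<in>W. \<pi> w = y" and ker: "\<And>w. w \<in> W \<Longrightarrow> \<pi> w = 0 \<longleftrightarrow> w \<in> U"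
  shows "fg W"
proof -
  interpret M: fls_space "E_obj p 0" by (rule fls_space_E_obj[OF p])
  note W' = ksubD[OF W]
  have "fg {w \<in> W. \<pi> w \<in> Y}" if "M.fg Y" for Y
    using that
  proof (induction rule: M.fg.induct)
    case zero
    have "{w \<in> W. \<pi> w \<in> {\<zero>\<^bsub>E_obj p 0\<^esub>}} = U" using UW ker by auto
    then show ?case using U by simp
  next
    case (adjoin Y b)
    obtain w where w: "w \<in> W" "\<pi> w = b" using surj by blast
    note Y = M.ksubD[OF M.fg_ksub[OF adjoin.hyps(1)]]
    have "{v \<in> W. \<pi> v \<in> M.adjoin Y b} = adjoin {v \<in> W. \<pi> v \<in> Y} w"
    proof (intro equalityI subsetI)
      fix v assume "v \<in> {v \<in> W. \<pi> v \<in> M.adjoin Y b}"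
      then obtain y h where v: "v \<in> W" "y \<in> Y" "\<pi> v = y + fls_compose_power h p * b"
        by (auto simp: M.adjoin_def)
      define u where "u = v \<ominus> h \<odot> w"
      have hw: "h \<odot> w \<in> W" using W'(4) w by blast
      have u: "u \<in> W" using W'(6) v(1) hw by (simp add: u_def)
      have vu: "v = u \<oplus> h \<odot> w" using W'(7) v(1) hw by (simp add: u_def)
      have "\<pi> u = y" using add[OF u hw] v(3) smult[OF w(1)] w(2) vu by simp
      then show "v \<in> adjoin {v \<in> W. \<pi> v \<in> Y} w" unfolding vu
        using u v(2) by (intro adjoinI) simp
    next
      fix v assume "v \<in> adjoin {v \<in> W. \<pi> v \<in> Y} w"
      then obtain u h where "u \<in> W" "\<pi> u \<in> Y" "v = u \<oplus> h \<odot> w" by (auto simp: adjoin_def)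
      then show "v \<in> {v \<in> W. \<pi> v \<in> M.adjoin Y b}"
        using W'(3,4) w add smult by (auto simp: M.adjoin_def)
    qed
    then show ?case using fg.adjoin[OF adjoin.IH W'(7)[OF w(1)]] by simp
  qed
  from this[OF fg_E_obj[OF p]] show ?thesis by simp
qed

lemma (in fls_space) filtered_fg:
  assumes "filtered_by E \<M> W" and sm: "\<And>M. M \<in> \<M> \<Longrightarrow> \<exists>p\<ge>1. \<forall>h v. h \<odot>\<^bsub>M\<^esub> v = fls_compose_power h p * v"
  shows "fg W"
  using assms(1)
proof (induction rule: filtered_by.induct)
  case zero
  show ?case by (rule fg.zero)
next
  case (step U W M \<pi>)
  obtain p where p: "p \<ge> 1" "\<And>h v. h \<odot>\<^bsub>M\<^esub> v = fls_compose_power h p * v" using sm step.hyps by blast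
  note m = model_mapD[OF \<open>model_map E W U M \<pi>\<close>]
  show ?case
    by (rule fg_extension[OF p(1) step.IH, where \<pi> = \<pi>])
      (use step.hyps m p(2) in \<open>auto simp: stable_subspace_def ksub_iff_subspace\<close>)
qed

context semilinear_space
begin

lemma shift_modelI:
  assumes "stable W" "stable U" "U \<subseteq> W" "p \<ge> 1" "s \<ge> 1"
    and m: "model_map E W U M \<pi>" and sm: "\<And>h v. h \<odot>\<^bsub>M\<^esub> v = fls_compose_power h p * v"
    and T0: "elliptic (- int s) T0" "\<And>w. w \<in> W \<Longrightarrow> \<pi> (T w) = T0 (\<pi> w)"
  shows "shift_model W U p s \<pi>"
  unfolding shift_model_def
  using assms(1-5) model_mapD[OF m] sm T0(2) elliptic_ord[OF T0(1), of "_ :: int"] stableD(1)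
  by (auto simp: diff_conv_add_uminus simp del: add_uminus_conv_diff)

lemma shift_model_funpow:
  assumes M: "shift_model W U p s \<pi>" and w: "w \<in> W"
  shows "ord_ge (n - int k * int s) (\<pi> ((T ^^ k) w)) \<longleftrightarrow> ord_ge n (\<pi> w)"
proof (induction k)
  case (Suc k)
  note M' = shift_modelD[OF M]
  have e: "n - int (Suc k) * int s = (n - int k * int s) - int s" by (simp add: algebra_simps)
  show ?case
    unfolding e using M'(11)[OF stable_funpow[OF M'(3) w, of k], of "n - int k * int s"] Suc by simp
qed simp

end

context mellin_pair
begin

lemma stable_P: assumes S: "stable S" and v: "v \<in> S" shows "P n v \<in> S"
proof -
  note S' = ksubD[OF stableD(1)[OF S]]
  have pos: "P (int k) v \<in> S" for k
  proof (induction k)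
    case 0
    then show ?case using v S'(7) by (simp add: P_0)
  next
    case (Suc k)
    obtain u where u: "u \<in> S" "T u = P (int k) v"
      using shift_filtered_surj[OF shift_filtered_carrier S Suc S'(7)[OF Suc]] by blast
    have "T (P (int k + 1) v) = T u" using u(2) T_P[OF S'(7)[OF v]] by simp
    then have "P (int k + 1) v = u" by (rule T_inj[rotated 2]) (use S'(7) u(1) v in auto)
    then show ?case using u(1) by (simp add: add.commute)
  qed
  show ?thesis
  proof (cases "n \<ge> 0")
    case True
    then show ?thesis using pos[of "nat n"] by simp
  next
    case False
    then show ?thesis using P_neg[OF S'(7)[OF v], of "nat (- n)"] stable_funpow[OF S v, of "nat (- n)"] by simp
  qed
qed

text \<open>A stable subspace contains with \<open>v\<close> also \<open>T^n v\<close> for every integer \<open>n\<close>, and it is closed.\<close>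

lemma stable_act: assumes S: "stable S" and v: "v \<in> S" shows "act h v \<in> S"
proof -
  note S' = ksubD[OF stableD(1)[OF S]]
  have vc: "v \<in> carrier E" by (rule S'(7)[OF v])
  obtain j where j: "v \<in> G j" using G_exhaustive[OF vc] by blast
  have ap: "\<exists>s\<in>S. act h v \<ominus> s \<in> G m" for m
    by (rule approximation[OF S'(1-3), where e = "\<lambda>h. act h v" and Fl = G and c = j])
      (use vc S'(4) stable_P[OF S v] act_G[OF j] in \<open>auto simp: act_add_left act_const_left act_X intro: G_mono\<close>)
  show ?thesis
  proof (rule fg_closed[OF ksub_fg[OF fg_carrier stableD(1)[OF S] S'(1)] S'(1)])
    show "act h v \<in> carrier E" using vc by simp
    show "\<exists>s\<in>S. act h v \<ominus> s \<in> F n" for n using G_in_F[of n] ap by blast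
  qed
qed

lemma stable_twist_ksub:
  assumes "stable S"
  shows "fls_space.ksub (twist R) S"
proof -
  interpret E': fls_space "twist R" by (rule fls_space_twist)
  show ?thesis unfolding E'.ksub_def
    using ksubD[OF stableD(1)[OF assms]] stable_act[OF assms] by auto
qed

text \<open>The converse with the roles of the two structures exchanged: \<open>X^(- 1)\<close>, as an operator on the new
  space, is bijective on its stable subspaces, and these are closed. Since the topologies
  agree, they are subspaces for the old scalars.\<close>

lemma twist_stable_imp_stable:
  assumes E': "semilinear_space (twist R) T' a' d'"
    and T': "\<And>v. v \<in> carrier E \<Longrightarrow> T' v = fls_X_inv \<odot> v"
    and shift_filtered': "semilinear_space.shift_filtered (twist R) T' (carrier E)"
    and S: "semilinear_space.stable (twist R) T' S"
  shows "stable S"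
proof -
  interpret E': semilinear_space "twist R" T' a' d' by (rule E')
  interpret G: filtration "twist R" "carrier E" G by (rule filtration_twist)
  note S' = E'.ksubD[OF E'.stableD(1)[OF S], simplified]
  have X: "fls_X_intpow n \<odot> v \<in> S" if v: "v \<in> S" for n v
  proof -
    have pos: "fls_X_intpow (int k) \<odot> v \<in> S" for k
    proof (induction k)
      case 0
      then show ?case using v S'(7) by simp
    next
      case (Suc k)
      define y where "y = fls_X_intpow (int k) \<odot> v"
      have y: "y \<in> S" "y \<in> carrier E" using Suc S'(7) by (auto simp: y_def)
      obtain u where u: "u \<in> S" "T' u = y" using E'.shift_filtered_surj[OF shift_filtered' S y] by blast
      have uc: "u \<in> carrier E" by (rule S'(7)[OF u(1)])
      have "fls_X \<odot> y = u" using u(2) T'[OF uc] X_X_inv(1)[OF uc] by simp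
      moreover have "fls_X \<odot> y = fls_X_intpow (int (Suc k)) \<odot> v"
      proof -
        have "fls_X * fls_X_intpow (int k) = (fls_X_intpow (int (Suc k)) :: 'k fls)"
          by (rule fls_eqI) (auto simp: fls_X_times_conv_shift)
        then show ?thesis using S'(7)[OF v] by (simp only: y_def smult_smult)
      qed
      ultimately show ?case using u(1) by simp
    qed
    have neg: "fls_X_intpow (- int k) \<odot> v \<in> S" for k
    proof (induction k)
      case 0
      then show ?case using v S'(7) by simp
    next
      case (Suc k)
      define y where "y = fls_X_intpow (- int k) \<odot> v"
      have y: "y \<in> S" "y \<in> carrier E" using Suc S'(7) by (auto simp: y_def)
      have "fls_X_inv \<odot> y \<in> S" using E'.stableD(2)[OF S y(1)] T'[OF y(2)] by simp
      moreover have "fls_X_inv \<odot> y = fls_X_intpow (- int (Suc k)) \<odot> v"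
      proof -
        have "fls_X_inv * fls_X_intpow (- int k) = (fls_X_intpow (- int (Suc k)) :: 'k fls)"
          by (rule fls_eqI) (auto simp: fls_X_inv_times_conv_shift)
        then show ?thesis using S'(7)[OF v] by (simp only: y_def smult_smult)
      qed
      ultimately show ?case by simp
    qed
    show ?thesis using pos[of "nat n"] neg[of "nat (- n)"] by (cases "n \<ge> 0") auto
  qed
  have const: "fls_const c \<odot> v \<in> S" if "v \<in> S" for c v
    using S'(4)[OF that, of "fls_const c"] act_const_left[OF S'(7)[OF that], of c 1] act_one[OF S'(7)[OF that]] by simp
  have smult: "h \<odot> v \<in> S" if v: "v \<in> S" for h v
  proof (rule G.fg_closed)
    show "E'.fg S" by (rule E'.ksub_fg[OF E'.fg_carrier E'.stableD(1)[OF S]]) (use S'(1) in simp)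
    show "S \<subseteq> carrier E" by (rule S'(1))
    have vc: "v \<in> carrier E" by (rule S'(7)[OF v])
    then show "h \<odot> v \<in> carrier E" by simp
    obtain j where j: "v \<in> F j" using F_exhaustive[OF vc] by blast
    \<comment> \<open>\<open>S\<close> contains the multiples of \<open>v\<close> by monomials, hence approximates all of them.\<close>
    have ap: "\<exists>s\<in>S. h \<odot> v \<ominus> s \<in> F m" for m h
    proof (rule approximation[OF S'(1-3), where e = "\<lambda>h. h \<odot> v" and Fl = F and c = j])
      show "(g + h) \<odot> v = g \<odot> v \<oplus> h \<odot> v" for g h by (rule smult_add_left[OF vc])
      show "(fls_const b * h) \<odot> v = fls_const b \<odot> (h \<odot> v)" for b h by (simp only: smult_smult[OF vc])
      show "fls_const b \<odot> (fls_X_intpow n \<odot> v) \<in> S" for b n by (intro const X v)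
      show "h \<odot> v \<in> F (n + j)" if "ord_ge n h" for n h
        using F_smult[OF that j] by (simp add: add.commute)
    qed (use vc F_mono in auto)
    show "\<exists>s\<in>S. h \<odot> v \<ominus>\<^bsub>twist R\<^esub> s \<in> G n" for n
    proof -
      obtain m where m: "F m \<subseteq> G n" using F_in_G by blast
      obtain s where "s \<in> S" "h \<odot> v \<ominus> s \<in> F m" using ap by blast
      then show ?thesis using m by (intro bexI[of _ s]) auto
    qed
  qed
  have "T v \<in> S" if v: "v \<in> S" for v
  proof -
    have "T v = P (- 1) v" using P_neg[OF S'(7)[OF v], of 1] by simp
    also have "\<dots> = act (fls_X_intpow (- 1)) v" using S'(7)[OF v] by (simp only: act_X)
    finally show ?thesis using S'(4)[OF v] by simp
  qed
  then show ?thesis using S'(1,2,3) smult by (auto simp: stable_def ksub_def)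
qed

text \<open>\<open>\<pi>\<close> is continuous for the filtration \<open>G\<close>. The slope \<open>s\<close> appears because on the quotient \<open>T\<close> lowers the order by
  \<open>s\<close>.\<close>

lemma shift_model_bounded:
  assumes M: "shift_model W U p s \<pi>"
  shows "\<exists>c. \<forall>n. \<forall>u\<in>W. u \<in> G n \<longrightarrow> ord_ge (int s * n + c) (\<pi> u)"
proof -
  note M' = shift_modelD[OF M] and kW = ksubD[OF shift_modelD(4)[OF M]]
  define L where "L = {w \<in> W. ord_ge 0 (\<pi> w)}"
  have pi0: "\<pi> \<zero> = 0" using M'(10)[OF kW(2)] ksubD(2)[OF M'(5)] by simp
  have "osub L"
    unfolding osub_def
  proof (intro conjI ballI allI impI)
    show "h \<odot> v \<in> L" if "ord_ge 0 h" "v \<in> L" for h v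
      using that kW(4) ord_ge_mult[OF ord_ge_compose_power[OF M'(1) that(1)], of 0 "\<pi> v"]
      by (auto simp: L_def M'(8))
  qed (use kW pi0 M'(7) in \<open>auto simp: L_def intro: ord_ge_add\<close>)
  moreover have "\<exists>m. fls_X_intpow m \<odot> v \<in> L" if v: "v \<in> W" for v
  proof -
    define m where "m = \<bar>fls_subdegree (\<pi> v)\<bar>"
    have "m \<le> int p * m" using M'(1) by (simp add: m_def mult_le_cancel_right1)
    then have "ord_ge 0 (fls_compose_power (fls_X_intpow m) p * \<pi> v)"
      using ord_ge_mult[OF ord_ge_compose_power[OF M'(1) ord_ge_X_intpow[of m]] ord_ge_subdegree[of "\<pi> v"]]
      by (rule_tac ord_ge_mono) (auto simp: m_def)
    then have "fls_X_intpow m \<odot> v \<in> L" using kW(4)[OF v] by (simp add: L_def M'(8)[OF v])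
    then show ?thesis by blast
  qed
  ultimately obtain m where m: "\<And>v. v \<in> W \<Longrightarrow> v \<in> F m \<Longrightarrow> v \<in> L"
    using fg_open[OF ksub_fg[OF fg_carrier M'(4) kW(1)] kW(1)] by metis
  define c where "c = - (int p * m)"
  have F0: "ord_ge c (\<pi> w)" if w: "w \<in> W" "w \<in> F 0" for w
  proof -
    have "fls_X_intpow m \<odot> w \<in> L"
      using m kW(4)[OF w(1)] F_smult[OF ord_ge_X_intpow[of m] w(2)] by simp
    then have "ord_ge 0 (fls_compose_power (fls_X_intpow m) p * \<pi> w)" by (simp add: L_def M'(8)[OF w(1)])
    moreover have "fls_compose_power (fls_X_intpow m) p = (fls_X_intpow (int p * m) :: 'k fls)"
      by (rule fls_compose_power_X_intpow) (use M'(1) in simp)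
    ultimately have "ord_ge 0 (fls_shift (- (int p * m)) (\<pi> w))"
      by (simp only: fls_X_intpow_times_conv_shift)
    then show ?thesis by (simp add: c_def)
  qed
  have "ord_ge (int s * n + c) (\<pi> u)" if u: "u \<in> W" "u \<in> G n" for n u
  proof -
    have Pu: "P (- n) u \<in> W" "P (- n) u \<in> F 0" using stable_P[OF M'(3) u(1)] u(2) by (auto simp: G_def)
    note b = F0[OF Pu]
    have uc: "u \<in> carrier E" by (rule kW(7)[OF u(1)])
    show ?thesis
    proof (cases "n \<ge> 0")
      case True
      then have "P (- n) u = (T ^^ nat n) u" using P_neg[OF uc, of "nat n"] by simp
      then show ?thesis
        using b shift_model_funpow[OF M u(1), of "int s * n + c" "nat n"] True by (simp add: algebra_simps)
    next
      case False
      then have "(T ^^ nat (- n)) (P (- n) u) = u"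
        using P_neg[of "P (- n) u" "nat (- n)"] uc by (simp add: P_P P_0)
      then show ?thesis
        using b shift_model_funpow[OF M Pu(1), of c "nat (- n)"] False by (simp add: algebra_simps)
    qed
  qed
  then show ?thesis by blast
qed

text \<open>The new variable \<open>T^(- 1)\<close> becomes \<open>t^s\<close> in the coordinate \<open>\<Psi>\<close>, so the two sides agree on
  monomials, and both are continuous in \<open>h\<close>.\<close>

lemma shift_model_act:
  assumes M: "shift_model W U p s \<pi>"
    and \<Psi>: "const_lin \<Psi>" "raises_ord 0 \<Psi>"
    and \<Psi>T: "\<And>w. w \<in> W \<Longrightarrow> \<Psi> (\<pi> (T w)) = fls_shift (int s) (\<Psi> (\<pi> w))"
    and w: "w \<in> W"
  shows "\<Psi> (\<pi> (act h w)) = fls_compose_power h s * \<Psi> (\<pi> w)"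
proof -
  note M' = shift_modelD[OF M] and kW = ksubD[OF shift_modelD(4)[OF M]]
  note \<Psi>' = const_linD[OF \<Psi>(1)]
  interpret Q: filtration "E_obj s 0" UNIV "\<lambda>n. {y. ord_ge (int s * n) y}"
    by (rule filtration_E_obj[OF M'(2)])
  have wc: "w \<in> carrier E" by (rule kW(7)[OF w])
  obtain j where j: "w \<in> G j" using G_exhaustive[OF wc] by blast
  obtain c where c: "\<And>n u. u \<in> W \<Longrightarrow> u \<in> G n \<Longrightarrow> ord_ge (int s * n + c) (\<pi> u)"
    using shift_model_bounded[OF M] by blast
  have aW: "act h w \<in> W" for h by (rule stable_act[OF M'(3) w])
  define i where "i = fls_subdegree (\<Psi> (\<pi> w))"
  have X: "\<Psi> (\<pi> (P n w)) = fls_shift (- (int s * n)) (\<Psi> (\<pi> w))" for n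
  proof -
    have PW: "P n w \<in> W" for n by (rule stable_P[OF M'(3) w])
    have st: "\<Psi> (\<pi> (P n w)) = fls_shift (int s) (\<Psi> (\<pi> (P (n + 1) w)))" for n
      using \<Psi>T[OF PW[of "n + 1"]] T_P[OF wc] by simp
    show ?thesis
    proof (induction n rule: int_induct[where k = 0])
      case base
      then show ?case using wc by (simp add: P_0)
    next
      case (step1 n)
      have "\<Psi> (\<pi> (P (n + 1) w)) = fls_shift (- int s) (\<Psi> (\<pi> (P n w)))" by (subst st) simp
      then show ?case using step1 by (simp add: algebra_simps)
    next
      case (step2 n)
      have "\<Psi> (\<pi> (P (n - 1) w)) = fls_shift (int s) (\<Psi> (\<pi> (P n w)))" by (subst st) simp
      then show ?case using step2 by (simp add: algebra_simps)
    qed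
  qed
  define e where "e h = \<Psi> (\<pi> (act h w)) - fls_compose_power h s * \<Psi> (\<pi> w)" for h
  \<comment> \<open>Absolute values make the bounds survive multiplication by \<open>s \<ge> 1\<close>.\<close>
  define b where "b = min (j - \<bar>c\<bar>) (- \<bar>i\<bar>)"
  have ap: "\<exists>z\<in>{\<zero>\<^bsub>E_obj s 0\<^esub>}. e h \<ominus>\<^bsub>E_obj s 0\<^esub> z \<in> {y. ord_ge (int s * m) y}" for m
  proof (rule Q.approximation[where e = e and Fl = "\<lambda>n. {y. ord_ge (int s * n) y}" and c = b])
    show "e h \<in> carrier (E_obj s 0)" for h by simp
    show "e (g + h) = e g \<oplus>\<^bsub>E_obj s 0\<^esub> e h" for g h
      using wc aW by (simp add: e_def act_add_left M'(7) \<Psi>' algebra_simps)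
    show "e (fls_const x * h) = fls_const x \<odot>\<^bsub>E_obj s 0\<^esub> e h" for x h
    proof -
      have "\<Psi> (\<pi> (act (fls_const x * h) w)) = fls_const x * \<Psi> (\<pi> (act h w))"
        by (simp add: act_const_left[OF wc] M'(13)[OF aW] \<Psi>')
      then show ?thesis using M'(2) by (simp add: e_def right_diff_distrib mult.assoc)
    qed
    show "fls_const x \<odot>\<^bsub>E_obj s 0\<^esub> e (fls_X_intpow n) \<in> {\<zero>\<^bsub>E_obj s 0\<^esub>}" for x n
    proof -
      have "fls_compose_power (fls_X_intpow n) s = (fls_X_intpow (int s * n) :: 'k fls)"
        by (rule fls_compose_power_X_intpow) (use M'(2) in simp)
      moreover have "act (fls_X_intpow n) w = P n w" by (rule act_X[OF wc])
      ultimately have "e (fls_X_intpow n) = 0"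
        unfolding e_def by (simp only: X fls_X_intpow_times_conv_shift diff_self) simp
      then show ?thesis by simp
    qed
    show "e h \<in> {y. ord_ge (int s * (n + b)) y}" if h: "ord_ge n h" for n h
    proof -
      have "ord_ge (int s * (n + j) + c) (\<pi> (act h w))" by (rule c[OF aW act_G[OF j h]])
      then have "ord_ge (int s * (n + j) + c + 0) (\<Psi> (\<pi> (act h w)))" by (rule raises_ordD[OF \<Psi>(2)])
      moreover have "int s * (n + b) \<le> int s * (n + j) + c + 0"
      proof -
        have "int s * (n + b) \<le> int s * (n + j - \<bar>c\<bar>)" by (intro mult_left_mono) (auto simp: b_def)
        also have "\<dots> = int s * (n + j) - int s * \<bar>c\<bar>" by (simp add: algebra_simps)
        finally have "int s * (n + b) \<le> int s * (n + j) - int s * \<bar>c\<bar>" .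
        moreover have "\<bar>c\<bar> \<le> int s * \<bar>c\<bar>" using M'(2) by (simp add: mult_le_cancel_right1)
        ultimately show ?thesis by linarith
      qed
      ultimately have 1: "ord_ge (int s * (n + b)) (\<Psi> (\<pi> (act h w)))" by (rule ord_ge_mono)
      have "ord_ge (int s * n + i) (fls_compose_power h s * \<Psi> (\<pi> w))"
        unfolding i_def by (rule ord_ge_mult[OF ord_ge_compose_power[OF M'(2) h] ord_ge_subdegree])
      moreover have "int s * (n + b) \<le> int s * n + i"
      proof -
        have "int s * (n + b) \<le> int s * (n - \<bar>i\<bar>)" by (intro mult_left_mono) (auto simp: b_def)
        also have "\<dots> = int s * n - int s * \<bar>i\<bar>" by (simp add: algebra_simps)
        finally have "int s * (n + b) \<le> int s * n - int s * \<bar>i\<bar>" .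
        moreover have "\<bar>i\<bar> \<le> int s * \<bar>i\<bar>" using M'(2) by (simp add: mult_le_cancel_right1)
        ultimately show ?thesis by linarith
      qed
      ultimately have 2: "ord_ge (int s * (n + b)) (fls_compose_power h s * \<Psi> (\<pi> w))" by (rule ord_ge_mono)
      show ?thesis unfolding e_def using ord_ge_diff[OF 1 2] by simp
    qed
    show "\<And>m n v. m \<le> n \<Longrightarrow> v \<in> {y. ord_ge (int s * n) y} \<Longrightarrow> v \<in> {y. ord_ge (int s * m) y}"
      by (auto elim!: ord_ge_mono intro: mult_left_mono)
  qed simp_all
  have "e h = \<zero>\<^bsub>E_obj s 0\<^esub>"
    by (rule Q.F_separated) (use ap M'(2) in auto)
  then show ?thesis by (simp add: e_def)
qed

text \<open>A coordinate change on the Puiseux series that brings \<open>T\<close> into normal form turns a model of \<open>W/U\<close>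
  over the old field into one over the new field, with \<open>t^s\<close> in place of \<open>t^p\<close>.\<close>

lemma model_map_transfer:
  assumes st: "stable W" and M: "shift_model W U p s \<pi>"
    and \<Psi>: "const_lin \<Psi>" "raises_ord 0 \<Psi>" "\<And>v. \<Psi> (\<Psi>' v) = v" "\<And>v. \<Psi>' (\<Psi> v) = v"
    and \<Psi>T: "\<And>w. w \<in> W \<Longrightarrow> \<Psi> (\<pi> (T w)) = fls_shift (int s) (\<Psi> (\<pi> w))"
    and sm: "\<And>h v. h \<odot>\<^bsub>M'\<^esub> v = fls_compose_power h s * v"
    and R: "\<And>w. w \<in> W \<Longrightarrow> \<Psi> (\<pi> (R w)) = opr M' (\<Psi> (\<pi> w))"
  shows "model_map (twist R) W U M' (\<lambda>w. \<Psi> (\<pi> w))"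
proof -
  note m = shift_modelD[OF M] and \<Psi>l = const_linD[OF \<Psi>(1)]
  have z: "\<Psi> y = 0 \<longleftrightarrow> y = 0" for y using \<Psi>(4)[of y] \<Psi>(4)[of 0] \<Psi>l(3) by metis
  have "\<exists>w\<in>W. \<Psi> (\<pi> w) = y" for y using m(9)[of "\<Psi>' y"] \<Psi>(3) by metis
  then show ?thesis
    unfolding model_map_def
    using m(7,10) \<Psi>l(1) R shift_model_act[OF M \<Psi>(1,2) \<Psi>T] sm z by simp
qed

end

lemma UN_eq_const: "a \<in> A \<Longrightarrow> (\<And>x. x \<in> A \<Longrightarrow> f x = c) \<Longrightarrow> (\<Union>x\<in>A. f x) = c"
  by auto

section \<open>Irreducible subquotients\<close>

locale op_space = fls_space E for E :: "('k::field_char_0 fls, 'v) op_module" (structure) +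
  assumes opr_closed: "v \<in> carrier E \<Longrightarrow> opr E v \<in> carrier E"
    and opr_add: "u \<in> carrier E \<Longrightarrow> v \<in> carrier E \<Longrightarrow> opr E (u \<oplus> v) = opr E u \<oplus> opr E v"
begin

lemma stable_subspace_iff: "stable_subspace E S \<longleftrightarrow> ksub S \<and> (\<forall>v\<in>S. opr E v \<in> S)"
  by (auto simp: stable_subspace_def ksub_iff_subspace)

lemma opr_zero: "opr E \<zero> = \<zero>"
  using opr_add[of \<zero> \<zero>] by (metis opr_closed add.l_cancel_one r_zero zero_closed)

lemma opr_diff: assumes "u \<in> carrier E" "v \<in> carrier E" shows "opr E (u \<ominus> v) = opr E u \<ominus> opr E v"
proof -
  have "opr E (u \<ominus> v) \<oplus> opr E v = opr E u" using opr_add[of "u \<ominus> v" v] assms by simp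
  then show ?thesis using assms by (metis opr_closed add_diff_cancel minus_closed)
qed

text \<open>\<open>W/U\<close> is irreducible.\<close>

definition simple_pair :: "'v set \<Rightarrow> 'v set \<Rightarrow> bool" where
  "simple_pair W U \<longleftrightarrow> stable_subspace E W \<and> stable_subspace E U \<and> U \<subseteq> W \<and> U \<noteq> W \<and>
     (\<forall>S. stable_subspace E S \<longrightarrow> U \<subseteq> S \<longrightarrow> S \<subseteq> W \<longrightarrow> S = U \<or> S = W)"

context
  fixes W U assumes W: "stable_subspace E W" and U: "stable_subspace E U" and UW: "U \<subseteq> W"
begin

lemma kW: "ksub W" and kU: "ksub U" using W U by (auto simp: stable_subspace_iff)

definition coset :: "'v \<Rightarrow> 'v set" where "coset w = U +> w"

lemma coset_iff: "w \<in> W \<Longrightarrow> x \<in> coset w \<longleftrightarrow> x \<in> W \<and> x \<ominus> w \<in> U"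
proof
  assume w: "w \<in> W" and "x \<in> coset w"
  then obtain u where u: "u \<in> U" "x = u \<oplus> w" by (auto simp: coset_def a_r_coset_def')
  then show "x \<in> W \<and> x \<ominus> w \<in> U" using ksubD(3,7)[OF kW] ksubD(7)[OF kU] w UW by auto
next
  assume w: "w \<in> W" and x: "x \<in> W \<and> x \<ominus> w \<in> U"
  then have "x = (x \<ominus> w) \<oplus> w" using ksubD(7)[OF kW] by simp
  then show "x \<in> coset w" using x by (auto simp: coset_def a_r_coset_def')
qed

lemma coset_eq_iff: assumes "w \<in> W" "w' \<in> W" shows "coset w = coset w' \<longleftrightarrow> w \<ominus> w' \<in> U"
proof
  note c = ksubD(7)[OF kW]
  have "w \<in> coset w" using assms ksubD(2)[OF kU] c by (simp add: coset_iff)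
  then show "coset w = coset w' \<Longrightarrow> w \<ominus> w' \<in> U" using assms by (simp add: coset_iff)
  assume d: "w \<ominus> w' \<in> U"
  have "x \<ominus> w \<in> U \<longleftrightarrow> x \<ominus> w' \<in> U" if x: "x \<in> W" for x
  proof
    assume "x \<ominus> w \<in> U"
    from ksubD(3)[OF kU this d] show "x \<ominus> w' \<in> U" using c assms x by (simp add: diff_add_diff)
  next
    assume "x \<ominus> w' \<in> U"
    moreover have "\<ominus> (w \<ominus> w') \<in> U" using ksubD(5)[OF kU d] .
    ultimately have "(x \<ominus> w') \<oplus> \<ominus> (w \<ominus> w') \<in> U" by (rule ksubD(3)[OF kU])
    then show "x \<ominus> w \<in> U" using c assms x by (simp add: minus_diff diff_add_diff)
  qed
  then show "coset w = coset w'" using coset_iff assms by (intro Set.set_eqI) blast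
qed

lemma coset_U: assumes "w \<in> W" shows "coset w = U \<longleftrightarrow> w \<in> U"
proof -
  have "coset \<zero> = U"
    using ksubD(7)[OF kU] ksubD(2)[OF kW] UW by (auto simp: coset_iff subset_iff ksubD(7)[OF kW])
  then show ?thesis using coset_eq_iff[OF assms ksubD(2)[OF kW]] ksubD(7)[OF kW assms] by simp
qed

abbreviation "Q \<equiv> subquotient E W U"

lemma Q_carrier: "carrier Q = coset ` W" by (simp add: subquotient_def coset_def image_def)
lemma Q_zero: "zero Q = U" by (simp add: subquotient_def)

lemma Q_add: assumes "w \<in> W" "w' \<in> W" shows "coset w \<oplus>\<^bsub>Q\<^esub> coset w' = coset (w \<oplus> w')"
proof -
  note c = ksubD(7)[OF kW]
  have "coset w \<oplus>\<^bsub>Q\<^esub> coset w' = {x \<oplus> y | x y. x \<in> coset w \<and> y \<in> coset w'}"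
    by (auto simp: subquotient_def set_add_def')
  also have "\<dots> = coset (w \<oplus> w')"
  proof (intro equalityI subsetI)
    fix z assume "z \<in> {x \<oplus> y | x y. x \<in> coset w \<and> y \<in> coset w'}"
    then obtain x y where xy: "z = x \<oplus> y" "x \<in> W" "x \<ominus> w \<in> U" "y \<in> W" "y \<ominus> w' \<in> U"
      using assms by (auto simp: coset_iff)
    have "z \<ominus> (w \<oplus> w') = (x \<ominus> w) \<oplus> (y \<ominus> w')" using xy c assms by (simp add: add_diff_add)
    then show "z \<in> coset (w \<oplus> w')" using xy ksubD(3)[OF kW] ksubD(3)[OF kU] assms by (simp add: coset_iff)
  next
    fix z assume "z \<in> coset (w \<oplus> w')"
    then have z: "z \<in> W" "z \<ominus> (w \<oplus> w') \<in> U" using assms ksubD(3)[OF kW] by (auto simp: coset_iff)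
    have "z = (z \<ominus> w') \<oplus> w'" using z c assms by simp
    moreover have "(z \<ominus> w') \<ominus> w \<in> U" using z c assms by (simp add: diff_diff_eq a_comm)
    moreover have "z \<ominus> w' \<in> W" using ksubD(6)[OF kW] z assms by blast
    moreover have "w' \<in> coset w'" using assms ksubD(2)[OF kU] c by (simp add: coset_iff)
    ultimately show "z \<in> {x \<oplus> y | x y. x \<in> coset w \<and> y \<in> coset w'}" using assms coset_iff by blast
  qed
  finally show ?thesis .
qed

lemma coset_self: "w \<in> W \<Longrightarrow> w \<in> coset w"
  using ksubD(2)[OF kU] ksubD(7)[OF kW] by (simp add: coset_iff)

lemma Q_smult: assumes "w \<in> W" shows "h \<odot>\<^bsub>Q\<^esub> coset w = coset (h \<odot> w)"
proof -
  have "coset (h \<odot> x) = coset (h \<odot> w)" if "x \<in> coset w" for x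
  proof -
    have x: "x \<in> W" "x \<ominus> w \<in> U" using that assms coset_iff by auto
    have "h \<odot> (x \<ominus> w) \<in> U" by (rule ksubD(4)[OF kU x(2)])
    then have "h \<odot> x \<ominus> h \<odot> w \<in> U" using x(1) assms ksubD(7)[OF kW] by (simp add: smult_diff_right)
    then show ?thesis using coset_eq_iff ksubD(4)[OF kW] x(1) assms by simp
  qed
  then have "(\<Union>x\<in>coset w. coset (h \<odot> x)) = coset (h \<odot> w)"
    by (rule UN_eq_const[OF coset_self[OF assms]])
  then show ?thesis by (simp add: subquotient_def coset_def)
qed

lemma Q_opr: assumes "w \<in> W" shows "opr Q (coset w) = coset (opr E w)"
proof -
  have "coset (opr E x) = coset (opr E w)" if "x \<in> coset w" for x
  proof -
    have x: "x \<in> W" "x \<ominus> w \<in> U" using that assms coset_iff by auto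
    have "opr E (x \<ominus> w) \<in> U" using U x(2) by (simp add: stable_subspace_iff)
    then have "opr E x \<ominus> opr E w \<in> U" using x(1) assms ksubD(7)[OF kW] by (simp add: opr_diff)
    then show ?thesis using coset_eq_iff W x(1) assms by (simp add: stable_subspace_iff)
  qed
  then have "(\<Union>x\<in>coset w. coset (opr E x)) = coset (opr E w)"
    by (rule UN_eq_const[OF coset_self[OF assms]])
  then show ?thesis by (simp add: subquotient_def coset_def)
qed

lemma Q_vectorspace: "vectorspace class_ring Q"
proof -
  note W' = ksubD[OF kW]
  have z: "zero Q = coset \<zero>" using coset_U[OF W'(2)] ksubD(2)[OF kU] by (simp add: Q_zero)
  show ?thesis
  proof (rule vs_criteria)
    show "field (class_ring :: 'k fls ring)" by (rule class_field)
    show "\<forall>v\<in>carrier Q. \<exists>neg_v\<in>carrier Q. v \<oplus>\<^bsub>Q\<^esub> neg_v = \<zero>\<^bsub>Q\<^esub>"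
    proof
      fix v assume "v \<in> carrier Q"
      then obtain w where w: "w \<in> W" "v = coset w" by (auto simp: Q_carrier)
      then show "\<exists>neg_v\<in>carrier Q. v \<oplus>\<^bsub>Q\<^esub> neg_v = \<zero>\<^bsub>Q\<^esub>"
        using W'(5,7)[OF w(1)] by (intro bexI[of _ "coset (\<ominus> w)"]) (auto simp: Q_add Q_carrier z r_neg)
    qed
  qed (use W'(2,3,4,7) in \<open>auto simp: Q_carrier z Q_add Q_smult a_ac smult_add_left smult_add_right smult_smult\<close>)
qed

lemma stable_preimage:
  assumes S: "stable_subspace Q S"
  shows "stable_subspace E {w \<in> W. coset w \<in> S}" "U \<subseteq> {w \<in> W. coset w \<in> S}" "S = coset ` {w \<in> W. coset w \<in> S}"
proof -
  note W' = ksubD[OF kW]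
  have sub: "S \<subseteq> carrier Q" "\<zero>\<^bsub>Q\<^esub> \<in> S" "\<And>u v. u \<in> S \<Longrightarrow> v \<in> S \<Longrightarrow> u \<oplus>\<^bsub>Q\<^esub> v \<in> S"
    "\<And>h v. v \<in> S \<Longrightarrow> h \<odot>\<^bsub>Q\<^esub> v \<in> S" "\<And>v. v \<in> S \<Longrightarrow> opr Q v \<in> S"
    using S by (auto simp: stable_subspace_def VectorSpace.subspace_def LinearCombinations.submodule_def)
  show sU: "U \<subseteq> {w \<in> W. coset w \<in> S}"
  proof
    fix u assume "u \<in> U"
    then have "u \<in> W" "coset u = U" using UW coset_U[of u] by auto
    then show "u \<in> {w \<in> W. coset w \<in> S}" using sub(2) by (simp add: Q_zero)
  qed
  show "S = coset ` {w \<in> W. coset w \<in> S}" using sub(1) by (auto simp: Q_carrier)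
  have "w \<oplus> w' \<in> {w \<in> W. coset w \<in> S}" if "w \<in> W" "coset w \<in> S" "w' \<in> W" "coset w' \<in> S" for w w'
    using that sub(3)[of "coset w" "coset w'"] W'(3) by (simp add: Q_add)
  moreover have "h \<odot> w \<in> {w \<in> W. coset w \<in> S}" if "w \<in> W" "coset w \<in> S" for w h
    using that sub(4)[of "coset w" h] W'(4) by (simp add: Q_smult)
  moreover have "opr E w \<in> {w \<in> W. coset w \<in> S}" if "w \<in> W" "coset w \<in> S" for w
    using that sub(5)[of "coset w"] W by (simp add: Q_opr stable_subspace_iff)
  moreover have "\<zero> \<in> {w \<in> W. coset w \<in> S}"
    using sU ksubD(2)[OF kU] by blast
  ultimately show "stable_subspace E {w \<in> W. coset w \<in> S}"
    unfolding stable_subspace_iff ksub_def using W'(1) by blast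
qed

lemma stable_image:
  assumes S: "stable_subspace E S" and SW: "S \<subseteq> W"
  shows "stable_subspace Q (coset ` S)"
proof -
  have kS: "ksub S" and opS: "\<And>v. v \<in> S \<Longrightarrow> opr E v \<in> S" using S by (auto simp: stable_subspace_iff)
  note S' = ksubD[OF kS]
  have m: "Module.module class_ring Q" using Q_vectorspace by (simp add: vectorspace_def)
  have "\<zero>\<^bsub>Q\<^esub> = coset \<zero>" using coset_U[OF ksubD(2)[OF kW]] ksubD(2)[OF kU] by (simp add: Q_zero)
  moreover have "coset u \<oplus>\<^bsub>Q\<^esub> coset v \<in> coset ` S" if "u \<in> S" "v \<in> S" for u v
    using Q_add[of u v] S'(3)[OF that] that SW by auto
  moreover have "h \<odot>\<^bsub>Q\<^esub> coset v \<in> coset ` S" if "v \<in> S" for h v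
    using Q_smult[of v h] S'(4)[OF that] that SW by auto
  moreover have "opr Q (coset v) \<in> coset ` S" if "v \<in> S" for v
    using Q_opr[of v] opS[OF that] that SW by auto
  ultimately show ?thesis
    unfolding stable_subspace_def VectorSpace.subspace_def LinearCombinations.submodule_def
    using Q_vectorspace m S'(2) SW by (auto simp: Q_carrier)
qed

lemma op_irreducible_subquotient_iff: "op_irreducible Q \<longleftrightarrow> simple_pair W U"
proof
  assume irr: "op_irreducible Q"
  have ne: "U \<noteq> W"
  proof
    assume "U = W"
    then have "coset w = U" if "w \<in> W" for w using coset_U[OF that] that by simp
    then have "carrier Q = {U}" unfolding Q_carrier using ksubD(2)[OF kW] by auto
    then show False using irr by (simp add: op_irreducible_def Q_zero)
  qed
  have "S = U \<or> S = W" if S: "stable_subspace E S" "U \<subseteq> S" "S \<subseteq> W" for S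
  proof -
    note S' = ksubD[OF S(1)[unfolded stable_subspace_iff, THEN conjunct1]]
    have "coset ` S = {U} \<or> coset ` S = coset ` W"
      using irr stable_image[OF S(1,3)] by (simp add: op_irreducible_def Q_zero Q_carrier)
    then show ?thesis
    proof
      assume h: "coset ` S = {U}"
      have "s \<in> U" if "s \<in> S" for s using h that S(3) coset_U[of s] by blast
      then show ?thesis using S(2) by blast
    next
      assume h: "coset ` S = coset ` W"
      have "w \<in> S" if w: "w \<in> W" for w
      proof -
        obtain s where s: "s \<in> S" "coset w = coset s" using h w by blast
        then have "w \<ominus> s \<in> S" using coset_eq_iff[OF w, of s] S(2,3) by blast
        then have "(w \<ominus> s) \<oplus> s \<in> S" using S'(3) s(1) by blast
        then show ?thesis using w s(1) S'(7) ksubD(7)[OF kW] by simp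
      qed
      then show ?thesis using S(3) by blast
    qed
  qed
  then show "simple_pair W U" unfolding simple_pair_def using W U UW ne by blast
next
  assume sp: "simple_pair W U"
  then obtain w where w: "w \<in> W" "w \<notin> U" using UW by (auto simp: simple_pair_def)
  then have "coset w \<noteq> U" using coset_U by blast
  then have "carrier Q \<noteq> {\<zero>\<^bsub>Q\<^esub>}" using w(1) by (auto simp: Q_carrier Q_zero)
  moreover have "S = {\<zero>\<^bsub>Q\<^esub>} \<or> S = carrier Q" if S: "stable_subspace Q S" for S
  proof -
    note pre = stable_preimage[OF S]
    have "{w \<in> W. coset w \<in> S} = U \<or> {w \<in> W. coset w \<in> S} = W"
      using sp pre(1,2) unfolding simple_pair_def by blast
    then show ?thesis
    proof
      assume h: "{w \<in> W. coset w \<in> S} = U"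
      have "coset ` U = (\<lambda>_. U) ` U" using coset_U UW by (intro image_cong) auto
      also have "\<dots> = {U}" by (rule image_constant[OF ksubD(2)[OF kU]])
      finally have "coset ` U = {U}" .
      then show ?thesis using pre(3) h by (simp add: Q_zero)
    next
      assume "{w \<in> W. coset w \<in> S} = W"
      then show ?thesis using pre(3) by (simp add: Q_carrier)
    qed
  qed
  ultimately show "op_irreducible Q" by (simp add: op_irreducible_def)
qed

lemma op_isomorphic_subquotient_iff:
  fixes M :: "('k fls, 'k fls) op_module"
  assumes M: "carrier M = UNIV" "add M = (+)"
  shows "op_isomorphic Q M \<longleftrightarrow> (\<exists>\<pi>. model_map E W U M \<pi>)"
proof
  assume "op_isomorphic Q M"
  then obtain h where h: "h \<in> op_hom Q M" "bij_betw h (carrier Q) (carrier M)" by (auto simp: op_isomorphic_def)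
  have add: "h (coset u \<oplus>\<^bsub>Q\<^esub> coset v) = h (coset u) + h (coset v)" if "u \<in> W" "v \<in> W" for u v
    using h(1) that M by (auto simp: op_hom_def LinearCombinations.module_hom_def Q_carrier)
  have smult: "h (c \<odot>\<^bsub>Q\<^esub> coset v) = c \<odot>\<^bsub>M\<^esub> h (coset v)" if "v \<in> W" for c v
    using h(1) that M by (auto simp: op_hom_def LinearCombinations.module_hom_def Q_carrier)
  have opr: "h (opr Q (coset v)) = opr M (h (coset v))" if "v \<in> W" for v
    using h(1) that M by (auto simp: op_hom_def Q_carrier)
  have zW: "\<zero> \<in> W" by (rule ksubD(2)[OF kW])
  have "h (coset \<zero>) = 0" using add[OF zW zW] Q_add[OF zW zW] by simp
  moreover have "coset \<zero> = U" using coset_U[OF zW] ksubD(2)[OF kU] by simp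
  ultimately have hU: "h U = 0" by simp
  have ker: "h (coset w) = 0 \<longleftrightarrow> w \<in> U" if w: "w \<in> W" for w
  proof
    assume "h (coset w) = 0"
    then have "h (coset w) = h (coset \<zero>)" using \<open>h (coset \<zero>) = 0\<close> by simp
    then have "coset w = coset \<zero>" using h(2) w zW unfolding bij_betw_def inj_on_def Q_carrier by blast
    then show "w \<in> U" using coset_U[OF w] \<open>coset \<zero> = U\<close> by simp
  qed (use coset_U[OF w] hU in simp)
  have surj: "\<exists>w\<in>W. h (coset w) = y" for y
    using h(2) M(1) unfolding bij_betw_def Q_carrier by (metis UNIV_I imageE)
  show "\<exists>\<pi>. model_map E W U M \<pi>"
    unfolding model_map_def
    by (rule exI[of _ "\<lambda>w. h (coset w)"])
      (use add smult opr ker surj Q_add Q_smult Q_opr in simp)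
next
  assume "\<exists>\<pi>. model_map E W U M \<pi>"
  then obtain \<pi> where \<pi>: "model_map E W U M \<pi>" by blast
  note m = model_mapD[OF \<pi>]
  have diff: "\<pi> w = \<pi> w' \<longleftrightarrow> w \<ominus> w' \<in> U" if w: "w \<in> W" "w' \<in> W" for w w'
  proof -
    have d: "w \<ominus> w' \<in> W" by (rule ksubD(6)[OF kW w])
    have "\<pi> w = \<pi> (w \<ominus> w') + \<pi> w'" using m(1)[OF d w(2)] w ksubD(7)[OF kW] by simp
    then show ?thesis using m(4)[OF d] by auto
  qed
  define l where "l X = (SOME w. w \<in> W \<and> coset w = X)" for X
  have l: "l (coset w) \<in> W" "coset (l (coset w)) = coset w" if "w \<in> W" for w
    using someI_ex[of "\<lambda>x. x \<in> W \<and> coset x = coset w"] that unfolding l_def by blast+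
  define h where "h = restrict (\<lambda>X. \<pi> (l X)) (carrier Q)"
  have h: "h (coset w) = \<pi> w" if "w \<in> W" for w
    using that l[OF that] diff[OF l(1)[OF that] that] coset_eq_iff[OF l(1)[OF that] that]
    by (simp add: h_def Q_carrier)
  have cl: "u \<oplus> v \<in> W" "c \<odot> v \<in> W" "opr E v \<in> W" if "u \<in> W" "v \<in> W" for u v c
    using that ksubD(3,4)[OF kW] W by (auto simp: stable_subspace_iff)
  have "h \<in> op_hom Q M"
    unfolding op_hom_def LinearCombinations.module_hom_def
    using M by (auto simp: Q_carrier h Q_add Q_smult Q_opr cl m) (auto simp: h_def Q_carrier)
  moreover have "bij_betw h (carrier Q) (carrier M)"
    unfolding bij_betw_def
  proof
    show "inj_on h (carrier Q)"
      by (auto simp: inj_on_def Q_carrier h diff coset_eq_iff)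
    show "h ` carrier Q = carrier M"
    proof -
      have "y \<in> h ` carrier Q" for y
      proof -
        obtain w where "w \<in> W" "\<pi> w = y" using m(3) by blast
        then show ?thesis using h[of w] unfolding Q_carrier
          by (intro image_eqI[of _ _ "coset w"] imageI) simp_all
      qed
      then show ?thesis using M(1) by blast
    qed
  qed
  ultimately show "op_isomorphic Q M" by (auto simp: op_isomorphic_def)
qed

end

text \<open>The conditions on irreducible components that define the two categories only speak of stable
  subspaces and model maps, so they can be transported along the transform.\<close>

lemma irreducible_components_models:
  fixes \<M> :: "('k fls, 'k fls) op_module set"
  assumes M: "\<And>M. M \<in> \<M> \<Longrightarrow> carrier M = UNIV \<and> add M = (+)"
  shows "(\<forall>L\<in>irreducible_components E. \<exists>M\<in>\<M>. op_isomorphic L M) \<longleftrightarrow>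
    (\<forall>W U. simple_pair W U \<longrightarrow> (\<exists>M\<in>\<M>. \<exists>\<pi>. model_map E W U M \<pi>))"
proof -
  have D: "stable_subspace E W \<and> stable_subspace E U \<and> U \<subseteq> W" if "simple_pair W U" for W U
    using that by (simp add: simple_pair_def)
  have eq: "simple_pair W U \<longleftrightarrow> stable_subspace E U \<and> stable_subspace E W \<and> U \<subseteq> W \<and>
      op_irreducible (subquotient E W U)" for W U
    using op_irreducible_subquotient_iff[of W U] D[of W U] by blast
  have A: "L \<in> irreducible_components E \<longleftrightarrow> (\<exists>W U. L = subquotient E W U \<and> simple_pair W U)" for L
    unfolding irreducible_components_def eq by blast
  have B: "(\<exists>M\<in>\<M>. op_isomorphic (subquotient E W U) M) \<longleftrightarrow> (\<exists>M\<in>\<M>. \<exists>\<pi>. model_map E W U M \<pi>)"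
    if "simple_pair W U" for W U
    using op_isomorphic_subquotient_iff[of W U] M D[OF that] by blast
  show ?thesis
  proof (intro iffI allI impI ballI)
    fix W U assume l: "\<forall>L\<in>irreducible_components E. \<exists>M\<in>\<M>. op_isomorphic L M" and sp: "simple_pair W U"
    have "subquotient E W U \<in> irreducible_components E" using A sp by blast
    then show "\<exists>M\<in>\<M>. \<exists>\<pi>. model_map E W U M \<pi>" using l B[OF sp] by simp
  next
    fix L assume r: "\<forall>W U. simple_pair W U \<longrightarrow> (\<exists>M\<in>\<M>. \<exists>\<pi>. model_map E W U M \<pi>)"
      and "L \<in> irreducible_components E"
    then obtain W U where L: "L = subquotient E W U" and sp: "simple_pair W U" using A by blast
    show "\<exists>M\<in>\<M>. op_isomorphic L M" unfolding L B[OF sp] using r sp by blast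
  qed
qed

text \<open>Existence of a composition series. Among the stable subspaces that have one, \<open>U\<close> is a maximal one;
  if it is not the whole space, a minimal stable subspace above it gives an extension.\<close>

lemma filtered_by_carrier:
  fixes \<M> :: "('k fls, 'k fls) op_module set"
  assumes fg: "fg (carrier E)"
    and models: "\<And>W U. simple_pair W U \<Longrightarrow> \<exists>M\<in>\<M>. \<exists>\<pi>. model_map E W U M \<pi>"
  shows "filtered_by E \<M> (carrier E)"
proof (rule ccontr)
  assume no: "\<not> filtered_by E \<M> (carrier E)"
  obtain \<mu> :: "'v set \<Rightarrow> nat" and k where
    \<mu>: "\<And>S S'. ksub S \<Longrightarrow> ksub S' \<Longrightarrow> S \<subset> S' \<Longrightarrow> S' \<subseteq> carrier E \<Longrightarrow> \<mu> S < \<mu> S' \<and> \<mu> S' \<le> k"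
    using fg_length[OF fg] by blast
  define P where "P U \<longleftrightarrow> filtered_by E \<M> U \<and> stable_subspace E U" for U
  have st0: "stable_subspace E {\<zero>}" and stE: "stable_subspace E (carrier E)"
    using ksub_zero ksub_carrier opr_zero opr_closed by (auto simp: stable_subspace_iff)
  have "P {\<zero>}" using st0 by (simp add: P_def filtered_by.zero)
  moreover have "\<forall>U. P U \<longrightarrow> \<mu> U < Suc (max k (\<mu> {\<zero>}))"
  proof (intro allI impI)
    fix U assume "P U"
    then have U: "ksub U" by (simp add: P_def stable_subspace_iff)
    show "\<mu> U < Suc (max k (\<mu> {\<zero>}))"
    proof (cases "U = {\<zero>}")
      case False
      then have "{\<zero>} \<subset> U" using ksubD(2)[OF U] by blast
      then show ?thesis using \<mu>[OF ksub_zero U _ ksubD(1)[OF U]] by simp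
    qed simp
  qed
  ultimately obtain U where U: "P U" and max: "\<And>U'. P U' \<Longrightarrow> \<mu> U' \<le> \<mu> U"
    using ex_has_greatest_nat[of P "{\<zero>}" \<mu> "Suc (max k (\<mu> {\<zero>}))"] by blast
  have stU: "stable_subspace E U" "ksub U" "U \<noteq> carrier E" "U \<subseteq> carrier E"
    using U no ksubD(1) by (auto simp: P_def stable_subspace_iff)
  define R where "R W \<longleftrightarrow> stable_subspace E W \<and> U \<subset> W" for W
  have "R (carrier E)" using stE stU by (auto simp: R_def)
  then obtain W where W: "R W" and min: "\<And>W'. R W' \<Longrightarrow> \<mu> W \<le> \<mu> W'"
    using ex_has_least_nat[of R "carrier E" \<mu>] by blast
  have stW: "stable_subspace E W" "ksub W" "U \<subset> W" using W by (auto simp: R_def stable_subspace_iff)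
  have "simple_pair W U"
    unfolding simple_pair_def
  proof (intro conjI allI impI)
    fix S assume S: "stable_subspace E S" "U \<subseteq> S" "S \<subseteq> W"
    show "S = U \<or> S = W"
    proof (rule ccontr)
      assume "\<not> (S = U \<or> S = W)"
      then have "U \<subset> S" "S \<subset> W" using S by auto
      then show False
        using min[of S] S(1) \<mu>[of S W] stW ksubD(1)[OF stW(2)] by (auto simp: R_def stable_subspace_iff)
    qed
  qed (use stW stU in auto)
  then obtain M \<pi> where "M \<in> \<M>" "model_map E W U M \<pi>" using models by blast
  then have "P W" using U stW unfolding P_def by (auto intro: filtered_by.step)
  then show False using max[of W] \<mu>[OF stU(2) stW(2,3) ksubD(1)[OF stW(2)]] by simp
qed

end

section \<open>Functoriality and involutivity of the exchange\<close>

context mellin_pair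
begin

lemma P_unique:
  assumes "\<And>v n. v \<in> carrier E \<Longrightarrow> Q n v \<in> carrier E" "\<And>v. v \<in> carrier E \<Longrightarrow> Q 0 v = v"
    "\<And>v n. v \<in> carrier E \<Longrightarrow> T (Q (n + 1) v) = Q n v" and v: "v \<in> carrier E"
  shows "Q n v = P n v"
proof (induction n rule: int_induct[where k = 0])
  case base
  then show ?case using assms(2) v by (simp add: P_0)
next
  case (step1 n)
  have "T (Q (n + 1) v) = T (P (n + 1) v)" using assms(3)[OF v] T_P[OF v] step1 by simp
  then show ?case by (rule T_inj[rotated 2]) (use assms(1) v in simp_all)
next
  case (step2 n)
  show ?case using assms(3)[OF v, of "n - 1"] T_P[OF v, of "n - 1"] step2 by simp
qed

text \<open>In contrast to \<open>F_in_G\<close>, \<open>m\<close> is given here.\<close>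

lemma F_sub_G: "\<exists>n. F m \<subseteq> G n"
proof -
  obtain l where l: "F l \<subseteq> G 0" using F_in_G by blast
  define r where "r = nat (l - m)"
  have "v \<in> G (- int (Suc N * r))" if v: "v \<in> F m" for v
  proof -
    have vc: "v \<in> carrier E" by (rule F_carrier[OF v])
    define w where "w = P (int (Suc N * r)) v"
    have w: "w \<in> carrier E" unfolding w_def by (rule P_closed[OF vc])
    have "(T ^^ (Suc N * r)) w = v"
      using P_neg[OF w, of "Suc N * r"] by (simp only: w_def P_P[OF vc] P_0[OF vc] add.left_inverse)
    then have "w \<in> F (m + int r)" using TNj_F[OF w, of r m] v by simp
    then have "w \<in> F l" by (rule F_mono) (simp add: r_def)
    then have "w \<in> G (- int (Suc N * r) + int (Suc N * r))" using l by auto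
    then show ?thesis using G_P[OF vc, of "int (Suc N * r)" "- int (Suc N * r)"] by (simp only: w_def)
  qed
  then show ?thesis by blast
qed

lemma act_const: "v \<in> carrier E \<Longrightarrow> act (fls_const c) v = fls_const c \<odot> v"
  using act_const_left[of v c 1] act_one[of v] by simp

lemma act_minus: "v \<in> carrier E \<Longrightarrow> act h (\<ominus> v) = \<ominus> act h v"
proof -
  interpret E': fls_space "twist (\<lambda>v. v)" by (rule fls_space_twist)
  show "v \<in> carrier E \<Longrightarrow> act h (\<ominus> v) = \<ominus> act h v" using E'.smult_minus_right[of v h] by simp
qed

lemma act_X_inv: "v \<in> carrier E \<Longrightarrow> act fls_X_inv v = T v"
  using act_X[of v "- 1"] P_neg[of v 1] by (simp add: fls_X_inv_conv_shift_1)

lemma act_X1: "v \<in> carrier E \<Longrightarrow> act fls_X v = P 1 v"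
  using act_X[of v 1] by (simp add: fls_X_conv_shift_1)

end

text \<open>A linear map that commutes with \<open>T\<close> commutes with all powers of \<open>T\<close>, and it is continuous because a
  linear map on a finite-dimensional space is.\<close>

lemma hom_act:
  assumes A: "mellin_pair E T a d P F N" and B: "mellin_pair E2 T2 a2 d2 P2 F2 N2"
    and f: "\<And>v. v \<in> carrier E \<Longrightarrow> f v \<in> carrier E2"
      "\<And>u v. u \<in> carrier E \<Longrightarrow> v \<in> carrier E \<Longrightarrow> f (u \<oplus>\<^bsub>E\<^esub> v) = f u \<oplus>\<^bsub>E2\<^esub> f v"
      "\<And>h v. v \<in> carrier E \<Longrightarrow> f (h \<odot>\<^bsub>E\<^esub> v) = h \<odot>\<^bsub>E2\<^esub> f v"
      "\<And>v. v \<in> carrier E \<Longrightarrow> f (T v) = T2 (f v)"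
    and v: "v \<in> carrier E"
  shows "f (P n v) = P2 n (f v)" "f (series_smult E P h v) = series_smult E2 P2 h (f v)"
proof -
  interpret A: mellin_pair E T a d P F N by (rule A)
  interpret B: mellin_pair E2 T2 a2 d2 P2 F2 N2 by (rule B)
  have fP: "f (P n v) = P2 n (f v)" if v: "v \<in> carrier E" for n v
  proof (induction n rule: int_induct[where k = 0])
    case base
    then show ?case using v f(1) by (simp add: A.P_0 B.P_0)
  next
    case (step1 n)
    have "T2 (f (P (n + 1) v)) = T2 (P2 (n + 1) (f v))"
      using f(1,4) v step1 A.T_P[OF v] B.T_P[OF f(1)[OF v]] by (simp flip: f(4))
    then show ?case by (rule B.T_inj[rotated 2]) (use f(1) v in simp_all)
  next
    case (step2 n)
    have "f (P (n - 1) v) = f (T (P n v))" using A.T_P[OF v, of "n - 1"] by simp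
    also have "\<dots> = P2 (n - 1) (f v)" using f(4) v step2 B.T_P[OF f(1)[OF v], of "n - 1"] by simp
    finally show ?case .
  qed
  show "f (P n v) = P2 n (f v)" by (rule fP[OF v])
  have z: "f \<zero>\<^bsub>E\<^esub> = \<zero>\<^bsub>E2\<^esub>" using f(3)[of "\<zero>\<^bsub>E\<^esub>" 0] f(1)[of "\<zero>\<^bsub>E\<^esub>"] by simp
  have "A.osub {v \<in> carrier E. f v \<in> F2 0}"
    unfolding A.osub_def using f(1-3) z B.F_zero
    by (auto intro: B.F_add B.osubD(4)[OF B.F_osub])
  moreover have "\<exists>m. fls_X_intpow m \<odot>\<^bsub>E\<^esub> v \<in> {v \<in> carrier E. f v \<in> F2 0}" if v: "v \<in> carrier E" for v
  proof -
    obtain j where "f v \<in> F2 j" using B.F_exhaustive f(1) v by blast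
    then have "fls_X_intpow (- j) \<odot>\<^bsub>E2\<^esub> f v \<in> F2 0" using B.F_shift[of "f v" "- j" j] f(1) v by simp
    then show ?thesis using f(3) v by (intro exI[of _ "- j"]) simp
  qed
  ultimately obtain m where m: "\<And>v. v \<in> carrier E \<Longrightarrow> v \<in> F m \<Longrightarrow> v \<in> {v \<in> carrier E. f v \<in> F2 0}"
    using A.fg_open[OF A.fg_carrier order_refl] by metis
  have F0: "f v \<in> F2 (- m)" if v: "v \<in> F 0" for v
  proof -
    have vc: "v \<in> carrier E" by (rule A.F_carrier[OF v])
    have "fls_X_intpow m \<odot>\<^bsub>E\<^esub> v \<in> F m" using A.F_smult[OF ord_ge_X_intpow v, of m] by simp
    then have "fls_X_intpow m \<odot>\<^bsub>E2\<^esub> f v \<in> F2 0" using m[of "fls_X_intpow m \<odot>\<^bsub>E\<^esub> v"] vc f(3) by simp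
    then show ?thesis using B.F_shift[of "f v" m "- m"] f(1) vc by simp
  qed
  obtain c where c: "F2 (- m) \<subseteq> B.G c" using B.F_sub_G by blast
  have fG: "f u \<in> B.G (n + c)" if u: "u \<in> A.G n" for u n
  proof -
    have uc: "u \<in> carrier E" by (rule A.G_carrier[OF u])
    have "P2 (- n) (f u) \<in> F2 (- m)" using F0[of "P (- n) u"] u fP[OF uc] by (simp add: A.G_def)
    then have "P2 (- n) (f u) \<in> B.G (n + c + - n)" using c by auto
    then show ?thesis using B.G_P[of "f u" "- n" "n + c"] f(1)[OF uc] by simp
  qed
  obtain j where j: "v \<in> A.G j" using A.G_exhaustive[OF v] by blast
  have "f (A.act h v) = B.act h (f v)"
  proof (rule B.act_unique[where c = "j + c"])
    show "f v \<in> carrier E2" by (rule f(1)[OF v])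
    show "f (A.act h v) \<in> carrier E2" for h using f(1) v by simp
    show "f (A.act (g + h) v) = f (A.act g v) \<oplus>\<^bsub>E2\<^esub> f (A.act h v)" for g h
      using f(2) v by (simp add: A.act_add_left)
    show "f (A.act (fls_const b * h) v) = fls_const b \<odot>\<^bsub>E2\<^esub> f (A.act h v)" for b h
      using f(3) v by (simp add: A.act_const_left)
    show "f (A.act (fls_X_intpow n) v) = P2 n (f v)" for n using fP v A.act_X[OF v] by simp
    show "f (A.act h v) \<in> B.G (n + (j + c))" if "ord_ge n h" for n h
      using fG[OF A.act_G[OF j that]] by (simp add: add.assoc)
  qed
  then show "f (series_smult E P h v) = series_smult E2 P2 h (f v)" by (simp add: A.act_def B.act_def)
qed

text \<open>Performing the exchange of scalars twice. The new variable of the second step is the inverse of \<open>X^(- 1)\<close>, so its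
  powers are those of \<open>X\<close>; the original scalar multiplication is continuous for the topology,
  which has not changed, and uniqueness applies.\<close>

lemma double_twist:
  fixes E :: "('k::field_char_0 fls, 'v) op_module"
  assumes A: "mellin_pair E T a d P F N" and B: "mellin_pair (mellin_pair.twist E P R) T2 a2 d2 P2 F2 N2"
    and T2: "\<And>v. v \<in> carrier E \<Longrightarrow> T2 v = fls_X_inv \<odot>\<^bsub>E\<^esub> v" and v: "v \<in> carrier E"
  shows "P2 n v = fls_X_intpow n \<odot>\<^bsub>E\<^esub> v" "series_smult (mellin_pair.twist E P R) P2 h v = h \<odot>\<^bsub>E\<^esub> v"
proof -
  interpret A: mellin_pair E T a d P F N by (rule A)
  interpret B: mellin_pair "A.twist R" T2 a2 d2 P2 F2 N2 by (rule B)
  interpret G: filtration "A.twist R" "carrier E" A.G by (rule A.filtration_twist)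
  have mono: "fls_X_intpow n \<odot>\<^bsub>E\<^esub> v = P2 n v" if "v \<in> carrier E" for n v
  proof (rule B.P_unique)
    show "v \<in> carrier (A.twist R)" using that by simp
    show "fls_X_intpow n \<odot>\<^bsub>E\<^esub> v \<in> carrier (A.twist R)" if "v \<in> carrier (A.twist R)" for v n using that by simp
    show "fls_X_intpow 0 \<odot>\<^bsub>E\<^esub> v = v" if "v \<in> carrier (A.twist R)" for v using that by simp
    show "T2 (fls_X_intpow (n + 1) \<odot>\<^bsub>E\<^esub> v) = fls_X_intpow n \<odot>\<^bsub>E\<^esub> v" if "v \<in> carrier (A.twist R)" for v n
    proof -
      have "fls_X_inv * fls_X_intpow (n + 1) = (fls_X_intpow n :: 'k fls)"
        by (rule fls_eqI) (auto simp: fls_X_inv_times_conv_shift)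
      then show ?thesis using that by (simp add: T2 A.smult_smult del: fls_shift_fls_shift)
    qed
  qed
  then show P2: "P2 n v = fls_X_intpow n \<odot>\<^bsub>E\<^esub> v" for n using v by simp
  obtain i where i: "v \<in> F i" using A.F_exhaustive v by blast
  obtain k where k: "F i \<subseteq> A.G k" using A.F_sub_G by blast
  have "\<exists>m. fls_X_intpow m \<odot>\<^bsub>A.twist R\<^esub> u \<in> F2 0" if u: "u \<in> carrier E" for u
  proof -
    obtain j where j: "u \<in> F2 j" using B.F_exhaustive u by auto
    show ?thesis using B.F_smult[OF ord_ge_X_intpow j, of "- j"] by (intro exI[of _ "- j"]) simp
  qed
  then obtain m where m: "\<And>u. u \<in> carrier E \<Longrightarrow> u \<in> A.G m \<Longrightarrow> u \<in> F2 0"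
    using G.fg_open[OF _ order_refl B.F_osub] B.fg_carrier by (metis A.twist_sel(1))
  have G0: "u \<in> F2 (k - m)" if u: "u \<in> A.G k" for u
  proof -
    have uc: "u \<in> carrier E" by (rule A.G_carrier[OF u])
    have "P (m - k) u \<in> A.G m" using A.G_P[OF uc, of "m - k" k] u by simp
    then have "P (m - k) u \<in> F2 0" using m uc by simp
    then have "fls_X_intpow (m - k) \<odot>\<^bsub>A.twist R\<^esub> u \<in> F2 (k - m + (m - k))"
      using A.act_X[OF uc, of "m - k"] by simp
    then show ?thesis using B.F_shift[of u "m - k" "k - m"] uc by simp
  qed
  obtain c where c: "F2 (k - m) \<subseteq> B.G c" using B.F_sub_G by blast
  have "h \<odot>\<^bsub>E\<^esub> v = B.act h v"
  proof (rule B.act_unique[where c = c])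
    show "v \<in> carrier (A.twist R)" using v by simp
    show "h \<odot>\<^bsub>E\<^esub> v \<in> carrier (A.twist R)" for h using v by simp
    show "(g + h) \<odot>\<^bsub>E\<^esub> v = g \<odot>\<^bsub>E\<^esub> v \<oplus>\<^bsub>A.twist R\<^esub> h \<odot>\<^bsub>E\<^esub> v" for g h
      using v by (simp add: A.smult_add_left)
    show "(fls_const b * h) \<odot>\<^bsub>E\<^esub> v = fls_const b \<odot>\<^bsub>A.twist R\<^esub> (h \<odot>\<^bsub>E\<^esub> v)" for b h
      using v by (simp add: A.act_const A.smult_smult)
    show "fls_X_intpow n \<odot>\<^bsub>E\<^esub> v = P2 n v" for n by (simp only: P2)
    show "h \<odot>\<^bsub>E\<^esub> v \<in> B.G (n + c)" if h: "ord_ge n h" for n h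
    proof -
      have hv: "h \<odot>\<^bsub>E\<^esub> v \<in> carrier (A.twist R)" using v by simp
      have "fls_X_intpow (- n) * h = fls_shift n h"
        using fls_X_intpow_times_conv_shift(1)[of "- n" h] by simp
      then have "P2 (- n) (h \<odot>\<^bsub>E\<^esub> v) = fls_shift n h \<odot>\<^bsub>E\<^esub> v"
        using mono[of "h \<odot>\<^bsub>E\<^esub> v" "- n"] v by (simp add: A.smult_smult)
      moreover have "fls_shift n h \<odot>\<^bsub>E\<^esub> v \<in> F i"
        using h by (intro fls_space.osubD(4)[OF A.fls_space_axioms A.F_osub _ i]) simp
      ultimately have "P2 (- n) (h \<odot>\<^bsub>E\<^esub> v) \<in> B.G (n + c + - n)" using k G0 c by auto
      then show ?thesis using B.G_P[OF hv, of "- n" "n + c"] by simp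
    qed
  qed
  then show "series_smult (A.twist R) P2 h v = h \<odot>\<^bsub>E\<^esub> v" by (simp add: B.act_def)
qed

section \<open>Powers of the inverse operator\<close>

definition iter_power :: "('v \<Rightarrow> 'v) \<Rightarrow> ('v \<Rightarrow> 'v) \<Rightarrow> int \<Rightarrow> 'v \<Rightarrow> 'v" where
  "iter_power X T n = (if n \<ge> 0 then X ^^ nat n else T ^^ nat (- n))"

lemma (in semilinear_space) mellin_pair_exists:
  assumes shift_filtered: "shift_filtered (carrier E)" and X: "\<And>v. v \<in> carrier E \<Longrightarrow> X v \<in> carrier E" "\<And>v. v \<in> carrier E \<Longrightarrow> T (X v) = v"
  shows "\<exists>F N. mellin_pair E T a d (iter_power X T) F N"
proof -
  obtain F N where FN: "contracting (carrier E) F N" using shift_filtered_contracting[OF shift_filtered] by blast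
  have XT: "(X ^^ k) v \<in> carrier E" "(T ^^ k) v \<in> carrier E" if "v \<in> carrier E" for v k
    using that X(1) by (induction k) auto
  have "mellin_pair E T a d (iter_power X T) F N"
  proof (unfold_locales)
    show "shift_filtered (carrier E)" "contracting (carrier E) F N" by (fact shift_filtered FN)+
    fix v n assume v: "v \<in> carrier E"
    show "iter_power X T 0 v = v" by (simp add: iter_power_def)
    show "iter_power X T n v \<in> carrier E" using XT v by (simp add: iter_power_def)
    show "T (iter_power X T (n + 1) v) = iter_power X T n v"
    proof (cases "n \<ge> 0")
      case True
      then have "nat (n + 1) = Suc (nat n)" by simp
      then show ?thesis using True XT(1)[OF v] X(2) by (simp add: iter_power_def)
    next
      case False
      show ?thesis
      proof (cases "n = -1")
        case True
        then show ?thesis by (simp add: iter_power_def)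
      next
        case ne: False
        then have "nat (- n) = Suc (nat (- (n + 1)))" using False by simp
        then show ?thesis using False ne by (simp add: iter_power_def)
      qed
    qed
  qed
  then show ?thesis by blast
qed

lemma (in semilinear_space) T_bij:
  assumes shift_filtered: "shift_filtered (carrier E)"
  shows "inj_on T (carrier E)" "T ` carrier E = carrier E"
proof -
  show "inj_on T (carrier E)"
  proof (rule inj_onI)
    fix u v assume uv: "u \<in> carrier E" "v \<in> carrier E" "T u = T v"
    then have "u \<ominus> v = \<zero>" using shift_filtered_inj[OF shift_filtered, of "u \<ominus> v"] by (simp add: T_diff)
    then show "u = v" using uv by (simp add: diff_eq_zero_iff)
  qed
  show "T ` carrier E = carrier E"
  proof
    show "carrier E \<subseteq> T ` carrier E"
      using shift_filtered_surj[OF shift_filtered shift_filtered_stable[OF shift_filtered]] by blast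
  qed auto
qed

lemma fls_spaceI: "vectorspace class_ring E \<Longrightarrow> fls_space E"
  by (simp add: fls_space_def fls_space_axioms_def vectorspace_def Module.module_def)

context mellin_pair
begin

lemma twist_filtered:
  assumes "filtered_by E \<M> W"
    and st: "\<And>S. stable_subspace E S \<Longrightarrow> stable S \<and> stable_subspace (twist R) S"
    and tr: "\<And>W U M \<pi>. stable W \<Longrightarrow> stable U \<Longrightarrow> U \<subseteq> W \<Longrightarrow> M \<in> \<M> \<Longrightarrow> model_map E W U M \<pi> \<Longrightarrow>
      \<exists>M'\<in>\<M>'. \<exists>\<pi>'. model_map (twist R) W U M' \<pi>'"
  shows "filtered_by (twist R) \<M>' W"
  using assms(1)
proof (induction rule: filtered_by.induct)
  case zero
  then show ?case using filtered_by.zero[of "twist R" \<M>'] by simp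
next
  case (step U W M \<pi>)
  then obtain M' \<pi>' where "M' \<in> \<M>'" "model_map (twist R) W U M' \<pi>'" using tr st by meson
  then show ?case using step st filtered_by.step by meson
qed

lemma stable_twist_stable_subspace:
  assumes "stable S" "\<And>v. v \<in> S \<Longrightarrow> R v \<in> S"
  shows "stable_subspace (twist R) S"
  using stable_twist_ksub[OF assms(1), of R] fls_space.ksub_iff_subspace[OF fls_space_twist] assms(2)
  by (auto simp: stable_subspace_def)

end

section \<open>Connections\<close>

definition T_conn :: "('k::field_char_0 fls, 'v) op_module \<Rightarrow> 'v \<Rightarrow> 'v" where
  "T_conn E v = \<ominus>\<^bsub>E\<^esub> z_nabla E v"

lemma X_inv_d_dz: "fls_X_inv * d_dz h = - (fls_X * fls_deriv h)"
proof -
  have "fls_X_inv * (fls_X ^ 2 * fls_deriv h) = (fls_X_inv * fls_X) * (fls_X * fls_deriv h)"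
    by (simp add: power2_eq_square mult.assoc)
  then show ?thesis by (simp add: d_dz_def)
qed

lemma ord_ge_euler: "ord_ge n h \<Longrightarrow> ord_ge n (fls_X * fls_deriv h :: 'k::field_char_0 fls)"
  unfolding ord_ge_def by (simp add: fls_X_times_conv_shift)

context
  fixes E :: "('k::field_char_0 fls, 'v) op_module" (structure)
  assumes conn: "connection_at_infinity E"
begin

lemma conn_fls_space: "fls_space E"
  using conn by (intro fls_spaceI) (simp add: connection_at_infinity_def)

lemma conn_fg: "fls_space.fg E (carrier E)"
  using conn fls_space.fin_dim_iff_fg[OF conn_fls_space]
  by (simp add: connection_at_infinity_def connection_at_infinity_axioms_def)

lemma conn_opr:
  "v \<in> carrier E \<Longrightarrow> opr E v \<in> carrier E"
  "u \<in> carrier E \<Longrightarrow> v \<in> carrier E \<Longrightarrow> opr E (u \<oplus> v) = opr E u \<oplus> opr E v"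
  "v \<in> carrier E \<Longrightarrow> opr E (h \<odot> v) = h \<odot> opr E v \<oplus> d_dz h \<odot> v"
  using conn by (auto simp: connection_at_infinity_def connection_at_infinity_axioms_def const_linear_def)

lemma conn_op_space: "op_space E"
  using conn_fls_space conn_opr by (simp add: op_space_def op_space_axioms_def)

lemma conn_semilinear: "semilinear_space E (T_conn E) (\<lambda>h. h) (\<lambda>h. fls_X * fls_deriv h)"
proof -
  interpret fls_space E by (rule conn_fls_space)
  show ?thesis
  proof
    show "fg (carrier E)" by (rule conn_fg)
    fix u v h assume v: "v \<in> carrier E"
    show "T_conn E v \<in> carrier E" using v conn_opr(1) by (simp add: T_conn_def z_nabla_def)
    show "T_conn E (u \<oplus> v) = T_conn E u \<oplus> T_conn E v" if "u \<in> carrier E"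
      using that v conn_opr(1,2) by (simp add: T_conn_def z_nabla_def smult_add_right minus_add)
    have "T_conn E (h \<odot> v) = \<ominus> ((fls_X_inv * h) \<odot> opr E v \<oplus> (fls_X_inv * d_dz h) \<odot> v)"
      using v conn_opr(1,3) by (simp add: T_conn_def z_nabla_def smult_add_right smult_smult)
    also have "\<dots> = h \<odot> T_conn E v \<oplus> (fls_X * fls_deriv h) \<odot> v"
      using v conn_opr(1)
      by (simp add: T_conn_def z_nabla_def X_inv_d_dz smult_minus_left smult_minus_right smult_smult minus_add mult.commute)
    finally show "T_conn E (h \<odot> v) = h \<odot> T_conn E v \<oplus> (fls_X * fls_deriv h) \<odot> v" .
  qed (auto intro: ord_ge_euler)
qed

lemma conn_opr_eq: "v \<in> carrier E \<Longrightarrow> opr E v = \<ominus> (fls_X \<odot> T_conn E v)"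
proof -
  interpret fls_space E by (rule conn_fls_space)
  assume v: "v \<in> carrier E"
  show ?thesis using v conn_opr(1) by (simp add: T_conn_def z_nabla_def smult_minus_right)
qed

lemma conn_stable_iff: "semilinear_space.stable E (T_conn E) S \<longleftrightarrow> stable_subspace E S"
proof -
  interpret semilinear_space E "T_conn E" "\<lambda>h. h" "\<lambda>h. fls_X * fls_deriv h" by (rule conn_semilinear)
  have "(\<forall>v\<in>S. T_conn E v \<in> S) \<longleftrightarrow> (\<forall>v\<in>S. opr E v \<in> S)" if S: "ksub S"
  proof
    assume "\<forall>v\<in>S. T_conn E v \<in> S"
    then show "\<forall>v\<in>S. opr E v \<in> S" using ksubD(4,5,7)[OF S] by (simp add: conn_opr_eq)
  next
    assume "\<forall>v\<in>S. opr E v \<in> S"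
    then show "\<forall>v\<in>S. T_conn E v \<in> S" using ksubD(4,5,7)[OF S] by (simp add: T_conn_def z_nabla_def)
  qed
  then show ?thesis
    using op_space.stable_subspace_iff[OF conn_op_space, of S] by (auto simp: stable_def)
qed

lemma conn_shift_model:
  assumes W: "stable_subspace E W" and U: "stable_subspace E U" and UW: "U \<subseteq> W"
    and m: "model_map E W U (E_obj q f) \<pi>" and q: "q \<ge> 1" "s \<ge> 1" "fls_subdegree f = - int s"
  shows "semilinear_space.shift_model E (T_conn E) W U q s \<pi>"
    "w \<in> W \<Longrightarrow> \<pi> (T_conn E w) = - fls_shift (int q) (opr (E_obj q f) (\<pi> w))"
    "w \<in> W \<Longrightarrow> \<pi> (fls_X_inv \<odot> w) = fls_shift (int q) (\<pi> w)"
proof -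
  interpret semilinear_space E "T_conn E" "\<lambda>h. h" "\<lambda>h. fls_X * fls_deriv h" by (rule conn_semilinear)
  note m' = model_mapD[OF m]
  have kW: "ksub W" and opW: "\<And>w. w \<in> W \<Longrightarrow> opr E w \<in> W"
    using W op_space.stable_subspace_iff[OF conn_op_space] by auto
  note W' = ksubD[OF kW]
  have X: "\<pi> (fls_X_inv \<odot> w) = fls_shift (int q) (\<pi> w)" if "w \<in> W" for w
    using m'(2)[OF that, of fls_X_inv] q(1) fls_X_intpow_times_conv_shift(1)[of "- int q" "\<pi> w"] by simp
  show "w \<in> W \<Longrightarrow> \<pi> (fls_X_inv \<odot> w) = fls_shift (int q) (\<pi> w)" by (rule X)
  have T: "\<pi> (T_conn E w) = - fls_shift (int q) (opr (E_obj q f) (\<pi> w))" if w: "w \<in> W" for w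
  proof -
    have z: "fls_X_inv \<odot> opr E w \<in> W" using W'(4) opW[OF w] by blast
    have "T_conn E w = (- 1) \<odot> (fls_X_inv \<odot> opr E w)"
      using W'(7)[OF z] by (simp add: T_conn_def z_nabla_def smult_minus_left)
    then have "\<pi> (T_conn E w) = fls_compose_power (- 1) q * \<pi> (fls_X_inv \<odot> opr E w)"
      using m'(2)[OF z, of "- 1"] by simp
    then show ?thesis using X[OF opW[OF w]] m'(5)[OF w] q(1) by simp
  qed
  then show "w \<in> W \<Longrightarrow> \<pi> (T_conn E w) = - fls_shift (int q) (opr (E_obj q f) (\<pi> w))" .
  show "shift_model W U q s \<pi>"
    by (rule shift_modelI[OF _ _ UW q(1,2) m _ elliptic_E_obj[OF q] T])
      (use W U conn_stable_iff in auto)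
qed

lemma conn_shift_filtered:
  assumes "filtered_by E conn_models W"
  shows "semilinear_space.shift_filtered E (T_conn E) W"
proof -
  interpret semilinear_space E "T_conn E" "\<lambda>h. h" "\<lambda>h. fls_X * fls_deriv h" by (rule conn_semilinear)
  show ?thesis using assms
  proof (induction rule: filtered_by.induct)
    case zero
    show ?case by (rule shift_filtered.zero)
  next
    case (step U W M \<pi>)
    obtain q f s where M: "M = E_obj q f" "q \<ge> 1" "s \<ge> 1" "fls_subdegree f = - int s"
      using \<open>M \<in> conn_models\<close> by (rule conn_modelsE)
    show ?case
      by (rule shift_filtered.step[OF step.IH conn_shift_model(1)[OF step.hyps(2-4) _ M(2-4)]]) (use step M in auto)
  qed
qed

lemma theta_power_eq: "theta_power E = iter_power (theta E) (T_conn E)"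
  by (rule ext) (auto simp: theta_power_def iter_power_def T_conn_def[abs_def])

text \<open>\<open>theta\<close> is defined through a chosen preimage of \<open>z \<nabla>\<close>. It is the inverse of \<open>T\<close> because \<open>T\<close> is
  bijective on spaces filtered by models.\<close>

lemma conn_pair:
  assumes "filtered_by E conn_models (carrier E)"
  shows "\<exists>F N. mellin_pair E (T_conn E) (\<lambda>h. h) (\<lambda>h. fls_X * fls_deriv h) (theta_power E) F N"
proof -
  interpret semilinear_space E "T_conn E" "\<lambda>h. h" "\<lambda>h. fls_X * fls_deriv h" by (rule conn_semilinear)
  note shift_filtered = conn_shift_filtered[OF assms]
  have zc: "z_nabla E v \<in> carrier E" if "v \<in> carrier E" for v
    using that conn_opr(1) by (simp add: z_nabla_def)
  have zT: "z_nabla E v = \<ominus> T_conn E v" if "v \<in> carrier E" for v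
    using zc[OF that] by (simp add: T_conn_def)
  have surj: "v \<in> z_nabla E ` carrier E" if v: "v \<in> carrier E" for v
  proof -
    have "\<ominus> v \<in> T_conn E ` carrier E" using T_bij(2)[OF shift_filtered] v by simp
    then obtain u where u: "u \<in> carrier E" "T_conn E u = \<ominus> v" by force
    then have "z_nabla E u = v" using v zT by simp
    then show ?thesis using u(1) by blast
  qed
  have theta: "theta E v \<in> carrier E" "T_conn E (theta E v) = v" if v: "v \<in> carrier E" for v
  proof -
    have i: "inv_into (carrier E) (z_nabla E) v \<in> carrier E" by (rule inv_into_into[OF surj[OF v]])
    then show "theta E v \<in> carrier E" by (simp add: theta_def)
    have "T_conn E (theta E v) = \<ominus> T_conn E (inv_into (carrier E) (z_nabla E) v)"
      using i by (simp add: theta_def T_minus)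
    also have "\<dots> = z_nabla E (inv_into (carrier E) (z_nabla E) v)" using i by (simp add: zT)
    also have "\<dots> = v" by (rule f_inv_into_f[OF surj[OF v]])
    finally show "T_conn E (theta E v) = v" .
  qed
  show ?thesis unfolding theta_power_eq by (rule mellin_pair_exists[OF shift_filtered theta])
qed

lemma positive_slopes_iff:
  "positive_slopes E \<longleftrightarrow> (\<forall>W U. op_space.simple_pair E W U \<longrightarrow> (\<exists>M\<in>conn_models. \<exists>\<pi>. model_map E W U M \<pi>))"
proof -
  interpret op_space E by (rule conn_op_space)
  have "positive_slopes E \<longleftrightarrow> (\<forall>L\<in>irreducible_components E. \<exists>M\<in>conn_models. op_isomorphic L M)"
    unfolding positive_slopes_def conn_models_def by blast
  also have "\<dots> \<longleftrightarrow> (\<forall>W U. simple_pair W U \<longrightarrow> (\<exists>M\<in>conn_models. \<exists>\<pi>. model_map E W U M \<pi>))"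
    by (rule irreducible_components_models) (auto simp: conn_models_def)
  finally show ?thesis .
qed

lemma positive_slopes_filtered: "positive_slopes E \<Longrightarrow> filtered_by E conn_models (carrier E)"
  using op_space.filtered_by_carrier[OF conn_op_space conn_fg] positive_slopes_iff by blast

end

section \<open>Difference modules\<close>

lemma phi_const [simp]: "phi (fls_const c) = fls_const c"
  by (simp add: phi_def)

lemma const_lin_phi: "const_lin phi" and raises_ord_phi: "raises_ord 0 phi"
  using elliptic_phi_root[of 1] by (auto simp: elliptic_def phi_eq_phi_root symbol_def)

lemma ord_ge_phi: "ord_ge n h \<Longrightarrow> ord_ge n (phi h)"
  using raises_ordD[OF raises_ord_phi] by fastforce

lemma phi_X_inv: "phi fls_X_inv = fls_X_inv + (1 :: 'k::field_char_0 fls)"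
  using phi_root_shift[of 1 "1 :: 'k fls"] by (simp add: phi_eq_phi_root fls_X_inv_conv_shift_1)

lemma phi_X_intpow: "phi (fls_X_intpow n) = (fls_X_inv + (1 :: 'k::field_char_0 fls)) powi (- n)"
proof -
  have nz: "fps_X / (1 + fps_X) \<noteq> (0 :: 'k fps)" "fps_nth (fps_X / (1 + fps_X) :: 'k fps) 0 = 0"
    using phi_root_series[of 1] by (simp_all add: fps_binomial_minus_one fps_divide_unit)
  have "fls_X_intpow n = (fls_X_inv :: 'k fls) powi (- n)"
    by (simp add: power_int_minus flip: fls_inverse_X power_int_inverse)
  then have "phi (fls_X_intpow n :: 'k fls) = phi fls_X_inv powi (- n)"
    unfolding phi_def by (simp only: fls_compose_fps_powi[OF nz])
  then show ?thesis by (simp add: phi_X_inv)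
qed

context
  fixes W :: "('k::field_char_0 fls, 'v) op_module" (structure)
  assumes diff: "difference_module W"
begin

lemma diff_fls_space: "fls_space W"
  using diff by (intro fls_spaceI) (simp add: difference_module_def)

lemma diff_fg: "fls_space.fg W (carrier W)"
  using diff fls_space.fin_dim_iff_fg[OF diff_fls_space]
  by (simp add: difference_module_def difference_module_axioms_def)

lemma diff_opr:
  "v \<in> carrier W \<Longrightarrow> opr W v \<in> carrier W"
  "u \<in> carrier W \<Longrightarrow> v \<in> carrier W \<Longrightarrow> opr W (u \<oplus> v) = opr W u \<oplus> opr W v"
  "v \<in> carrier W \<Longrightarrow> opr W (h \<odot> v) = phi h \<odot> opr W v"
  "bij_betw (opr W) (carrier W) (carrier W)"
  using diff by (auto simp: difference_module_def difference_module_axioms_def const_linear_def)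

lemma diff_op_space: "op_space W"
  using diff_fls_space diff_opr by (simp add: op_space_def op_space_axioms_def)

lemma diff_semilinear: "semilinear_space W (opr W) phi (\<lambda>_. 0)"
proof -
  interpret fls_space W by (rule diff_fls_space)
  show ?thesis
    by unfold_locales (auto simp: diff_fg diff_opr ord_ge_phi)
qed

lemma diff_stable_iff: "semilinear_space.stable W (opr W) S \<longleftrightarrow> stable_subspace W S"
proof -
  interpret semilinear_space W "opr W" phi "\<lambda>_. 0" by (rule diff_semilinear)
  show ?thesis using op_space.stable_subspace_iff[OF diff_op_space, of S] by (simp add: stable_def)
qed

lemma diff_shift_model:
  assumes V: "stable_subspace W V" and U: "stable_subspace W U" and UV: "U \<subseteq> V"
    and m: "model_map W V U (D_obj q g) \<pi>" and q: "q \<ge> 1" "s \<ge> 1" "g \<noteq> 0" "fls_subdegree g = - int s"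
  shows "semilinear_space.shift_model W (opr W) V U q s \<pi>"
proof -
  interpret semilinear_space W "opr W" phi "\<lambda>_. 0" by (rule diff_semilinear)
  have el: "elliptic (- int s) (opr (D_obj q g))" using elliptic_D_obj[OF q(1,3)] q(4) by simp
  show "shift_model V U q s \<pi>"
    by (rule shift_modelI[OF _ _ UV q(1,2) m _ el model_mapD(5)[OF m]])
      (use V U diff_stable_iff in auto)
qed

lemma diff_shift_filtered:
  assumes "filtered_by W diff_models V"
  shows "semilinear_space.shift_filtered W (opr W) V"
proof -
  interpret semilinear_space W "opr W" phi "\<lambda>_. 0" by (rule diff_semilinear)
  show ?thesis using assms
  proof (induction rule: filtered_by.induct)
    case zero
    show ?case by (rule shift_filtered.zero)
  next
    case (step U V M \<pi>)
    obtain q g s where M: "M = D_obj q g" "q \<ge> 1" "s \<ge> 1" "g \<noteq> 0" "fls_subdegree g = - int s"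
      using \<open>M \<in> diff_models\<close> by (rule diff_modelsE)
    show ?case
      by (rule shift_filtered.step[OF step.IH diff_shift_model[OF step.hyps(2-4) _ M(2-5)]]) (use step M in auto)
  qed
qed

definition phi_power :: "('a fls, 'b) op_module \<Rightarrow> int \<Rightarrow> 'b \<Rightarrow> 'b" where
  "phi_power V = iter_power (inv_into (carrier V) (opr V)) (opr V)"

lemma diff_pair:
  assumes "filtered_by W diff_models (carrier W)"
  shows "\<exists>F N. mellin_pair W (opr W) phi (\<lambda>_. 0) (phi_power W) F N"
proof -
  interpret semilinear_space W "opr W" phi "\<lambda>_. 0" by (rule diff_semilinear)
  have "v \<in> opr W ` carrier W" if "v \<in> carrier W" for v using diff_opr(4) that by (auto simp: bij_betw_def)
  then show ?thesis unfolding phi_power_def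
    by (intro mellin_pair_exists[OF diff_shift_filtered[OF assms]]) (auto intro: inv_into_into f_inv_into_f)
qed

lemma negative_orders_iff:
  "negative_orders W \<longleftrightarrow> (\<forall>V U. op_space.simple_pair W V U \<longrightarrow> (\<exists>M\<in>diff_models. \<exists>\<pi>. model_map W V U M \<pi>))"
proof -
  interpret op_space W by (rule diff_op_space)
  have "negative_orders W \<longleftrightarrow> (\<forall>L\<in>irreducible_components W. \<exists>M\<in>diff_models. op_isomorphic L M)"
    unfolding negative_orders_def diff_models_def by blast
  also have "\<dots> \<longleftrightarrow> (\<forall>V U. simple_pair V U \<longrightarrow> (\<exists>M\<in>diff_models. \<exists>\<pi>. model_map W V U M \<pi>))"
    by (rule irreducible_components_models) (auto simp: diff_models_def D_obj_def)
  finally show ?thesis .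
qed

lemma negative_orders_filtered: "negative_orders W \<Longrightarrow> filtered_by W diff_models (carrier W)"
  using op_space.filtered_by_carrier[OF diff_op_space diff_fg] negative_orders_iff by blast

end

section \<open>The transform of a connection\<close>

locale conn_mellin = mellin_pair E T "\<lambda>h. h" "\<lambda>h. fls_X * fls_deriv h" P F N
  for E :: "('k::field_char_0 fls, 'v) op_module" (structure) and T P F N
begin

lemma T_X:
  assumes v: "v \<in> carrier E"
  shows "T (fls_X \<odot> v) = fls_X \<odot> act (fls_X_inv + 1) v"
  using v T_smult[OF v, of fls_X] by (simp add: act_add_left act_X_inv act_one smult_add_right)

text \<open>From \<open>T X = X (T + 1)\<close> by induction. In terms of \<open>\<theta> = T^(- 1)\<close> this is the rule that multiplication
  by \<open>z\<close> changes \<open>\<theta>^(- 1)\<close> into \<open>\<theta>^(- 1) + 1\<close>.\<close>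

lemma P_X:
  assumes v: "v \<in> carrier E"
  shows "P (- m) (fls_X \<odot> v) = fls_X \<odot> act ((fls_X_inv + 1) powi m) v"
proof -
  define u :: "'k fls" where "u = fls_X_inv + 1"
  have "u $$ (- 1) = 1" by (simp add: u_def)
  then have u: "u \<noteq> 0" by auto
  have "P (- m) (fls_X \<odot> v) = fls_X \<odot> act (u powi m) v"
  proof (induction m rule: int_induct[where k = 0])
    case base
    then show ?case using v by (simp add: P_0 act_one)
  next
    case (step1 m)
    have "P (- (m + 1)) (fls_X \<odot> v) = T (P (- m) (fls_X \<odot> v))"
      using T_P[of "fls_X \<odot> v" "- (m + 1)"] v by simp
    also have "\<dots> = fls_X \<odot> act (u * u powi m) v"
      using v T_X[of "act (u powi m) v"] by (simp add: step1 act_mult u_def)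
    also have "u * u powi m = u powi (m + 1)" using u by (simp add: power_int_add mult.commute)
    finally show ?case .
  next
    case (step2 m)
    have "T (P (- (m - 1)) (fls_X \<odot> v)) = P (- m) (fls_X \<odot> v)"
      using T_P[of "fls_X \<odot> v" "- m"] v by (simp add: add.commute)
    also have "\<dots> = fls_X \<odot> act (u powi m) v" by (rule step2)
    also have "u powi m = u * u powi (m - 1)" using u by (simp add: power_int_diff)
    also have "fls_X \<odot> act (u * u powi (m - 1)) v = T (fls_X \<odot> act (u powi (m - 1)) v)"
      using v T_X[of "act (u powi (m - 1)) v"] by (simp add: act_mult u_def)
    finally show ?case by (rule T_inj[rotated 2]) (use v in simp_all)
  qed
  then show ?thesis by (simp add: u_def)
qed

lemma X_G:
  assumes v: "v \<in> G m"
  shows "fls_X \<odot> v \<in> G m"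
proof -
  have vc: "v \<in> carrier E" by (rule G_carrier[OF v])
  have "ord_ge (- m) (phi (fls_X_intpow (- m)) :: 'k fls)" by (rule ord_ge_phi[OF ord_ge_X_intpow])
  then have "ord_ge (- m) ((fls_X_inv + (1 :: 'k fls)) powi m)"
    using phi_X_intpow[of "- m", where 'k = 'k] by (simp only: group_add_class.minus_minus)
  from act_G[OF v this] have "act ((fls_X_inv + 1) powi m) v \<in> F 0"
    using vc by (simp add: G_def P_0)
  then have "fls_X \<odot> act ((fls_X_inv + 1) powi m) v \<in> F 0"
    by (intro osubD(4)[OF F_osub]) (simp_all add: ord_ge_def)
  then show ?thesis using vc by (simp add: G_def P_X)
qed

text \<open>Multiplication by \<open>z\<close> is semilinear over \<open>\<phi>\<close>: on monomials in \<open>\<theta>\<close> this is the preceding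
  commutation rule, and both sides are continuous in \<open>h\<close>.\<close>

lemma X_inv_act:
  assumes v: "v \<in> carrier E"
  shows "fls_X_inv \<odot> act h v = act (phi h) (fls_X_inv \<odot> v)"
proof -
  define w where "w = fls_X_inv \<odot> v"
  have w: "w \<in> carrier E" "v = fls_X \<odot> w" using v by (simp_all add: w_def)
  note phi = const_linD[OF const_lin_phi]
  obtain j where j: "w \<in> G j" using G_exhaustive[OF w(1)] by blast
  have "fls_X \<odot> act (phi h) w = act h v"
  proof (rule act_unique[OF v, where c = j])
    show "fls_X \<odot> act (phi (g + h)) w = fls_X \<odot> act (phi g) w \<oplus> fls_X \<odot> act (phi h) w" for g h
      using w by (simp add: phi act_add_left smult_add_right)
    show "fls_X \<odot> act (phi (fls_const b * h)) w = fls_const b \<odot> (fls_X \<odot> act (phi h) w)" for b h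
      using w by (simp add: phi(2) act_const_left smult_smult mult.commute[of fls_X])
    show "fls_X \<odot> act (phi (fls_X_intpow n)) w = P n v" for n
      using P_X[OF w(1), of "- n"] w(2) by (simp only: phi_X_intpow group_add_class.minus_minus)
    show "fls_X \<odot> act (phi h) w \<in> G (n + j)" if "ord_ge n h" for n h
      by (rule X_G[OF act_G[OF j ord_ge_phi[OF that]]])
  qed (use w in simp)
  then have "fls_X_inv \<odot> act h v = fls_X_inv \<odot> (fls_X \<odot> act (phi h) w)" by simp
  then show ?thesis using w(1) by (simp add: w_def)
qed

end

lemma theta_smult_eq: "theta_smult E = series_smult E (theta_power E)"
  by (simp add: fun_eq_iff theta_smult_def series_smult_def)

lemma mellin_obj_eq_twist:
  assumes "mellin_pair E T a d (theta_power E) F N"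
  shows "mellin_obj E = mellin_pair.twist E (theta_power E) (\<lambda>v. fls_X_inv \<odot>\<^bsub>E\<^esub> v)"
  by (simp add: mellin_obj_def theta_smult_eq mellin_pair.twist_def[OF assms])

context mellin_pair
begin

lemma twist_fin_dim:
  assumes "filtered_by (twist R) \<M> (carrier E)"
    "\<And>M. M \<in> \<M> \<Longrightarrow> \<exists>p\<ge>1. \<forall>h v. h \<odot>\<^bsub>M\<^esub> v = fls_compose_power h p * v"
  shows "vectorspace.fin_dim class_ring (twist R)"
  using fls_space.filtered_fg[OF fls_space_twist assms] fls_space.fin_dim_iff_fg[OF fls_space_twist, of R] by simp

end

lemma conn_model_transfer:
  fixes E :: "('k::{alg_closed_field,field_char_0} fls, 'v) op_module"
  assumes conn: "connection_at_infinity E"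
    and pair: "mellin_pair E (T_conn E) (\<lambda>h. h) (\<lambda>h. fls_X * fls_deriv h) P F N"
    and W: "stable_subspace E W" and U: "stable_subspace E U" and UW: "U \<subseteq> W"
    and M: "M \<in> conn_models" and m: "model_map E W U M \<pi>"
  shows "\<exists>M'\<in>diff_models. \<exists>\<pi>'. model_map (mellin_pair.twist E P (\<lambda>v. fls_X_inv \<odot>\<^bsub>E\<^esub> v)) W U M' \<pi>'"
proof -
  interpret mellin_pair E "T_conn E" "\<lambda>h. h" "\<lambda>h. fls_X * fls_deriv h" P F N by (rule pair)
  obtain q f s where q: "M = E_obj q f" "q \<ge> 1" "s \<ge> 1" "fls_subdegree f = - int s"
    using M by (rule conn_modelsE)
  note sm = conn_shift_model[OF conn W U UW m[unfolded q(1)] q(2-4)]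
  have stW: "stable W" using W conn_stable_iff[OF conn] by simp
  obtain g \<Psi> \<Psi>' where g: "g \<noteq> 0" "fls_subdegree g = - int q"
    and \<Psi>: "const_lin \<Psi>" "raises_ord 0 \<Psi>" "\<forall>v. \<Psi> (\<Psi>' v) = v" "\<forall>v. \<Psi>' (\<Psi> v) = v"
      "\<forall>v. \<Psi> (- fls_shift (int q) (opr (E_obj q f) v)) = fls_shift (int s) (\<Psi> v)"
      "\<forall>v. \<Psi> (fls_shift (int q) v) = opr (D_obj s g) (\<Psi> v)"
    using mellin_of_E_obj[OF q(2-4)] by blast
  have "model_map (twist (\<lambda>v. fls_X_inv \<odot>\<^bsub>E\<^esub> v)) W U (D_obj s g) (\<lambda>w. \<Psi> (\<pi> w))"
    by (rule model_map_transfer[OF stW sm(1) \<Psi>(1,2), where \<Psi>' = \<Psi>']) (use \<Psi> sm in simp_all)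
  moreover have "D_obj s g \<in> diff_models"
    using q(2,3) g by (auto simp: diff_models_def puiseux_ord_neg intro!: exI[of _ s] exI[of _ g])
  ultimately show ?thesis by blast
qed

lemma diff_models_smult: "M \<in> diff_models \<Longrightarrow> \<exists>p\<ge>1. \<forall>h v. h \<odot>\<^bsub>M\<^esub> v = fls_compose_power h p * v"
  by (auto simp: diff_models_def)

lemma conn_models_smult: "M \<in> conn_models \<Longrightarrow> \<exists>p\<ge>1. \<forall>h v. h \<odot>\<^bsub>M\<^esub> v = fls_compose_power h p * v"
  by (auto simp: conn_models_def)

lemma simple_pair_cong:
  assumes "op_space E" "op_space E'" "\<And>S. stable_subspace E S \<longleftrightarrow> stable_subspace E' S"
  shows "op_space.simple_pair E W U \<longleftrightarrow> op_space.simple_pair E' W U"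
  unfolding op_space.simple_pair_def[OF assms(1)] op_space.simple_pair_def[OF assms(2)] assms(3) ..

text \<open>The stable subspaces of both structures coincide. Therefore the irreducible subquotients of the
  transform are the transforms of those of \<open>E\<close>, and these are known explicitly.\<close>

theorem mellin_obj_in_N_neg:
  fixes E :: "('k::{alg_closed_field,field_char_0} fls, 'v) op_module"
  assumes conn: "connection_at_infinity E" and pos: "positive_slopes E"
  shows "difference_module (mellin_obj E)" "negative_orders (mellin_obj E)"
proof -
  note fb = positive_slopes_filtered[OF conn pos]
  obtain F N where pair: "mellin_pair E (T_conn E) (\<lambda>h. h) (\<lambda>h. fls_X * fls_deriv h) (theta_power E) F N"
    using conn_pair[OF conn fb] by blast
  interpret conn_mellin E "T_conn E" "theta_power E" F N
    unfolding conn_mellin_def by (rule pair)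
  define R where "R = (\<lambda>v. fls_X_inv \<odot>\<^bsub>E\<^esub> v)"
  have mE: "mellin_obj E = twist R" unfolding R_def by (rule mellin_obj_eq_twist[OF pair])
  have st: "stable S \<and> stable_subspace (twist R) S" if S: "stable_subspace E S" for S
  proof -
    have s: "stable S" using S conn_stable_iff[OF conn] by simp
    have "stable_subspace (twist R) S"
      by (rule stable_twist_stable_subspace[OF s]) (simp add: R_def ksubD(4)[OF stableD(1)[OF s]])
    then show ?thesis using s by simp
  qed
  have tr: "\<exists>M'\<in>diff_models. \<exists>\<pi>'. model_map (twist R) W U M' \<pi>'"
    if "stable W" "stable U" "U \<subseteq> W" "M \<in> conn_models" "model_map E W U M \<pi>" for W U M \<pi>
    unfolding R_def using conn_model_transfer[OF conn pair _ _ that(3-5)] that(1,2) conn_stable_iff[OF conn] by simp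
  have fb': "filtered_by (twist R) diff_models (carrier E)"
    by (rule twist_filtered[OF fb st tr])
  interpret E': fls_space "twist R" by (rule fls_space_twist)
  have "difference_module (twist R)"
    unfolding difference_module_def difference_module_axioms_def
  proof (intro conjI allI impI)
    show "vectorspace class_ring (twist R)" by (rule E'.vectorspace)
    show "vectorspace.fin_dim class_ring (twist R)" by (rule twist_fin_dim[OF fb' diff_models_smult])
    show "const_linear (twist R) (opr (twist R))"
      unfolding const_linear_def
      by (auto simp: R_def smult_add_right act_const smult_smult mult.commute)
    show "bij_betw (opr (twist R)) (carrier (twist R)) (carrier (twist R))"
      by (rule bij_betw_byWitness[where f' = "\<lambda>v. fls_X \<odot>\<^bsub>E\<^esub> v"]) (auto simp: R_def)
    show "opr (twist R) (h \<odot>\<^bsub>twist R\<^esub> v) = phi h \<odot>\<^bsub>twist R\<^esub> opr (twist R) v"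
      if "v \<in> carrier (twist R)" for v h
      using that X_inv_act by (simp add: R_def)
  qed
  then show diff: "difference_module (mellin_obj E)" by (simp add: mE)
  note diff' = diff[unfolded mE]
  have opr': "opr (twist R) = R" by simp
  have "stable_subspace E S \<longleftrightarrow> stable_subspace (twist R) S" for S
  proof
    assume S: "stable_subspace (twist R) S"
    have "stable S"
    proof (rule twist_stable_imp_stable[OF diff_semilinear[OF diff']])
      show "semilinear_space.shift_filtered (twist R) (opr (twist R)) (carrier E)" by (rule diff_shift_filtered[OF diff' fb'])
      show "semilinear_space.stable (twist R) (opr (twist R)) S" using S diff_stable_iff[OF diff'] by simp
    qed (simp add: R_def)
    then show "stable_subspace E S" using conn_stable_iff[OF conn] by simp
  qed (use st in blast)
  from simple_pair_cong[OF conn_op_space[OF conn] diff_op_space[OF diff'] this]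
  have sp: "op_space.simple_pair E W U \<longleftrightarrow> op_space.simple_pair (twist R) W U" for W U .
  have "\<exists>M\<in>diff_models. \<exists>\<pi>. model_map (twist R) V U M \<pi>" if s: "op_space.simple_pair (twist R) V U" for V U
  proof -
    have s': "op_space.simple_pair E V U" using s sp by simp
    then obtain M \<pi> where "M \<in> conn_models" "model_map E V U M \<pi>"
      using pos positive_slopes_iff[OF conn] by blast
    then show ?thesis using tr s' st op_space.simple_pair_def[OF conn_op_space[OF conn]] by meson
  qed
  then show "negative_orders (mellin_obj E)"
    unfolding mE negative_orders_iff[OF diff'] by blast
qed


section \<open>The inverse transform of a difference module\<close>

locale diff_mellin = mellin_pair E T phi "\<lambda>_. 0" P F N
  for E :: "('k::field_char_0 fls, 'v) op_module" (structure) and T P F N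
begin

text \<open>From \<open>T X^(- 1) = (X^(- 1) + 1) T\<close>: the commutator of \<open>T^m\<close> and \<open>X^(- 1)\<close> is \<open>m T^m\<close>.\<close>

lemma P_X_inv:
  assumes v: "v \<in> carrier E"
  shows "P (- m) (fls_X_inv \<odot> v) = fls_X_inv \<odot> P (- m) v \<oplus> fls_const (of_int m) \<odot> P (- m) v"
proof -
  have T: "T (fls_X_inv \<odot> w \<oplus> fls_const (of_int i) \<odot> w) = fls_X_inv \<odot> T w \<oplus> fls_const (of_int (i + 1)) \<odot> T w"
    if w: "w \<in> carrier E" for w i
  proof -
    have "T (fls_X_inv \<odot> w \<oplus> fls_const (of_int i) \<odot> w)
        = (fls_X_inv + 1) \<odot> T w \<oplus> fls_const (of_int i) \<odot> T w"
      using w by (simp add: T_add T_smult phi_X_inv)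
    also have "\<dots> = (fls_X_inv + (1 + fls_const (of_int i))) \<odot> T w"
      using w by (simp only: add.assoc smult_add_left[symmetric] T_closed)
    also have "1 + fls_const (of_int i) = (fls_const (of_int (i + 1)) :: 'k fls)"
      by (rule fls_eqI) simp
    also have "(fls_X_inv + fls_const (of_int (i + 1))) \<odot> T w
        = fls_X_inv \<odot> T w \<oplus> fls_const (of_int (i + 1)) \<odot> T w"
      using w by (simp only: smult_add_left T_closed)
    finally show ?thesis .
  qed
  show ?thesis
  proof (induction m rule: int_induct[where k = 0])
    case base
    then show ?case using v by (simp add: P_0)
  next
    case (step1 m)
    have s: "P (- (m + 1)) w = T (P (- m) w)" if "w \<in> carrier E" for w
      using T_P[of w "- (m + 1)"] that by simp
    show ?case unfolding s[OF v] using v by (simp only: s step1 T smult_closed P_closed)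
  next
    case (step2 m)
    have s: "T (P (- (m - 1)) w) = P (- m) w" if "w \<in> carrier E" for w
      using T_P[of w "- m"] that by (simp add: add.commute)
    have "T (P (- (m - 1)) (fls_X_inv \<odot> v)) = P (- m) (fls_X_inv \<odot> v)"
      using v by (intro s) simp
    also have "\<dots> = T (fls_X_inv \<odot> P (- (m - 1)) v \<oplus> fls_const (of_int (m - 1)) \<odot> P (- (m - 1)) v)"
      using T[of "P (- (m - 1)) v" "m - 1"] s[OF v] step2 v by simp
    finally show ?case by (rule T_inj[rotated 2]) (use v in simp_all)
  qed
qed

lemma X_inv_G: "\<exists>c\<le>0. \<forall>m. \<forall>v\<in>G m. fls_X_inv \<odot> v \<in> G (m + c)"
proof -
  obtain c0 where c0: "F (- 1) \<subseteq> G c0" using F_sub_G by blast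
  define c where "c = min c0 0"
  have "fls_X_inv \<odot> v \<in> G (m + c)" if v: "v \<in> G m" for m v
  proof -
    have vc: "v \<in> carrier E" by (rule G_carrier[OF v])
    have P: "P (- m) v \<in> F 0" using v by (simp add: G_def)
    then have P0: "P (- m) v \<in> G 0" using vc by (simp add: G_def P_0)
    have "ord_ge (- 1) (fls_X_inv :: 'k fls)" by (auto simp: ord_ge_def)
    then have "fls_X_inv \<odot> P (- m) v \<in> F (- 1)" using F_smult[OF _ P] by fastforce
    then have "fls_X_inv \<odot> P (- m) v \<in> G c" using c0 by (auto simp: c_def intro: G_mono)
    moreover have "fls_const (of_int m) \<odot> P (- m) v \<in> G c"
      by (rule G_mono[OF G_const[OF P0]]) (simp add: c_def)
    ultimately have "P (- m) (fls_X_inv \<odot> v) \<in> G (m + c + - m)"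
      using G_add P_X_inv[OF vc] by simp
    then show ?thesis using G_P[of "fls_X_inv \<odot> v" "- m" "m + c"] vc by simp
  qed
  then show ?thesis by (intro exI[of _ c]) (simp add: c_def)
qed

text \<open>Multiplication by \<open>1/\<theta>\<close> acts on series in \<open>\<zeta>\<close> as the derivation \<open>\<zeta> d/d\<zeta>\<close>: on monomials this is the
  commutator above. It yields the Leibniz rule.\<close>

lemma X_inv_act:
  assumes v: "v \<in> carrier E"
  shows "fls_X_inv \<odot> act h v = act h (fls_X_inv \<odot> v) \<oplus> act (fls_X * fls_deriv h) v"
proof -
  obtain j where j: "v \<in> G j" using G_exhaustive[OF v] by blast
  obtain c where c: "c \<le> 0" "\<And>m v. v \<in> G m \<Longrightarrow> fls_X_inv \<odot> v \<in> G (m + c)" using X_inv_G by blast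
  have "fls_X_inv \<odot> act h v \<ominus> act (fls_X * fls_deriv h) v = act h (fls_X_inv \<odot> v)"
  proof (rule act_unique[where c = "j + c"])
    show "fls_X_inv \<odot> act (g + h) v \<ominus> act (fls_X * fls_deriv (g + h)) v
        = (fls_X_inv \<odot> act g v \<ominus> act (fls_X * fls_deriv g) v)
          \<oplus> (fls_X_inv \<odot> act h v \<ominus> act (fls_X * fls_deriv h) v)" for g h
      using v by (simp add: distrib_left act_add_left smult_add_right add_diff_add)
    show "fls_X_inv \<odot> act (fls_const b * h) v \<ominus> act (fls_X * fls_deriv (fls_const b * h)) v
        = fls_const b \<odot> (fls_X_inv \<odot> act h v \<ominus> act (fls_X * fls_deriv h) v)" for b h
    proof -
      have "fls_X * fls_deriv (fls_const b * h) = fls_const b * (fls_X * fls_deriv h)" by simp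
      then have "act (fls_X * fls_deriv (fls_const b * h)) v = fls_const b \<odot> act (fls_X * fls_deriv h) v"
        using v by (simp only: act_const_left)
      then show ?thesis using v
        by (simp only: act_const_left smult_diff_right smult_smult mult.commute[of fls_X_inv] act_closed smult_closed)
    qed
    show "fls_X_inv \<odot> act (fls_X_intpow n) v \<ominus> act (fls_X * fls_deriv (fls_X_intpow n)) v
        = P n (fls_X_inv \<odot> v)" for n
    proof -
      have "fls_X * fls_deriv (fls_X_intpow n) = fls_const (of_int n) * (fls_X_intpow n :: 'k fls)"
        by (rule fls_eqI) (simp add: fls_X_times_conv_shift)
      then have "act (fls_X * fls_deriv (fls_X_intpow n)) v = fls_const (of_int n) \<odot> P n v"
        using v by (simp only: act_const_left act_X)
      moreover have "fls_const (of_int (- n)) = - (fls_const (of_int n) :: 'k fls)" by (rule fls_eqI) simp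
      ultimately show ?thesis
        using P_X_inv[OF v, of "- n"] act_X[OF v, of n] v
        by (simp only: group_add_class.minus_minus smult_minus_left P_closed) (simp add: a_minus_def)
    qed
    show "fls_X_inv \<odot> act h v \<ominus> act (fls_X * fls_deriv h) v \<in> G (n + (j + c))" if h: "ord_ge n h" for n h
    proof (rule G_diff)
      show "fls_X_inv \<odot> act h v \<in> G (n + (j + c))" using c(2)[OF act_G[OF j h]] by (simp add: add.assoc)
      show "act (fls_X * fls_deriv h) v \<in> G (n + (j + c))"
        by (rule G_mono[OF act_G[OF j ord_ge_euler[OF h]]]) (use c(1) in simp)
    qed
  qed (use v in simp_all)
  then have "act h (fls_X_inv \<odot> v) = fls_X_inv \<odot> act h v \<ominus> act (fls_X * fls_deriv h) v" by simp
  then show ?thesis using v by simp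
qed

text \<open>The definition \<open>\<theta> = - (z \<nabla>)^(- 1)\<close> solved for \<open>\<nabla>\<close>: it is \<open>- \<zeta> \<theta>^(- 1)\<close>, where \<open>\<zeta> = T^(- 1)\<close>.\<close>

definition nabla :: "'v \<Rightarrow> 'v" where
  "nabla v = \<ominus> P 1 (fls_X_inv \<odot> v)"

lemma nabla_closed [simp]: "v \<in> carrier E \<Longrightarrow> nabla v \<in> carrier E"
  by (simp add: nabla_def)

lemma nabla_add: "u \<in> carrier E \<Longrightarrow> v \<in> carrier E \<Longrightarrow> nabla (u \<oplus> v) = nabla u \<oplus> nabla v"
  by (simp add: nabla_def smult_add_right P_add minus_add)

lemma nabla_const: assumes v: "v \<in> carrier E" shows "nabla (fls_const c \<odot> v) = fls_const c \<odot> nabla v"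
proof -
  have "fls_X_inv \<odot> (fls_const c \<odot> v) = fls_const c \<odot> (fls_X_inv \<odot> v)"
    using v by (simp add: smult_smult mult.commute)
  then show ?thesis using v by (simp add: nabla_def P_const smult_minus_right)
qed

lemma nabla_act:
  assumes v: "v \<in> carrier E"
  shows "nabla (act h v) = act h (nabla v) \<oplus> act (d_dz h) v"
proof -
  interpret E': fls_space "twist nabla" by (rule fls_space_twist)
  define y where "y = fls_X_inv \<odot> v"
  have y: "y \<in> carrier E" using v by (simp add: y_def)
  have "P 1 (fls_X_inv \<odot> act h v) = act fls_X (act h y) \<oplus> act fls_X (act (fls_X * fls_deriv h) v)"
    using v y by (simp add: X_inv_act P_add act_X1 flip: y_def)
  also have "\<dots> = act h (P 1 y) \<oplus> act (fls_X ^ 2 * fls_deriv h) v"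
    using v y by (simp add: power2_eq_square mult.commute mult.left_commute flip: act_mult act_X1)
  finally have "nabla (act h v) = \<ominus> act h (P 1 y) \<oplus> \<ominus> act (fls_X ^ 2 * fls_deriv h) v"
    using v y by (simp add: nabla_def minus_add)
  moreover have "act (d_dz h) v = \<ominus> act (fls_X ^ 2 * fls_deriv h) v"
    using E'.smult_minus_left[of v "fls_X ^ 2 * fls_deriv h"] v by (simp add: d_dz_def)
  ultimately show ?thesis using y by (simp add: nabla_def act_minus flip: y_def)
qed

lemma T_conn_twist:
  assumes v: "v \<in> carrier E"
  shows "T_conn (twist nabla) v = fls_X_inv \<odot> v"
proof -
  have "T (P 1 (fls_X_inv \<odot> v)) = fls_X_inv \<odot> v"
    using T_P[of "fls_X_inv \<odot> v" 0] v by (simp add: P_0)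
  then show ?thesis using v
    by (simp add: T_conn_def z_nabla_def nabla_def act_X_inv T_minus)
qed

end

definition inv_mellin :: "('k::field_char_0 fls, 'v) op_module \<Rightarrow> ('k fls, 'v) op_module" where
  "inv_mellin W = W\<lparr>smult := series_smult W (phi_power W),
     opr := (\<lambda>v. \<ominus>\<^bsub>W\<^esub> phi_power W 1 (fls_X_inv \<odot>\<^bsub>W\<^esub> v))\<rparr>"

lemma inv_mellin_eq_twist:
  assumes "diff_mellin W T (phi_power W) F N"
  shows "inv_mellin W = mellin_pair.twist W (phi_power W) (diff_mellin.nabla W (phi_power W))"
proof -
  interpret diff_mellin W T "phi_power W" F N by (rule assms)
  show ?thesis by (simp add: inv_mellin_def twist_def nabla_def[abs_def])
qed

lemma diff_model_transfer:
  fixes W :: "('k::{alg_closed_field,field_char_0} fls, 'v) op_module"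
  assumes diff: "difference_module W"
    and pair: "diff_mellin W (opr W) P F N"
    and V: "stable_subspace W V" and U: "stable_subspace W U" and UV: "U \<subseteq> V"
    and M: "M \<in> diff_models" and m: "model_map W V U M \<pi>"
  shows "\<exists>M'\<in>conn_models. \<exists>\<pi>'. model_map (mellin_pair.twist W P (diff_mellin.nabla W P)) V U M' \<pi>'"
proof -
  interpret diff_mellin W "opr W" P F N by (rule pair)
  obtain q g s where q: "M = D_obj q g" "q \<ge> 1" "s \<ge> 1" "g \<noteq> 0" "fls_subdegree g = - int s"
    using M by (rule diff_modelsE)
  note m' = model_mapD[OF m[unfolded q(1)]]
  have sm: "shift_model V U q s \<pi>" by (rule diff_shift_model[OF diff V U UV m[unfolded q(1)] q(2-5)])
  have stV: "stable V" using V diff_stable_iff[OF diff] by simp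
  note V' = ksubD[OF stableD(1)[OF stV]]
  obtain f \<Psi> \<Psi>' where f: "fls_subdegree f = - int q"
    and \<Psi>: "const_lin \<Psi>" "raises_ord 0 \<Psi>" "\<forall>v. \<Psi> (\<Psi>' v) = v" "\<forall>v. \<Psi>' (\<Psi> v) = v"
      "\<forall>v. \<Psi> (opr (D_obj q g) v) = fls_shift (int s) (\<Psi> v)"
      "\<forall>v. \<Psi> (fls_shift (int q) v) = - fls_shift (int s) (opr (E_obj s f) (\<Psi> v))"
    using inverse_mellin_of_D_obj[OF q(2,3,5)] by blast
  have T: "\<Psi> (\<pi> (opr W w)) = fls_shift (int s) (\<Psi> (\<pi> w))" if "w \<in> V" for w
    using m'(5)[OF that] \<Psi>(5) by simp
  have R: "\<Psi> (\<pi> (nabla w)) = opr (E_obj s f) (\<Psi> (\<pi> w))" if w: "w \<in> V" for w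
  proof -
    define x where "x = P 1 (fls_X_inv \<odot>\<^bsub>W\<^esub> w)"
    have x: "x \<in> V" unfolding x_def by (rule stable_P[OF stV V'(4)[OF w]])
    have "opr W x = fls_X_inv \<odot>\<^bsub>W\<^esub> w"
      using T_P[of "fls_X_inv \<odot>\<^bsub>W\<^esub> w" 0] V'(7)[OF w] by (simp add: x_def P_0)
    moreover have "\<pi> (fls_X_inv \<odot>\<^bsub>W\<^esub> w) = fls_shift (int q) (\<pi> w)"
      using m'(2)[OF w, of fls_X_inv] q(2) fls_X_intpow_times_conv_shift(1)[of "- int q" "\<pi> w"] by simp
    ultimately have "fls_shift (int s) (\<Psi> (\<pi> x)) = - fls_shift (int s) (opr (E_obj s f) (\<Psi> (\<pi> w)))"
      using T[OF x] \<Psi>(6) by simp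
    then have "fls_shift (- int s) (fls_shift (int s) (\<Psi> (\<pi> x)))
        = fls_shift (- int s) (fls_shift (int s) (- opr (E_obj s f) (\<Psi> (\<pi> w))))" by simp
    then have e: "\<Psi> (\<pi> x) = - opr (E_obj s f) (\<Psi> (\<pi> w))" by simp
    have "nabla w = fls_const (- 1) \<odot>\<^bsub>W\<^esub> x"
    proof -
      have "fls_const (- 1) = (- 1 :: 'k fls)" by (rule fls_eqI) simp
      then show ?thesis using V'(7)[OF x] by (simp add: nabla_def smult_minus_left flip: x_def)
    qed
    then have "\<Psi> (\<pi> (nabla w)) = fls_const (- 1) * \<Psi> (\<pi> x)"
      using shift_modelD(13)[OF sm x, of "- 1"] const_linD(2)[OF \<Psi>(1), of "- 1" "\<pi> x"] by simp
    then show ?thesis using e by simp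
  qed
  have "model_map (twist nabla) V U (E_obj s f) (\<lambda>w. \<Psi> (\<pi> w))"
    by (rule model_map_transfer[OF stV sm \<Psi>(1,2), where \<Psi>' = \<Psi>']) (use \<Psi>(3,4) T R in simp_all)
  moreover have "E_obj s f \<in> conn_models"
    using q(2,3) f by (auto simp: conn_models_def puiseux_ord_neg intro!: exI[of _ s] exI[of _ f])
  ultimately show ?thesis by blast
qed

text \<open>As for the transform itself, by comparison of stable subspaces. The last claim says that \<open>- z \<nabla>\<close> is again
  multiplication by \<open>1/\<theta>\<close>.\<close>

theorem inv_mellin_in_C_inf_pos:
  fixes W :: "('k::{alg_closed_field,field_char_0} fls, 'v) op_module"
  assumes diff: "difference_module W" and neg: "negative_orders W"
  shows "connection_at_infinity (inv_mellin W)" "positive_slopes (inv_mellin W)"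
    "v \<in> carrier W \<Longrightarrow> T_conn (inv_mellin W) v = fls_X_inv \<odot>\<^bsub>W\<^esub> v"
proof -
  note fb = negative_orders_filtered[OF diff neg]
  obtain F N where pair: "mellin_pair W (opr W) phi (\<lambda>_. 0) (phi_power W) F N"
    using diff_pair[OF diff fb] by blast
  then have dm: "diff_mellin W (opr W) (phi_power W) F N" by (simp add: diff_mellin_def)
  interpret diff_mellin W "opr W" "phi_power W" F N by (rule dm)
  have mE: "inv_mellin W = twist nabla" by (rule inv_mellin_eq_twist[OF dm])
  have st: "stable S \<and> stable_subspace (twist nabla) S" if S: "stable_subspace W S" for S
  proof -
    have s: "stable S" using S diff_stable_iff[OF diff] by simp
    note S' = ksubD[OF stableD(1)[OF s]]
    have "stable_subspace (twist nabla) S"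
      by (rule stable_twist_stable_subspace[OF s]) (simp add: nabla_def S'(4,5) stable_P[OF s])
    then show ?thesis using s by simp
  qed
  have tr: "\<exists>M'\<in>conn_models. \<exists>\<pi>'. model_map (twist nabla) V U M' \<pi>'"
    if "stable V" "stable U" "U \<subseteq> V" "M \<in> diff_models" "model_map W V U M \<pi>" for V U M \<pi>
    using diff_model_transfer[OF diff dm _ _ that(3-5)] that(1,2) diff_stable_iff[OF diff] by simp
  have fb': "filtered_by (twist nabla) conn_models (carrier W)"
    by (rule twist_filtered[OF fb st tr])
  interpret E': fls_space "twist nabla" by (rule fls_space_twist)
  have "connection_at_infinity (twist nabla)"
    unfolding connection_at_infinity_def connection_at_infinity_axioms_def
  proof (intro conjI allI impI)
    show "vectorspace class_ring (twist nabla)" by (rule E'.vectorspace)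
    show "vectorspace.fin_dim class_ring (twist nabla)" by (rule twist_fin_dim[OF fb' conn_models_smult])
    show "const_linear (twist nabla) (opr (twist nabla))"
      unfolding const_linear_def by (auto simp: nabla_add nabla_const act_const)
    show "opr (twist nabla) (h \<odot>\<^bsub>twist nabla\<^esub> v)
        = h \<odot>\<^bsub>twist nabla\<^esub> opr (twist nabla) v \<oplus>\<^bsub>twist nabla\<^esub> d_dz h \<odot>\<^bsub>twist nabla\<^esub> v"
      if "v \<in> carrier (twist nabla)" for v h
      using that nabla_act by simp
  qed
  then show conn: "connection_at_infinity (inv_mellin W)" by (simp add: mE)
  note conn' = conn[unfolded mE]
  show "v \<in> carrier W \<Longrightarrow> T_conn (inv_mellin W) v = fls_X_inv \<odot>\<^bsub>W\<^esub> v"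
    unfolding mE by (rule T_conn_twist)
  have "stable_subspace W S \<longleftrightarrow> stable_subspace (twist nabla) S" for S
  proof
    assume S: "stable_subspace (twist nabla) S"
    have "stable S"
    proof (rule twist_stable_imp_stable[OF conn_semilinear[OF conn'] T_conn_twist])
      show "semilinear_space.shift_filtered (twist nabla) (T_conn (twist nabla)) (carrier W)"
        by (rule conn_shift_filtered[OF conn' fb'])
      show "semilinear_space.stable (twist nabla) (T_conn (twist nabla)) S"
        using S conn_stable_iff[OF conn'] by simp
    qed
    then show "stable_subspace W S" using diff_stable_iff[OF diff] by simp
  qed (use st in blast)
  from simple_pair_cong[OF diff_op_space[OF diff] conn_op_space[OF conn'] this]
  have sp: "op_space.simple_pair W V U \<longleftrightarrow> op_space.simple_pair (twist nabla) V U" for V U .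
  have "\<exists>M\<in>conn_models. \<exists>\<pi>. model_map (twist nabla) V U M \<pi>" if s: "op_space.simple_pair (twist nabla) V U" for V U
  proof -
    have s': "op_space.simple_pair W V U" using s sp by simp
    then obtain M \<pi> where "M \<in> diff_models" "model_map W V U M \<pi>"
      using neg negative_orders_iff[OF diff] by blast
    then show ?thesis using tr s' st op_space.simple_pair_def[OF diff_op_space[OF diff]] by meson
  qed
  then show "positive_slopes (inv_mellin W)"
    unfolding mE positive_slopes_iff[OF conn'] by blast
qed

section \<open>Equivalence of categories\<close>

lemma op_hom_iff:
  fixes E :: "('k::field_char_0 fls, 'v) op_module" and E' :: "('k fls, 'w) op_module"
  assumes "fls_space E" "fls_space E'"
  shows "f \<in> op_hom E E' \<longleftrightarrow> f \<in> carrier E \<rightarrow>\<^sub>E carrier E' \<and>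
    (\<forall>u\<in>carrier E. \<forall>v\<in>carrier E. f (u \<oplus>\<^bsub>E\<^esub> v) = f u \<oplus>\<^bsub>E'\<^esub> f v) \<and>
    (\<forall>h. \<forall>v\<in>carrier E. f (h \<odot>\<^bsub>E\<^esub> v) = h \<odot>\<^bsub>E'\<^esub> f v) \<and> (\<forall>v\<in>carrier E. f (opr E v) = opr E' (f v))"
  unfolding op_hom_def LinearCombinations.module_hom_def by auto

lemma op_space_closed:
  assumes "op_space E" "u \<in> carrier E" "v \<in> carrier E"
  shows "h \<odot>\<^bsub>E\<^esub> v \<in> carrier E" "u \<oplus>\<^bsub>E\<^esub> v \<in> carrier E" "opr E v \<in> carrier E"
proof -
  interpret op_space E by (rule assms(1))
  show "h \<odot>\<^bsub>E\<^esub> v \<in> carrier E" "u \<oplus>\<^bsub>E\<^esub> v \<in> carrier E" "opr E v \<in> carrier E"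
    using assms(2,3) opr_closed by simp_all
qed

lemma op_cat_category:
  fixes P :: "('k::field_char_0 fls, 'v) op_module \<Rightarrow> bool"
  assumes "\<And>E. P E \<Longrightarrow> op_space E"
  shows "category (full_subcategory (op_cat P) Q)"
proof -
  have fls: "fls_space E" if "P E" for E using assms[OF that] by (simp add: op_space_def)
  note cl = op_space_closed[OF assms]
  show ?thesis
  proof (unfold_locales, goal_cases)
    case (1 X)
    then show ?case
      by (simp add: full_subcategory_def op_cat_def op_hom_iff fls cl)
  next
    case (2 X Y Z f g)
    then have p: "P X" "P Y" "P Z" by (auto simp: full_subcategory_def op_cat_def)
    have "f \<in> op_hom X Y" "g \<in> op_hom Y Z" using 2 by (auto simp: full_subcategory_def op_cat_def)
    then have "compose (carrier X) g f \<in> op_hom X Z"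
      using p by (simp add: op_hom_iff fls cl compose_def) (auto simp: PiE_def Pi_def)
    then show ?case by (simp add: full_subcategory_def op_cat_def)
  next
    case (3 X Y f)
    then have "f \<in> extensional (carrier X)" by (auto simp: full_subcategory_def op_cat_def op_hom_def PiE_def)
    then show ?case by (auto simp: full_subcategory_def op_cat_def compose_def extensional_def fun_eq_iff)
  next
    case (4 X Y f)
    then have f: "f \<in> carrier X \<rightarrow>\<^sub>E carrier Y" by (auto simp: full_subcategory_def op_cat_def op_hom_def)
    then show ?case
      by (auto simp: full_subcategory_def op_cat_def compose_def extensional_def fun_eq_iff)
  next
    case (5 W X Y Z f g h)
    then have "f \<in> carrier W \<rightarrow> carrier X" by (auto simp: full_subcategory_def op_cat_def op_hom_def)
    then show ?case by (simp add: full_subcategory_def op_cat_def compose_assoc)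
  qed
qed

text \<open>The scalar multiplication \<open>theta_smult\<close> has unspecified values outside the carrier, so the two
  composites of the transforms return a module only up to such values.\<close>

definition agrees_with :: "('k::field_char_0 fls, 'v) op_module \<Rightarrow> ('k fls, 'v) op_module \<Rightarrow> bool" where
  "agrees_with E E' \<longleftrightarrow> carrier E = carrier E' \<and> add E = add E' \<and>
     (\<forall>v\<in>carrier E. (\<forall>h. h \<odot>\<^bsub>E\<^esub> v = h \<odot>\<^bsub>E'\<^esub> v) \<and> opr E v = opr E' v)"

text \<open>The identity map of the carrier is the required isomorphism.\<close>

lemma agrees_with_naturally_isomorphic:
  fixes P :: "('k::field_char_0 fls, 'v) op_module \<Rightarrow> bool"
  assumes sp: "\<And>E. P E \<Longrightarrow> op_space E"
    and F: "\<And>X. X \<in> obj (full_subcategory (op_cat P) Q) \<Longrightarrow> fobj F X \<in> obj (full_subcategory (op_cat P) Q) \<and> agrees_with (fobj F X) X"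
    and Fm: "\<And>X Y f. fmap F X Y f = f"
  shows "naturally_isomorphic (full_subcategory (op_cat P) Q) (full_subcategory (op_cat P) Q) F ident_ftor"
proof -
  let ?C = "full_subcategory (op_cat P) Q"
  have fls: "fls_space E" if "P E" for E using sp[OF that] by (simp add: op_space_def)
  note cl = op_space_closed[OF sp]
  define \<eta> :: "('k fls, 'v) op_module \<Rightarrow> 'v \<Rightarrow> 'v" where "\<eta> X = restrict (\<lambda>v. v) (carrier X)" for X
  show ?thesis unfolding naturally_isomorphic_def
  proof (intro exI[of _ \<eta>] conjI ballI)
    fix X assume X: "X \<in> obj ?C"
    have p: "P X" "P (fobj F X)" using X F[OF X] by (auto simp: full_subcategory_def op_cat_def)
    note a = F[OF X, THEN conjunct2, unfolded agrees_with_def]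
    have "\<eta> X \<in> op_hom (fobj F X) X" "\<eta> X \<in> op_hom X (fobj F X)"
      using a p cl[OF p(1)] by (simp_all add: op_hom_iff fls \<eta>_def)
    moreover have "compose (carrier X) (\<eta> X) (\<eta> X) = \<eta> X"
      by (auto simp: compose_def \<eta>_def)
    ultimately show "is_iso ?C (fobj F X) (fobj ident_ftor X) (\<eta> X)"
      using a by (auto simp: is_iso_def full_subcategory_def op_cat_def ident_ftor_def \<eta>_def intro!: bexI[of _ "\<eta> X"])
  next
    fix X Y f assume X: "X \<in> obj ?C" and Y: "Y \<in> obj ?C" and f: "f \<in> hom ?C X Y"
    have f': "f \<in> carrier X \<rightarrow>\<^sub>E carrier Y" using f by (auto simp: full_subcategory_def op_cat_def op_hom_def)
    have "carrier (fobj F X) = carrier X" using F[OF X] by (simp add: agrees_with_def)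
    then show "comp ?C (fobj F X) (fobj ident_ftor X) (fobj ident_ftor Y) (fmap ident_ftor X Y f) (\<eta> X)
        = comp ?C (fobj F X) (fobj F Y) (fobj ident_ftor Y) (\<eta> Y) (fmap F X Y f)"
      using f' by (auto simp: full_subcategory_def op_cat_def ident_ftor_def Fm \<eta>_def compose_def fun_eq_iff)
  qed
qed

lemma mellin_sel:
  "carrier (mellin_obj E) = carrier E" "add (mellin_obj E) = add E"
  "carrier (inv_mellin W) = carrier W" "add (inv_mellin W) = add W"
  by (simp_all add: mellin_obj_def inv_mellin_def)

lemma minus_hom:
  assumes E: "fls_space E" and E': "fls_space E'"
    and f: "\<And>h v. v \<in> carrier E \<Longrightarrow> f (h \<odot>\<^bsub>E\<^esub> v) = h \<odot>\<^bsub>E'\<^esub> f v" "\<And>v. v \<in> carrier E \<Longrightarrow> f v \<in> carrier E'"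
    and v: "v \<in> carrier E"
  shows "f (\<ominus>\<^bsub>E\<^esub> v) = \<ominus>\<^bsub>E'\<^esub> f v"
  using f(1)[OF v, of "- 1"] f(2)[OF v] v fls_space.smult_minus_left[OF E v, of 1]
    fls_space.smult_minus_left[OF E' f(2)[OF v], of 1] fls_space.smult_one[OF E v] fls_space.smult_one[OF E' f(2)[OF v]]
  by simp

lemma mellin_hom:
  fixes E F :: "('k::{alg_closed_field,field_char_0} fls, 'v) op_module"
  assumes E: "connection_at_infinity E" "positive_slopes E" and F: "connection_at_infinity F" "positive_slopes F"
    and f: "f \<in> op_hom E F"
  shows "f \<in> op_hom (mellin_obj E) (mellin_obj F)"
proof -
  obtain FE NE where pE: "mellin_pair E (T_conn E) (\<lambda>h. h) (\<lambda>h. fls_X * fls_deriv h) (theta_power E) FE NE"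
    using conn_pair[OF E(1) positive_slopes_filtered[OF E]] by blast
  obtain FF NF where pF: "mellin_pair F (T_conn F) (\<lambda>h. h) (\<lambda>h. fls_X * fls_deriv h) (theta_power F) FF NF"
    using conn_pair[OF F(1) positive_slopes_filtered[OF F]] by blast
  note sp = conn_fls_space[OF E(1)] conn_fls_space[OF F(1)]
  have f': "f \<in> carrier E \<rightarrow>\<^sub>E carrier F" "\<And>v. v \<in> carrier E \<Longrightarrow> f v \<in> carrier F"
    "\<And>u v. u \<in> carrier E \<Longrightarrow> v \<in> carrier E \<Longrightarrow> f (u \<oplus>\<^bsub>E\<^esub> v) = f u \<oplus>\<^bsub>F\<^esub> f v"
    "\<And>h v. v \<in> carrier E \<Longrightarrow> f (h \<odot>\<^bsub>E\<^esub> v) = h \<odot>\<^bsub>F\<^esub> f v"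
    "\<And>v. v \<in> carrier E \<Longrightarrow> f (opr E v) = opr F (f v)"
    using f by (auto simp: op_hom_iff sp)
  have T: "f (T_conn E v) = T_conn F (f v)" if v: "v \<in> carrier E" for v
  proof -
    note o = conn_opr(1)[OF E(1) v]
    show ?thesis
      using minus_hom[OF sp f'(4,2), of "fls_X_inv \<odot>\<^bsub>E\<^esub> opr E v"] f'(4)[OF o] f'(5)[OF v]
        fls_space.smult_closed[OF sp(1) o] by (simp add: T_conn_def z_nabla_def)
  qed
  have act: "f (series_smult E (theta_power E) h v) = series_smult F (theta_power F) h (f v)"
    if "v \<in> carrier E" for h v
    using hom_act(2)[OF pE pF, where f = f] f' T that by blast
  show ?thesis
    using diff_fls_space[OF mellin_obj_in_N_neg(1)[OF E]] diff_fls_space[OF mellin_obj_in_N_neg(1)[OF F]] f' act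
    by (simp add: op_hom_iff mellin_obj_def theta_smult_eq)
qed

lemma inv_mellin_hom:
  fixes V W :: "('k::{alg_closed_field,field_char_0} fls, 'v) op_module"
  assumes V: "difference_module V" "negative_orders V" and W: "difference_module W" "negative_orders W"
    and f: "f \<in> op_hom V W"
  shows "f \<in> op_hom (inv_mellin V) (inv_mellin W)"
proof -
  obtain FV NV where pV: "mellin_pair V (opr V) phi (\<lambda>_. 0) (phi_power V) FV NV"
    using diff_pair[OF V(1) negative_orders_filtered[OF V]] by blast
  obtain FW NW where pW: "mellin_pair W (opr W) phi (\<lambda>_. 0) (phi_power W) FW NW"
    using diff_pair[OF W(1) negative_orders_filtered[OF W]] by blast
  note sp = diff_fls_space[OF V(1)] diff_fls_space[OF W(1)]
  have f': "f \<in> carrier V \<rightarrow>\<^sub>E carrier W" "\<And>v. v \<in> carrier V \<Longrightarrow> f v \<in> carrier W"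
    "\<And>u v. u \<in> carrier V \<Longrightarrow> v \<in> carrier V \<Longrightarrow> f (u \<oplus>\<^bsub>V\<^esub> v) = f u \<oplus>\<^bsub>W\<^esub> f v"
    "\<And>h v. v \<in> carrier V \<Longrightarrow> f (h \<odot>\<^bsub>V\<^esub> v) = h \<odot>\<^bsub>W\<^esub> f v"
    "\<And>v. v \<in> carrier V \<Longrightarrow> f (opr V v) = opr W (f v)"
    using f by (auto simp: op_hom_iff sp)
  have act: "f (series_smult V (phi_power V) h v) = series_smult W (phi_power W) h (f v)"
    and pow: "f (phi_power V n v) = phi_power W n (f v)" if "v \<in> carrier V" for h n v
    using hom_act[OF pV pW, where f = f] f' that by blast+
  have n: "f (\<ominus>\<^bsub>V\<^esub> phi_power V 1 (fls_X_inv \<odot>\<^bsub>V\<^esub> v)) = \<ominus>\<^bsub>W\<^esub> phi_power W 1 (fls_X_inv \<odot>\<^bsub>W\<^esub> f v)"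
    if v: "v \<in> carrier V" for v
  proof -
    have x: "fls_X_inv \<odot>\<^bsub>V\<^esub> v \<in> carrier V" by (rule fls_space.smult_closed[OF sp(1) v])
    show ?thesis
      using minus_hom[OF sp f'(4,2) mellin_pair.P_closed[OF pV x, of 1]] pow[OF x, of 1] f'(4)[OF v] by simp
  qed
  show ?thesis
    using conn_fls_space[OF inv_mellin_in_C_inf_pos(1)[OF V]] conn_fls_space[OF inv_mellin_in_C_inf_pos(1)[OF W]] f' act n
    by (simp add: op_hom_iff inv_mellin_def)
qed

text \<open>The scalars return by \<open>double_twist\<close>, and the operator is \<open>- \<zeta> T\<close>, which is \<open>\<nabla>\<close>.\<close>

lemma inv_mellin_mellin:
  fixes E :: "('k::{alg_closed_field,field_char_0} fls, 'v) op_module"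
  assumes E: "connection_at_infinity E" "positive_slopes E"
  shows "agrees_with (inv_mellin (mellin_obj E)) E"
proof -
  obtain F N where pair: "mellin_pair E (T_conn E) (\<lambda>h. h) (\<lambda>h. fls_X * fls_deriv h) (theta_power E) F N"
    using conn_pair[OF E(1) positive_slopes_filtered[OF E]] by blast
  interpret mellin_pair E "T_conn E" "\<lambda>h. h" "\<lambda>h. fls_X * fls_deriv h" "theta_power E" F N by (rule pair)
  define M where "M = twist (\<lambda>v. fls_X_inv \<odot>\<^bsub>E\<^esub> v)"
  have M: "mellin_obj E = M" unfolding M_def by (rule mellin_obj_eq_twist[OF pair])
  note nM = mellin_obj_in_N_neg[OF E, unfolded M]
  obtain F2 N2 where B: "mellin_pair M (opr M) phi (\<lambda>_. 0) (phi_power M) F2 N2"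
    using diff_pair[OF nM(1) negative_orders_filtered[OF nM]] by blast
  note dt = double_twist[OF pair B[unfolded M_def], folded M_def]
  have o: "opr M v = fls_X_inv \<odot>\<^bsub>E\<^esub> v" for v by (simp add: M_def)
  have c: "phi_power M n v = fls_X_intpow n \<odot>\<^bsub>E\<^esub> v" "series_smult M (phi_power M) h v = h \<odot>\<^bsub>E\<^esub> v"
    if "v \<in> carrier E" for n h v
    using dt[OF o that] by simp_all
  have "\<ominus>\<^bsub>M\<^esub> phi_power M 1 (fls_X_inv \<odot>\<^bsub>M\<^esub> v) = opr E v" if v: "v \<in> carrier E" for v
  proof -
    have "fls_X_inv \<odot>\<^bsub>M\<^esub> v = T_conn E v" using act_X_inv[OF v] by (simp add: M_def)
    moreover have "phi_power M 1 (T_conn E v) = fls_X \<odot>\<^bsub>E\<^esub> T_conn E v"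
      using c(1)[of "T_conn E v" 1] v by (simp add: fls_X_conv_shift_1)
    ultimately show ?thesis using conn_opr_eq[OF E(1) v] by (simp add: M_def)
  qed
  then show ?thesis unfolding M using c
    by (simp add: agrees_with_def inv_mellin_def) (simp add: M_def)
qed

text \<open>The new operator is multiplication by \<open>\<zeta>^(- 1)\<close> on the inverse transform, which is
  \<open>T = \<Phi>\<close>.\<close>

lemma mellin_inv_mellin:
  fixes W :: "('k::{alg_closed_field,field_char_0} fls, 'v) op_module"
  assumes W: "difference_module W" "negative_orders W"
  shows "agrees_with (mellin_obj (inv_mellin W)) W"
proof -
  obtain F N where pair: "mellin_pair W (opr W) phi (\<lambda>_. 0) (phi_power W) F N"
    using diff_pair[OF W(1) negative_orders_filtered[OF W]] by blast
  then have dm: "diff_mellin W (opr W) (phi_power W) F N" by (simp add: diff_mellin_def)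
  interpret diff_mellin W "opr W" "phi_power W" F N by (rule dm)
  define M where "M = twist nabla"
  have M: "inv_mellin W = M" unfolding M_def by (rule inv_mellin_eq_twist[OF dm])
  note cM = inv_mellin_in_C_inf_pos[OF W, unfolded M]
  obtain F2 N2 where B: "mellin_pair M (T_conn M) (\<lambda>h. h) (\<lambda>h. fls_X * fls_deriv h) (theta_power M) F2 N2"
    using conn_pair[OF cM(1) positive_slopes_filtered[OF cM(1,2)]] by blast
  note dt = double_twist(2)[OF pair B[unfolded M_def], folded M_def, OF cM(3)]
  have "fls_X_inv \<odot>\<^bsub>M\<^esub> v = opr W v" if "v \<in> carrier W" for v
    using act_X_inv[OF that] by (simp add: M_def)
  then show ?thesis unfolding M using dt
    by (simp add: agrees_with_def mellin_obj_def theta_smult_eq) (simp add: M_def)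
qed

definition inverse_local_mellin ::
  "(('k::field_char_0 fls, 'v) op_module, 'v \<Rightarrow> 'v, ('k fls, 'v) op_module, 'v \<Rightarrow> 'v) ftor" where
  "inverse_local_mellin = \<lparr>fobj = inv_mellin, fmap = (\<lambda>X Y f. f)\<rparr>"

lemma obj_C_inf_pos: "E \<in> obj C_inf_pos \<longleftrightarrow> connection_at_infinity E \<and> positive_slopes E"
  and hom_C_inf_pos: "hom C_inf_pos = op_hom"
  by (simp_all add: C_inf_pos_def C_inf_def full_subcategory_def op_cat_def)

lemma obj_N_neg: "W \<in> obj N_neg \<longleftrightarrow> difference_module W \<and> negative_orders W"
  and hom_N_neg: "hom N_neg = op_hom"
  by (simp_all add: N_neg_def N_cat_def full_subcategory_def op_cat_def)

lemma category_C_inf_pos: "category C_inf_pos"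
  unfolding C_inf_pos_def C_inf_def by (rule op_cat_category[OF conn_op_space])

lemma category_N_neg: "category N_neg"
  unfolding N_neg_def N_cat_def by (rule op_cat_category[OF diff_op_space])

lemma cat_functor_local_mellin:
  "cat_functor (C_inf_pos :: (('k::{alg_closed_field, field_char_0} fls, 'v) op_module, 'v \<Rightarrow> 'v) cat) N_neg local_mellin"
  unfolding cat_functor_def cat_functor_axioms_def
  by (auto simp: category_C_inf_pos category_N_neg local_mellin_def obj_C_inf_pos obj_N_neg hom_C_inf_pos hom_N_neg
      mellin_obj_in_N_neg mellin_hom)
    (simp_all add: C_inf_pos_def C_inf_def N_neg_def N_cat_def full_subcategory_def op_cat_def mellin_sel)

lemma cat_functor_inverse_local_mellin:
  "cat_functor (N_neg :: (('k::{alg_closed_field, field_char_0} fls, 'v) op_module, 'v \<Rightarrow> 'v) cat) C_inf_pos inverse_local_mellin"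
  unfolding cat_functor_def cat_functor_axioms_def
  by (auto simp: category_C_inf_pos category_N_neg inverse_local_mellin_def obj_C_inf_pos obj_N_neg hom_C_inf_pos hom_N_neg
      inv_mellin_in_C_inf_pos inv_mellin_hom)
    (simp_all add: C_inf_pos_def C_inf_def N_neg_def N_cat_def full_subcategory_def op_cat_def mellin_sel)

theorem theorem9p13:
  shows "cat_equivalence
    (C_inf_pos :: (('k::{alg_closed_field, field_char_0} fls, 'v) op_module, 'v \<Rightarrow> 'v) cat)
    N_neg local_mellin"
  unfolding cat_equivalence_def
proof (intro conjI exI[of _ inverse_local_mellin])
  show "cat_functor (C_inf_pos :: (('k fls, 'v) op_module, 'v \<Rightarrow> 'v) cat) N_neg local_mellin"
    by (rule cat_functor_local_mellin)
  show "cat_functor N_neg (C_inf_pos :: (('k fls, 'v) op_module, 'v \<Rightarrow> 'v) cat) inverse_local_mellin"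
    by (rule cat_functor_inverse_local_mellin)
  show "naturally_isomorphic (C_inf_pos :: (('k fls, 'v) op_module, 'v \<Rightarrow> 'v) cat) C_inf_pos
      (comp_ftor inverse_local_mellin local_mellin) ident_ftor"
    unfolding C_inf_pos_def C_inf_def
  proof (rule agrees_with_naturally_isomorphic[OF conn_op_space], unfold C_inf_pos_def[symmetric] C_inf_def[symmetric])
    show "fobj (comp_ftor inverse_local_mellin local_mellin) E \<in> obj C_inf_pos \<and>
        agrees_with (fobj (comp_ftor inverse_local_mellin local_mellin) E) E"
      if "E \<in> obj C_inf_pos" for E :: "('k fls, 'v) op_module"
      using that by (simp add: comp_ftor_def inverse_local_mellin_def local_mellin_def obj_C_inf_pos
          inv_mellin_in_C_inf_pos mellin_obj_in_N_neg inv_mellin_mellin)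
  qed (simp_all add: comp_ftor_def inverse_local_mellin_def local_mellin_def)
  show "naturally_isomorphic (N_neg :: (('k fls, 'v) op_module, 'v \<Rightarrow> 'v) cat) N_neg
      (comp_ftor local_mellin inverse_local_mellin) ident_ftor"
    unfolding N_neg_def N_cat_def
  proof (rule agrees_with_naturally_isomorphic[OF diff_op_space], unfold N_neg_def[symmetric] N_cat_def[symmetric])
    show "fobj (comp_ftor local_mellin inverse_local_mellin) W \<in> obj N_neg \<and>
        agrees_with (fobj (comp_ftor local_mellin inverse_local_mellin) W) W"
      if "W \<in> obj N_neg" for W :: "('k fls, 'v) op_module"
      using that by (simp add: comp_ftor_def inverse_local_mellin_def local_mellin_def obj_N_neg
          inv_mellin_in_C_inf_pos mellin_obj_in_N_neg mellin_inv_mellin)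
  qed (simp_all add: comp_ftor_def inverse_local_mellin_def local_mellin_def)
qed

end
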